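(* Let $n=2$ and let $u$ be a variational solution in $\Omega\subset\mathbb{R}^2$. Then the set $\Sigma^u$ is locally finite in $\Omega$, i.e. every compact subset of $\Omega$ contains only finitely many points of $\Sigma^u$.
   Context: $\Omega\subset\mathbb{R}^2$ is a bounded domain meeting $\{x_2=0\}$; $a^+=\max(a,0)$; $\chi_A$ characteristic function. Variational solution (with $n=2$): $u\in W^{1,2}_{\mathrm{loc}}(\Omega)\cap C^0(\Omega)\cap C^2(\Omega\cap\{u>0\})$, $u\ge0$, $u\equiv0$ in $\Omega\cap\{x_n\le0\}$, and $\int_\Omega(|\nabla u|^2\mathrm{div}\phi-2\nabla u D\phi\nabla u+x_n\chi_{\{u>0\}}\mathrm{div}\phi+\chi_{\{u>0\}}\phi_n)=0$ for all $\phi\in C^1_0(\Omega;\mathbb{R}^n)$. $S^u:=\{x\in\Omega:x_n=0,\ x\in\partial\{u>0\}\}$; for $x^0_n=0$ and $0<r<\mathrm{dist}(x^0,\partial\Omega)/2$, $\Phi^{\mathrm{bound}}_{x^0,u}(r):=r^{-n-1}\int_{B_r(x^0)}(|\nabla u|^2+x_n\chi_{\{u>0\}})-\tfrac32r^{-n-2}\int_{\partial B_r(x^0)}u^2d\mathcal H^{n-1}$, with limit $\Phi^{\mathrm{bound}}_{x^0,u}(0+)$ as $r\searrow0$ (which exists); $\Sigma^u:=\{x^0\in S^u:\Phi^{\mathrm{bound}}_{x^0,u}(0+)=\int_{B_1}x_n^+\}$. *)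

theory Defs
  imports "HOL-Analysis.Analysis"
begin

type_synonym pt = "real ^ 2"

fun Ck_on :: "nat \<Rightarrow> pt set \<Rightarrow> (pt \<Rightarrow> real) \<Rightarrow> bool" where
  "Ck_on 0 S f = continuous_on S f"
| "Ck_on (Suc k) S f =
     (\<exists>G :: pt \<Rightarrow> pt. (\<forall>x\<in>S. (f has_derivative (\<lambda>h. G x \<bullet> h)) (at x))
        \<and> (\<forall>i. Ck_on k S (\<lambda>x. G x $ i)))"

definition Cinf_on :: "pt set \<Rightarrow> (pt \<Rightarrow> real) \<Rightarrow> bool" where
  "Cinf_on S f \<longleftrightarrow> (\<forall>k. Ck_on k S f)"

definition compact_supp_in :: "pt set \<Rightarrow> (pt \<Rightarrow> 'b::zero) \<Rightarrow> bool" where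
  "compact_supp_in \<Omega> f \<longleftrightarrow>
     compact (closure {x. f x \<noteq> 0}) \<and> closure {x. f x \<noteq> 0} \<subseteq> \<Omega>"

definition test_fun :: "pt set \<Rightarrow> (pt \<Rightarrow> real) \<Rightarrow> bool" where
  "test_fun \<Omega> \<psi> \<longleftrightarrow> Cinf_on UNIV \<psi> \<and> compact_supp_in \<Omega> \<psi>"

definition C1_0_field :: "pt set \<Rightarrow> (pt \<Rightarrow> pt) \<Rightarrow> bool" where
  "C1_0_field \<Omega> \<phi> \<longleftrightarrow> (\<forall>i. Ck_on 1 UNIV (\<lambda>x. \<phi> x $ i)) \<and> compact_supp_in \<Omega> \<phi>"

definition Dfield :: "(pt \<Rightarrow> pt) \<Rightarrow> pt \<Rightarrow> pt \<Rightarrow> pt" where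
  "Dfield \<phi> x = frechet_derivative \<phi> (at x)"

definition divg :: "(pt \<Rightarrow> pt) \<Rightarrow> pt \<Rightarrow> real" where
  "divg \<phi> x = (\<Sum>i\<in>UNIV. Dfield \<phi> x (axis i 1) $ i)"

definition weak_gradient :: "pt set \<Rightarrow> (pt \<Rightarrow> real) \<Rightarrow> (pt \<Rightarrow> pt) \<Rightarrow> bool" where
  "weak_gradient \<Omega> u g \<longleftrightarrow>
     (\<forall>\<psi>. test_fun \<Omega> \<psi> \<longrightarrow> (\<forall>i.
        (LINT x:\<Omega>|lebesgue. u x * frechet_derivative \<psi> (at x) (axis i 1))
          = - (LINT x:\<Omega>|lebesgue. g x $ i * \<psi> x)))"

definition W12_loc :: "pt set \<Rightarrow> (pt \<Rightarrow> real) \<Rightarrow> (pt \<Rightarrow> pt) \<Rightarrow> bool" where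
  "W12_loc \<Omega> u g \<longleftrightarrow>
     (\<forall>K. compact K \<and> K \<subseteq> \<Omega> \<longrightarrow>
        set_integrable lebesgue K (\<lambda>x. (u x)\<^sup>2) \<and>
        set_integrable lebesgue K (\<lambda>x. (norm (g x))\<^sup>2) \<and>
        set_integrable lebesgue K u \<and> (\<forall>i. set_integrable lebesgue K (\<lambda>x. g x $ i)))
     \<and> weak_gradient \<Omega> u g"

definition chi_pos :: "(pt \<Rightarrow> real) \<Rightarrow> pt \<Rightarrow> real" where
  "chi_pos u x = (if u x > 0 then 1 else 0)"

definition variational_solution :: "pt set \<Rightarrow> (pt \<Rightarrow> real) \<Rightarrow> (pt \<Rightarrow> pt) \<Rightarrow> bool" where
  "variational_solution \<Omega> u g \<longleftrightarrow>
     W12_loc \<Omega> u g \<and> continuous_on \<Omega> u \<and> Ck_on 2 (\<Omega> \<inter> {x. u x > 0}) u \<and>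
     (\<forall>x\<in>\<Omega>. u x \<ge> 0) \<and> (\<forall>x\<in>\<Omega>. x $ 2 \<le> 0 \<longrightarrow> u x = 0) \<and>
     (\<forall>\<phi>. C1_0_field \<Omega> \<phi> \<longrightarrow>
        (LINT x:\<Omega>|lebesgue.
            (norm (g x))\<^sup>2 * divg \<phi> x - 2 * (g x \<bullet> Dfield \<phi> x (g x))
          + x $ 2 * chi_pos u x * divg \<phi> x + chi_pos u x * \<phi> x $ 2) = 0)"

definition S_set :: "pt set \<Rightarrow> (pt \<Rightarrow> real) \<Rightarrow> pt set" where
  "S_set \<Omega> u = {x\<in>\<Omega>. x $ 2 = 0 \<and> x \<in> frontier {y\<in>\<Omega>. u y > 0}}"

text \<open>Boundary-adjusted monotonicity quantity, n = 2; the H^1 integral over the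
  circle \<partial>B_r(x0) is written via the arc-length parametrization.\<close>
definition Phi_bound :: "(pt \<Rightarrow> real) \<Rightarrow> (pt \<Rightarrow> pt) \<Rightarrow> pt \<Rightarrow> real \<Rightarrow> real" where
  "Phi_bound u g x0 r =
     (LINT x:ball x0 r|lebesgue. (norm (g x))\<^sup>2 + x $ 2 * chi_pos u x) / r ^ 3
   - 3 / 2 * (LBINT t=0..2 * pi. (u (x0 + r *\<^sub>R vector [cos t, sin t]))\<^sup>2 * r) / r ^ 4"

definition Sigma_set :: "pt set \<Rightarrow> (pt \<Rightarrow> real) \<Rightarrow> (pt \<Rightarrow> pt) \<Rightarrow> pt set" where
  "Sigma_set \<Omega> u g = {x0 \<in> S_set \<Omega> u.
      ((\<lambda>r. Phi_bound u g x0 r) \<longlongrightarrow>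
          (LINT x:ball (0::pt) 1|lebesgue. max (x $ 2) 0)) (at_right 0)}"

end

theory Submission
  imports Defs
begin

text \<open>
  Write \<open>p\<close> for the gradient of \<open>u\<close> on \<open>{u > 0}\<close>, extended by zero. The variational equation gives
  harmonicity of \<open>u\<close> on \<open>{u > 0}\<close> and a stress identity whose right-hand side lives on the part
  \<open>E\<close> of the upper half-plane where \<open>u = 0\<close>. At a point \<open>c\<close> of \<open>\<Sigma>\<close> the monotonicity formula
  makes the frequency \<open>H(\<tau>)\<close>, the quotient of energy minus \<open>E\<close>-volume by the mass of \<open>u\<^sup>2\<close>,
  at least \<open>3/2\<close> and nondecreasing in \<open>\<tau>\<close>; both properties pass to limits of centers.

  Suppose \<open>c\<close> is an accumulation point of \<open>\<Sigma>\<close>, and let \<open>z \<in> \<Sigma>\<close> have distance \<open>d\<close> to \<open>c\<close>.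
  Since \<open>H\<close> converges as \<open>\<tau>\<close> decreases to 0, at scale \<open>d\<close> the function \<open>u\<close> is almost homogeneous about
  \<open>c\<close> and \<open>E\<close> is almost negligible. Testing the stress identity with a rotation field about \<open>c\<close>
  that is supported in the annulus \<open>|x - c| \<approx> d\<close> of relative width \<open>s\<close> and vanishes near \<open>z\<close>
  bounds the energy in the annulus by \<open>1/s\<close> times the energy in a ball of radius \<open>4 s d\<close> about \<open>z\<close>, up to
  small errors. As the frequency at \<open>z\<close> is at least \<open>3/2\<close>, the latter is of order \<open>s\<^sup>3\<close>, so the annulus
  carries at most order \<open>s\<^sup>2\<close> of the energy; almost homogeneity and the doubling property at \<open>c\<close>
  force it to carry at least order \<open>s\<close>. For small \<open>s\<close> this is a contradiction.
\<close>

subsection \<open>Test functions and the fundamental lemma\<close>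

text \<open>Rotation fields are effective because of the dimension. For a planar \<open>p\<close>,
  the stress of \<open>B\<close> times the rotation field about \<open>c\<close> equals minus |p|^2
  times the angular derivative of \<open>B\<close>, plus twice \<open>rad c\<close> times the cross
  product of \<open>p\<close> with the gradient of \<open>B\<close>. If \<open>rad c\<close> is
  replaced by \<open>N * U\<close>, the last term becomes N times the cross product of the gradients
  of U^2 and \<open>B\<close>, which integrates to zero. So for homogeneous \<open>u\<close> and
  negligible \<open>E\<close> the energy density on a circle about \<open>c\<close> does not vary
  with the angle above the axis, and it cannot be small at \<open>z\<close> alone. The obstacle is
  the integral over \<open>E\<close>: it is known to be small only with the weight
  \<open>x $ 2\<close>, whereas the vertical component of the field enters without this weight.
  Hence the test gives a one-sided inequality: near \<open>z\<close> the field is cut off, on the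
  opposite side of the annulus it points downwards, and on the rest of its support the height is of
  order \<open>s\<close>, so that the weight dominates. No blow-up limit is formed. All steps are
  estimates at a definite scale, with constants determined by an upper bound for the
  frequency.\<close>

lemma borel_measurable_vec_nth [measurable (raw)]:
  fixes f :: "'a \<Rightarrow> real ^ 'n"
  assumes [measurable]: "f \<in> borel_measurable M"
  shows "(\<lambda>x. f x $ i) \<in> borel_measurable M"
proof -
  have "(\<lambda>x. f x \<bullet> axis i 1) \<in> borel_measurable M" by measurable
  then show ?thesis by (simp add: inner_axis)
qed

lemma norm_sq_pt: "(norm (x::pt))\<^sup>2 = (x $ 1)\<^sup>2 + (x $ 2)\<^sup>2"
  by (simp add: norm_vec_def L2_set_def sum_2)

lemma inner_pt: "(x::pt) \<bullet> y = x $ 1 * y $ 1 + x $ 2 * y $ 2"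
  by (simp add: inner_vec_def sum_2)

text \<open>The gradient is a parameter, so that integrals can mention it without choosing a
  derivative. Only C^1 is asked: the truncations and kernels that serve as tests later are built
  from positive parts and are not smooth.\<close>

definition C1c :: "pt set \<Rightarrow> (pt \<Rightarrow> real) \<Rightarrow> (pt \<Rightarrow> pt) \<Rightarrow> bool" where
  "C1c \<Omega> \<psi> G \<longleftrightarrow> (\<forall>x. (\<psi> has_derivative (\<lambda>h. G x \<bullet> h)) (at x)) \<and> continuous_on UNIV G
     \<and> compact_supp_in \<Omega> \<psi>"

lemma C1c_deriv: "C1c \<Omega> \<psi> G \<Longrightarrow> (\<psi> has_derivative (\<lambda>h. G x \<bullet> h)) (at x)"
  by (simp add: C1c_def)

lemma C1c_continuous: "C1c \<Omega> \<psi> G \<Longrightarrow> continuous_on UNIV \<psi>"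
  by (rule has_derivative_continuous_on[OF has_derivative_at_withinI[OF C1c_deriv]])

lemma C1c_continuous_grad: "C1c \<Omega> \<psi> G \<Longrightarrow> continuous_on UNIV G"
  by (simp add: C1c_def)

lemma has_derivative_inner_unique:
  assumes "(f has_derivative (\<lambda>h. a \<bullet> h)) (at x)" "(f has_derivative (\<lambda>h. b \<bullet> h)) (at (x::'a::euclidean_space))"
  shows "a = b"
proof -
  have "(\<lambda>h. a \<bullet> h) = (\<lambda>h. b \<bullet> h)" using assms by (rule has_derivative_unique)
  then have "a \<bullet> h = b \<bullet> h" for h by metis
  then show ?thesis by (metis inner_commute vector_eq_ldot)
qed

lemma has_derivative_zero_off_closed:
  fixes f :: "pt \<Rightarrow> real"
  assumes "closed K" "\<And>x. x \<notin> K \<Longrightarrow> f x = 0" "x \<notin> K"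
  shows "(f has_derivative (\<lambda>h. 0 \<bullet> h)) (at x)"
proof -
  have "((\<lambda>x. 0) has_derivative (\<lambda>h. 0)) (at x)" by simp
  then have "(f has_derivative (\<lambda>h. 0)) (at x)"
    by (rule has_derivative_transform_within_open[where s="- K"]) (use assms in auto)
  then show ?thesis by simp
qed

lemma C1c_support:
  assumes "C1c \<Omega> \<psi> G"
  obtains K where "compact K" "K \<subseteq> \<Omega>" "\<And>x. x \<notin> K \<Longrightarrow> \<psi> x = 0" "\<And>x. x \<notin> K \<Longrightarrow> G x = 0"
proof
  let ?K = "closure {x. \<psi> x \<noteq> 0}"
  show "compact ?K" "?K \<subseteq> \<Omega>" using assms by (auto simp: C1c_def compact_supp_in_def)
  show z: "\<psi> x = 0" if "x \<notin> ?K" for x using that closure_subset[of "{x. \<psi> x \<noteq> 0}"] by auto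
  show "G x = 0" if "x \<notin> ?K" for x
    using has_derivative_inner_unique[OF C1c_deriv[OF assms] has_derivative_zero_off_closed[OF closed_closure z that]]
    by simp
qed

lemma compact_supp_inI:
  assumes "compact K" "K \<subseteq> \<Omega>" "\<And>x. x \<notin> K \<Longrightarrow> f x = 0"
  shows "compact_supp_in \<Omega> f"
proof -
  have "closure {x. f x \<noteq> 0} \<subseteq> K"
    by (rule closure_minimal) (use assms in \<open>auto simp: compact_imp_closed\<close>)
  then have "K \<inter> closure {x. f x \<noteq> 0} = closure {x. f x \<noteq> 0}" by auto
  then have "compact (closure {x. f x \<noteq> 0})"
    using compact_Int_closed[OF assms(1) closed_closure] by metis
  with \<open>closure {x. f x \<noteq> 0} \<subseteq> K\<close> show ?thesis using assms(2) by (auto simp: compact_supp_in_def)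
qed

lemma C1cI:
  assumes "compact K" "K \<subseteq> \<Omega>" "\<And>x. x \<notin> K \<Longrightarrow> \<psi> x = 0"
    "\<And>x. (\<psi> has_derivative (\<lambda>h. G x \<bullet> h)) (at x)" "continuous_on UNIV G"
  shows "C1c \<Omega> \<psi> G"
  using assms compact_supp_inI[of K \<Omega> \<psi>] by (simp add: C1c_def)

lemma C1c_mono: "C1c \<Omega> \<psi> G \<Longrightarrow> \<Omega> \<subseteq> \<Omega>' \<Longrightarrow> C1c \<Omega>' \<psi> G"
  by (auto simp: C1c_def compact_supp_in_def)

lemma bounded_on_compact:
  fixes f :: "pt \<Rightarrow> 'b::real_normed_vector"
  assumes "compact K" "continuous_on K f"
  obtains C where "C > 0" "\<And>x. x \<in> K \<Longrightarrow> norm (f x) \<le> C"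
proof -
  have "bounded (f ` K)" using assms compact_continuous_image compact_imp_bounded by blast
  then show ?thesis by (metis bounded_pos imageI that)
qed

lemma integrable_mult_compact:
  fixes f \<psi> :: "pt \<Rightarrow> real"
  assumes f: "set_integrable lborel K f" and K: "compact K"
    and \<psi>: "continuous_on K \<psi>" "\<And>x. x \<notin> K \<Longrightarrow> \<psi> x = 0"
  shows "integrable lborel (\<lambda>x. f x * \<psi> x)"
proof -
  obtain C where C: "C > 0" "\<And>x. x \<in> K \<Longrightarrow> norm (\<psi> x) \<le> C"
    using bounded_on_compact[OF K \<psi>(1)] by blast
  have m: "(\<lambda>x. indicator K x *\<^sub>R \<psi> x) \<in> borel_measurable borel"
    by (rule borel_measurable_continuous_on_indicator) (use K \<psi> in \<open>auto simp: borel_compact\<close>)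
  have i: "integrable lborel (\<lambda>x. indicator K x *\<^sub>R f x)" using f by (simp add: set_integrable_def)
  have "integrable lborel (\<lambda>x. (indicator K x *\<^sub>R f x) * (indicator K x *\<^sub>R \<psi> x))"
  proof (rule Bochner_Integration.integrable_bound[OF integrable_mult_right[OF i, of C]])
    show "(\<lambda>x. (indicator K x *\<^sub>R f x) * (indicator K x *\<^sub>R \<psi> x)) \<in> borel_measurable lborel"
      using m borel_measurable_integrable[OF i] by (intro borel_measurable_times) auto
    show "AE x in lborel. norm ((indicator K x *\<^sub>R f x) * (indicator K x *\<^sub>R \<psi> x))
        \<le> norm (C * (indicator K x *\<^sub>R f x))"
      using C by (intro AE_I2) (auto simp: indicator_def abs_mult mult.commute[of C] intro: mult_left_mono)
  qed
  moreover have "(\<lambda>x. (indicator K x *\<^sub>R f x) * (indicator K x *\<^sub>R \<psi> x)) = (\<lambda>x. f x * \<psi> x)"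
    using \<psi>(2) by (auto simp: indicator_def)
  ultimately show ?thesis by simp
qed

lemma integral_lborel_translate:
  fixes f :: "pt \<Rightarrow> real"
  assumes "f \<in> borel_measurable borel"
  shows "(\<integral>x. f (a + x) \<partial>lborel) = (\<integral>x. f x \<partial>lborel)"
proof -
  have "distr lborel borel (\<lambda>x. a + x) = (lborel :: pt measure)"
    using lborel_affine[of 1 a] by (simp add: density_1)
  moreover have "(\<integral>x. f x \<partial>distr lborel borel (\<lambda>x. a + x)) = (\<integral>x. f (a + x) \<partial>lborel)"
    by (rule integral_distr) (use assms in auto)
  ultimately show ?thesis by simp
qed

lemma integrable_lborel_translate:
  fixes f :: "pt \<Rightarrow> real"
  assumes "integrable lborel f"
  shows "integrable lborel (\<lambda>x. f (a + x))"
proof -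
  have "distr lborel borel (\<lambda>x. a + x) = (lborel :: pt measure)"
    using lborel_affine[of 1 a] by (simp add: density_1)
  then have "integrable (distr lborel borel (\<lambda>x. a + x)) f" using assms by simp
  then show ?thesis by (subst (asm) integrable_distr_eq) (use assms in auto)
qed

text \<open>Translating \<open>\<psi>\<close> does not change its integral; differentiate at translation zero.\<close>

lemma C1c_integral_grad:
  assumes "C1c \<Omega> \<psi> G"
  shows "(\<integral>x. G x $ i \<partial>lborel) = 0"
proof -
  obtain K where K: "compact K" "K \<subseteq> \<Omega>" "\<And>x. x \<notin> K \<Longrightarrow> \<psi> x = 0" "\<And>x. x \<notin> K \<Longrightarrow> G x = 0"
    using C1c_support[OF assms] by blast
  obtain C where C: "C > 0" "\<And>x. x \<in> K \<Longrightarrow> norm (G x) \<le> C"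
    using bounded_on_compact[OF K(1) continuous_on_subset[OF C1c_continuous_grad[OF assms] subset_UNIV]] by blast
  have C': "norm (G x) \<le> C" for x using C K(4)[of x] by (cases "x \<in> K") auto
  obtain R where R: "R > 0" "\<And>x. x \<in> K \<Longrightarrow> norm x \<le> R"
    using compact_imp_bounded[OF K(1)] bounded_pos by blast
  have cont: "continuous_on UNIV \<psi>" using C1c_continuous[OF assms] .
  then have [measurable]: "\<psi> \<in> borel_measurable borel" by (rule borel_measurable_continuous_onI)
  have [measurable]: "G \<in> borel_measurable borel"
    using C1c_continuous_grad[OF assms] by (rule borel_measurable_continuous_onI)
  have int: "integrable lborel \<psi>"
  proof -
    have "set_integrable lborel K (\<lambda>x. 1::real)"
      using K(1) emeasure_compact_finite[OF K(1)] by (simp add: set_integrable_def borel_compact)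
    from integrable_mult_compact[OF this K(1) _ K(3)] cont show ?thesis
      by (simp add: continuous_on_subset)
  qed
  have lip: "\<bar>\<psi> x - \<psi> y\<bar> \<le> C * norm (x - y)" for x y
  proof -
    have "norm (\<psi> x - \<psi> y) \<le> C * norm (x - y)"
    proof (rule differentiable_bound[of UNIV \<psi> "\<lambda>x h. G x \<bullet> h"])
      show "onorm (\<lambda>h. G x \<bullet> h) \<le> C" for x
        using C'[of x] Cauchy_Schwarz_ineq2[of "G x"]
        by (intro onorm_le) (metis mult_right_mono norm_ge_zero order_trans real_norm_def)
    qed (auto intro: C1c_deriv[OF assms])
    then show ?thesis by simp
  qed
  define t :: "nat \<Rightarrow> real" where "t n = 1 / (Suc n)" for n
  define e where "e = axis i (1::real)"
  have ne: "norm e = 1" by (simp add: e_def)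
  have t: "t n > 0" "t n \<le> 1" for n by (auto simp: t_def)
  define f where "f n x = (\<psi> (t n *\<^sub>R e + x) - \<psi> x) / t n" for n x
  have lim: "(\<lambda>n. \<integral>x. f n x \<partial>lborel) \<longlonglongrightarrow> (\<integral>x. G x $ i \<partial>lborel)"
  \<comment> \<open>The translations have length at most 1, so every difference quotient is
    supported in the ball of radius \<open>R + 1\<close>, where the Lipschitz constant bounds
    it.\<close>
  proof (rule integral_dominated_convergence[where w="\<lambda>x. C * indicator (cball 0 (R + 1)) x"])
    show "(\<lambda>x. G x $ i) \<in> borel_measurable lborel" by measurable
    show "f n \<in> borel_measurable lborel" for n unfolding f_def by measurable
    show "integrable lborel (\<lambda>x. C * indicator (cball 0 (R + 1)) (x::pt))"
      using emeasure_bounded_finite[OF bounded_cball, of "0::pt" "R + 1"]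
      by (intro integrable_mult_right integrable_real_indicator) (auto simp: less_top)
    show "AE x in lborel. (\<lambda>n. f n x) \<longlonglongrightarrow> G x $ i"
    proof (intro AE_I2)
      fix x
      have "((\<lambda>h. \<psi> (x + h *\<^sub>R e)) has_derivative (\<lambda>h. G x \<bullet> (h *\<^sub>R e))) (at 0)"
        by (rule has_derivative_compose[where f="\<lambda>h. x + h *\<^sub>R e" and g=\<psi>, THEN has_derivative_eq_rhs])
           (auto intro!: derivative_eq_intros C1c_deriv[OF assms])
      then have "((\<lambda>h. \<psi> (x + h *\<^sub>R e)) has_real_derivative (G x $ i)) (at 0)"
        by (rule has_derivative_imp_has_field_derivative) (simp add: e_def inner_axis)
      then have "(\<lambda>h. (\<psi> (x + h *\<^sub>R e) - \<psi> x) / h) \<midarrow>0\<rightarrow> G x $ i"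
        by (simp add: has_field_derivative_iff)
      moreover have "filterlim t (at 0) sequentially"
        unfolding filterlim_at t_def
        using LIMSEQ_inverse_real_of_nat by (auto simp: inverse_eq_divide)
      ultimately have "(\<lambda>n. (\<psi> (x + t n *\<^sub>R e) - \<psi> x) / t n) \<longlonglongrightarrow> G x $ i"
        by (rule filterlim_compose)
      then show "(\<lambda>n. f n x) \<longlonglongrightarrow> G x $ i" by (simp add: f_def add.commute)
    qed
    show "AE x in lborel. norm (f n x) \<le> C * indicator (cball 0 (R + 1)) x" for n
    proof (intro AE_I2)
      fix x
      have "\<bar>\<psi> (t n *\<^sub>R e + x) - \<psi> x\<bar> \<le> C * t n"
        using lip[of "t n *\<^sub>R e + x" x] t[of n] ne by simp
      then have b: "norm (f n x) \<le> C" using t[of n] by (simp add: f_def field_simps)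
      show "norm (f n x) \<le> C * indicator (cball 0 (R + 1)) x"
      proof (cases "x \<in> cball 0 (R + 1)")
        case True then show ?thesis using b by simp
      next
        case False
        then have x: "norm x > R + 1" by simp
        then have "x \<notin> K" using R by fastforce
        moreover have "norm (t n *\<^sub>R e + x) \<ge> norm x - 1"
          using norm_triangle_ineq2[of x "- (t n *\<^sub>R e)"] ne t[of n] by (simp add: add.commute)
        then have "t n *\<^sub>R e + x \<notin> K" using R x by fastforce
        ultimately show ?thesis using K(3) C(1) by (simp add: f_def)
      qed
    qed
  qed
  have "(\<integral>x. f n x \<partial>lborel) = 0" for n
    unfolding f_def using int
    by (simp add: integral_lborel_translate integrable_lborel_translate)
  then show ?thesis using lim by (simp add: LIMSEQ_const_iff)
qed

text \<open>\<open>P\<close> and the complement of \<open>K\<close> are open and cover the plane,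
  and on their intersection the gradient is zero, so the two local descriptions glue to a continuous
  one.\<close>

lemma C1c_extend_zero:
  fixes f :: "pt \<Rightarrow> real"
  assumes "open P" "compact K" "K \<subseteq> P" and z: "\<And>x. x \<notin> K \<Longrightarrow> f x = 0"
    and d: "\<And>x. x \<in> P \<Longrightarrow> (f has_derivative (\<lambda>h. F x \<bullet> h)) (at x)" and c: "continuous_on P F"
  shows "C1c P f (\<lambda>x. indicator P x *\<^sub>R F x)"
proof (rule C1cI[OF assms(2,3) z])
  let ?G = "\<lambda>x. indicator P x *\<^sub>R F x"
  have cl: "closed K" using assms(2) compact_imp_closed by blast
  have der0: "(f has_derivative (\<lambda>h. 0 \<bullet> h)) (at x)" if "x \<notin> K" for x
    using has_derivative_zero_off_closed[OF cl z that] .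
  have F0: "F x = 0" if "x \<in> P" "x \<notin> K" for x
    by (rule has_derivative_inner_unique[OF d[OF that(1)] der0[OF that(2)]])
  show "(f has_derivative (\<lambda>h. ?G x \<bullet> h)) (at x)" for x
    using d[of x] der0[of x] assms(3) by (cases "x \<in> P") auto
  have "continuous_on (P \<union> - K) ?G"
  proof (rule continuous_on_open_Un)
    show "continuous_on P ?G"
      by (rule continuous_on_eq[OF c]) auto
    show "continuous_on (- K) ?G"
      by (rule continuous_on_eq[OF continuous_on_const[of _ 0]]) (use F0 in \<open>auto simp: indicator_def\<close>)
  qed (use assms cl in auto)
  moreover have "P \<union> - K = UNIV" using assms by auto
  ultimately show "continuous_on UNIV ?G" by simp
qed

text \<open>Multiplying by a test function on \<open>P\<close> admits a factor, such as
  \<open>u\<close> or one of its derivatives, that is regular only on \<open>P\<close>.\<close>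

lemma C1c_mult:
  assumes \<psi>: "C1c P \<psi> G" and P: "open P"
    and d: "\<And>x. x \<in> P \<Longrightarrow> (f has_derivative (\<lambda>h. F x \<bullet> h)) (at x)" and c: "continuous_on P F"
  shows "C1c P (\<lambda>x. f x * \<psi> x) (\<lambda>x. indicator P x *\<^sub>R (\<psi> x *\<^sub>R F x + f x *\<^sub>R G x))"
proof -
  obtain K where K: "compact K" "K \<subseteq> P" "\<And>x. x \<notin> K \<Longrightarrow> \<psi> x = 0" "\<And>x. x \<notin> K \<Longrightarrow> G x = 0"
    using C1c_support[OF \<psi>] by blast
  have cf: "continuous_on P f"
    by (rule has_derivative_continuous_on[OF has_derivative_at_withinI[OF d]])
  show ?thesis
  proof (rule C1c_extend_zero[OF P K(1,2)])
    show "((\<lambda>x. f x * \<psi> x) has_derivative (\<lambda>h. (\<psi> x *\<^sub>R F x + f x *\<^sub>R G x) \<bullet> h)) (at x)" if "x \<in> P" for x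
      by (rule has_derivative_eq_rhs[OF has_derivative_mult[OF d[OF that] C1c_deriv[OF \<psi>]]])
        (auto simp: inner_add_left algebra_simps)
    show "continuous_on P (\<lambda>x. \<psi> x *\<^sub>R F x + f x *\<^sub>R G x)"
      by (intro continuous_intros c cf continuous_on_subset[OF C1c_continuous[OF \<psi>]]
          continuous_on_subset[OF C1c_continuous_grad[OF \<psi>]]) auto
  qed (use K in auto)
qed

section \<open>Smooth bumps and the fundamental lemma of the calculus of variations\<close>

definition bexp :: "nat \<Rightarrow> real \<Rightarrow> real" where
  "bexp n t = (if t \<le> 0 then 0 else exp (- (1 / t)) / t ^ n)"

text \<open>From x \<le> exp x at x = 1 / (t * m), raised to the power m = n + 2. The two surplus
  powers of \<open>t\<close> make the function differentiable at 0 with derivative 0.\<close>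

lemma bexp_bound: "\<bar>bexp n t\<bar> \<le> real (n + 2) ^ (n + 2) * t\<^sup>2"
proof (cases "t \<le> 0")
  case False
  then have t: "t > 0" by simp
  define m where "m = n + 2"
  have m: "m > 0" by (simp add: m_def)
  have "1 / (t * m) \<le> exp (1 / (t * m))"
    using exp_ge_add_one_self[of "1 / (t * m)"] by linarith
  then have "(1 / (t * m)) ^ m \<le> exp (1 / (t * m)) ^ m"
    using t by (intro power_mono) auto
  also have "\<dots> = exp (1 / t)"
    using m by (simp add: exp_of_nat_mult[symmetric])
  finally have "exp (- (1 / t)) \<le> (t * m) ^ m"
    using t m by (simp add: exp_minus field_simps)
  then have "exp (- (1 / t)) / t ^ n \<le> (t * m) ^ m / t ^ n"
    using t by (intro divide_right_mono) auto
  also have "\<dots> = real m ^ m * t\<^sup>2"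
    unfolding m_def power_mult_distrib power_add using t by simp
  finally show ?thesis using t by (simp add: bexp_def m_def abs_of_pos)
qed (simp add: bexp_def)

text \<open>The derivative stays in the family, which is why all the powers of 1 / t are carried
  along.\<close>

lemma bexp_deriv: "(bexp n has_real_derivative (bexp (n + 2) t - n * bexp (n + 1) t)) (at t)"
proof -
  consider "t < 0" | "t = 0" | "t > 0" by linarith
  then show ?thesis
  proof cases
    case 1
    have "((\<lambda>t. 0) has_real_derivative 0) (at t)" by simp
    then have "(bexp n has_real_derivative 0) (at t)"
      by (rule has_field_derivative_transform_within_open[where S="{..<0}"]) (use 1 in \<open>auto simp: bexp_def\<close>)
    then show ?thesis using 1 by (simp add: bexp_def)
  next
    case 2
    have "(\<lambda>h. bexp n h / h) \<midarrow>0\<rightarrow> 0"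
    proof (rule Lim_null_comparison)
      have "norm (bexp n h / h) \<le> real (n + 2) ^ (n + 2) * \<bar>h\<bar>" if "h \<noteq> 0" for h
      proof -
        have "\<bar>bexp n h\<bar> / \<bar>h\<bar> \<le> real (n + 2) ^ (n + 2) * h\<^sup>2 / \<bar>h\<bar>"
          by (intro divide_right_mono bexp_bound) auto
        also have "\<dots> = real (n + 2) ^ (n + 2) * \<bar>h\<bar>"
          using that by (simp add: power2_eq_square abs_if)
        finally show ?thesis by simp
      qed
      then show "\<forall>\<^sub>F h in at 0. norm (bexp n h / h) \<le> real (n + 2) ^ (n + 2) * \<bar>h\<bar>"
        by (simp add: eventually_at_filter)
      show "((\<lambda>h. real (n + 2) ^ (n + 2) * \<bar>h\<bar>) \<longlongrightarrow> 0) (at 0)"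
        by (auto intro!: tendsto_eq_intros)
    qed
    then show ?thesis using 2 by (simp add: has_field_derivative_iff bexp_def)
  next
    case 3
    define q where "q = 1 / t"
    have 1: "((\<lambda>t. 1 / t) has_real_derivative - (q * q)) (at t)"
      using 3 by (auto intro!: derivative_eq_intros simp: q_def)
    have 2: "((\<lambda>q. exp (- q) * q ^ n) has_real_derivative - exp (- q) * q ^ n + exp (- q) * (n * q ^ (n - 1))) (at q)"
      by (auto intro!: derivative_eq_intros)
    have "((\<lambda>t. exp (- (1 / t)) * (1 / t) ^ n) has_real_derivative
       (- exp (- q) * q ^ n + exp (- q) * (n * q ^ (n - 1))) * - (q * q)) (at t)"
      by (rule DERIV_chain2[where f="\<lambda>q. exp (- q) * q ^ n" and g="\<lambda>t. 1 / t", OF _ 1])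
        (use 2 in \<open>simp add: q_def\<close>)
    moreover have "(- exp (- q) * q ^ n + exp (- q) * (n * q ^ (n - 1))) * - (q * q)
        = exp (- q) * q ^ (n + 2) - n * (exp (- q) * q ^ (n + 1))"
      by (cases n) (simp_all add: algebra_simps power2_eq_square)
    moreover have "bexp k t = exp (- q) * q ^ k" for k
      using 3 by (simp add: bexp_def q_def power_divide)
    ultimately have "((\<lambda>t. exp (- (1 / t)) / t ^ n) has_real_derivative
        (bexp (n + 2) t - n * bexp (n + 1) t)) (at t)"
      by (simp add: power_divide)
    then show ?thesis
      by (rule has_field_derivative_transform_within_open[where S="{0<..}"]) (use 3 in \<open>auto simp: bexp_def\<close>)
  qed
qed

text \<open>An algebra closed under partial derivatives. Membership yields all orders of
  differentiability by one induction, without a formula for higher derivatives.\<close>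

inductive_set smooth_alg :: "(pt \<Rightarrow> real) set" where
  const: "(\<lambda>x. c) \<in> smooth_alg"
| bexp: "(\<lambda>x. bexp n (a * x $ i + b)) \<in> smooth_alg"
| add: "f \<in> smooth_alg \<Longrightarrow> g \<in> smooth_alg \<Longrightarrow> (\<lambda>x. f x + g x) \<in> smooth_alg"
| mult: "f \<in> smooth_alg \<Longrightarrow> g \<in> smooth_alg \<Longrightarrow> (\<lambda>x. f x * g x) \<in> smooth_alg"

lemma has_derivative_compose_coordinate:
  fixes x :: pt
  assumes "(f has_real_derivative D) (at (a * x $ i + b))"
  shows "((\<lambda>x. f (a * x $ i + b)) has_derivative (\<lambda>h. ((a * D) *\<^sub>R axis i 1) \<bullet> h)) (at x)"
proof -
  have 1: "((\<lambda>x::pt. a * x $ i + b) has_derivative (\<lambda>h. a * h $ i)) (at x)"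
    by (auto intro!: derivative_eq_intros bounded_linear_imp_has_derivative bounded_linear_vec_nth)
  show ?thesis
    by (rule has_derivative_eq_rhs[OF has_derivative_compose[OF 1 assms[unfolded has_field_derivative_def]]])
      (auto simp: inner_axis' mult_ac)
qed

lemma smooth_alg_deriv:
  assumes "f \<in> smooth_alg"
  shows "\<exists>G. (\<forall>x. (f has_derivative (\<lambda>h. G x \<bullet> h)) (at x)) \<and> (\<forall>i. (\<lambda>x. G x $ i) \<in> smooth_alg)"
  using assms
proof induction
  case (const c)
  show ?case by (rule exI[of _ "\<lambda>x. 0"]) (auto intro: smooth_alg.const)
next
  case (bexp n a i b)
  let ?D = "\<lambda>x::pt. bexp (n + 2) (a * x $ i + b) - n * bexp (n + 1) (a * x $ i + b)"
  show ?case
  proof (intro exI conjI allI)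
    show "((\<lambda>x. bexp n (a * x $ i + b)) has_derivative (\<lambda>h. ((a * ?D x) *\<^sub>R axis i 1) \<bullet> h)) (at x)" for x
      by (rule has_derivative_compose_coordinate[OF bexp_deriv])
    have "(\<lambda>x. a * (bexp (n + 2) (a * x $ i + b) + (- real n) * bexp (n + 1) (a * x $ i + b))) \<in> smooth_alg"
      by (intro smooth_alg.intros)
    then show "(\<lambda>x. ((a * ?D x) *\<^sub>R axis i 1) $ j) \<in> smooth_alg" for j
      by (cases "j = i") (auto simp: axis_def intro: smooth_alg.const)
  qed
next
  case (add f g)
  then obtain F G where *: "\<forall>x. (f has_derivative (\<lambda>h. F x \<bullet> h)) (at x)" "\<forall>i. (\<lambda>x. F x $ i) \<in> smooth_alg"
    "\<forall>x. (g has_derivative (\<lambda>h. G x \<bullet> h)) (at x)" "\<forall>i. (\<lambda>x. G x $ i) \<in> smooth_alg" by blast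
  show ?case
    by (rule exI[of _ "\<lambda>x. F x + G x"])
      (use * in \<open>auto simp: inner_add_left intro!: has_derivative_add smooth_alg.add\<close>)
next
  case (mult f g)
  then obtain F G where *: "\<forall>x. (f has_derivative (\<lambda>h. F x \<bullet> h)) (at x)" "\<forall>i. (\<lambda>x. F x $ i) \<in> smooth_alg"
    "\<forall>x. (g has_derivative (\<lambda>h. G x \<bullet> h)) (at x)" "\<forall>i. (\<lambda>x. G x $ i) \<in> smooth_alg" by blast
  show ?case
  proof (intro exI[of _ "\<lambda>x. f x *\<^sub>R G x + g x *\<^sub>R F x"] conjI allI)
    show "((\<lambda>x. f x * g x) has_derivative (\<lambda>h. (f x *\<^sub>R G x + g x *\<^sub>R F x) \<bullet> h)) (at x)" for x
      by (rule has_derivative_eq_rhs[OF has_derivative_mult]) (use * in \<open>auto simp: inner_add_left\<close>)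
    show "(\<lambda>x. (f x *\<^sub>R G x + g x *\<^sub>R F x) $ i) \<in> smooth_alg" for i
      using * mult by (auto intro!: smooth_alg.add smooth_alg.mult)
  qed
qed

lemma smooth_alg_Ck: "f \<in> smooth_alg \<Longrightarrow> Ck_on k UNIV f"
proof (induction k arbitrary: f)
  case 0
  then obtain G where "\<forall>x. (f has_derivative (\<lambda>h. G x \<bullet> h)) (at x)" using smooth_alg_deriv by blast
  then show ?case
    using has_derivative_continuous_on[of UNIV f "\<lambda>x h. G x \<bullet> h"] by simp
next
  case (Suc k)
  then show ?case using smooth_alg_deriv[OF Suc.prems] by auto
qed

definition box_bump :: "pt \<Rightarrow> pt \<Rightarrow> nat \<Rightarrow> pt \<Rightarrow> real" where
  "box_bump a b m x = (bexp 0 (Suc m * (x $ 1 - a $ 1)) * bexp 0 (Suc m * (b $ 1 - x $ 1)))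
     * (bexp 0 (Suc m * (x $ 2 - a $ 2)) * bexp 0 (Suc m * (b $ 2 - x $ 2)))"

lemma mem_box_pt: "x \<in> box a (b::pt) \<longleftrightarrow> a $ 1 < x $ 1 \<and> x $ 1 < b $ 1 \<and> a $ 2 < x $ 2 \<and> x $ 2 < b $ 2"
  by (auto simp add: mem_box_cart forall_2)

lemma test_fun_box_bump:
  assumes "cbox a b \<subseteq> O'"
  shows "test_fun O' (box_bump a b m)"
proof -
  have "box_bump a b m = (\<lambda>x. (bexp 0 (Suc m * x $ 1 + (- Suc m * a $ 1)) * bexp 0 ((- Suc m) * x $ 1 + Suc m * b $ 1))
     * (bexp 0 (Suc m * x $ 2 + (- Suc m * a $ 2)) * bexp 0 ((- Suc m) * x $ 2 + Suc m * b $ 2)))"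
    by (auto simp: box_bump_def fun_eq_iff algebra_simps)
  also have "\<dots> \<in> smooth_alg" by (intro smooth_alg.intros)
  finally have "Cinf_on UNIV (box_bump a b m)" by (simp add: Cinf_on_def smooth_alg_Ck)
  moreover have "compact_supp_in O' (box_bump a b m)"
  proof (rule compact_supp_inI[OF compact_cbox assms])
    fix x assume "x \<notin> cbox a b"
    then have "x \<notin> box a b" using box_subset_cbox by blast
    then show "box_bump a b m x = 0"
      unfolding mem_box_pt by (auto simp: box_bump_def bexp_def mult_le_0_iff)
  qed
  ultimately show ?thesis by (simp add: test_fun_def)
qed

lemma bexp0_bounds: "0 \<le> bexp 0 t" "bexp 0 t \<le> 1"
  by (auto simp: bexp_def)

lemma bexp0_lim:
  fixes t :: real
  assumes "t > 0" shows "(\<lambda>m. bexp 0 (real (Suc m) * t)) \<longlonglongrightarrow> 1"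
proof -
  have "(\<lambda>m. exp (- (inverse (real (Suc m)) * (1 / t)))) \<longlonglongrightarrow> exp (- (0 * (1 / t)))"
    by (intro tendsto_intros LIMSEQ_inverse_real_of_nat)
  moreover have "bexp 0 (real (Suc m) * t) = exp (- (inverse (real (Suc m)) * (1 / t)))" for m
    using assms by (simp add: bexp_def mult_le_0_iff field_simps del: of_nat_Suc)
  ultimately show ?thesis by simp
qed

lemma box_bump_lim: "(\<lambda>m. box_bump a b m x) \<longlonglongrightarrow> indicator (box a b) x"
proof (cases "x \<in> box a b")
  case True
  then have "(\<lambda>m. box_bump a b m x) \<longlonglongrightarrow> (1 * 1) * (1 * 1)"
    unfolding box_bump_def by (intro tendsto_mult bexp0_lim) (simp_all add: mem_box_pt)
  then show ?thesis using True by simp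
next
  case False
  then have "box_bump a b m x = 0" for m
    unfolding mem_box_pt by (auto simp: box_bump_def bexp_def mult_le_0_iff)
  then show ?thesis using False by simp
qed

lemma box_bump_bound: "\<bar>box_bump a b m x\<bar> \<le> indicator (cbox a b) x"
proof (cases "x \<in> cbox a b")
  case True
  have "\<bar>box_bump a b m x\<bar> \<le> (1 * 1) * (1 * 1)"
    unfolding box_bump_def abs_mult by (intro mult_mono) (auto simp: bexp0_bounds)
  then show ?thesis using True by simp
next
  case False
  then have "x \<notin> box a b" using box_subset_cbox by blast
  then show ?thesis
      unfolding mem_box_pt by (auto simp: box_bump_def bexp_def mult_le_0_iff)
qed

lemma box_bump_continuous: "continuous_on UNIV (box_bump a b m)"
  using test_fun_box_bump[of a b UNIV m] unfolding test_fun_def Cinf_on_def by (metis Ck_on.simps(1) subset_UNIV)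

lemma integral_box_zero_if_weakly_zero:
  fixes w :: "pt \<Rightarrow> real"
  assumes w: "w \<in> borel_measurable borel" "set_integrable lborel (cbox a b) w"
    and z: "\<And>m. (\<integral>x. w x * box_bump a b m x \<partial>lborel) = 0"
  shows "(LINT x:box a b|lborel. w x) = 0"
proof -
  have [measurable]: "box_bump a b m \<in> borel_measurable borel" for m
    using box_bump_continuous by (rule borel_measurable_continuous_onI)
  note [measurable] = w(1)
  have "(\<lambda>m. \<integral>x. w x * box_bump a b m x \<partial>lborel) \<longlonglongrightarrow> (\<integral>x. w x * indicator (box a b) x \<partial>lborel)"
  proof (rule integral_dominated_convergence[where w="\<lambda>x. \<bar>indicator (cbox a b) x *\<^sub>R w x\<bar>"])
    show "integrable lborel (\<lambda>x. \<bar>indicator (cbox a b) x *\<^sub>R w x\<bar>)"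
      using w(2) unfolding set_integrable_def by (rule integrable_abs)
    show "AE x in lborel. (\<lambda>m. w x * box_bump a b m x) \<longlonglongrightarrow> w x * indicator (box a b) x"
      by (intro AE_I2 tendsto_mult tendsto_const box_bump_lim)
    show "AE x in lborel. norm (w x * box_bump a b m x) \<le> \<bar>indicator (cbox a b) x *\<^sub>R w x\<bar>" for m
      using mult_left_mono[OF box_bump_bound[of a b m], of "\<bar>w x\<bar>" for x]
      by (intro AE_I2) (auto simp: abs_mult mult.commute)
  qed measurable
  then show ?thesis unfolding z
    by (simp add: LIMSEQ_const_iff set_lebesgue_integral_def mult.commute)
qed

lemma AE_not_in_box_boundary: "AE x in lborel. x \<notin> cbox a b - box a (b::pt)"
proof (rule AE_not_in)
  have "emeasure lborel (cbox a b - box a b) = emeasure lborel (cbox a b) - emeasure lborel (box a b)"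
    by (rule emeasure_Diff) (auto simp: emeasure_lborel_box_eq box_subset_cbox)
  also have "\<dots> = 0" by (simp add: emeasure_lborel_box_eq emeasure_lborel_cbox_eq)
  finally show "cbox a b - box a b \<in> null_sets lborel" by (simp add: null_sets_def)
qed

text \<open>The open boxes are an intersection-stable generator of the Borel sets, so vanishing
  integrals over boxes spread to all Borel sets, and a function whose integrals over all of them
  vanish is zero almost everywhere.\<close>

lemma fundamental_lemma_box:
  fixes w :: "pt \<Rightarrow> real"
  assumes w: "w \<in> borel_measurable borel" "\<And>K. compact K \<Longrightarrow> K \<subseteq> O' \<Longrightarrow> set_integrable lborel K w"
    and z: "\<And>\<psi>. test_fun O' \<psi> \<Longrightarrow> (\<integral>x. w x * \<psi> x \<partial>lborel) = 0"
    and cd: "cbox c d \<subseteq> O'"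
  shows "AE x in lborel. x \<in> cbox c d \<longrightarrow> w x = 0"
proof -
  let ?v = "\<lambda>x. indicator (box c d) x *\<^sub>R w x"
  have box0: "(LINT x:box a b|lborel. w x) = 0" if "cbox a b \<subseteq> O'" for a b
    by (rule integral_box_zero_if_weakly_zero[OF w(1) w(2)[OF compact_cbox that]])
       (rule z[OF test_fun_box_bump[OF that]])
  have iv: "integrable lborel ?v"
  proof -
    have "set_integrable lborel (box c d) w"
      by (rule set_integrable_subset[OF w(2)[OF compact_cbox cd]]) (auto simp: box_subset_cbox)
    then show ?thesis by (simp add: set_integrable_def)
  qed
  have siv: "set_integrable lborel A ?v" if "A \<in> sets lborel" for A
    unfolding set_integrable_def using integrable_mult_indicator[OF that iv] .
  have "(LINT x:A|lborel. ?v x) = 0" if "A \<in> sets borel" for A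
  proof -
    have "Int_stable (range (\<lambda>(a, b). box a (b::pt)))"
      by (auto simp: Int_stable_def box_Int_box)
    moreover have "range (\<lambda>(a, b). box a (b::pt)) \<subseteq> Pow UNIV" by auto
    moreover have "A \<in> sigma_sets UNIV (range (\<lambda>(a, b). box a b))"
      using that unfolding borel_eq_box by simp
    ultimately show ?thesis
    proof (induction rule: sigma_sets_induct_disjoint)
      case (basic A)
      then obtain a b where A: "A = box a b" by auto
      \<comment> \<open>\<open>?v\<close> is already cut off to \<open>box c d\<close>, and two
        boxes meet in a box. If this is nonempty, its closure stays in \<open>cbox c d\<close>,
        where tests are available.\<close>
      obtain e f where ef: "box a b \<inter> box c d = box e f" using box_Int_box[of a b c d] by blast
      have "(LINT x:box e f|lborel. w x) = 0"
      proof (cases "box e f = {}")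
        case True then show ?thesis by (simp add: set_lebesgue_integral_def)
      next
        case False
        then have "cbox e f = closure (box e f)" by (simp add: closure_box)
        also have "\<dots> \<subseteq> cbox c d"
          by (rule closure_minimal) (use ef box_subset_cbox in auto)
        finally show ?thesis using cd by (intro box0) auto
      qed
      moreover have "indicator A x *\<^sub>R ?v x = indicator (box e f) x *\<^sub>R w x" for x
        unfolding ef[symmetric] A by (auto simp: indicator_def)
      ultimately show ?case by (simp only: set_lebesgue_integral_def)
    next
      case empty then show ?case by (simp add: set_lebesgue_integral_def)
    next
      case (compl A)
      then have A: "A \<in> sets lborel" unfolding borel_eq_box sets_lborel by simp
      have "(LINT x:UNIV|lborel. ?v x) = (LINT x:A \<union> (UNIV - A)|lborel. ?v x)" by simp
      also have "\<dots> = (LINT x:A|lborel. ?v x) + (LINT x:UNIV - A|lborel. ?v x)"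
        by (rule set_integral_Un) (use A siv in auto)
      finally show ?case
        using compl box0[OF cd] by (simp add: set_lebesgue_integral_def)
    next
      case (union A)
      then have A: "A i \<in> sets lborel" for i unfolding borel_eq_box sets_lborel by auto
      have "(LINT x:(\<Union>i. A i)|lborel. ?v x) = (\<Sum>i. (LINT x:A i|lborel. ?v x))"
        by (rule lebesgue_integral_countable_add)
          (use A siv union in \<open>auto simp: disjoint_family_on_def\<close>)
      then show ?case using union by simp
    qed
  qed
  then have "AE x in lborel. ?v x = 0"
    by (intro sigma_finite_measure.density_zero[OF sigma_finite_lborel iv]) auto
  then show ?thesis using AE_not_in_box_boundary[of c d]
    by eventually_elim (auto simp: indicator_def split: if_splits)
qed

lemma fundamental_lemma:
  fixes w :: "pt \<Rightarrow> real"
  assumes "open O'"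
    and w: "w \<in> borel_measurable borel" "\<And>K. compact K \<Longrightarrow> K \<subseteq> O' \<Longrightarrow> set_integrable lborel K w"
    and z: "\<And>\<psi>. test_fun O' \<psi> \<Longrightarrow> (\<integral>x. w x * \<psi> x \<partial>lborel) = 0"
  shows "AE x in lborel. x \<in> O' \<longrightarrow> w x = 0"
proof -
  obtain \<D> where D: "countable \<D>" "\<D> \<subseteq> Pow O'" "\<And>X. X \<in> \<D> \<Longrightarrow> \<exists>a b. X = cbox a b" "\<Union>\<D> = O'"
    using open_countable_Union_open_cbox[OF assms(1)] by metis
  have "AE x in lborel. \<forall>X\<in>\<D>. x \<in> X \<longrightarrow> w x = 0"
    unfolding AE_ball_countable[OF D(1)]
  proof
    fix X assume "X \<in> \<D>"
    then obtain a b where X: "X = cbox a b" "cbox a b \<subseteq> O'" using D(2,3) by blast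
    show "AE x in lborel. x \<in> X \<longrightarrow> w x = 0"
      unfolding X(1) by (rule fundamental_lemma_box[OF w z X(2)])
  qed
  then show ?thesis using D(4) by (auto elim: eventually_mono)
qed

section \<open>From Lebesgue to Borel integrals\<close>

lemma measurable_lebesgue_AE:
  fixes f f' :: "pt \<Rightarrow> real"
  assumes f': "f' \<in> borel_measurable borel" and ae: "AE x in lborel. f x = f' x"
  shows "f \<in> borel_measurable lebesgue"
proof (rule measurableI)
  fix S :: "real set" assume S: "S \<in> sets borel"
  have "f' -` S \<inter> space borel \<in> sets borel" using measurable_sets[OF f' S] .
  then have A: "f' -` S \<in> sets lebesgue" by (simp add: sets_completionI_sets)
  have B: "AE x in lebesgue. x \<in> f' -` S \<longleftrightarrow> x \<in> f -` S"
    by (rule AE_completion) (use ae in eventually_elim, auto)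
  have "f -` S \<in> sets lebesgue"
    by (rule completion.in_sets_AE[OF B A]) simp
  then show "f -` S \<inter> space lebesgue \<in> sets lebesgue" by simp
qed simp

text \<open>The hypotheses on the solution are integrals over the completed measure of functions
  known up to null sets. This moves them to the Borel measure, where Fubini, substitution and
  \<open>fundamental_lemma\<close> are applied.\<close>

lemma lebesgue_to_lborel:
  fixes f f' :: "pt \<Rightarrow> real"
  assumes f': "f' \<in> borel_measurable borel" and A: "A \<in> sets borel" and ae: "AE x in lborel. x \<in> A \<longrightarrow> f x = f' x"
  shows "(LINT x:A|lebesgue. f x) = (\<integral>x. indicator A x * f' x \<partial>lborel)"
    and "set_integrable lebesgue A f \<longleftrightarrow> set_integrable lborel A f'"
proof -
  have [measurable]: "A \<in> sets borel" "f' \<in> borel_measurable borel" using f' A by auto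
  have ae': "AE x in lborel. indicator A x *\<^sub>R f x = indicator A x * f' x"
    using ae by eventually_elim (auto simp: indicator_def)
  have m: "(\<lambda>x. indicator A x *\<^sub>R f x) \<in> borel_measurable lebesgue"
    by (rule measurable_lebesgue_AE[OF _ ae']) measurable
  have m': "(\<lambda>x. indicator A x * f' x) \<in> borel_measurable lborel" by measurable
  have m'': "(\<lambda>x. indicator A x * f' x) \<in> borel_measurable lebesgue"
    using m' by (rule measurable_completion)
  have "(LINT x:A|lebesgue. f x) = (\<integral>x. indicator A x * f' x \<partial>lebesgue)"
    unfolding set_lebesgue_integral_def by (rule integral_cong_AE[OF m m'' AE_completion[OF ae']])
  also have "\<dots> = (\<integral>x. indicator A x * f' x \<partial>lborel)" by (rule integral_completion[OF m'])
  finally show "(LINT x:A|lebesgue. f x) = (\<integral>x. indicator A x * f' x \<partial>lborel)" .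
  show "set_integrable lebesgue A f \<longleftrightarrow> set_integrable lborel A f'"
    unfolding set_integrable_def
    using integrable_cong_AE[OF m m'' AE_completion[OF ae']] integrable_completion[OF m'] by simp
qed

text \<open>Local integrability gives measurability on each compact box, countably many boxes
  exhaust \<open>\<Omega>\<close>, and a Lebesgue measurable function has a Borel version.\<close>

lemma borel_representative:
  fixes g :: "pt \<Rightarrow> real"
  assumes "open \<Omega>" "\<And>K. compact K \<Longrightarrow> K \<subseteq> \<Omega> \<Longrightarrow> set_integrable lebesgue K g"
  shows "\<exists>g'\<in>borel_measurable borel. AE x in lborel. x \<in> \<Omega> \<longrightarrow> g x = g' x"
proof -
  obtain \<D> where D: "countable \<D>" "\<D> \<subseteq> Pow \<Omega>" "\<And>X. X \<in> \<D> \<Longrightarrow> \<exists>a b. X = cbox a b" "\<Union>\<D> = \<Omega>"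
    using open_countable_Union_open_cbox[OF assms(1)] by metis
  let ?f = "\<lambda>x. indicator \<Omega> x *\<^sub>R g x"
  have "?f \<in> borel_measurable lebesgue"
  proof (rule measurable_piecewise_restrict[where C="insert (- \<Omega>) \<D>"])
    show "countable (insert (- \<Omega>) \<D>)" using D(1) by simp
    show "space lebesgue \<subseteq> \<Union>(insert (- \<Omega>) \<D>)" using D(4) by auto
    fix X assume X: "X \<in> insert (- \<Omega>) \<D>"
    have "- \<Omega> \<in> sets borel" using assms(1) by auto
    then have "X \<in> sets borel" using X D(3)[of X] by auto
    then show Xl: "X \<inter> space lebesgue \<in> sets lebesgue" by (simp add: sets_completionI_sets)
    show "?f \<in> borel_measurable (restrict_space lebesgue X)"
    proof (subst borel_measurable_restrict_space_iff[OF Xl])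
      show "(\<lambda>x. indicator X x *\<^sub>R ?f x) \<in> borel_measurable lebesgue"
      proof (cases "X = - \<Omega>")
        case True
        then have "(\<lambda>x. indicator X x *\<^sub>R ?f x) = (\<lambda>x. 0)" by (auto simp: indicator_def)
        then show ?thesis by simp
      next
        case False
        then have XD: "X \<in> \<D>" using X by simp
        then have "set_integrable lebesgue X g" using D(2,3) assms(2) by (metis PowD compact_cbox subsetD)
        then have "(\<lambda>x. indicator X x *\<^sub>R g x) \<in> borel_measurable lebesgue"
          unfolding set_integrable_def by (rule borel_measurable_integrable)
        moreover have "(\<lambda>x. indicator X x *\<^sub>R ?f x) = (\<lambda>x. indicator X x *\<^sub>R g x)"
          using D(2) XD by (auto simp: indicator_def fun_eq_iff)
        ultimately show ?thesis by simp
      qed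
    qed
  qed
  then obtain g' where g': "g' \<in> borel_measurable lborel" "AE x in lborel. ?f x = g' x"
    using completion_ex_borel_measurable_real by blast
  show ?thesis
  proof (intro bexI)
    show "AE x in lborel. x \<in> \<Omega> \<longrightarrow> g x = g' x"
      using g'(2) by eventually_elim auto
  qed (use g' in auto)
qed

lemma continuous_on_gradI:
  fixes G :: "pt \<Rightarrow> pt"
  assumes "\<And>i. continuous_on S (\<lambda>x. G x $ i)"
  shows "continuous_on S G"
  using continuous_on_vec_lambda[of S "\<lambda>i x. G x $ i"] assms by simp

lemma Ck1_C1c:
  assumes "Ck_on 1 UNIV \<psi>" "compact_supp_in \<Omega> \<psi>"
  obtains G where "C1c \<Omega> \<psi> G"
proof -
  obtain G where "\<forall>x. (\<psi> has_derivative (\<lambda>h. G x \<bullet> h)) (at x)" "\<forall>i. continuous_on UNIV (\<lambda>x. G x $ i)"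
    using assms(1) by (auto simp: One_nat_def)
  then have "C1c \<Omega> \<psi> G" using assms(2) continuous_on_gradI[of UNIV G] by (auto simp: C1c_def)
  then show ?thesis by (rule that)
qed

lemma C1c_Ck1: "C1c \<Omega> \<psi> G \<Longrightarrow> Ck_on 1 UNIV \<psi>"
  unfolding C1c_def by (auto simp: One_nat_def intro!: exI[of _ G] continuous_on_component)

lemma frechet_derivative_C1c: "C1c \<Omega> \<psi> G \<Longrightarrow> frechet_derivative \<psi> (at x) = (\<lambda>h. G x \<bullet> h)"
  using frechet_derivative_at[OF C1c_deriv] by metis

lemma test_fun_C1c:
  assumes "test_fun \<Omega> \<psi>"
  obtains G where "C1c \<Omega> \<psi> G"
  using assms Ck1_C1c unfolding test_fun_def Cinf_on_def by blast

text \<open>Composition with \<open>gam e\<close> cuts \<open>u\<close> off near its free boundary, where it need not be differentiable;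
  \<open>gam'\<close> is the derivative.\<close>

definition gam :: "real \<Rightarrow> real \<Rightarrow> real" where
  "gam e t = (if t \<le> e then 0 else (t - e)\<^sup>2 / t)"

definition gam' :: "real \<Rightarrow> real \<Rightarrow> real" where
  "gam' e t = (if t \<le> e then 0 else 1 - (e / t)\<^sup>2)"

text \<open>The numerator vanishes to second order at \<open>t = e\<close>, so the truncation is C^1
  across the threshold.\<close>

lemma gam_deriv:
  assumes "e > 0" shows "(gam e has_real_derivative gam' e t) (at t)"
proof -
  have gd: "((\<lambda>t. (t - e)\<^sup>2 / t) has_real_derivative 1 - (e / t)\<^sup>2) (at t)" if "t \<ge> e" for t
    using that assms by (auto intro!: derivative_eq_intros simp: field_simps power2_eq_square)
  consider "t < e" | "t = e" | "t > e" by linarith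
  then show ?thesis
  proof cases
    case 1
    have "((\<lambda>t. 0) has_real_derivative 0) (at t)" by simp
    then have "(gam e has_real_derivative 0) (at t)"
      by (rule has_field_derivative_transform_within_open[where S="{..<e}"]) (use 1 in \<open>auto simp: gam_def\<close>)
    then show ?thesis using 1 by (simp add: gam'_def)
  next
    case 2
    have "(\<lambda>h. gam e (e + h) / h) \<midarrow>0\<rightarrow> 0"
    proof (rule Lim_null_comparison)
      have "norm (gam e (e + h) / h) \<le> \<bar>h\<bar> / e" if "h \<noteq> 0" for h
      proof (cases "h > 0")
        case True
        then have "norm (gam e (e + h) / h) = h / (e + h)"
          using assms by (simp add: gam_def power2_eq_square)
        also have "\<dots> \<le> \<bar>h\<bar> / e" using True assms by (simp add: frac_le)
        finally show ?thesis .
      qed (use assms in \<open>simp add: gam_def divide_nonpos_pos\<close>)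
      then show "\<forall>\<^sub>F h in at 0. norm (gam e (e + h) / h) \<le> \<bar>h\<bar> / e"
        by (simp add: eventually_at_filter)
      have "((\<lambda>h. \<bar>h\<bar> / e) \<longlongrightarrow> \<bar>0\<bar> / e) (at 0)"
        using assms by (intro tendsto_intros) auto
      then show "((\<lambda>h. \<bar>h\<bar> / e) \<longlongrightarrow> 0) (at 0)" by simp
    qed
    then show ?thesis using 2 by (simp add: DERIV_def gam'_def) (simp add: gam_def)
  next
    case 3
    show ?thesis
      by (rule has_field_derivative_transform_within_open[OF _ , where S="{e<..}" and f="\<lambda>t. (t - e)\<^sup>2 / t"])
        (use 3 gd[of t] in \<open>auto simp: gam_def gam'_def\<close>)
  qed
qed

lemma gam'_continuous:
  assumes "e > 0" shows "continuous_on UNIV (gam' e)"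
proof -
  have "gam' e = (\<lambda>t. if t \<le> e then 0 else 1 - (e / t)\<^sup>2)" by (simp add: gam'_def fun_eq_iff)
  moreover have "continuous_on ({..e} \<union> {e..}) (\<lambda>t. if t \<le> e then 0 else 1 - (e / t)\<^sup>2)"
    by (rule continuous_on_If) (use assms in \<open>auto intro!: continuous_intros\<close>)
  moreover have "{..e} \<union> {e..} = (UNIV :: real set)" by auto
  ultimately show ?thesis by simp
qed

text \<open>Together with \<open>gam_bounds\<close> this is the domination, uniform in
  \<open>e\<close>, for letting \<open>e\<close> tend to 0.\<close>

lemma gam'_bounds: "e > 0 \<Longrightarrow> 0 \<le> gam' e t \<and> gam' e t \<le> 1"
  by (auto simp: gam'_def power_le_one)

lemma gam_bounds: "e > 0 \<Longrightarrow> 0 \<le> gam e t \<and> gam e t \<le> max 0 t"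
proof (cases "t \<le> e")
  case False
  assume e: "e > 0"
  have "(t - e) * (t - e) \<le> t * t" using False e by (intro mult_mono) auto
  then show ?thesis using False e by (auto simp: gam_def pos_divide_le_eq power2_eq_square)
qed (simp add: gam_def)

lemma gam_zero: "t \<le> e \<Longrightarrow> gam e t = 0" "t \<le> e \<Longrightarrow> gam' e t = 0"
  by (auto simp: gam_def gam'_def)

definition eps :: "nat \<Rightarrow> real" where "eps n = inverse (real (Suc n))"

lemma eps_pos: "eps n > 0" by (simp add: eps_def)

lemma eps_lim: "eps \<longlonglongrightarrow> 0" unfolding eps_def by (rule LIMSEQ_inverse_real_of_nat)

lemma eventually_eps_less: "t > 0 \<Longrightarrow> \<forall>\<^sub>F n in sequentially. eps n < t"
  using eps_lim by (rule order_tendstoD(2))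

lemma gam_lim: "(\<lambda>n. gam (eps n) t) \<longlonglongrightarrow> max 0 t"
proof (cases "t > 0")
  case True
  have "(\<lambda>n. (t - eps n)\<^sup>2 / t) \<longlonglongrightarrow> (t - 0)\<^sup>2 / t" by (intro tendsto_intros eps_lim) (use True in auto)
  then have "(\<lambda>n. (t - eps n)\<^sup>2 / t) \<longlonglongrightarrow> max 0 t" using True by (simp add: power2_eq_square)
  then show ?thesis
    by (rule Lim_transform_eventually) (use eventually_eps_less[OF True] in \<open>eventually_elim, auto simp: gam_def\<close>)
next
  case False
  then have "gam (eps n) t = 0" for n using eps_pos[of n] by (auto simp: gam_def)
  then show ?thesis using False by (simp add: max_def)
qed

lemma gam'_lim: "(\<lambda>n. gam' (eps n) t) \<longlonglongrightarrow> (if t > 0 then 1 else 0)"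
proof (cases "t > 0")
  case True
  have "(\<lambda>n. 1 - (eps n / t)\<^sup>2) \<longlonglongrightarrow> 1 - (0 / t)\<^sup>2" by (intro tendsto_intros eps_lim) (use True in auto)
  then have "(\<lambda>n. 1 - (eps n / t)\<^sup>2) \<longlonglongrightarrow> (if t > 0 then 1 else 0)" using True by simp
  then show ?thesis
    by (rule Lim_transform_eventually) (use eventually_eps_less[OF True] in \<open>eventually_elim, auto simp: gam'_def\<close>)
next
  case False
  then have "gam' (eps n) t = 0" for n using eps_pos[of n] by (auto simp: gam'_def)
  then show ?thesis using False by simp
qed

subsection \<open>The gradient of a variational solution\<close>

locale varsol =
  fixes \<Omega> :: "pt set" and u :: "pt \<Rightarrow> real" and g :: "pt \<Rightarrow> pt"
  assumes op: "open \<Omega>" and vs: "variational_solution \<Omega> u g"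
begin

text \<open>The weak gradient \<open>g\<close> is only determined almost everywhere; \<open>p\<close> is its pointwise representative.\<close>

definition P where "P = {x \<in> \<Omega>. u x > 0}"

definition U where "U x = indicator \<Omega> x * u x"

definition p0 :: "pt \<Rightarrow> pt" where
  "p0 = (SOME G. (\<forall>x\<in>P. (u has_derivative (\<lambda>h. G x \<bullet> h)) (at x)) \<and> (\<forall>i. Ck_on 1 P (\<lambda>x. G x $ i)))"

definition p where "p x = indicator P x *\<^sub>R p0 x"

lemma u_cont: "continuous_on \<Omega> u" and u_nonneg: "x \<in> \<Omega> \<Longrightarrow> u x \<ge> 0"
  and u_lower: "x \<in> \<Omega> \<Longrightarrow> x $ 2 \<le> 0 \<Longrightarrow> u x = 0"
  using vs by (auto simp: variational_solution_def)

lemma P_open: "open P"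
proof -
  have "P = \<Omega> \<inter> u -` {0<..}" by (auto simp: P_def)
  then show ?thesis using continuous_open_preimage[OF u_cont op, of "{0<..}"] by simp
qed

lemma P_subset: "P \<subseteq> \<Omega>" by (auto simp: P_def)

lemma P_pos: "x \<in> P \<Longrightarrow> x $ 2 > 0"
  using u_lower by (force simp: P_def)

lemma p0_props: "(\<forall>x\<in>P. (u has_derivative (\<lambda>h. p0 x \<bullet> h)) (at x)) \<and> (\<forall>i. Ck_on 1 P (\<lambda>x. p0 x $ i))"
proof -
  have "\<Omega> \<inter> {x. u x > 0} = P" by (auto simp: P_def)
  then have "Ck_on (Suc 1) P u" using vs by (simp add: variational_solution_def numeral_2_eq_2)
  then have "\<exists>G. (\<forall>x\<in>P. (u has_derivative (\<lambda>h. G x \<bullet> h)) (at x)) \<and> (\<forall>i. Ck_on 1 P (\<lambda>x. G x $ i))"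
    by (simp only: Ck_on.simps)
  then show ?thesis unfolding p0_def by (rule someI_ex)
qed

lemma p0_deriv: "x \<in> P \<Longrightarrow> (u has_derivative (\<lambda>h. p0 x \<bullet> h)) (at x)"
  using p0_props by blast

lemma hess_ex: "\<exists>H. (\<forall>x\<in>P. ((\<lambda>x. p0 x $ i) has_derivative (\<lambda>h. H x \<bullet> h)) (at x)) \<and> continuous_on P H"
proof -
  have "Ck_on (Suc 0) P (\<lambda>x. p0 x $ i)" using p0_props by simp
  then obtain H where "\<forall>x\<in>P. ((\<lambda>x. p0 x $ i) has_derivative (\<lambda>h. H x \<bullet> h)) (at x)"
     "\<forall>j. continuous_on P (\<lambda>x. H x $ j)"
    by (auto simp del: One_nat_def)
  then show ?thesis using continuous_on_gradI[of P H] by blast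
qed

definition hess :: "2 \<Rightarrow> pt \<Rightarrow> pt" where
  "hess i = (SOME H. (\<forall>x\<in>P. ((\<lambda>x. p0 x $ i) has_derivative (\<lambda>h. H x \<bullet> h)) (at x)) \<and> continuous_on P H)"

lemma hess_deriv: "x \<in> P \<Longrightarrow> ((\<lambda>x. p0 x $ i) has_derivative (\<lambda>h. hess i x \<bullet> h)) (at x)"
  and hess_cont: "continuous_on P (hess i)"
  using someI_ex[OF hess_ex[of i]] unfolding hess_def by blast+

lemma p0_cont: "continuous_on P p0"
  by (rule continuous_on_gradI)
     (rule has_derivative_continuous_on[OF has_derivative_at_withinI[OF hess_deriv]])

lemma U_measurable [measurable]: "U \<in> borel_measurable borel"
  using borel_measurable_continuous_on_indicator[of \<Omega> u] op u_cont unfolding U_def by simp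

lemma p_measurable [measurable]: "p \<in> borel_measurable borel"
  using borel_measurable_continuous_on_indicator[of P p0] P_open p0_cont unfolding p_def by simp

lemma P_measurable [measurable]: "P \<in> sets borel" using P_open by simp

lemma Om_measurable [measurable]: "\<Omega> \<in> sets borel" using op by simp

lemma U_cont: "continuous_on \<Omega> U"
  by (rule continuous_on_eq[OF u_cont]) (simp add: U_def)

lemma U_eq: "x \<in> \<Omega> \<Longrightarrow> U x = u x" by (simp add: U_def)

lemma set_integrable_continuous:
  fixes f :: "pt \<Rightarrow> real"
  assumes "compact K" "continuous_on K f" shows "set_integrable lborel K f"
  unfolding set_integrable_def by (rule borel_integrable_compact[OF assms])

text \<open>Any function of \<open>u\<close> vanishing for \<open>u \<le> e\<close> turns a test function on \<open>\<Omega>\<close> into one on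
  the set where \<open>u\<close> is regular.\<close>

lemma C1c_truncate:
  assumes e: "e > 0" and G: "\<And>t. (\<Gamma> has_real_derivative \<Gamma>' t) (at t)" "continuous_on UNIV \<Gamma>'"
    "\<And>t. t \<le> e \<Longrightarrow> \<Gamma> t = 0" and \<psi>: "C1c \<Omega> \<psi> G"
  shows "C1c P (\<lambda>x. \<Gamma> (u x) * \<psi> x) (\<lambda>x. indicator P x *\<^sub>R ((\<psi> x * \<Gamma>' (u x)) *\<^sub>R p0 x + \<Gamma> (u x) *\<^sub>R G x))"
proof -
  obtain K where K: "compact K" "K \<subseteq> \<Omega>" "\<And>x. x \<notin> K \<Longrightarrow> \<psi> x = 0" "\<And>x. x \<notin> K \<Longrightarrow> G x = 0"
    using C1c_support[OF \<psi>] by blast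
  \<comment> \<open>The part of the support of \<psi> on which \<open>u\<close> is at least
    \<open>e\<close>: a compact subset of \<open>P\<close> outside which the truncated test
    vanishes.\<close>
  define L where "L = K \<inter> u -` {e..}"
  have "continuous_on K u" by (rule continuous_on_subset[OF u_cont K(2)])
  then have "closed L" unfolding L_def
    using compact_imp_closed[OF K(1)] by (intro continuous_closed_preimage) auto
  then have L: "compact L" unfolding L_def using K(1)
    by (metis compact_Int_closed inf.left_idem)
  have LP: "L \<subseteq> P" using e K(2) by (auto simp: L_def P_def)
  show ?thesis
  proof (rule C1c_extend_zero[OF P_open L LP])
    show "\<Gamma> (u x) * \<psi> x = 0" if "x \<notin> L" for x
      using that K(3)[of x] G(3)[of "u x"] by (cases "x \<in> K") (auto simp: L_def)
    show "((\<lambda>x. \<Gamma> (u x) * \<psi> x) has_derivative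
        (\<lambda>h. ((\<psi> x * \<Gamma>' (u x)) *\<^sub>R p0 x + \<Gamma> (u x) *\<^sub>R G x) \<bullet> h)) (at x)" if "x \<in> P" for x
    proof -
      have "((\<lambda>x. \<Gamma> (u x)) has_derivative (\<lambda>h. \<Gamma>' (u x) * (p0 x \<bullet> h))) (at x)"
        by (rule has_derivative_compose[OF p0_deriv[OF that] G(1)[unfolded has_field_derivative_def]])
      from has_derivative_mult[OF this C1c_deriv[OF \<psi>]] show ?thesis
        by (rule has_derivative_eq_rhs) (auto simp: inner_add_left algebra_simps)
    qed
    have u: "continuous_on P u" by (rule continuous_on_subset[OF u_cont P_subset])
    have "continuous_on UNIV \<Gamma>"
      by (rule has_derivative_continuous_on) (use G(1) in \<open>auto simp: has_field_derivative_def\<close>)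
    then have "continuous_on P (\<lambda>x. \<Gamma> (u x))" by (rule continuous_on_compose2[OF _ u]) auto
    moreover have "continuous_on P (\<lambda>x. \<Gamma>' (u x))" by (rule continuous_on_compose2[OF G(2) u]) auto
    ultimately show "continuous_on P (\<lambda>x. (\<psi> x * \<Gamma>' (u x)) *\<^sub>R p0 x + \<Gamma> (u x) *\<^sub>R G x)"
      by (intro continuous_intros p0_cont continuous_on_subset[OF C1c_continuous[OF \<psi>]]
          continuous_on_subset[OF C1c_continuous_grad[OF \<psi>]]) auto
  qed
qed

lemma integral_by_parts_P:
  assumes \<psi>: "C1c P \<psi> G"
    and d: "\<And>x. x \<in> P \<Longrightarrow> (f has_derivative (\<lambda>h. F x \<bullet> h)) (at x)" and c: "continuous_on P F"
  shows "(\<integral>x. indicator P x * (\<psi> x * F x $ i + f x * G x $ i) \<partial>lborel) = 0"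
  using C1c_integral_grad[OF C1c_mult[OF \<psi> P_open d c], of i] by simp

lemma integrable_cont_P:
  assumes \<psi>: "C1c P \<psi> G" and f: "continuous_on P f"
  shows "integrable lborel (\<lambda>x. indicator P x * (f x * \<psi> x))" "integrable lborel (\<lambda>x. indicator P x * (f x * G x $ i))"
proof -
  obtain K where K: "compact K" "K \<subseteq> P" "\<And>x. x \<notin> K \<Longrightarrow> \<psi> x = 0" "\<And>x. x \<notin> K \<Longrightarrow> G x = 0"
    using C1c_support[OF \<psi>] by blast
  have K5: "G x $ i = 0" if "x \<notin> K" for x using K(4)[OF that] by simp
  have fi: "set_integrable lborel K f"
    by (rule set_integrable_continuous[OF K(1) continuous_on_subset[OF f K(2)]])
  have "integrable lborel (\<lambda>x. f x * \<psi> x)"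
    by (rule integrable_mult_compact[OF fi K(1) continuous_on_subset[OF C1c_continuous[OF \<psi>]] K(3)]) auto
  moreover have "(\<lambda>x. f x * \<psi> x) = (\<lambda>x. indicator P x * (f x * \<psi> x))"
    using K by (auto simp: indicator_def fun_eq_iff)
  ultimately show "integrable lborel (\<lambda>x. indicator P x * (f x * \<psi> x))" by simp
  have "integrable lborel (\<lambda>x. f x * G x $ i)"
    by (rule integrable_mult_compact[OF fi K(1)])
      (use K(4) in \<open>auto intro: continuous_on_subset[OF continuous_on_component[OF C1c_continuous_grad[OF \<psi>]]]\<close>)
  moreover have "(\<lambda>x. f x * G x $ i) = (\<lambda>x. indicator P x * (f x * G x $ i))"
    using K(2) K5 by (auto simp: indicator_def fun_eq_iff)
  ultimately show "integrable lborel (\<lambda>x. indicator P x * (f x * G x $ i))" by simp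
qed

lemma g_loc_integrable:
  assumes "compact K" "K \<subseteq> \<Omega>"
  shows "set_integrable lebesgue K (\<lambda>x. g x $ i)" "set_integrable lebesgue K (\<lambda>x. (norm (g x))\<^sup>2)"
  using vs assms by (auto simp: variational_solution_def W12_loc_def)

definition gb :: "2 \<Rightarrow> pt \<Rightarrow> real" where
  "gb i = (SOME g'. g' \<in> borel_measurable borel \<and> (AE x in lborel. x \<in> \<Omega> \<longrightarrow> g x $ i = g' x))"

lemma gb_props: "gb i \<in> borel_measurable borel" "AE x in lborel. x \<in> \<Omega> \<longrightarrow> g x $ i = gb i x"
proof -
  have "\<exists>g'. g' \<in> borel_measurable borel \<and> (AE x in lborel. x \<in> \<Omega> \<longrightarrow> g x $ i = g' x)"
    using borel_representative[OF op g_loc_integrable(1)[of _ i]] by blast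
  from someI_ex[OF this] show "gb i \<in> borel_measurable borel" "AE x in lborel. x \<in> \<Omega> \<longrightarrow> g x $ i = gb i x"
    unfolding gb_def by blast+
qed

lemma gb_loc_integrable:
  assumes "compact K" "K \<subseteq> \<Omega>" shows "set_integrable lborel K (gb i)"
proof -
  have "AE x in lborel. x \<in> K \<longrightarrow> g x $ i = gb i x"
    using gb_props(2)[of i] by eventually_elim (use assms in auto)
  from lebesgue_to_lborel(2)[OF gb_props(1) _ this] show ?thesis
    using g_loc_integrable(1)[OF assms] assms(1) by (simp add: borel_compact)
qed

lemma weak_gradient_lborel:
  assumes t: "test_fun \<Omega> \<psi>" and \<psi>: "C1c \<Omega> \<psi> G"
  shows "(\<integral>x. U x * G x $ i \<partial>lborel) = - (\<integral>x. gb i x * \<psi> x \<partial>lborel)"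
proof -
  obtain K where K: "compact K" "K \<subseteq> \<Omega>" "\<And>x. x \<notin> K \<Longrightarrow> \<psi> x = 0" "\<And>x. x \<notin> K \<Longrightarrow> G x = 0"
    using C1c_support[OF \<psi>] by blast
  note [measurable] = borel_measurable_continuous_onI[OF C1c_continuous[OF \<psi>]]
    borel_measurable_continuous_onI[OF C1c_continuous_grad[OF \<psi>]] gb_props(1)
  have "(LINT x:\<Omega>|lebesgue. u x * frechet_derivative \<psi> (at x) (axis i 1))
      = - (LINT x:\<Omega>|lebesgue. g x $ i * \<psi> x)"
    using vs t by (simp add: variational_solution_def W12_loc_def weak_gradient_def)
  moreover have "(LINT x:\<Omega>|lebesgue. u x * frechet_derivative \<psi> (at x) (axis i 1))
      = (\<integral>x. indicator \<Omega> x * (U x * G x $ i) \<partial>lborel)"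
    by (rule lebesgue_to_lborel(1)) (auto simp: frechet_derivative_C1c[OF \<psi>] U_eq inner_axis)
  moreover have "(LINT x:\<Omega>|lebesgue. g x $ i * \<psi> x) = (\<integral>x. indicator \<Omega> x * (gb i x * \<psi> x) \<partial>lborel)"
  proof (rule lebesgue_to_lborel(1))
    show "AE x in lborel. x \<in> \<Omega> \<longrightarrow> g x $ i * \<psi> x = gb i x * \<psi> x"
      using gb_props(2)[of i] by eventually_elim auto
  qed auto
  moreover have "(\<lambda>x. indicator \<Omega> x * (U x * G x $ i)) = (\<lambda>x. U x * G x $ i)"
     by (auto simp: U_def indicator_def)
  moreover have "(\<lambda>x. indicator \<Omega> x * (gb i x * \<psi> x)) = (\<lambda>x. gb i x * \<psi> x)"
    using K by (auto simp: indicator_def fun_eq_iff)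
  ultimately show ?thesis by simp
qed

text \<open>Tests supported in \<open>P\<close> see the classical gradient through integration by
  parts, so there it coincides with the weak one.\<close>

lemma gb_eq_p0: "AE x in lborel. x \<in> P \<longrightarrow> gb i x = p0 x $ i"
proof -
  let ?w = "\<lambda>x. indicator P x * gb i x - p x $ i"
  note [measurable] = gb_props(1)
  have "AE x in lborel. x \<in> P \<longrightarrow> ?w x = 0"
  proof (rule fundamental_lemma[OF P_open])
    show "?w \<in> borel_measurable borel" by measurable
    show "set_integrable lborel K ?w" if K: "compact K" "K \<subseteq> P" for K
    proof -
      have "set_integrable lborel K (\<lambda>x. gb i x - p0 x $ i)"
        by (intro set_integral_diff gb_loc_integrable set_integrable_continuous K
            continuous_on_component continuous_on_subset[OF p0_cont]) (use K P_subset in auto)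
      then show ?thesis
        by (rule set_integrable_cong[THEN iffD1, rotated -1]) (use K in \<open>auto simp: p_def indicator_def\<close>)
    qed
    fix \<psi> assume t: "test_fun P \<psi>"
    then obtain G where G: "C1c P \<psi> G" by (rule test_fun_C1c)
    obtain K where K: "compact K" "K \<subseteq> P" "\<And>x. x \<notin> K \<Longrightarrow> \<psi> x = 0" "\<And>x. x \<notin> K \<Longrightarrow> G x = 0"
      using C1c_support[OF G] by blast
    have K5: "G x $ i = 0" if "x \<notin> K" for x using K(4)[OF that] by simp
    have t': "test_fun \<Omega> \<psi>" using t P_subset by (auto simp: test_fun_def compact_supp_in_def)
    have 1: "(\<integral>x. U x * G x $ i \<partial>lborel) = - (\<integral>x. gb i x * \<psi> x \<partial>lborel)"
      by (rule weak_gradient_lborel[OF t' C1c_mono[OF G P_subset]])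
    have uc: "continuous_on P u" by (rule continuous_on_subset[OF u_cont P_subset])
    have pc: "continuous_on P (\<lambda>x. p0 x $ i)" by (intro continuous_on_component p0_cont)
    have "0 = (\<integral>x. indicator P x * (\<psi> x * p0 x $ i + u x * G x $ i) \<partial>lborel)"
      by (rule integral_by_parts_P[OF G p0_deriv p0_cont, symmetric])
    also have "\<dots> = (\<integral>x. indicator P x * (p0 x $ i * \<psi> x) + indicator P x * (u x * G x $ i) \<partial>lborel)"
      by (simp add: algebra_simps)
    also have "\<dots> = (\<integral>x. indicator P x * (p0 x $ i * \<psi> x) \<partial>lborel) + (\<integral>x. indicator P x * (u x * G x $ i) \<partial>lborel)"
      by (rule Bochner_Integration.integral_add[OF integrable_cont_P(1)[OF G pc] integrable_cont_P(2)[OF G uc]])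
    also have "(\<lambda>x. indicator P x * (u x * G x $ i)) = (\<lambda>x. U x * G x $ i)"
      using K(2) K5 P_subset by (auto simp: indicator_def fun_eq_iff U_def)
    finally have 2: "(\<integral>x. gb i x * \<psi> x \<partial>lborel) = (\<integral>x. indicator P x * (p0 x $ i * \<psi> x) \<partial>lborel)"
      using 1 by simp
    have "integrable lborel (\<lambda>x. gb i x * \<psi> x)"
      by (rule integrable_mult_compact[OF gb_loc_integrable K(1) continuous_on_subset[OF C1c_continuous[OF G]] K(3)])
        (use K P_subset in auto)
    then have "(\<integral>x. gb i x * \<psi> x - indicator P x * (p0 x $ i * \<psi> x) \<partial>lborel) = 0"
      using 2 integrable_cont_P(1)[OF G pc] by simp
    moreover have "gb i x * \<psi> x - indicator P x * (p0 x $ i * \<psi> x) = ?w x * \<psi> x" for x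
      using K by (auto simp: indicator_def p_def algebra_simps)
    ultimately show "(\<integral>x. ?w x * \<psi> x \<partial>lborel) = 0" by simp
  qed
  then show ?thesis by eventually_elim (auto simp: p_def)
qed

text \<open>\<open>p\<close> is either zero or, almost everywhere, equal to \<open>gb\<close>, so
  the bounds for the weak gradient carry over. Equality off \<open>P\<close> comes only with
  \<open>g_eq_p\<close>, whose proof relies on this integrability.\<close>

lemma p_loc_integrable:
  assumes K: "compact K" "K \<subseteq> \<Omega>"
  shows "set_integrable lborel K (\<lambda>x. p x $ i)" "set_integrable lborel K (\<lambda>x. (norm (p x))\<^sup>2)"
proof -
  note [measurable] = gb_props(1) borel_compact[OF K(1)]
  have 1: "set_integrable lborel K (gb i)" by (rule gb_loc_integrable[OF K])
  have ae: "AE x in lborel. \<forall>i. x \<in> P \<longrightarrow> gb i x = p0 x $ i"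
    unfolding AE_all_countable using gb_eq_p0 by blast
  show "set_integrable lborel K (\<lambda>x. p x $ i)"
    unfolding set_integrable_def
  proof (rule Bochner_Integration.integrable_bound[OF 1[unfolded set_integrable_def]])
    show "AE x in lborel. norm (indicator K x *\<^sub>R p x $ i) \<le> norm (indicator K x *\<^sub>R gb i x)"
      using ae by eventually_elim (auto simp: indicator_def p_def)
  qed measurable
  have aeg: "AE x in lborel. x \<in> \<Omega> \<longrightarrow> g x = (\<chi> i. gb i x)"
  proof -
    have "AE x in lborel. \<forall>i. x \<in> \<Omega> \<longrightarrow> g x $ i = gb i x"
      unfolding AE_all_countable using gb_props(2) by blast
    then show ?thesis by eventually_elim (auto simp: vec_eq_iff)
  qed
  have m: "(\<lambda>x. (norm (\<chi> i. gb i x))\<^sup>2) \<in> borel_measurable borel"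
  proof -
    have "(norm (\<chi> i. gb i x))\<^sup>2 = (\<Sum>i\<in>UNIV. (gb i x)\<^sup>2)" for x
      by (simp add: norm_vec_def L2_set_def sum_nonneg)
    then show ?thesis by simp
  qed
  have 2: "set_integrable lborel K (\<lambda>x. (norm (\<chi> i. gb i x))\<^sup>2)"
  proof -
    have "AE x in lborel. x \<in> K \<longrightarrow> (norm (g x))\<^sup>2 = (norm (\<chi> i. gb i x))\<^sup>2"
      using aeg by eventually_elim (use K in auto)
    from lebesgue_to_lborel(2)[OF m _ this] show ?thesis
      using g_loc_integrable(2)[OF K] by simp
  qed
  show "set_integrable lborel K (\<lambda>x. (norm (p x))\<^sup>2)"
    unfolding set_integrable_def
  proof (rule Bochner_Integration.integrable_bound[OF 2[unfolded set_integrable_def]])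
    show "AE x in lborel. norm (indicator K x *\<^sub>R (norm (p x))\<^sup>2) \<le> norm (indicator K x *\<^sub>R (norm (\<chi> i. gb i x))\<^sup>2)"
      using ae
    proof eventually_elim
      case (elim x)
      then have "x \<in> P \<Longrightarrow> p x = (\<chi> i. gb i x)" by (simp add: p_def vec_eq_iff)
      then show ?case by (auto simp: indicator_def p_def)
    qed
  qed measurable
qed

end

section \<open>Symmetry of second derivatives\<close>

lemma has_real_derivative_along_line:
  fixes f :: "pt \<Rightarrow> real"
  assumes "(f has_derivative (\<lambda>h. G \<bullet> h)) (at (a + s *\<^sub>R e))"
  shows "((\<lambda>s. f (a + s *\<^sub>R e)) has_real_derivative (G \<bullet> e)) (at s)"
proof -
  have "((\<lambda>s. a + s *\<^sub>R e) has_derivative (\<lambda>h. h *\<^sub>R e)) (at s)"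
    by (auto intro!: derivative_eq_intros)
  from has_derivative_compose[OF this assms] show ?thesis
    by (rule has_derivative_imp_has_field_derivative) simp
qed

text \<open>The mean value theorem in direction i, applied to a difference in direction j, and then
  the mean value theorem in direction j.\<close>

lemma second_difference:
  fixes u :: "pt \<Rightarrow> real" and p0 :: "pt \<Rightarrow> pt" and hess :: "2 \<Rightarrow> pt \<Rightarrow> pt"
  assumes p0_deriv: "\<And>x. x \<in> P \<Longrightarrow> (u has_derivative (\<lambda>h. p0 x \<bullet> h)) (at x)"
    and hess_deriv: "\<And>x i. x \<in> P \<Longrightarrow> ((\<lambda>x. p0 x $ i) has_derivative (\<lambda>h. hess i x \<bullet> h)) (at x)"
    and sub: "ball x r \<subseteq> P" and h: "0 < h" "2 * h < r"
  obtains \<xi> where "dist \<xi> x < r"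
    "u (x + h *\<^sub>R axis i 1 + h *\<^sub>R axis j 1) - u (x + h *\<^sub>R axis i 1) - u (x + h *\<^sub>R axis j 1) + u x
       = h\<^sup>2 * hess i \<xi> $ j"
proof -
  let ?e = "axis i (1::real)" and ?f = "axis j (1::real)"
  have inP: "x + s *\<^sub>R ?e + t *\<^sub>R ?f \<in> ball x r" if "0 \<le> s" "s \<le> h" "0 \<le> t" "t \<le> h" for s t
  proof -
    have "norm (s *\<^sub>R ?e + t *\<^sub>R ?f) \<le> norm (s *\<^sub>R ?e) + norm (t *\<^sub>R ?f)" by (rule norm_triangle_ineq)
    also have "\<dots> = s + t" using that by simp
    finally have "norm (s *\<^sub>R ?e + t *\<^sub>R ?f) < r" using that h by linarith
    moreover have "x + s *\<^sub>R ?e + t *\<^sub>R ?f - x = s *\<^sub>R ?e + t *\<^sub>R ?f" by simp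
    ultimately show ?thesis unfolding mem_ball by (metis dist_commute dist_norm)
  qed
  have d1: "((\<lambda>s. u (x + h *\<^sub>R ?f + s *\<^sub>R ?e) - u (x + s *\<^sub>R ?e)) has_real_derivative
      (p0 (x + h *\<^sub>R ?f + s *\<^sub>R ?e) $ i - p0 (x + s *\<^sub>R ?e) $ i)) (at s)" if "0 \<le> s" "s \<le> h" for s
  proof -
    have "x + h *\<^sub>R ?f + s *\<^sub>R ?e \<in> P" "x + s *\<^sub>R ?e \<in> P"
      using inP[of s h] inP[of s 0] that h sub by (auto simp: algebra_simps)
    from has_real_derivative_along_line[OF p0_deriv[OF this(1)]] has_real_derivative_along_line[OF p0_deriv[OF this(2)]]
    show ?thesis by (auto intro!: derivative_eq_intros simp: inner_axis)
  qed
  obtain s where s: "0 < s" "s < h" and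
    1: "(u (x + h *\<^sub>R ?f + h *\<^sub>R ?e) - u (x + h *\<^sub>R ?e)) - (u (x + h *\<^sub>R ?f + 0 *\<^sub>R ?e) - u (x + 0 *\<^sub>R ?e))
      = (h - 0) * (p0 (x + h *\<^sub>R ?f + s *\<^sub>R ?e) $ i - p0 (x + s *\<^sub>R ?e) $ i)"
    using MVT2[OF h(1) d1] by auto
  have d2: "((\<lambda>t. p0 (x + s *\<^sub>R ?e + t *\<^sub>R ?f) $ i) has_real_derivative hess i (x + s *\<^sub>R ?e + t *\<^sub>R ?f) $ j) (at t)"
    if "0 \<le> t" "t \<le> h" for t
  proof -
    have "x + s *\<^sub>R ?e + t *\<^sub>R ?f \<in> P" using inP[of s t] s that h sub by auto
    from has_real_derivative_along_line[OF hess_deriv[OF this]] show ?thesis by (simp add: inner_axis)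
  qed
  obtain t where t: "0 < t" "t < h" and
    2: "p0 (x + s *\<^sub>R ?e + h *\<^sub>R ?f) $ i - p0 (x + s *\<^sub>R ?e + 0 *\<^sub>R ?f) $ i = (h - 0) * hess i (x + s *\<^sub>R ?e + t *\<^sub>R ?f) $ j"
    using MVT2[OF h(1) d2] by auto
  show ?thesis
  proof
    show "dist (x + s *\<^sub>R ?e + t *\<^sub>R ?f) x < r"
      using inP[of s t] s t by (simp add: dist_commute)
    show "u (x + h *\<^sub>R ?e + h *\<^sub>R ?f) - u (x + h *\<^sub>R ?e) - u (x + h *\<^sub>R ?f) + u x
       = h\<^sup>2 * hess i (x + s *\<^sub>R ?e + t *\<^sub>R ?f) $ j"
      using 1 2 by (simp add: add_ac power2_eq_square)
  qed
qed

text \<open>The second difference is symmetric in the two directions, and on a small ball continuity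
  of the Hessian keeps both mixed derivatives close to it.\<close>

lemma mixed_partials_symmetric:
  fixes u :: "pt \<Rightarrow> real" and p0 :: "pt \<Rightarrow> pt" and hess :: "2 \<Rightarrow> pt \<Rightarrow> pt"
  assumes P_open: "open P"
    and p0_deriv: "\<And>x. x \<in> P \<Longrightarrow> (u has_derivative (\<lambda>h. p0 x \<bullet> h)) (at x)"
    and hess_deriv: "\<And>x i. x \<in> P \<Longrightarrow> ((\<lambda>x. p0 x $ i) has_derivative (\<lambda>h. hess i x \<bullet> h)) (at x)"
    and hess_cont: "\<And>i. continuous_on P (hess i)" and x: "x \<in> P"
  shows "hess i x $ j = hess j x $ i"
proof (rule ccontr)
  assume ne: "hess i x $ j \<noteq> hess j x $ i"
  define d where "d = \<bar>hess i x $ j - hess j x $ i\<bar> / 2"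
  have d: "d > 0" using ne by (simp add: d_def)
  have c: "isCont (\<lambda>y. hess i y $ j) x" for i j
    using hess_cont[of i] x P_open
    by (intro continuous_component) (simp add: continuous_on_eq_continuous_at)
  obtain r1 where r1: "r1 > 0" "\<And>y. dist y x < r1 \<Longrightarrow> dist (hess i y $ j) (hess i x $ j) < d"
    using c[of i j] d unfolding continuous_at_eps_delta by metis
  obtain r2 where r2: "r2 > 0" "\<And>y. dist y x < r2 \<Longrightarrow> dist (hess j y $ i) (hess j x $ i) < d"
    using c[of j i] d unfolding continuous_at_eps_delta by metis
  obtain r3 where r3: "r3 > 0" "ball x r3 \<subseteq> P" using P_open x open_contains_ball by blast
  define r where "r = min r1 (min r2 r3)"
  have r: "r > 0" "ball x r \<subseteq> P" using r1 r2 r3 by (auto simp: r_def)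
  define h where "h = r / 4"
  have h: "0 < h" "2 * h < r" using r by (auto simp: h_def)
  obtain \<xi> where 1: "dist \<xi> x < r"
    "u (x + h *\<^sub>R axis i 1 + h *\<^sub>R axis j 1) - u (x + h *\<^sub>R axis i 1) - u (x + h *\<^sub>R axis j 1) + u x = h\<^sup>2 * hess i \<xi> $ j"
    using second_difference[OF p0_deriv hess_deriv r(2) h] by blast
  obtain \<eta> where 2: "dist \<eta> x < r"
    "u (x + h *\<^sub>R axis j 1 + h *\<^sub>R axis i 1) - u (x + h *\<^sub>R axis j 1) - u (x + h *\<^sub>R axis i 1) + u x = h\<^sup>2 * hess j \<eta> $ i"
    using second_difference[OF p0_deriv hess_deriv r(2) h] by blast
  have "x + h *\<^sub>R axis j 1 + h *\<^sub>R axis i 1 = x + h *\<^sub>R axis i 1 + h *\<^sub>R axis j (1::real)" by (simp add: add_ac)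
  then have "h\<^sup>2 * hess i \<xi> $ j = h\<^sup>2 * hess j \<eta> $ i" using 1(2) 2(2) by (simp only:)
  then have "hess i \<xi> $ j = hess j \<eta> $ i" using h by simp
  moreover have "dist (hess i \<xi> $ j) (hess i x $ j) < d" "dist (hess j \<eta> $ i) (hess j x $ i) < d"
    using r1(2) r2(2) 1(1) 2(1) by (auto simp: r_def)
  moreover have False if "\<bar>a - A\<bar> < \<bar>A - B\<bar> / 2" "\<bar>a - B\<bar> < \<bar>A - B\<bar> / 2" for a A B :: real
    using that by (auto simp: abs_if split: if_splits)
  ultimately show False unfolding dist_real_def d_def by metis
qed

context varsol begin

lemma U_off_P: "x \<notin> P \<Longrightarrow> U x = 0"
  using u_nonneg[of x] by (cases "x \<in> \<Omega>") (auto simp: P_def U_def)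

lemma hess_symmetric: "x \<in> P \<Longrightarrow> hess i x $ j = hess j x $ i"
  by (rule mixed_partials_symmetric[OF P_open p0_deriv hess_deriv hess_cont])

section \<open>Integration by parts across the free boundary\<close>

lemma truncated_by_parts:
  assumes e: "e > 0" and \<psi>: "C1c \<Omega> \<psi> G"
    and d: "\<And>x. x \<in> P \<Longrightarrow> (f has_derivative (\<lambda>h. F x \<bullet> h)) (at x)" and c: "continuous_on P F"
  shows "(\<integral>x. indicator P x * (gam e (u x) * \<psi> x * F x $ i + f x * (\<psi> x * gam' e (u x) * p0 x $ i + gam e (u x) * G x $ i)) \<partial>lborel) = 0"
    "integrable lborel (\<lambda>x. indicator P x * (gam e (u x) * \<psi> x * F x $ i + f x * (\<psi> x * gam' e (u x) * p0 x $ i + gam e (u x) * G x $ i)))"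
proof -
  note t = C1c_truncate[OF e gam_deriv[OF e] gam'_continuous[OF e] gam_zero(1) \<psi>]
  have eq: "indicator P x * (gam e (u x) * \<psi> x * F x $ i +
          f x * (indicator P x *\<^sub>R ((\<psi> x * gam' e (u x)) *\<^sub>R p0 x + gam e (u x) *\<^sub>R G x)) $ i)
       = indicator P x * (gam e (u x) * \<psi> x * F x $ i + f x * (\<psi> x * gam' e (u x) * p0 x $ i + gam e (u x) * G x $ i))" for x
    by (auto simp: indicator_def)
  show "(\<integral>x. indicator P x * (gam e (u x) * \<psi> x * F x $ i + f x * (\<psi> x * gam' e (u x) * p0 x $ i + gam e (u x) * G x $ i)) \<partial>lborel) = 0"
    using integral_by_parts_P[OF t d c, of i] unfolding eq .
  have cF: "continuous_on P (\<lambda>x. F x $ i)" using c by (rule continuous_on_component)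
  have cf: "continuous_on P f"
    by (rule has_derivative_continuous_on[OF has_derivative_at_withinI[OF d]])
  from Bochner_Integration.integrable_add[OF integrable_cont_P(1)[OF t cF] integrable_cont_P(2)[OF t cf, of i]]
  show "integrable lborel (\<lambda>x. indicator P x * (gam e (u x) * \<psi> x * F x $ i + f x * (\<psi> x * gam' e (u x) * p0 x $ i + gam e (u x) * G x $ i)))"
    unfolding eq[symmetric] by (simp add: algebra_simps)
qed

text \<open>The passage of \<open>e\<close> to 0 common to the integrations by parts: the integrand
  splits into a part carrying \<open>gam'\<close> and one carrying \<open>gam\<close>, and these
  factors tend to the indicator of \<open>P\<close> and to \<open>u\<close>.\<close>

lemma truncation_limit:
  assumes z: "\<And>n. (\<integral>x. indicator P x * (gam' (eps n) (u x) * a x + gam (eps n) (u x) * b x) \<partial>lborel) = 0"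
    and a: "integrable lborel (\<lambda>x. indicator P x * a x)" and b: "integrable lborel (\<lambda>x. indicator P x * (u x * b x))"
    and bm: "(\<lambda>x. indicator P x * b x) \<in> borel_measurable borel"
  shows "(\<integral>x. indicator P x * a x \<partial>lborel) + (\<integral>x. indicator P x * (u x * b x) \<partial>lborel) = 0"
proof -
  have [measurable]: "(\<lambda>x. indicator P x * a x) \<in> borel_measurable borel" "gam e \<in> borel_measurable borel"
    "gam' e \<in> borel_measurable borel" for e
    using borel_measurable_integrable[OF a] by (auto simp: gam_def[abs_def] gam'_def[abs_def])
  note [measurable] = bm
  let ?f = "\<lambda>n x. gam' (eps n) (U x) * (indicator P x * a x) + gam (eps n) (U x) * (indicator P x * b x)"
  have eq: "indicator P x * (gam' (eps n) (u x) * a x + gam (eps n) (u x) * b x) = ?f n x" for n x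
    using P_subset by (auto simp: indicator_def U_def)
  have lim: "(\<lambda>n. \<integral>x. ?f n x \<partial>lborel) \<longlonglongrightarrow> (\<integral>x. indicator P x * a x + indicator P x * (u x * b x) \<partial>lborel)"
  proof (rule integral_dominated_convergence[where w="\<lambda>x. \<bar>indicator P x * a x\<bar> + \<bar>indicator P x * (u x * b x)\<bar>"])
    show "integrable lborel (\<lambda>x. \<bar>indicator P x * a x\<bar> + \<bar>indicator P x * (u x * b x)\<bar>)"
      by (intro Bochner_Integration.integrable_add integrable_abs a b)
    show "(\<lambda>x. indicator P x * a x + indicator P x * (u x * b x)) \<in> borel_measurable lborel"
      using borel_measurable_integrable[OF Bochner_Integration.integrable_add[OF a b]] .
    show "AE x in lborel. (\<lambda>n. ?f n x) \<longlonglongrightarrow> indicator P x * a x + indicator P x * (u x * b x)"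
    proof (intro AE_I2)
      fix x
      have "(\<lambda>n. ?f n x) \<longlonglongrightarrow> (if U x > 0 then 1 else 0) * (indicator P x * a x) + max 0 (U x) * (indicator P x * b x)"
        by (intro tendsto_intros gam_lim gam'_lim)
      moreover have "(if U x > 0 then 1 else 0) * (indicator P x * a x) + max 0 (U x) * (indicator P x * b x)
          = indicator P x * a x + indicator P x * (u x * b x)"
        by (auto simp: P_def U_def indicator_def)
      ultimately show "(\<lambda>n. ?f n x) \<longlonglongrightarrow> indicator P x * a x + indicator P x * (u x * b x)" by simp
    qed
    show "AE x in lborel. norm (?f n x) \<le> \<bar>indicator P x * a x\<bar> + \<bar>indicator P x * (u x * b x)\<bar>" for n
    proof (intro AE_I2)
      fix x
      have 1: "\<bar>gam' (eps n) (U x) * (indicator P x * a x)\<bar> \<le> 1 * \<bar>indicator P x * a x\<bar>"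
        unfolding abs_mult[of "gam' (eps n) (U x)"]
        using gam'_bounds[OF eps_pos[of n], of "U x"] by (intro mult_right_mono) auto
      have "\<bar>gam (eps n) (U x)\<bar> * \<bar>indicator P x * b x\<bar> \<le> max 0 (U x) * \<bar>indicator P x * b x\<bar>"
        using gam_bounds[OF eps_pos[of n], of "U x"] by (intro mult_right_mono) auto
      also have "\<dots> = \<bar>indicator P x * (u x * b x)\<bar>"
        by (auto simp: P_def U_def indicator_def abs_mult)
      finally have 2: "\<bar>gam (eps n) (U x) * (indicator P x * b x)\<bar> \<le> \<bar>indicator P x * (u x * b x)\<bar>"
        by (simp add: abs_mult)
      show "norm (?f n x) \<le> \<bar>indicator P x * a x\<bar> + \<bar>indicator P x * (u x * b x)\<bar>"
        unfolding real_norm_def using 1 2 by linarith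
    qed
  qed measurable
  have "(\<integral>x. ?f n x \<partial>lborel) = 0" for n using z[of n] unfolding eq .
  then have "(\<integral>x. indicator P x * a x + indicator P x * (u x * b x) \<partial>lborel) = 0"
    using lim by (simp add: LIMSEQ_const_iff)
  then show ?thesis using Bochner_Integration.integral_add[OF a b] by simp
qed

definition loc_int :: "(pt \<Rightarrow> real) \<Rightarrow> bool" where
  "loc_int f \<longleftrightarrow> (\<forall>K. compact K \<longrightarrow> K \<subseteq> \<Omega> \<longrightarrow> set_integrable lborel K f)"

lemma loc_int_mult_test:
  assumes "loc_int f" and \<psi>: "C1c \<Omega> \<psi> G"
  shows "integrable lborel (\<lambda>x. f x * \<psi> x)" "integrable lborel (\<lambda>x. f x * G x $ i)"
proof -
  obtain K where K: "compact K" "K \<subseteq> \<Omega>" "\<And>x. x \<notin> K \<Longrightarrow> \<psi> x = 0" "\<And>x. x \<notin> K \<Longrightarrow> G x = 0"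
    using C1c_support[OF \<psi>] by blast
  have f: "set_integrable lborel K f" using assms(1) K by (auto simp: loc_int_def)
  show "integrable lborel (\<lambda>x. f x * \<psi> x)"
    by (rule integrable_mult_compact[OF f K(1) continuous_on_subset[OF C1c_continuous[OF \<psi>]] K(3)]) auto
  show "integrable lborel (\<lambda>x. f x * G x $ i)"
    by (rule integrable_mult_compact[OF f K(1)])
      (use K(4) in \<open>auto intro: continuous_on_subset[OF continuous_on_component[OF C1c_continuous_grad[OF \<psi>]]]\<close>)
qed

lemma loc_int_times_continuous:
  assumes "loc_int f" "continuous_on \<Omega> h" shows "loc_int (\<lambda>x. f x * h x)"
  unfolding loc_int_def
proof (intro allI impI)
  fix K assume K: "compact K" "K \<subseteq> \<Omega>"
  have "integrable lborel (\<lambda>x. f x * (if x \<in> K then h x else 0))"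
  proof (rule integrable_mult_compact[OF _ K(1)])
    show "set_integrable lborel K f" using assms K by (auto simp: loc_int_def)
    show "continuous_on K (\<lambda>x. if x \<in> K then h x else 0)"
      by (rule continuous_on_eq[OF continuous_on_subset[OF assms(2) K(2)]]) auto
  qed auto
  moreover have "(\<lambda>x. f x * (if x \<in> K then h x else 0)) = (\<lambda>x. indicator K x *\<^sub>R (f x * h x))"
    by (auto simp: indicator_def)
  ultimately show "set_integrable lborel K (\<lambda>x. f x * h x)" by (simp add: set_integrable_def)
qed

lemma loc_int_continuous: "continuous_on \<Omega> f \<Longrightarrow> loc_int f"
  unfolding loc_int_def using set_integrable_continuous continuous_on_subset by blast

lemma loc_int_p: "loc_int (\<lambda>x. p x $ i)" and loc_int_p2: "loc_int (\<lambda>x. (norm (p x))\<^sup>2)"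
  using p_loc_integrable by (auto simp: loc_int_def)

lemma loc_int_Up: "loc_int (\<lambda>x. U x * p x $ i)"
  using loc_int_times_continuous[OF loc_int_p U_cont] by (simp add: mult.commute)

lemma loc_int_U2: "loc_int (\<lambda>x. (U x)\<^sup>2)"
  by (rule loc_int_continuous) (intro continuous_intros U_cont)

text \<open>\<open>u\<close> vanishes continuously at the free boundary, so no boundary term
  survives in the limit of the truncations, whatever the regularity of that boundary.\<close>

lemma U_weak_gradient:
  assumes \<psi>: "C1c \<Omega> \<psi> G"
  shows "(\<integral>x. U x * G x $ i \<partial>lborel) = - (\<integral>x. p x $ i * \<psi> x \<partial>lborel)"
proof -
  note [measurable] = borel_measurable_continuous_onI[OF C1c_continuous_grad[OF \<psi>]]
  have a: "(\<lambda>x. indicator P x * (\<psi> x * p0 x $ i)) = (\<lambda>x. p x $ i * \<psi> x)"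
    by (auto simp: p_def indicator_def)
  have b: "(\<lambda>x. indicator P x * (u x * G x $ i)) = (\<lambda>x. U x * G x $ i)"
    using u_nonneg by (force simp: P_def U_def indicator_def)
  have "(\<integral>x. indicator P x * (\<psi> x * p0 x $ i) \<partial>lborel) + (\<integral>x. indicator P x * (u x * G x $ i) \<partial>lborel) = 0"
  proof (rule truncation_limit)
    show "(\<integral>x. indicator P x * (gam' (eps n) (u x) * (\<psi> x * p0 x $ i) + gam (eps n) (u x) * G x $ i) \<partial>lborel) = 0" for n
      using truncated_by_parts(1)[OF eps_pos \<psi>, of "\<lambda>x. 1" "\<lambda>x. 0" n i] by (simp add: mult_ac)
    show "integrable lborel (\<lambda>x. indicator P x * (\<psi> x * p0 x $ i))"
      unfolding a by (rule loc_int_mult_test(1)[OF loc_int_p \<psi>])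
    show "integrable lborel (\<lambda>x. indicator P x * (u x * G x $ i))"
      unfolding b by (rule loc_int_mult_test(2)[OF loc_int_continuous[OF U_cont] \<psi>])
  qed measurable
  then show ?thesis unfolding a b by simp
qed

text \<open>It suffices to truncate one of the two factors of \<open>u * u\<close>; each factor
  contributes one term with \<open>p\<close>, hence the 2.\<close>

lemma U_sq_by_parts:
  assumes \<psi>: "C1c \<Omega> \<psi> G"
  shows "(\<integral>x. (U x)\<^sup>2 * G x $ i \<partial>lborel) = - 2 * (\<integral>x. U x * p x $ i * \<psi> x \<partial>lborel)"
proof -
  note [measurable] = borel_measurable_continuous_onI[OF C1c_continuous_grad[OF \<psi>]]
    borel_measurable_continuous_onI[OF C1c_continuous[OF \<psi>]]
  have a: "(\<lambda>x. indicator P x * (u x * \<psi> x * p0 x $ i)) = (\<lambda>x. U x * p x $ i * \<psi> x)"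
    using P_subset by (auto simp: p_def U_def indicator_def fun_eq_iff)
  have b: "(\<lambda>x. indicator P x * (u x * (\<psi> x * p0 x $ i + u x * G x $ i)))
      = (\<lambda>x. U x * p x $ i * \<psi> x + (U x)\<^sup>2 * G x $ i)"
  proof (rule ext)
    fix x
    consider "x \<in> P" "x \<in> \<Omega>" | "x \<notin> P" "U x = 0" using U_off_P[of x] P_subset by blast
    then show "indicator P x * (u x * (\<psi> x * p0 x $ i + u x * G x $ i)) = U x * p x $ i * \<psi> x + (U x)\<^sup>2 * G x $ i"
      by cases (auto simp: p_def U_eq power2_eq_square algebra_simps)
  qed
  have ia: "integrable lborel (\<lambda>x. U x * p x $ i * \<psi> x)" by (rule loc_int_mult_test(1)[OF loc_int_Up \<psi>])
  have ib: "integrable lborel (\<lambda>x. (U x)\<^sup>2 * G x $ i)" by (rule loc_int_mult_test(2)[OF loc_int_U2 \<psi>])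
  have "(\<integral>x. indicator P x * (u x * \<psi> x * p0 x $ i) \<partial>lborel)
     + (\<integral>x. indicator P x * (u x * (\<psi> x * p0 x $ i + u x * G x $ i)) \<partial>lborel) = 0"
  proof (rule truncation_limit)
    show "(\<integral>x. indicator P x * (gam' (eps n) (u x) * (u x * \<psi> x * p0 x $ i) + gam (eps n) (u x) * (\<psi> x * p0 x $ i + u x * G x $ i)) \<partial>lborel) = 0" for n
      using truncated_by_parts(1)[OF eps_pos \<psi> p0_deriv p0_cont, of n i] by (simp add: algebra_simps)
    show "integrable lborel (\<lambda>x. indicator P x * (u x * \<psi> x * p0 x $ i))" unfolding a by (rule ia)
    show "integrable lborel (\<lambda>x. indicator P x * (u x * (\<psi> x * p0 x $ i + u x * G x $ i)))"
      unfolding b using ia ib by simp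
    have "(\<lambda>x. indicator P x * (\<psi> x * p0 x $ i + u x * G x $ i))
        = (\<lambda>x. indicator P x * (\<psi> x * p x $ i + U x * G x $ i))"
      using P_subset by (auto simp: p_def U_def indicator_def fun_eq_iff)
    then show "(\<lambda>x. indicator P x * (\<psi> x * p0 x $ i + u x * G x $ i)) \<in> borel_measurable borel"
      by simp
  qed
  then show ?thesis unfolding a b using ia ib by simp
qed

text \<open>Both are weak gradients of the same function. From here on \<open>g\<close> can be
  replaced by \<open>p\<close>, which vanishes at every point off \<open>P\<close>.\<close>

lemma g_eq_p: "AE x in lborel. x \<in> \<Omega> \<longrightarrow> g x = p x"
proof -
  have "AE x in lborel. x \<in> \<Omega> \<longrightarrow> gb i x - p x $ i = 0" for i
  proof (rule fundamental_lemma[OF op])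
    note [measurable] = gb_props(1)
    show "(\<lambda>x. gb i x - p x $ i) \<in> borel_measurable borel" by measurable
    show "set_integrable lborel K (\<lambda>x. gb i x - p x $ i)" if "compact K" "K \<subseteq> \<Omega>" for K
      by (intro set_integral_diff gb_loc_integrable p_loc_integrable that)
    fix \<psi> assume t: "test_fun \<Omega> \<psi>"
    then obtain G where G: "C1c \<Omega> \<psi> G" by (rule test_fun_C1c)
    have "loc_int (gb i)" using gb_loc_integrable by (auto simp: loc_int_def)
    then have "integrable lborel (\<lambda>x. gb i x * \<psi> x)" "integrable lborel (\<lambda>x. p x $ i * \<psi> x)"
      using loc_int_mult_test(1)[OF _ G] loc_int_p by blast+
    then show "(\<integral>x. (gb i x - p x $ i) * \<psi> x \<partial>lborel) = 0"
      using weak_gradient_lborel[OF t G, of i] U_weak_gradient[OF G, of i] by (simp add: left_diff_distrib)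
  qed
  then have "AE x in lborel. \<forall>i. x \<in> \<Omega> \<longrightarrow> gb i x - p x $ i = 0" unfolding AE_all_countable by blast
  moreover have "AE x in lborel. \<forall>i. x \<in> \<Omega> \<longrightarrow> g x $ i = gb i x"
    unfolding AE_all_countable using gb_props(2) by blast
  ultimately show ?thesis by eventually_elim (auto simp: vec_eq_iff)
qed

subsection \<open>The stress identity\<close>

definition E where "E = {x \<in> \<Omega>. x $ 2 > 0 \<and> u x = 0}"

lemma E_eq: "E = {x \<in> \<Omega>. x $ 2 > 0} - P"
  using u_nonneg by (force simp: E_def P_def)

lemma E_measurable [measurable]: "E \<in> sets borel"
proof -
  have "E = (\<Omega> \<inter> {x. x $ 2 > 0}) - P" unfolding E_eq by auto
  also have "\<dots> \<in> sets borel" by measurable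
  finally show ?thesis .
qed

text \<open>The divergence theorem on the half-plane for \<open>max 0 (x $ 2)\<close> times a field;
  the boundary term is absent because the factor vanishes on the axis. The factor is approximated by
  \<open>gam (eps n)\<close> of the coordinate.\<close>

lemma halfplane_divergence:
  assumes \<psi>: "C1c \<Omega> \<psi> G"
  shows "(\<integral>x. max 0 (x $ 2) * G x $ 1 \<partial>lborel) = 0"
    "(\<integral>x. max 0 (x $ 2) * G x $ 2 + (if x $ 2 > 0 then 1 else 0) * \<psi> x \<partial>lborel) = 0"
proof -
  note [measurable] = borel_measurable_continuous_onI[OF C1c_continuous_grad[OF \<psi>]]
    borel_measurable_continuous_onI[OF C1c_continuous[OF \<psi>]]
  have [measurable]: "gam e \<in> borel_measurable borel" "gam' e \<in> borel_measurable borel" for e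
    by (auto simp: gam_def[abs_def] gam'_def[abs_def])
  have *: "(\<integral>x. gam (eps n) (x $ 2) * G x $ i + gam' (eps n) (x $ 2) * (if i = 2 then \<psi> x else 0) \<partial>lborel) = 0" for n i
  proof -
    have "C1c UNIV (\<lambda>x. gam (eps n) (1 * x $ 2 + 0) * \<psi> x)
       (\<lambda>x. indicator UNIV x *\<^sub>R (\<psi> x *\<^sub>R ((1 * gam' (eps n) (1 * x $ 2 + 0)) *\<^sub>R axis 2 1) + gam (eps n) (1 * x $ 2 + 0) *\<^sub>R G x))"
    proof (rule C1c_mult[OF C1c_mono[OF \<psi>]])
      show "((\<lambda>x. gam (eps n) (1 * x $ 2 + 0)) has_derivative
          (\<lambda>h. ((1 * gam' (eps n) (1 * x $ 2 + 0)) *\<^sub>R axis 2 1) \<bullet> h)) (at x)" for x :: pt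
        by (rule has_derivative_compose_coordinate[OF gam_deriv[OF eps_pos]])
      show "continuous_on UNIV (\<lambda>x::pt. (1 * gam' (eps n) (1 * x $ 2 + 0)) *\<^sub>R axis 2 (1::real))"
        by (intro continuous_intros continuous_on_compose2[OF gam'_continuous[OF eps_pos]]) auto
    qed auto
    from C1c_integral_grad[OF this, of i] show ?thesis
      by (cases "i = 2") (auto simp: axis_def algebra_simps)
  qed
  have "(\<lambda>n. \<integral>x. gam (eps n) (x $ 2) * G x $ i + gam' (eps n) (x $ 2) * (if i = 2 then \<psi> x else 0) \<partial>lborel)
     \<longlonglongrightarrow> (\<integral>x. max 0 (x $ 2) * G x $ i + (if x $ 2 > 0 then 1 else 0) * (if i = 2 then \<psi> x else 0) \<partial>lborel)" for i
  proof (rule integral_dominated_convergence[where w="\<lambda>x. \<bar>x $ 2 * G x $ i\<bar> + \<bar>1 * \<psi> x\<bar>"])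
    show "integrable lborel (\<lambda>x. \<bar>x $ 2 * G x $ i\<bar> + \<bar>1 * \<psi> x\<bar>)"
      by (intro Bochner_Integration.integrable_add integrable_abs loc_int_mult_test[OF _ \<psi>] loc_int_continuous continuous_intros)
    show "AE x in lborel. (\<lambda>n. gam (eps n) (x $ 2) * G x $ i + gam' (eps n) (x $ 2) * (if i = 2 then \<psi> x else 0))
       \<longlonglongrightarrow> max 0 (x $ 2) * G x $ i + (if x $ 2 > 0 then 1 else 0) * (if i = 2 then \<psi> x else 0)"
      by (intro AE_I2 tendsto_intros gam_lim gam'_lim)
    show "AE x in lborel. norm (gam (eps n) (x $ 2) * G x $ i + gam' (eps n) (x $ 2) * (if i = 2 then \<psi> x else 0))
      \<le> \<bar>x $ 2 * G x $ i\<bar> + \<bar>1 * \<psi> x\<bar>" for n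
    proof (intro AE_I2)
      fix x :: pt
      have "\<bar>gam (eps n) (x $ 2) * G x $ i\<bar> \<le> \<bar>x $ 2 * G x $ i\<bar>"
        unfolding abs_mult using gam_bounds[OF eps_pos[of n], of "x $ 2"] by (intro mult_right_mono) auto
      moreover have "\<bar>gam' (eps n) (x $ 2) * (if i = 2 then \<psi> x else 0)\<bar> \<le> \<bar>1 * \<psi> x\<bar>"
        unfolding abs_mult using gam'_bounds[OF eps_pos[of n], of "x $ 2"] by (intro mult_mono) auto
      ultimately show "norm (gam (eps n) (x $ 2) * G x $ i + gam' (eps n) (x $ 2) * (if i = 2 then \<psi> x else 0))
        \<le> \<bar>x $ 2 * G x $ i\<bar> + \<bar>1 * \<psi> x\<bar>"
        unfolding real_norm_def by linarith
    qed
  qed measurable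
  then have "(\<integral>x. max 0 (x $ 2) * G x $ i + (if x $ 2 > 0 then 1 else 0) * (if i = 2 then \<psi> x else 0) \<partial>lborel) = 0" for i
    unfolding * by (simp add: LIMSEQ_const_iff)
  from this[of 1] this[of 2] show "(\<integral>x. max 0 (x $ 2) * G x $ 1 \<partial>lborel) = 0"
    "(\<integral>x. max 0 (x $ 2) * G x $ 2 + (if x $ 2 > 0 then 1 else 0) * \<psi> x \<partial>lborel) = 0"
    by simp_all
qed

text \<open>The energy-momentum tensor of \<open>u\<close> tested with the field whose components
  have the gradients \<open>G1\<close> and \<open>G2\<close>.\<close>

definition stress :: "(pt \<Rightarrow> pt) \<Rightarrow> (pt \<Rightarrow> pt) \<Rightarrow> pt \<Rightarrow> real" where
  "stress G1 G2 x = (norm (p x))\<^sup>2 * (G1 x $ 1 + G2 x $ 2) - 2 * (p x $ 1 * (G1 x \<bullet> p x) + p x $ 2 * (G2 x \<bullet> p x))"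

lemma loc_int_pp: "loc_int (\<lambda>x. p x $ i * p x $ j)"
  unfolding loc_int_def
proof (intro allI impI)
  fix K assume K: "compact K" "K \<subseteq> \<Omega>"
  note [measurable] = borel_compact[OF K(1)]
  show "set_integrable lborel K (\<lambda>x. p x $ i * p x $ j)"
    unfolding set_integrable_def
  proof (rule Bochner_Integration.integrable_bound[OF p_loc_integrable(2)[OF K, unfolded set_integrable_def]])
    have "\<bar>p x $ i * p x $ j\<bar> \<le> (norm (p x))\<^sup>2" for x
      unfolding power2_eq_square abs_mult by (intro mult_mono component_le_norm_cart) auto
    then show "AE x in lborel. norm (indicator K x *\<^sub>R (p x $ i * p x $ j)) \<le> norm (indicator K x *\<^sub>R (norm (p x))\<^sup>2)"
      by (auto simp: indicator_def)
  qed measurable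
qed

lemma stress_expand:
  "stress G1 G2 x = (p x $ 1 * p x $ 1) * (- 1 * G1 x $ 1) + (p x $ 1 * p x $ 1) * G2 x $ 2
    + (p x $ 2 * p x $ 2) * G1 x $ 1 + (p x $ 2 * p x $ 2) * (- 1 * G2 x $ 2)
    + (p x $ 1 * p x $ 2) * (- 2 * G1 x $ 2) + (p x $ 1 * p x $ 2) * (- 2 * G2 x $ 1)"
  unfolding stress_def norm_sq_pt inner_pt by (simp add: power2_eq_square algebra_simps)

lemma stress_integrable:
  assumes "C1c \<Omega> \<phi>1 G1" "C1c \<Omega> \<phi>2 G2"
  shows "integrable lborel (stress G1 G2)"
proof -
  have 1: "integrable lborel (\<lambda>x. (p x $ i * p x $ j) * G1 x $ k)" "integrable lborel (\<lambda>x. (p x $ i * p x $ j) * G2 x $ k)" for i j k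
    by (rule loc_int_mult_test(2)[OF loc_int_pp assms(1)], rule loc_int_mult_test(2)[OF loc_int_pp assms(2)])
  have 2: "integrable lborel (\<lambda>x. (p x $ i * p x $ j) * (c * G1 x $ k))" "integrable lborel (\<lambda>x. (p x $ i * p x $ j) * (c * G2 x $ k))" for i j k c
    using integrable_mult_right[OF 1(1)[of i j k], of c] integrable_mult_right[OF 1(2)[of i j k], of c]
    by (simp_all add: mult_ac)
  have "integrable lborel (\<lambda>x. stress G1 G2 x)"
    unfolding stress_expand
    by (intro Bochner_Integration.integrable_add 1 2)
  then show ?thesis by simp
qed

text \<open>The divergence of \<open>x\<^sub>2 \<phi>\<close> integrates to zero over the upper half-plane, so the terms of the variational
  equation carried by \<open>{u > 0}\<close> become terms carried by \<open>E\<close>.\<close>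

lemma stress_identity:
  assumes 1: "C1c \<Omega> \<phi>1 G1" and 2: "C1c \<Omega> \<phi>2 G2"
  shows "(\<integral>x. stress G1 G2 x \<partial>lborel) = (\<integral>x. indicator E x * (x $ 2 * (G1 x $ 1 + G2 x $ 2) + \<phi>2 x) \<partial>lborel)"
proof -
  note [measurable] = borel_measurable_continuous_onI[OF C1c_continuous_grad[OF 1]]
    borel_measurable_continuous_onI[OF C1c_continuous_grad[OF 2]] borel_measurable_continuous_onI[OF C1c_continuous[OF 2]]
  obtain K1 where K1: "compact K1" "K1 \<subseteq> \<Omega>" "\<And>x. x \<notin> K1 \<Longrightarrow> \<phi>1 x = 0" "\<And>x. x \<notin> K1 \<Longrightarrow> G1 x = 0"
    using C1c_support[OF 1] by blast
  obtain K2 where K2: "compact K2" "K2 \<subseteq> \<Omega>" "\<And>x. x \<notin> K2 \<Longrightarrow> \<phi>2 x = 0" "\<And>x. x \<notin> K2 \<Longrightarrow> G2 x = 0"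
    using C1c_support[OF 2] by blast
  define \<phi> :: "pt \<Rightarrow> pt" where "\<phi> x = \<phi>1 x *\<^sub>R axis 1 1 + \<phi>2 x *\<^sub>R axis 2 1" for x
  have comp: "\<phi> x $ 1 = \<phi>1 x" "\<phi> x $ 2 = \<phi>2 x" for x by (auto simp: \<phi>_def axis_def)
  have D: "(\<phi> has_derivative (\<lambda>h. (G1 x \<bullet> h) *\<^sub>R axis 1 1 + (G2 x \<bullet> h) *\<^sub>R axis 2 1)) (at x)" for x
    unfolding \<phi>_def
    by (intro has_derivative_add has_derivative_scaleR_left C1c_deriv[OF 1] C1c_deriv[OF 2])
  have Df: "Dfield \<phi> x = (\<lambda>h. (G1 x \<bullet> h) *\<^sub>R axis 1 1 + (G2 x \<bullet> h) *\<^sub>R axis 2 1)" for x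
    unfolding Dfield_def using frechet_derivative_at[OF D] by simp
  have dv: "divg \<phi> x = G1 x $ 1 + G2 x $ 2" for x
    unfolding divg_def Df by (simp add: sum_2 axis_def inner_axis)
      (simp add: inner_axis[unfolded axis_def])
  have "C1_0_field \<Omega> \<phi>"
    unfolding C1_0_field_def
  proof
    show "\<forall>i. Ck_on 1 UNIV (\<lambda>x. \<phi> x $ i)"
      unfolding forall_2 comp using C1c_Ck1[OF 1] C1c_Ck1[OF 2] by simp
    show "compact_supp_in \<Omega> \<phi>"
      by (rule compact_supp_inI[of "K1 \<union> K2"]) (use K1 K2 in \<open>auto simp: \<phi>_def\<close>)
  qed
  then have z: "(LINT x:\<Omega>|lebesgue. (norm (g x))\<^sup>2 * divg \<phi> x - 2 * (g x \<bullet> Dfield \<phi> x (g x))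
          + x $ 2 * chi_pos u x * divg \<phi> x + chi_pos u x * \<phi> x $ 2) = 0"
    using vs by (simp add: variational_solution_def)
  let ?d = "\<lambda>x. G1 x $ 1 + G2 x $ 2"
  let ?f = "\<lambda>x. stress G1 G2 x + indicator P x * (x $ 2 * ?d x + \<phi>2 x)"
  have [measurable]: "stress G1 G2 \<in> borel_measurable borel"
    using borel_measurable_integrable[OF stress_integrable[OF 1 2]] by simp
  have "(\<integral>x. indicator \<Omega> x * ?f x \<partial>lborel) = 0"
    unfolding z[symmetric]
  proof (rule lebesgue_to_lborel(1)[symmetric])
    show "AE x in lborel. x \<in> \<Omega> \<longrightarrow> (norm (g x))\<^sup>2 * divg \<phi> x - 2 * (g x \<bullet> Dfield \<phi> x (g x))
          + x $ 2 * chi_pos u x * divg \<phi> x + chi_pos u x * \<phi> x $ 2 = ?f x"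
      using g_eq_p
    proof eventually_elim
      case (elim x)
      show ?case
      proof
        assume x: "x \<in> \<Omega>"
        have "chi_pos u x = indicator P x" using x by (simp add: chi_pos_def P_def)
        moreover have "p x \<bullet> Dfield \<phi> x (p x) = p x $ 1 * (G1 x \<bullet> p x) + p x $ 2 * (G2 x \<bullet> p x)"
          unfolding Df by (simp add: inner_add_right inner_axis)
        ultimately show "(norm (g x))\<^sup>2 * divg \<phi> x - 2 * (g x \<bullet> Dfield \<phi> x (g x))
          + x $ 2 * chi_pos u x * divg \<phi> x + chi_pos u x * \<phi> x $ 2 = ?f x"
          using elim x unfolding stress_def dv comp by (simp add: algebra_simps)
      qed
    qed
  qed measurable
  moreover have "(\<lambda>x. indicator \<Omega> x * ?f x) = ?f"
  proof (rule ext)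
    fix x
    have "G1 x = 0 \<and> G2 x = 0 \<and> \<phi>2 x = 0" if "x \<notin> \<Omega>" using K1(2,4) K2(2,3,4) that by blast
    then show "indicator \<Omega> x * ?f x = ?f x" by (cases "x \<in> \<Omega>") (auto simp: stress_def)
  qed
  ultimately have z1: "(\<integral>x. ?f x \<partial>lborel) = 0" by simp
  let ?h = "\<lambda>x. indicator P x * (x $ 2 * ?d x + \<phi>2 x)"
  \<comment> \<open>The divergence of \<open>max 0 (x $ 2)\<close> times the field. Its integral is
    zero, and subtracting the part carried by \<open>P\<close> leaves exactly the part carried by
    \<open>E\<close>.\<close>
  let ?k = "\<lambda>x. max 0 (x $ 2) * G1 x $ 1 + (max 0 (x $ 2) * G2 x $ 2 + (if x $ 2 > 0 then 1 else 0) * \<phi>2 x)"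
  have i1: "integrable lborel (\<lambda>x. x $ 2 * G1 x $ 1)" "integrable lborel (\<lambda>x. x $ 2 * G2 x $ 2)" "integrable lborel (\<lambda>x. 1 * \<phi>2 x)"
    by (intro loc_int_mult_test[OF _ 1] loc_int_mult_test[OF _ 2] loc_int_continuous continuous_intros)+
  have ih: "integrable lborel ?h"
  proof -
    have "integrable lborel (\<lambda>x. indicator P x *\<^sub>R (x $ 2 * G1 x $ 1 + x $ 2 * G2 x $ 2 + 1 * \<phi>2 x))"
      by (intro integrable_mult_indicator Bochner_Integration.integrable_add i1) simp
    then show ?thesis by (simp add: algebra_simps)
  qed
  have i2: "integrable lborel (\<lambda>x. max 0 (x $ 2) * G1 x $ 1)"
    by (rule loc_int_mult_test[OF _ 1]) (intro loc_int_continuous continuous_intros)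
  have i3: "integrable lborel (\<lambda>x. max 0 (x $ 2) * G2 x $ 2 + (if x $ 2 > 0 then 1 else 0) * \<phi>2 x)"
  proof (intro Bochner_Integration.integrable_add)
    show "integrable lborel (\<lambda>x. max 0 (x $ 2) * G2 x $ 2)"
      by (rule loc_int_mult_test[OF _ 2]) (intro loc_int_continuous continuous_intros)
    have "integrable lborel (\<lambda>x. indicator {x. x $ 2 > 0} x *\<^sub>R (1 * \<phi>2 x))"
      by (intro integrable_mult_indicator i1) simp
    moreover have "(\<lambda>x. indicator {x. x $ 2 > 0} x *\<^sub>R (1 * \<phi>2 x)) = (\<lambda>x. (if x $ 2 > 0 then 1 else 0) * \<phi>2 x)"
      by (auto simp: indicator_def)
    ultimately show "integrable lborel (\<lambda>x. (if x $ 2 > 0 then 1 else 0) * \<phi>2 x)" by simp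
  qed
  have k0: "(\<integral>x. ?k x \<partial>lborel) = 0"
    using halfplane_divergence(1)[OF 1] halfplane_divergence(2)[OF 2] i2 i3 by simp
  have "(\<integral>x. stress G1 G2 x \<partial>lborel) = - (\<integral>x. ?h x \<partial>lborel)"
    using z1 stress_integrable[OF 1 2] ih by simp
  also have "\<dots> = (\<integral>x. ?k x \<partial>lborel) - (\<integral>x. ?h x \<partial>lborel)" using k0 by simp
  also have "\<dots> = (\<integral>x. ?k x - ?h x \<partial>lborel)"
    by (rule Bochner_Integration.integral_diff[symmetric]) (intro Bochner_Integration.integrable_add i2 i3 ih)+
  also have "(\<lambda>x. ?k x - ?h x) = (\<lambda>x. indicator E x * (x $ 2 * ?d x + \<phi>2 x))"
  proof (rule ext)
    fix x
    have out: "x \<notin> \<Omega> \<Longrightarrow> G1 x $ 1 = 0 \<and> G2 x $ 2 = 0 \<and> \<phi>2 x = 0"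
      using K1(2,4) K2(2,3,4) by (metis subsetD zero_index)
    consider "x \<notin> \<Omega>" | "x \<in> P" "x \<notin> E" "x $ 2 > 0" | "x \<in> E" "x \<notin> P" "x $ 2 > 0" | "x \<notin> P" "x \<notin> E" "x $ 2 \<le> 0"
      using P_pos[of x] P_subset unfolding E_eq by force
    then show "?k x - ?h x = indicator E x * (x $ 2 * ?d x + \<phi>2 x)"
      by cases (use out in \<open>auto simp: algebra_simps max_def\<close>)
  qed
  finally show ?thesis .
qed

end

section \<open>Harmonicity of \<open>u\<close> where it is positive\<close>

lemma continuous_AE_zero:
  fixes f :: "pt \<Rightarrow> real"
  assumes "open P" "continuous_on P f" "AE x in lborel. x \<in> P \<longrightarrow> f x = 0" "x \<in> P"
  shows "f x = 0"
proof (rule ccontr)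
  assume "f x \<noteq> 0"
  let ?O = "P \<inter> f -` (- {0})"
  have O: "open ?O" using continuous_open_preimage[OF assms(2,1), of "- {0}"] by auto
  have "AE x in lborel. x \<notin> ?O" using assms(3) by eventually_elim auto
  moreover have "?O \<in> sets lborel" using O by simp
  ultimately have "?O \<in> null_sets lborel" by (simp add: AE_iff_null_sets)
  then have "negligible ?O" using negligible_iff_null_sets null_sets_completionI by blast
  moreover have "x \<in> ?O" using assms(4) \<open>f x \<noteq> 0\<close> by simp
  ultimately show False using open_not_negligible[OF O] by blast
qed

lemma C1c_zero: "C1c \<Omega> (\<lambda>x. 0) (\<lambda>x. 0)"
  by (rule C1cI[of "{}"]) auto

context varsol begin

lemma by_parts_product:
  assumes \<eta>: "C1c P \<eta> G"
  shows "(\<integral>x. indicator P x * (\<eta> x * (p0 x $ i * hess j x $ k + p0 x $ j * hess i x $ k) + p0 x $ i * p0 x $ j * G x $ k) \<partial>lborel) = 0"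
    and "integrable lborel (\<lambda>x. indicator P x * (\<eta> x * (p0 x $ i * hess j x $ k + p0 x $ j * hess i x $ k) + p0 x $ i * p0 x $ j * G x $ k))"
proof -
  let ?F = "\<lambda>x. p0 x $ i *\<^sub>R hess j x + p0 x $ j *\<^sub>R hess i x"
  have d: "((\<lambda>x. p0 x $ i * p0 x $ j) has_derivative (\<lambda>h. ?F x \<bullet> h)) (at x)" if "x \<in> P" for x
    by (rule has_derivative_eq_rhs[OF has_derivative_mult[OF hess_deriv[OF that] hess_deriv[OF that]]])
      (auto simp: inner_add_left)
  have c: "continuous_on P ?F" by (intro continuous_intros p0_cont hess_cont)
  show "(\<integral>x. indicator P x * (\<eta> x * (p0 x $ i * hess j x $ k + p0 x $ j * hess i x $ k) + p0 x $ i * p0 x $ j * G x $ k) \<partial>lborel) = 0"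
    using integral_by_parts_P[OF \<eta> d c, of k] by simp
  have "integrable lborel (\<lambda>x. indicator P x * ((p0 x $ i * hess j x $ k + p0 x $ j * hess i x $ k) * \<eta> x) + indicator P x * (p0 x $ i * p0 x $ j * G x $ k))"
    by (intro Bochner_Integration.integrable_add integrable_cont_P[OF \<eta>] continuous_intros p0_cont hess_cont)
  then show "integrable lborel (\<lambda>x. indicator P x * (\<eta> x * (p0 x $ i * hess j x $ k + p0 x $ j * hess i x $ k) + p0 x $ i * p0 x $ j * G x $ k))"
    by (simp add: algebra_simps)
qed

lemma stress_zero_P:
  assumes "C1c P \<phi>1 G1" "C1c P \<phi>2 G2"
  shows "(\<integral>x. stress G1 G2 x \<partial>lborel) = 0"
proof -
  obtain K1 where K1: "compact K1" "K1 \<subseteq> P" "\<And>x. x \<notin> K1 \<Longrightarrow> \<phi>1 x = 0" "\<And>x. x \<notin> K1 \<Longrightarrow> G1 x = 0"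
    using C1c_support[OF assms(1)] by blast
  obtain K2 where K2: "compact K2" "K2 \<subseteq> P" "\<And>x. x \<notin> K2 \<Longrightarrow> \<phi>2 x = 0" "\<And>x. x \<notin> K2 \<Longrightarrow> G2 x = 0"
    using C1c_support[OF assms(2)] by blast
  have "indicator E x * (x $ 2 * (G1 x $ 1 + G2 x $ 2) + \<phi>2 x) = 0" for x
  proof (cases "x \<in> E")
    case True
    then have "x \<notin> P" unfolding E_eq by simp
    then have "x \<notin> K1" "x \<notin> K2" using K1(2) K2(2) by auto
    then show ?thesis using K1 K2 by simp
  qed simp
  then show ?thesis
    unfolding stress_identity[OF C1c_mono[OF assms(1) P_subset] C1c_mono[OF assms(2) P_subset]]
    by (simp only: integral_zero)
qed

text \<open>For fields supported in \<open>P\<close> the stress identity has right-hand side zero.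
  Integrated by parts once more, the divergence of the stress tensor is, up to a factor, the
  gradient of \<open>u\<close> times its Laplacian.\<close>

lemma laplace_weak:
  assumes \<eta>: "C1c P \<eta> G"
  shows "(\<integral>x. indicator P x * (p0 x $ j * (hess 1 x $ 1 + hess 2 x $ 2)) * \<eta> x \<partial>lborel) = 0"
proof -
  note b = by_parts_product[OF \<eta>]
  have P0: "p x = p0 x \<and> hess 1 x $ 2 = hess 2 x $ 1" if "x \<in> P" for x
    using that hess_symmetric by (auto simp: p_def)
  obtain K where K: "compact K" "K \<subseteq> P" "\<And>x. x \<notin> K \<Longrightarrow> \<eta> x = 0" "\<And>x. x \<notin> K \<Longrightarrow> G x = 0"
    using C1c_support[OF \<eta>] by blast
  let ?b = "\<lambda>i j k x. indicator P x * (\<eta> x * (p0 x $ i * hess j x $ k + p0 x $ j * hess i x $ k) + p0 x $ i * p0 x $ j * G x $ k)"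
  let ?L = "\<lambda>j x. indicator P x * (p0 x $ j * (hess 1 x $ 1 + hess 2 x $ 2)) * \<eta> x"
  have si: "integrable lborel (stress G (\<lambda>x. 0))" "integrable lborel (stress (\<lambda>x. 0) G)"
    using stress_integrable[OF C1c_mono[OF \<eta> P_subset] C1c_zero] stress_integrable[OF C1c_zero C1c_mono[OF \<eta> P_subset]] by auto
  have sz: "(\<integral>x. stress G (\<lambda>x. 0) x \<partial>lborel) = 0" "(\<integral>x. stress (\<lambda>x. 0) G x \<partial>lborel) = 0"
    by (rule stress_zero_P[OF \<eta> C1c_zero], rule stress_zero_P[OF C1c_zero \<eta>])
  have hb: "has_bochner_integral lborel (?b i j k) 0" for i j k
    using b[of i j k] by (simp only: has_bochner_integral_iff simp_thms)
  have hs: "has_bochner_integral lborel (stress G (\<lambda>x. 0)) 0" "has_bochner_integral lborel (stress (\<lambda>x. 0) G) 0"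
    using si sz by (simp_all only: has_bochner_integral_iff simp_thms)
  have "has_bochner_integral lborel (\<lambda>x. 2 * ?L j x) 0"
  proof (cases "j = 1")
    case True
    \<comment> \<open>The terms \<open>?b\<close> are the integrations by parts of the products p1
      p1, p2 p2 and p1 p2. By symmetry of the Hessian everything but the Laplacian cancels.\<close>
    have eq: "2 * ?L j x = stress G (\<lambda>x. 0) x + ?b 1 1 1 x - ?b 2 2 1 x + 2 * ?b 1 2 2 x" for x
    proof (cases "x \<in> P")
      case in_P: True
      then show ?thesis using P0[OF in_P] True unfolding stress_expand by (simp add: algebra_simps)
    next
      case False
      then show ?thesis using K(2,4) by (auto simp: stress_expand subset_iff p_def)
    qed
    have "has_bochner_integral lborel (\<lambda>x. stress G (\<lambda>x. 0) x + ?b 1 1 1 x - ?b 2 2 1 x + 2 * ?b 1 2 2 x) (0 + 0 - 0 + 2 * 0)"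
      by (intro has_bochner_integral_add has_bochner_integral_diff has_bochner_integral_mult_right hb hs)
    then show ?thesis unfolding eq by simp
  next
    case False
    then have j: "j = 2" using exhaust_2[of j] by blast
    have eq: "2 * ?L j x = stress (\<lambda>x. 0) G x - ?b 1 1 2 x + ?b 2 2 2 x + 2 * ?b 1 2 1 x" for x
    proof (cases "x \<in> P")
      case in_P: True
      then show ?thesis using P0[OF in_P] j unfolding stress_expand by (simp add: algebra_simps)
    next
      case False
      then show ?thesis using K(2,4) by (auto simp: stress_expand subset_iff p_def)
    qed
    have "has_bochner_integral lborel (\<lambda>x. stress (\<lambda>x. 0) G x - ?b 1 1 2 x + ?b 2 2 2 x + 2 * ?b 1 2 1 x) (0 - 0 + 0 + 2 * 0)"
      by (intro has_bochner_integral_add has_bochner_integral_diff has_bochner_integral_mult_right hb hs)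
    then show ?thesis unfolding eq by simp
  qed
  then have "(\<integral>x. 2 * ?L j x \<partial>lborel) = 0" by (rule has_bochner_integral_integral_eq)
  then show ?thesis by simp
qed

lemma p0_laplace_zero:
  assumes "x \<in> P" shows "p0 x $ j * (hess 1 x $ 1 + hess 2 x $ 2) = 0"
proof (rule continuous_AE_zero[OF P_open _ _ assms])
  let ?f = "\<lambda>x. p0 x $ j * (hess 1 x $ 1 + hess 2 x $ 2)"
  show c: "continuous_on P ?f" by (intro continuous_intros p0_cont hess_cont)
  have "AE x in lborel. x \<in> P \<longrightarrow> indicator P x * ?f x = 0"
  proof (rule fundamental_lemma[OF P_open])
    show "(\<lambda>x. indicator P x * ?f x) \<in> borel_measurable borel"
      using borel_measurable_continuous_on_indicator[of P ?f] c P_open by simp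
    show "set_integrable lborel K (\<lambda>x. indicator P x * ?f x)" if K: "compact K" "K \<subseteq> P" for K
      by (rule set_integrable_continuous[OF K(1)])
        (rule continuous_on_eq[OF continuous_on_subset[OF c K(2)]], use K in auto)
    fix \<psi> assume "test_fun P \<psi>"
    then obtain G where "C1c P \<psi> G" by (rule test_fun_C1c)
    then show "(\<integral>x. indicator P x * ?f x * \<psi> x \<partial>lborel) = 0" by (rule laplace_weak)
  qed
  then show "AE x in lborel. x \<in> P \<longrightarrow> ?f x = 0" by eventually_elim auto
qed

text \<open>The variational equation yields only the product of gradient and Laplacian. On the open
  set where the Laplacian is nonzero the gradient vanishes identically, so the Hessian vanishes
  there too.\<close>

lemma laplace_zero:
  assumes "x \<in> P" shows "hess 1 x $ 1 + hess 2 x $ 2 = 0"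
proof (rule ccontr)
  let ?l = "\<lambda>x. hess 1 x $ 1 + hess 2 x $ 2"
  assume "?l x \<noteq> 0"
  let ?O = "P \<inter> ?l -` (- {0})"
  have "continuous_on P ?l" by (intro continuous_intros hess_cont)
  then have O: "open ?O" using continuous_open_preimage[OF _ P_open, of ?l "- {0}"] by auto
  have x: "x \<in> ?O" using assms \<open>?l x \<noteq> 0\<close> by simp
  have z: "p0 y $ i = 0" if "y \<in> ?O" for y i using p0_laplace_zero[of y i] that by auto
  have "hess i x = 0" for i
  proof -
    have "((\<lambda>x. 0) has_derivative (\<lambda>h. 0 \<bullet> h)) (at x)" by simp
    then have "((\<lambda>x. p0 x $ i) has_derivative (\<lambda>h. 0 \<bullet> h)) (at x)"
      by (rule has_derivative_transform_within_open[OF _ O x]) (use z in auto)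
    then show ?thesis using has_derivative_inner_unique[OF hess_deriv[OF assms]] by blast
  qed
  then show False using \<open>?l x \<noteq> 0\<close> by simp
qed

text \<open>Integrate the components of \<open>p0\<close> by parts against the truncated test and
  add: the Hessian terms sum to the Laplacian and drop out.\<close>

lemma energy_by_parts:
  assumes \<psi>: "C1c \<Omega> \<psi> G"
  shows "(\<integral>x. (norm (p x))\<^sup>2 * \<psi> x \<partial>lborel) = - (\<integral>x. U x * (p x \<bullet> G x) \<partial>lborel)"
proof -
  note [measurable] = borel_measurable_continuous_onI[OF C1c_continuous_grad[OF \<psi>]]
    borel_measurable_continuous_onI[OF C1c_continuous[OF \<psi>]]
  have a: "(\<lambda>x. indicator P x * ((norm (p0 x))\<^sup>2 * \<psi> x)) = (\<lambda>x. (norm (p x))\<^sup>2 * \<psi> x)"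
    by (auto simp: p_def indicator_def)
  have b: "(\<lambda>x. indicator P x * (u x * (p0 x \<bullet> G x))) = (\<lambda>x. U x * (p x \<bullet> G x))"
    using P_subset by (auto simp: p_def indicator_def fun_eq_iff U_def)
  have b': "(\<lambda>x. indicator P x * (p0 x \<bullet> G x)) = (\<lambda>x. p x \<bullet> G x)"
    by (auto simp: p_def indicator_def)
  have "(\<integral>x. indicator P x * ((norm (p0 x))\<^sup>2 * \<psi> x) \<partial>lborel) + (\<integral>x. indicator P x * (u x * (p0 x \<bullet> G x)) \<partial>lborel) = 0"
  proof (rule truncation_limit)
    fix n
    let ?t = "\<lambda>i x. indicator P x * (gam (eps n) (u x) * \<psi> x * hess i x $ i + p0 x $ i * (\<psi> x * gam' (eps n) (u x) * p0 x $ i + gam (eps n) (u x) * G x $ i))"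
    note t = truncated_by_parts[OF eps_pos \<psi> hess_deriv hess_cont, of n]
    have "(\<integral>x. ?t 1 x + ?t 2 x \<partial>lborel) = 0"
      using t(1)[of 1 1] t(1)[of 2 2] t(2)[of 1 1] t(2)[of 2 2] by simp
    moreover have "?t 1 x + ?t 2 x = indicator P x * (gam' (eps n) (u x) * ((norm (p0 x))\<^sup>2 * \<psi> x) + gam (eps n) (u x) * (p0 x \<bullet> G x))" for x
    proof (cases "x \<in> P")
      case True
      have "?t 1 x + ?t 2 x = gam (eps n) (u x) * \<psi> x * (hess 1 x $ 1 + hess 2 x $ 2) +
         gam' (eps n) (u x) * ((norm (p0 x))\<^sup>2 * \<psi> x) + gam (eps n) (u x) * (p0 x \<bullet> G x)"
        unfolding norm_sq_pt inner_pt using True by (simp add: power2_eq_square algebra_simps)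
      then show ?thesis using True laplace_zero[OF True] by simp
    qed simp
    ultimately show "(\<integral>x. indicator P x * (gam' (eps n) (u x) * ((norm (p0 x))\<^sup>2 * \<psi> x) + gam (eps n) (u x) * (p0 x \<bullet> G x)) \<partial>lborel) = 0"
      by simp
  next
    show "integrable lborel (\<lambda>x. indicator P x * ((norm (p0 x))\<^sup>2 * \<psi> x))"
      unfolding a by (rule loc_int_mult_test(1)[OF loc_int_p2 \<psi>])
    have "integrable lborel (\<lambda>x. U x * p x $ 1 * G x $ 1 + U x * p x $ 2 * G x $ 2)"
      by (intro Bochner_Integration.integrable_add loc_int_mult_test(2)[OF loc_int_Up \<psi>])
    then show "integrable lborel (\<lambda>x. indicator P x * (u x * (p0 x \<bullet> G x)))"
      unfolding b by (simp add: inner_pt algebra_simps)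
    show "(\<lambda>x. indicator P x * (p0 x \<bullet> G x)) \<in> borel_measurable borel"
      unfolding b' by measurable
  qed
  then show ?thesis unfolding a b by simp
qed

end

subsection \<open>Weighted energies and the frequency\<close>

definition pp :: "nat \<Rightarrow> real \<Rightarrow> real" where "pp n t = (max 0 t) ^ n"

lemma pp_nonneg: "0 \<le> pp n t" by (simp add: pp_def)

lemma pp_continuous [continuous_intros]: "continuous_on S f \<Longrightarrow> continuous_on S (\<lambda>x. pp n (f x))"
  unfolding pp_def by (intro continuous_intros)

lemma pp_zero: "t \<le> 0 \<Longrightarrow> n > 0 \<Longrightarrow> pp n t = 0" by (simp add: pp_def)

lemma pp_pos: "t \<ge> 0 \<Longrightarrow> pp n t = t ^ n" by (simp add: pp_def)

lemma pp_mono: "s \<le> t \<Longrightarrow> pp n s \<le> pp n t" unfolding pp_def by (intro power_mono) auto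

lemma pp_times: "n > 0 \<Longrightarrow> t * pp n t = pp (Suc n) t"
  by (cases "t \<ge> 0") (auto simp: pp_def)

lemma pp_deriv:
  assumes "n \<ge> 2"
  shows "(pp n has_real_derivative (n * pp (n - 1) t)) (at t)"
proof -
  consider "t < 0" | "t = 0" | "t > 0" by linarith
  then show ?thesis
  proof cases
    case 1
    have "((\<lambda>t. 0) has_real_derivative 0) (at t)" by simp
    then have "(pp n has_real_derivative 0) (at t)"
      by (rule has_field_derivative_transform_within_open[where S="{..<0}"]) (use 1 assms in \<open>auto simp: pp_def\<close>)
    then show ?thesis using 1 assms by (simp add: pp_zero)
  next
    case 2
    obtain m where n: "n = Suc (Suc m)" using assms by (metis add_2_eq_Suc le_Suc_ex)
    have "(\<lambda>h. pp n h / h) \<midarrow>0\<rightarrow> 0"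
    proof (rule Lim_null_comparison)
      have "norm (pp n h / h) \<le> pp (Suc m) h" if "h \<noteq> 0" for h
        using that by (auto simp: n pp_def max_def)
      then show "\<forall>\<^sub>F h in at 0. norm (pp n h / h) \<le> pp (Suc m) h"
        by (simp add: eventually_at_filter)
      have "(pp (Suc m) \<longlongrightarrow> pp (Suc m) 0) (at 0)"
        using pp_continuous[OF continuous_on_id, of UNIV "Suc m"] by (auto simp: continuous_on_def)
      then show "(pp (Suc m) \<longlongrightarrow> 0) (at 0)" by (simp add: pp_def)
    qed
    then show ?thesis using 2 by (simp add: DERIV_def pp_def n)
  next
    case 3
    have "((\<lambda>t. t ^ n) has_real_derivative (n * pp (n - 1) t)) (at t)"
      using 3 by (auto intro!: derivative_eq_intros simp: pp_def)
    then show ?thesis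
      by (rule has_field_derivative_transform_within_open[where S="{0<..}"]) (use 3 in \<open>auto simp: pp_def\<close>)
  qed
qed

text \<open>Here and in the cubic case the remainder is quadratic in \<open>h\<close> in spite of
  the kink of the positive part. This makes differentiation under the integral sign
  quantitative.\<close>

lemma pp2_taylor: "\<bar>pp 2 (a + h) - pp 2 a - 2 * h * pp 1 a\<bar> \<le> 2 * h\<^sup>2"
proof -
  consider "a \<ge> 0" "a + h \<ge> 0" | "a < 0" "a + h < 0" | "a \<ge> 0" "a + h < 0" | "a < 0" "a + h \<ge> 0" by linarith
  then show ?thesis
  proof cases
    case 1 then show ?thesis by (simp add: pp_def power2_eq_square algebra_simps)
  next
    case 2 then show ?thesis by (simp add: pp_def)
  next
    case 3
    then have "pp 2 (a + h) - pp 2 a - 2 * h * pp 1 a = a * (- a - 2 * h)" by (simp add: pp_def power2_eq_square algebra_simps)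
    also have "\<bar>\<dots>\<bar> \<le> (- h) * (2 * (- h))" unfolding abs_mult using 3 by (intro mult_mono) auto
    finally show ?thesis by (simp add: power2_eq_square)
  next
    case 4
    then have "\<bar>pp 2 (a + h) - pp 2 a - 2 * h * pp 1 a\<bar> = (a + h)\<^sup>2" by (simp add: pp_def)
    also have "\<dots> \<le> h\<^sup>2" using 4 by (intro power_mono) auto
    finally show ?thesis using zero_le_power2[of h] by linarith
  qed
qed

lemma pp3_taylor: "\<bar>pp 3 (a + h) - pp 3 a - 3 * h * pp 2 a\<bar> \<le> 3 * (max 0 a + \<bar>h\<bar>) * h\<^sup>2"
proof -
  consider "a \<ge> 0" "a + h \<ge> 0" | "a < 0" "a + h < 0" | "a \<ge> 0" "a + h < 0" | "a < 0" "a + h \<ge> 0" by linarith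
  then show ?thesis
  proof cases
    case 1
    then have "pp 3 (a + h) - pp 3 a - 3 * h * pp 2 a = (3 * a + h) * h\<^sup>2"
      by (simp add: pp_def power2_eq_square power3_eq_cube algebra_simps)
    also have "\<bar>\<dots>\<bar> \<le> (3 * (a + \<bar>h\<bar>)) * h\<^sup>2" unfolding abs_mult using 1 by (intro mult_mono) auto
    finally show ?thesis using 1 by simp
  next
    case 2 then show ?thesis by (simp add: pp_def)
  next
    case 3
    then have "pp 3 (a + h) - pp 3 a - 3 * h * pp 2 a = a\<^sup>2 * (- a - 3 * h)"
      by (simp add: pp_def power2_eq_square power3_eq_cube algebra_simps)
    also have "\<bar>\<dots>\<bar> \<le> (- h)\<^sup>2 * (3 * (a + \<bar>h\<bar>))" unfolding abs_mult using 3 by (intro mult_mono) (auto simp: abs_le_square_iff[symmetric])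
    finally show ?thesis using 3 by (simp add: mult_ac)
  next
    case 4
    then have "\<bar>pp 3 (a + h) - pp 3 a - 3 * h * pp 2 a\<bar> = (a + h) * (a + h)\<^sup>2" by (simp add: pp_def power2_eq_square power3_eq_cube)
    also have "\<dots> \<le> (3 * (0 + \<bar>h\<bar>)) * h\<^sup>2" using 4 by (intro mult_mono power_mono) auto
    finally show ?thesis using 4 by simp
  qed
qed

text \<open>Integrals against powers of \<open>(\<tau> - |x - c|\<^sup>2)\<^sup>+\<close> replace the integrals over the ball of radius \<open>\<surd>\<tau>\<close>
  and its boundary: they are differentiable in \<open>\<tau>\<close> everywhere, and no boundary terms occur.\<close>

definition kern :: "nat \<Rightarrow> pt \<Rightarrow> real \<Rightarrow> pt \<Rightarrow> real" where
  "kern n c \<tau> x = pp n (\<tau> - (norm (x - c))\<^sup>2)"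

lemma kern_nonneg: "0 \<le> kern n c \<tau> x" by (simp add: kern_def pp_nonneg)

lemma kern_continuous: "continuous_on S (kern n c \<tau>)"
  unfolding kern_def[abs_def] by (intro continuous_intros)

lemma kern_measurable [measurable]: "kern n c \<tau> \<in> borel_measurable borel"
  using kern_continuous by (rule borel_measurable_continuous_onI)

lemma in_cball_sqrt:
  assumes "\<tau> \<ge> 0" shows "x \<in> cball c (sqrt \<tau>) \<longleftrightarrow> (norm (x - c))\<^sup>2 \<le> \<tau>"
proof -
  have "norm (x - c) \<le> sqrt \<tau> \<longleftrightarrow> (norm (x - c))\<^sup>2 \<le> (sqrt \<tau>)\<^sup>2"
    using abs_le_square_iff[of "norm (x - c)" "sqrt \<tau>"] assms by simp
  then show ?thesis using assms by (simp add: dist_norm norm_minus_commute)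
qed

lemma kern_zero:
  assumes "n > 0" "\<tau> \<le> T" "0 \<le> T" "x \<notin> cball c (sqrt T)"
  shows "kern n c \<tau> x = 0"
  using assms in_cball_sqrt[of T x c] by (auto simp: kern_def intro!: pp_zero)

lemma kern_rho: "n > 0 \<Longrightarrow> (norm (x - c))\<^sup>2 * kern n c \<tau> x = \<tau> * kern n c \<tau> x - kern (Suc n) c \<tau> x"
  unfolding kern_def using pp_times[of n "\<tau> - (norm (x - c))\<^sup>2"] by (simp add: algebra_simps)

lemma kern_deriv:
  assumes "n \<ge> 2"
  shows "(kern n c \<tau> has_derivative (\<lambda>h. ((- 2 * real n * kern (n - 1) c \<tau> x) *\<^sub>R (x - c)) \<bullet> h)) (at x)"
proof -
  have 1: "((\<lambda>x. \<tau> - (x - c) \<bullet> (x - c)) has_derivative (\<lambda>h. - (2 * ((x - c) \<bullet> h)))) (at x)"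
    by (auto intro!: derivative_eq_intros simp: inner_commute)
  have "((\<lambda>x. pp n (\<tau> - (x - c) \<bullet> (x - c))) has_derivative
     (\<lambda>h. (n * pp (n - 1) (\<tau> - (x - c) \<bullet> (x - c))) * (- (2 * ((x - c) \<bullet> h))))) (at x)"
    by (rule has_derivative_compose[OF 1 pp_deriv[OF assms, unfolded has_field_derivative_def]])
  then show ?thesis
    unfolding kern_def[abs_def] power2_norm_eq_inner by (rule has_derivative_eq_rhs) auto
qed

lemma C1c_times:
  assumes \<psi>: "C1c \<Omega> \<psi> G" and d: "\<And>x. (f has_derivative (\<lambda>h. F x \<bullet> h)) (at x)" and c: "continuous_on UNIV F"
  shows "C1c \<Omega> (\<lambda>x. f x * \<psi> x) (\<lambda>x. \<psi> x *\<^sub>R F x + f x *\<^sub>R G x)"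
proof -
  obtain L where L: "compact L" "L \<subseteq> \<Omega>" "\<And>x. x \<notin> L \<Longrightarrow> \<psi> x = 0" "\<And>x. x \<notin> L \<Longrightarrow> G x = 0"
    using C1c_support[OF \<psi>] by blast
  have "C1c UNIV (\<lambda>x. f x * \<psi> x) (\<lambda>x. indicator UNIV x *\<^sub>R (\<psi> x *\<^sub>R F x + f x *\<^sub>R G x))"
    by (rule C1c_mult[OF C1c_mono[OF \<psi>] _ d c]) auto
  then show ?thesis
    by (intro C1cI[OF L(1,2)]) (use L in \<open>auto simp: C1c_def\<close>)
qed

lemma C1c_kern:
  assumes "n \<ge> 2" "0 \<le> \<tau>" "cball c (sqrt \<tau>) \<subseteq> \<Omega>"
  shows "C1c \<Omega> (kern n c \<tau>) (\<lambda>x. (- 2 * real n * kern (n - 1) c \<tau> x) *\<^sub>R (x - c))"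
proof (rule C1cI[OF compact_cball assms(3)])
  show "kern n c \<tau> x = 0" if "x \<notin> cball c (sqrt \<tau>)" for x
    using kern_zero[OF _ order_refl assms(2) that] assms(1) by simp
  show "continuous_on UNIV (\<lambda>x. (- 2 * real n * kern (n - 1) c \<tau> x) *\<^sub>R (x - c))"
    by (intro continuous_intros kern_continuous)
qed (rule kern_deriv[OF assms(1)])

lemma C1c_coord_kern:
  assumes "n \<ge> 2" "0 \<le> \<tau>" "cball c (sqrt \<tau>) \<subseteq> \<Omega>"
  shows "C1c \<Omega> (\<lambda>x. (x - c) $ i * kern n c \<tau> x)
     (\<lambda>x. kern n c \<tau> x *\<^sub>R axis i 1 + (x - c) $ i *\<^sub>R (- 2 * real n * kern (n - 1) c \<tau> x) *\<^sub>R (x - c))"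
proof (rule C1c_times[OF C1c_kern[OF assms]])
  show "((\<lambda>x. (x - c) $ i) has_derivative (\<lambda>h. axis i 1 \<bullet> h)) (at x)" for x
    by (auto intro!: derivative_eq_intros bounded_linear_imp_has_derivative bounded_linear_vec_nth simp: inner_axis')
qed auto

context varsol begin

definition adm :: "pt \<Rightarrow> real \<Rightarrow> bool" where
  "adm c \<tau> \<longleftrightarrow> 0 < \<tau> \<and> cball c (sqrt \<tau>) \<subseteq> \<Omega>"

lemma adm_mono: "adm c T \<Longrightarrow> 0 < \<tau> \<Longrightarrow> \<tau> \<le> T \<Longrightarrow> adm c \<tau>"
  unfolding adm_def by (meson order_trans real_sqrt_le_mono subset_cball)

definition kint :: "nat \<Rightarrow> (pt \<Rightarrow> real) \<Rightarrow> pt \<Rightarrow> real \<Rightarrow> real" where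
  "kint n f c \<tau> = (\<integral>x. f x * kern n c \<tau> x \<partial>lborel)"

lemma kern_integrable:
  assumes "loc_int f" "adm c \<tau>" "n > 0"
  shows "integrable lborel (\<lambda>x. f x * kern n c \<tau> x)"
proof (rule integrable_mult_compact)
  show "set_integrable lborel (cball c (sqrt \<tau>)) f" using assms by (auto simp: loc_int_def adm_def)
  show "kern n c \<tau> x = 0" if "x \<notin> cball c (sqrt \<tau>)" for x
    using kern_zero[OF assms(3) order_refl _ that] assms(2) by (simp add: adm_def)
qed (auto intro: kern_continuous)

text \<open>The kernels for all parameters up to \<open>T\<close> live on one fixed ball, where
  \<open>f\<close> is integrable, and the Taylor remainders are uniform in the point; so the
  difference quotient converges with an error of order \<open>h\<close>.\<close>

lemma kint_deriv:
  assumes f: "loc_int f" and T: "adm c T" and t: "0 < \<tau>" "\<tau> < T" and n: "n = 2 \<or> n = 3"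
  shows "((\<lambda>\<tau>. kint n f c \<tau>) has_real_derivative n * kint (n - 1) f c \<tau>) (at \<tau>)"
proof -
  let ?B = "cball c (sqrt T)"
  have T0: "T > 0" and BO: "?B \<subseteq> \<Omega>" using T by (auto simp: adm_def)
  have iB: "integrable lborel (\<lambda>x. \<bar>indicator ?B x *\<^sub>R f x\<bar>)"
    using f BO unfolding loc_int_def set_integrable_def by (intro integrable_abs) auto
  define M where "M = (\<integral>x. \<bar>indicator ?B x *\<^sub>R f x\<bar> \<partial>lborel)"
  \<comment> \<open>Covers both exponents: 2 from \<open>pp2_taylor\<close>, and 3 * (T + T) from
    \<open>pp3_taylor\<close>.\<close>
  define C where "C = 2 + 6 * T"
  have ptw: "\<bar>kern n c (\<tau> + h) x - kern n c \<tau> x - h * (n * kern (n - 1) c \<tau> x)\<bar> \<le> C * h\<^sup>2 * indicator ?B x"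
    if h: "\<tau> + h \<le> T" "\<bar>h\<bar> \<le> T" for h x
  proof (cases "x \<in> ?B")
    case False
    then have "kern n c (\<tau> + h) x = 0" "kern n c \<tau> x = 0" "kern (n - 1) c \<tau> x = 0"
      using kern_zero[OF _ _ _ False] h t T0 n by auto
    then show ?thesis using False by simp
  next
    case True
    define a where "a = \<tau> - (norm (x - c))\<^sup>2"
    have a: "\<tau> + h - (norm (x - c))\<^sup>2 = a + h" by (simp add: a_def)
    have aT: "max 0 a \<le> T" using t T0 by (auto simp: a_def) (smt (verit) zero_le_power2)
    show ?thesis
    proof (cases "n = 2")
      case True
      have "\<bar>kern n c (\<tau> + h) x - kern n c \<tau> x - h * (n * kern (n - 1) c \<tau> x)\<bar> = \<bar>pp 2 (a + h) - pp 2 a - 2 * h * pp 1 a\<bar>"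
        unfolding kern_def a a_def[symmetric] True by (simp add: mult_ac)
      also have "\<dots> \<le> 2 * h\<^sup>2" by (rule pp2_taylor)
      also have "\<dots> \<le> C * h\<^sup>2" using T0 by (intro mult_right_mono) (auto simp: C_def)
      finally show ?thesis using \<open>x \<in> ?B\<close> by simp
    next
      case False
      then have n3: "n = 3" using n by simp
      have "\<bar>kern n c (\<tau> + h) x - kern n c \<tau> x - h * (n * kern (n - 1) c \<tau> x)\<bar> = \<bar>pp 3 (a + h) - pp 3 a - 3 * h * pp 2 a\<bar>"
        unfolding kern_def a a_def[symmetric] n3 by (simp add: mult_ac)
      also have "\<dots> \<le> 3 * (max 0 a + \<bar>h\<bar>) * h\<^sup>2" by (rule pp3_taylor)
      also have "\<dots> \<le> C * h\<^sup>2" using aT h by (intro mult_right_mono) (auto simp: C_def)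
      finally show ?thesis using \<open>x \<in> ?B\<close> by simp
    qed
  qed
  have bnd: "\<bar>kint n f c (\<tau> + h) - kint n f c \<tau> - h * (n * kint (n - 1) f c \<tau>)\<bar> \<le> C * M * h\<^sup>2"
    if h: "0 < \<tau> + h" "\<tau> + h \<le> T" "\<bar>h\<bar> \<le> T" for h
  proof -
    have i: "integrable lborel (\<lambda>x. f x * kern n c (\<tau> + h) x)" "integrable lborel (\<lambda>x. f x * kern n c \<tau> x)"
       "integrable lborel (\<lambda>x. f x * kern (n - 1) c \<tau> x)"
      using n t h by (auto intro!: kern_integrable[OF f] intro: adm_mono[OF T])
    have hb: "has_bochner_integral lborel (\<lambda>x. f x * kern n c (\<tau> + h) x - f x * kern n c \<tau> x - (h * n) * (f x * kern (n - 1) c \<tau> x))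
       (kint n f c (\<tau> + h) - kint n f c \<tau> - (h * n) * kint (n - 1) f c \<tau>)"
      unfolding kint_def by (intro has_bochner_integral_diff has_bochner_integral_mult_right has_bochner_integral_integrable i)
    have "\<bar>\<integral>x. f x * kern n c (\<tau> + h) x - f x * kern n c \<tau> x - (h * n) * (f x * kern (n - 1) c \<tau> x) \<partial>lborel\<bar>
        \<le> (\<integral>x. (C * h\<^sup>2) * \<bar>indicator ?B x *\<^sub>R f x\<bar> \<partial>lborel)"
    proof (rule order_trans[OF integral_abs_bound integral_mono])
      show "integrable lborel (\<lambda>x. \<bar>f x * kern n c (\<tau> + h) x - f x * kern n c \<tau> x - (h * n) * (f x * kern (n - 1) c \<tau> x)\<bar>)"
        using hb by (intro integrable_abs) (auto simp: has_bochner_integral_iff)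
      show "integrable lborel (\<lambda>x. (C * h\<^sup>2) * \<bar>indicator ?B x *\<^sub>R f x\<bar>)" by (intro integrable_mult_right iB)
      fix x
      have "f x * kern n c (\<tau> + h) x - f x * kern n c \<tau> x - (h * n) * (f x * kern (n - 1) c \<tau> x)
         = f x * (kern n c (\<tau> + h) x - kern n c \<tau> x - h * (n * kern (n - 1) c \<tau> x))" by (simp add: algebra_simps)
      also have "\<bar>\<dots>\<bar> \<le> \<bar>f x\<bar> * (C * h\<^sup>2 * indicator ?B x)"
        unfolding abs_mult by (intro mult_left_mono ptw[unfolded abs_mult] h) (use ptw h in auto)
      also have "\<dots> = (C * h\<^sup>2) * \<bar>indicator ?B x *\<^sub>R f x\<bar>" by (simp add: abs_mult)
      finally show "\<bar>f x * kern n c (\<tau> + h) x - f x * kern n c \<tau> x - (h * n) * (f x * kern (n - 1) c \<tau> x)\<bar> \<le> (C * h\<^sup>2) * \<bar>indicator ?B x *\<^sub>R f x\<bar>" .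
    qed
    then show ?thesis
      unfolding has_bochner_integral_integral_eq[OF hb] using M_def by (simp add: mult_ac)
  qed
  have "(\<lambda>h. (kint n f c (\<tau> + h) - kint n f c \<tau>) / h - n * kint (n - 1) f c \<tau>) \<midarrow>0\<rightarrow> 0"
  proof (rule Lim_null_comparison)
    define d where "d = min \<tau> (T - \<tau>)"
    have d: "d > 0" "d \<le> \<tau>" "d \<le> T - \<tau>" using t by (auto simp: d_def)
    have "norm ((kint n f c (\<tau> + h) - kint n f c \<tau>) / h - n * kint (n - 1) f c \<tau>) \<le> (C * M) * \<bar>h\<bar>"
      if "h \<noteq> 0" "\<bar>h\<bar> < d" for h
    proof -
      have "(kint n f c (\<tau> + h) - kint n f c \<tau>) / h - n * kint (n - 1) f c \<tau>
         = (kint n f c (\<tau> + h) - kint n f c \<tau> - h * (n * kint (n - 1) f c \<tau>)) / h" using that by (simp add: field_simps)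
      also have "\<bar>\<dots>\<bar> \<le> (C * M * h\<^sup>2) / \<bar>h\<bar>"
        unfolding abs_divide using that d t by (intro divide_right_mono bnd) auto
      also have "\<dots> = (C * M) * \<bar>h\<bar>" using that by (simp add: power2_eq_square abs_if)
      finally show ?thesis by simp
    qed
    then show "\<forall>\<^sub>F h in at 0. norm ((kint n f c (\<tau> + h) - kint n f c \<tau>) / h - n * kint (n - 1) f c \<tau>) \<le> (C * M) * \<bar>h\<bar>"
      unfolding eventually_at using d(1) by (intro exI[of _ d]) auto
    have "((\<lambda>h. (C * M) * \<bar>h\<bar>) \<longlongrightarrow> (C * M) * \<bar>0\<bar>) (at 0)" by (intro tendsto_intros)
    then show "((\<lambda>h. (C * M) * \<bar>h\<bar>) \<longlongrightarrow> 0) (at 0)" by simp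
  qed
  then show ?thesis unfolding DERIV_def by (simp add: LIM_zero_iff)
qed

section \<open>The four weighted quantities and their identities\<close>

definition fE :: "pt \<Rightarrow> real" where "fE x = indicator E x * x $ 2"

definition rad :: "pt \<Rightarrow> pt \<Rightarrow> real" where "rad c x = (x - c) \<bullet> p x"

lemma loc_int_fE: "loc_int fE"
proof -
  have "loc_int (\<lambda>x. x $ 2)" by (intro loc_int_continuous continuous_intros)
  have "integrable lborel (\<lambda>x. indicator L x *\<^sub>R (indicator E x * x $ 2))" if "compact L" "L \<subseteq> \<Omega>" for L
  proof -
    have "integrable lborel (\<lambda>x. indicator L x *\<^sub>R x $ 2)"
      using \<open>loc_int (\<lambda>x. x $ 2)\<close> that by (simp add: loc_int_def set_integrable_def)
    from integrable_mult_indicator[OF _ this, of E] show ?thesis by (simp add: mult_ac)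
  qed
  then show ?thesis by (simp add: loc_int_def fE_def[abs_def] set_integrable_def)
qed

text \<open>With r the square root of \<tau>, the quantities \<open>Sq\<close>, \<open>Iq\<close>
  and \<open>Rq\<close> scale like r^9 when \<open>u\<close> is homogeneous of degree 3/2, which is
  also the scaling of the weighted volume in \<open>Yq\<close>. The factor 1/6 cancels the one from
  differentiating \<open>kern 3\<close>.\<close>

definition Sq where "Sq c \<tau> = kint 3 (\<lambda>x. (norm (p x))\<^sup>2) c \<tau> / 6"
definition Iq where "Iq c \<tau> = kint 2 (\<lambda>x. (U x)\<^sup>2) c \<tau>"
definition Yq where "Yq c \<tau> = kint 3 fE c \<tau> / 6"
definition Rq where "Rq c \<tau> = kint 2 (\<lambda>x. (rad c x)\<^sup>2) c \<tau>"

lemma loc_int_add: "loc_int f \<Longrightarrow> loc_int h \<Longrightarrow> loc_int (\<lambda>x. f x + h x)"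
  unfolding loc_int_def by (auto intro: set_integral_add)

lemma loc_int_Urad: "loc_int (\<lambda>x. U x * rad c x)"
proof -
  have "loc_int (\<lambda>x. U x * p x $ 1 * (x - c) $ 1 + U x * p x $ 2 * (x - c) $ 2)"
    by (intro loc_int_add loc_int_times_continuous loc_int_Up continuous_intros)
  then show ?thesis by (simp add: rad_def inner_pt algebra_simps)
qed

lemma loc_int_rad2: "loc_int (\<lambda>x. (rad c x)\<^sup>2)"
proof -
  have "loc_int (\<lambda>x. p x $ 1 * p x $ 1 * ((x - c) $ 1 * (x - c) $ 1)
     + p x $ 1 * p x $ 2 * (2 * (x - c) $ 1 * (x - c) $ 2) + p x $ 2 * p x $ 2 * ((x - c) $ 2 * (x - c) $ 2))"
    by (intro loc_int_add loc_int_times_continuous loc_int_pp continuous_intros)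
  moreover have "(\<lambda>x. p x $ 1 * p x $ 1 * ((x - c) $ 1 * (x - c) $ 1)
     + p x $ 1 * p x $ 2 * (2 * (x - c) $ 1 * (x - c) $ 2) + p x $ 2 * p x $ 2 * ((x - c) $ 2 * (x - c) $ 2))
     = (\<lambda>x. (rad c x)\<^sup>2)"
    unfolding rad_def inner_pt by (rule ext) algebra
  ultimately show ?thesis by simp
qed

lemma Sq_eq:
  assumes "adm c \<tau>" shows "Sq c \<tau> = kint 2 (\<lambda>x. U x * rad c x) c \<tau>"
proof -
  have C: "C1c \<Omega> (kern 3 c \<tau>) (\<lambda>x. (- 2 * real 3 * kern (3 - 1) c \<tau> x) *\<^sub>R (x - c))"
    by (rule C1c_kern) (use assms in \<open>auto simp: adm_def\<close>)
  have "kint 3 (\<lambda>x. (norm (p x))\<^sup>2) c \<tau> = - (\<integral>x. U x * (p x \<bullet> ((- 2 * real 3 * kern (3 - 1) c \<tau> x) *\<^sub>R (x - c))) \<partial>lborel)"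
    unfolding kint_def by (rule energy_by_parts[OF C])
  also have "\<dots> = - (\<integral>x. - 6 * (U x * rad c x * kern 2 c \<tau> x) \<partial>lborel)"
    by (simp add: rad_def inner_commute algebra_simps)
  also have "\<dots> = 6 * kint 2 (\<lambda>x. U x * rad c x) c \<tau>" by (simp add: kint_def)
  finally show ?thesis by (simp add: Sq_def)
qed

lemma kint_hb: "loc_int f \<Longrightarrow> adm c \<tau> \<Longrightarrow> n > 0 \<Longrightarrow> has_bochner_integral lborel (\<lambda>x. f x * kern n c \<tau> x) (kint n f c \<tau>)"
  unfolding kint_def by (rule has_bochner_integral_integrable[OF kern_integrable])

lemma norm_sq_minus: "((x - c) $ 1) * ((x - c) $ 1) + ((x - c) $ 2) * ((x - c) $ 2) = (norm (x - c :: pt))\<^sup>2"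
  unfolding norm_sq_pt by (simp add: power2_eq_square)

text \<open>Integrate \<open>(U x)\<^sup>2\<close> by parts against the dilation field
  \<open>(x - c)\<close> times \<open>kern 2\<close>; \<open>kern_rho\<close> turns the factor |x -
  c|^2 from the gradient of the kernel into \<tau> and a higher kernel.\<close>

lemma Iq_identity:
  assumes "adm c \<tau>"
  shows "2 * \<tau> * kint 1 (\<lambda>x. (U x)\<^sup>2) c \<tau> = 3 * Iq c \<tau> + Sq c \<tau>"
proof -
  have C: "C1c \<Omega> (\<lambda>x. (x - c) $ i * kern 2 c \<tau> x)
     (\<lambda>x. kern 2 c \<tau> x *\<^sub>R axis i 1 + (x - c) $ i *\<^sub>R (- 2 * real 2 * kern (2 - 1) c \<tau> x) *\<^sub>R (x - c))" for i
    by (rule C1c_coord_kern) (use assms in \<open>auto simp: adm_def\<close>)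
  let ?G = "\<lambda>i x. kern 2 c \<tau> x *\<^sub>R axis i 1 + (x - c) $ i *\<^sub>R (- 2 * real 2 * kern (2 - 1) c \<tau> x) *\<^sub>R (x - c)"
  have L: "has_bochner_integral lborel (\<lambda>x. (U x)\<^sup>2 * ?G i x $ i) (- 2 * (\<integral>x. U x * p x $ i * ((x - c) $ i * kern 2 c \<tau> x) \<partial>lborel))" for i
    using U_sq_by_parts[OF C[of i], of i] loc_int_mult_test(2)[OF loc_int_U2 C[of i], of i] by (simp add: has_bochner_integral_iff)
  have R: "has_bochner_integral lborel (\<lambda>x. U x * p x $ i * ((x - c) $ i * kern 2 c \<tau> x)) (\<integral>x. U x * p x $ i * ((x - c) $ i * kern 2 c \<tau> x) \<partial>lborel)" for i
    by (rule has_bochner_integral_integrable[OF loc_int_mult_test(1)[OF loc_int_Up C]])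
  have "has_bochner_integral lborel (\<lambda>x. U x * p x $ 1 * ((x - c) $ 1 * kern 2 c \<tau> x) + U x * p x $ 2 * ((x - c) $ 2 * kern 2 c \<tau> x))
      ((\<integral>x. U x * p x $ 1 * ((x - c) $ 1 * kern 2 c \<tau> x) \<partial>lborel) + (\<integral>x. U x * p x $ 2 * ((x - c) $ 2 * kern 2 c \<tau> x) \<partial>lborel))"
    by (rule has_bochner_integral_add[OF R R])
  moreover have "(\<lambda>x. U x * p x $ 1 * ((x - c) $ 1 * kern 2 c \<tau> x) + U x * p x $ 2 * ((x - c) $ 2 * kern 2 c \<tau> x)) = (\<lambda>x. U x * rad c x * kern 2 c \<tau> x)"
    by (simp add: rad_def inner_pt algebra_simps)
  ultimately have hs: "has_bochner_integral lborel (\<lambda>x. U x * rad c x * kern 2 c \<tau> x)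
      ((\<integral>x. U x * p x $ 1 * ((x - c) $ 1 * kern 2 c \<tau> x) \<partial>lborel) + (\<integral>x. U x * p x $ 2 * ((x - c) $ 2 * kern 2 c \<tau> x) \<partial>lborel))"
    by (simp only:)
  have s: "(\<integral>x. U x * p x $ 1 * ((x - c) $ 1 * kern 2 c \<tau> x) \<partial>lborel) + (\<integral>x. U x * p x $ 2 * ((x - c) $ 2 * kern 2 c \<tau> x) \<partial>lborel) = Sq c \<tau>"
    unfolding Sq_eq[OF assms] kint_def has_bochner_integral_integral_eq[OF hs] ..
  have h1: "has_bochner_integral lborel (\<lambda>x. (U x)\<^sup>2 * ?G 1 x $ 1 + (U x)\<^sup>2 * ?G 2 x $ 2) (- 2 * Sq c \<tau>)"
    using has_bochner_integral_add[OF L[of 1] L[of 2]] unfolding s[symmetric] by (simp only: distrib_left)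
  have eq: "(U x)\<^sup>2 * ?G 1 x $ 1 + (U x)\<^sup>2 * ?G 2 x $ 2 = 6 * ((U x)\<^sup>2 * kern 2 c \<tau> x) - (4 * \<tau>) * ((U x)\<^sup>2 * kern 1 c \<tau> x)" for x
  proof -
    have "?G 1 x $ 1 + ?G 2 x $ 2 = 2 * kern 2 c \<tau> x - 4 * ((((x - c) $ 1) * ((x - c) $ 1) + ((x - c) $ 2) * ((x - c) $ 2)) * kern 1 c \<tau> x)"
      by (simp add: axis_def algebra_simps)
    also have "\<dots> = 6 * kern 2 c \<tau> x - 4 * \<tau> * kern 1 c \<tau> x"
      unfolding norm_sq_minus using kern_rho[of 1 x c \<tau>] by (simp add: numeral_2_eq_2)
    finally have "(U x)\<^sup>2 * (?G 1 x $ 1 + ?G 2 x $ 2) = (U x)\<^sup>2 * (6 * kern 2 c \<tau> x - 4 * \<tau> * kern 1 c \<tau> x)" by simp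
    then show ?thesis by (simp only: distrib_left right_diff_distrib mult_ac)
  qed
  have h2: "has_bochner_integral lborel (\<lambda>x. 6 * ((U x)\<^sup>2 * kern 2 c \<tau> x) - (4 * \<tau>) * ((U x)\<^sup>2 * kern 1 c \<tau> x))
     (6 * Iq c \<tau> - (4 * \<tau>) * kint 1 (\<lambda>x. (U x)\<^sup>2) c \<tau>)"
    unfolding Iq_def by (intro has_bochner_integral_diff has_bochner_integral_mult_right kint_hb loc_int_U2 assms) auto
  have "6 * Iq c \<tau> - (4 * \<tau>) * kint 1 (\<lambda>x. (U x)\<^sup>2) c \<tau> = - 2 * Sq c \<tau>"
    by (rule has_bochner_integral_eq[OF h2 h1[unfolded eq]])
  then show ?thesis by simp
qed

text \<open>The stress identity for the dilation field \<open>(x - c)\<close> times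
  \<open>kern 3\<close>, a Rellich-Pohozaev identity. As \<open>c\<close> lies on the axis, the
  vertical component over \<open>E\<close> is again a multiple of \<open>x $ 2\<close>, so the whole
  right-hand side is expressed by \<open>fE\<close>.\<close>

lemma Sq_identity:
  assumes "adm c \<tau>" "c $ 2 = 0"
  shows "\<tau> * (kint 2 (\<lambda>x. (norm (p x))\<^sup>2) c \<tau> / 2 - kint 2 fE c \<tau> / 2) = 3 * Sq c \<tau> - 9 / 2 * Yq c \<tau> + Rq c \<tau>"
proof -
  have C: "C1c \<Omega> (\<lambda>x. (x - c) $ i * kern 3 c \<tau> x)
     (\<lambda>x. kern 3 c \<tau> x *\<^sub>R axis i 1 + (x - c) $ i *\<^sub>R (- 2 * real 3 * kern (3 - 1) c \<tau> x) *\<^sub>R (x - c))" for i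
    by (rule C1c_coord_kern) (use assms in \<open>auto simp: adm_def\<close>)
  let ?G = "\<lambda>i x. kern 3 c \<tau> x *\<^sub>R axis i 1 + (x - c) $ i *\<^sub>R (- 2 * real 3 * kern (3 - 1) c \<tau> x) *\<^sub>R (x - c)"
  have k3: "(norm (x - c))\<^sup>2 * kern 2 c \<tau> x = \<tau> * kern 2 c \<tau> x - kern 3 c \<tau> x" for x
    using kern_rho[of 2 x c \<tau>] by (simp add: numeral_3_eq_3 numeral_2_eq_2)
  have dv: "?G 1 x $ 1 + ?G 2 x $ 2 = 8 * kern 3 c \<tau> x - 6 * \<tau> * kern 2 c \<tau> x" for x
  proof -
    have "?G 1 x $ 1 + ?G 2 x $ 2 = 2 * kern 3 c \<tau> x - 6 * ((((x - c) $ 1) * ((x - c) $ 1) + ((x - c) $ 2) * ((x - c) $ 2)) * kern 2 c \<tau> x)"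
      by (simp add: axis_def algebra_simps)
    then show ?thesis unfolding norm_sq_minus k3 by simp
  qed
  have qd: "p x $ 1 * (?G 1 x \<bullet> p x) + p x $ 2 * (?G 2 x \<bullet> p x) = kern 3 c \<tau> x * (norm (p x))\<^sup>2 - 6 * kern 2 c \<tau> x * (rad c x)\<^sup>2" for x
    unfolding norm_sq_pt rad_def inner_pt by (simp add: axis_def power2_eq_square algebra_simps)
  have st: "stress (?G 1) (?G 2) x = 6 * ((norm (p x))\<^sup>2 * kern 3 c \<tau> x) - (6 * \<tau>) * ((norm (p x))\<^sup>2 * kern 2 c \<tau> x) + 12 * ((rad c x)\<^sup>2 * kern 2 c \<tau> x)" for x
    unfolding stress_def dv qd by (simp add: algebra_simps)
  have "has_bochner_integral lborel (\<lambda>x. 6 * ((norm (p x))\<^sup>2 * kern 3 c \<tau> x) - (6 * \<tau>) * ((norm (p x))\<^sup>2 * kern 2 c \<tau> x) + 12 * ((rad c x)\<^sup>2 * kern 2 c \<tau> x))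
     (6 * (6 * Sq c \<tau>) - (6 * \<tau>) * kint 2 (\<lambda>x. (norm (p x))\<^sup>2) c \<tau> + 12 * Rq c \<tau>)"
    unfolding Sq_def Rq_def using kint_hb[OF loc_int_p2 assms(1), of 3]
    by (intro has_bochner_integral_add has_bochner_integral_diff has_bochner_integral_mult_right kint_hb loc_int_p2 loc_int_rad2 assms) auto
  then have l: "(\<integral>x. stress (?G 1) (?G 2) x \<partial>lborel) = 36 * Sq c \<tau> - (6 * \<tau>) * kint 2 (\<lambda>x. (norm (p x))\<^sup>2) c \<tau> + 12 * Rq c \<tau>"
    unfolding st by (simp add: has_bochner_integral_integral_eq)
  have re: "indicator E x * (x $ 2 * (?G 1 x $ 1 + ?G 2 x $ 2) + (x - c) $ 2 * kern 3 c \<tau> x) = 9 * (fE x * kern 3 c \<tau> x) - (6 * \<tau>) * (fE x * kern 2 c \<tau> x)" for x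
    unfolding dv fE_def using assms(2) by (simp add: algebra_simps)
  have "has_bochner_integral lborel (\<lambda>x. 9 * (fE x * kern 3 c \<tau> x) - (6 * \<tau>) * (fE x * kern 2 c \<tau> x)) (9 * (6 * Yq c \<tau>) - (6 * \<tau>) * kint 2 fE c \<tau>)"
    unfolding Yq_def using kint_hb[OF loc_int_fE assms(1), of 3]
    by (intro has_bochner_integral_diff has_bochner_integral_mult_right kint_hb loc_int_fE assms) auto
  then have r: "(\<integral>x. indicator E x * (x $ 2 * (?G 1 x $ 1 + ?G 2 x $ 2) + (x - c) $ 2 * kern 3 c \<tau> x) \<partial>lborel) = 54 * Yq c \<tau> - (6 * \<tau>) * kint 2 fE c \<tau>"
    unfolding re by (simp add: has_bochner_integral_integral_eq)
  show ?thesis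
    using stress_identity[OF C[of 1] C[of 2]] unfolding l r by (simp add: algebra_simps)
qed

end

section \<open>Differential equations in \<tau> and monotonicity\<close>

lemma nondecreasing_if_deriv_nonneg:
  fixes f f' :: "real \<Rightarrow> real"
  assumes "a \<le> b" "\<And>x. a \<le> x \<Longrightarrow> x \<le> b \<Longrightarrow> (f has_real_derivative f' x) (at x)"
    "\<And>x. a \<le> x \<Longrightarrow> x \<le> b \<Longrightarrow> 0 \<le> f' x"
  shows "f a \<le> f b"
  using DERIV_nonneg_imp_nondecreasing[OF assms(1), of f] assms(2,3) by blast

context varsol begin

lemma Sq_deriv:
  assumes "adm c T" "0 < \<tau>" "\<tau> < T"
  shows "(Sq c has_real_derivative kint 2 (\<lambda>x. (norm (p x))\<^sup>2) c \<tau> / 2) (at \<tau>)"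
  unfolding Sq_def[abs_def] using kint_deriv[OF loc_int_p2 assms, of 3]
  by (auto intro!: derivative_eq_intros)

lemma Yq_deriv:
  assumes "adm c T" "0 < \<tau>" "\<tau> < T"
  shows "(Yq c has_real_derivative kint 2 fE c \<tau> / 2) (at \<tau>)"
  unfolding Yq_def[abs_def] using kint_deriv[OF loc_int_fE assms, of 3]
  by (auto intro!: derivative_eq_intros)

lemma Iq_deriv:
  assumes "adm c T" "0 < \<tau>" "\<tau> < T"
  shows "(Iq c has_real_derivative (3 * Iq c \<tau> + Sq c \<tau>) / \<tau>) (at \<tau>)"
proof -
  have "adm c \<tau>" using adm_mono[OF assms(1,2)] assms(3) by simp
  from Iq_identity[OF this] have "2 * kint 1 (\<lambda>x. (U x)\<^sup>2) c \<tau> = (3 * Iq c \<tau> + Sq c \<tau>) / \<tau>"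
    using assms by (simp add: field_simps)
  then show ?thesis
    unfolding Iq_def[abs_def] using kint_deriv[OF loc_int_U2 assms, of 2] by (simp add: Iq_def)
qed

lemma SY_deriv:
  assumes "adm c T" "0 < \<tau>" "\<tau> < T" "c $ 2 = 0"
  shows "((\<lambda>\<tau>. Sq c \<tau> - Yq c \<tau>) has_real_derivative (3 * Sq c \<tau> - 9 / 2 * Yq c \<tau> + Rq c \<tau>) / \<tau>) (at \<tau>)"
proof -
  have "adm c \<tau>" using adm_mono[OF assms(1,2)] assms(3) by simp
  from Sq_identity[OF this assms(4)] have "kint 2 (\<lambda>x. (norm (p x))\<^sup>2) c \<tau> / 2 - kint 2 fE c \<tau> / 2 = (3 * Sq c \<tau> - 9 / 2 * Yq c \<tau> + Rq c \<tau>) / \<tau>"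
    using assms by (simp add: field_simps)
  then show ?thesis using DERIV_diff[OF Sq_deriv[OF assms(1-3)] Yq_deriv[OF assms(1-3)]] by simp
qed

lemma kint_nonneg: "(\<And>x. f x \<ge> 0) \<Longrightarrow> kint n f c \<tau> \<ge> 0"
  unfolding kint_def by (intro integral_nonneg_AE AE_I2 mult_nonneg_nonneg kern_nonneg)

lemma fE_nonneg: "fE x \<ge> 0" by (auto simp: fE_def E_def indicator_def)

lemma quantities_nonneg: "Sq c \<tau> \<ge> 0" "Yq c \<tau> \<ge> 0" "Iq c \<tau> \<ge> 0"
  unfolding Sq_def Yq_def Iq_def using kint_nonneg[of fE] fE_nonneg by (auto intro!: kint_nonneg)

lemma kern_mono: "\<tau> \<le> T \<Longrightarrow> kern n c \<tau> x \<le> kern n c T x"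
  unfolding kern_def by (intro pp_mono) simp

lemma kint_mono:
  assumes "loc_int f" "adm c T" "0 < \<tau>" "\<tau> \<le> T" "n > 0" "\<And>x. f x \<ge> 0"
  shows "kint n f c \<tau> \<le> kint n f c T"
  unfolding kint_def using assms
  by (intro integral_mono kern_integrable[OF assms(1)] mult_left_mono kern_mono) (auto intro: adm_mono)

lemma quadratic_deviation:
  assumes "adm c \<tau>"
  shows "kint 2 (\<lambda>x. (rad c x - N * U x)\<^sup>2) c \<tau> = Rq c \<tau> - 2 * N * Sq c \<tau> + N\<^sup>2 * Iq c \<tau>"
proof -
  have "has_bochner_integral lborel (\<lambda>x. (rad c x)\<^sup>2 * kern 2 c \<tau> x - (2 * N) * (U x * rad c x * kern 2 c \<tau> x) + N\<^sup>2 * ((U x)\<^sup>2 * kern 2 c \<tau> x))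
     (Rq c \<tau> - (2 * N) * Sq c \<tau> + N\<^sup>2 * Iq c \<tau>)"
    unfolding Rq_def Iq_def Sq_eq[OF assms]
    by (intro has_bochner_integral_add has_bochner_integral_diff has_bochner_integral_mult_right kint_hb loc_int_U2 loc_int_rad2 loc_int_Urad assms) auto
  moreover have "(\<lambda>x. (rad c x)\<^sup>2 * kern 2 c \<tau> x - (2 * N) * (U x * rad c x * kern 2 c \<tau> x) + N\<^sup>2 * ((U x)\<^sup>2 * kern 2 c \<tau> x))
     = (\<lambda>x. (rad c x - N * U x)\<^sup>2 * kern 2 c \<tau> x)"
    by (rule ext) (simp add: power2_eq_square algebra_simps)
  ultimately show ?thesis unfolding kint_def by (simp add: has_bochner_integral_integral_eq)
qed

text \<open>At \<open>c \<in> \<Sigma>\<close> this is a weighted integral over radii \<open>r \<le> \<surd>\<tau>\<close> of \<open>\<Phi>(r) - \<Phi>(0+)\<close>.\<close>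

definition Gq where "Gq c \<tau> = Sq c \<tau> - Yq c \<tau> - 3 / 2 * Iq c \<tau>"

text \<open>9/2 is the common scaling exponent in \<tau>. What is left beside it is the integral of
  a square, which vanishes for functions homogeneous of degree 3/2, so \<open>Gq\<close> divided by
  \<tau> to the 9/2 is nondecreasing.\<close>

lemma Gq_deriv:
  assumes "adm c T" "0 < \<tau>" "\<tau> < T" "c $ 2 = 0"
  shows "(Gq c has_real_derivative (9 / 2 * Gq c \<tau> + kint 2 (\<lambda>x. (rad c x - 3 / 2 * U x)\<^sup>2) c \<tau>) / \<tau>) (at \<tau>)"
proof -
  have adm: "adm c \<tau>" using adm_mono[OF assms(1,2)] assms(3) by simp
  have "(Gq c has_real_derivative (3 * Sq c \<tau> - 9 / 2 * Yq c \<tau> + Rq c \<tau>) / \<tau> - 3 / 2 * ((3 * Iq c \<tau> + Sq c \<tau>) / \<tau>)) (at \<tau>)"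
    unfolding Gq_def[abs_def] by (intro DERIV_diff DERIV_cmult SY_deriv[OF assms] Iq_deriv[OF assms(1-3)])
  moreover have "(3 * Sq c \<tau> - 9 / 2 * Yq c \<tau> + Rq c \<tau>) / \<tau> - 3 / 2 * ((3 * Iq c \<tau> + Sq c \<tau>) / \<tau>)
     = (9 / 2 * Gq c \<tau> + kint 2 (\<lambda>x. (rad c x - 3 / 2 * U x)\<^sup>2) c \<tau>) / \<tau>"
    unfolding quadratic_deviation[OF adm] Gq_def using assms(2) by (simp add: field_simps power2_eq_square)
  ultimately show ?thesis by simp
qed

text \<open>Writing r^2 for \<tau> makes the exponent an integer: the quotient by r^9 is
  nondecreasing and starts at 0.\<close>

lemma Gq_nonneg_of_limit:
  assumes T: "adm c T" "c $ 2 = 0" and lim: "((\<lambda>r. Gq c (r\<^sup>2) / r ^ 9) \<longlongrightarrow> 0) (at_right 0)"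
    and t: "0 < \<tau>" "\<tau> < T"
  shows "Gq c \<tau> \<ge> 0"
proof -
  define b where "b = sqrt \<tau>"
  have b: "b > 0" "b\<^sup>2 = \<tau>" using t by (auto simp: b_def)
  have d: "((\<lambda>r. Gq c (r\<^sup>2) / r ^ 9) has_real_derivative
      2 * kint 2 (\<lambda>x. (rad c x - 3 / 2 * U x)\<^sup>2) c (r\<^sup>2) / r ^ 10) (at r)" if r: "0 < r" "r \<le> b" for r
  proof -
    have r2: "0 < r\<^sup>2" "r\<^sup>2 < T" using r t b power_mono[of r b 2] by auto
    have 1: "((\<lambda>r. Gq c (r\<^sup>2)) has_real_derivative
       ((9 / 2 * Gq c (r\<^sup>2) + kint 2 (\<lambda>x. (rad c x - 3 / 2 * U x)\<^sup>2) c (r\<^sup>2)) / r\<^sup>2) * (2 * r)) (at r)"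
      by (rule DERIV_chain2[where f="Gq c" and g="\<lambda>r. r\<^sup>2", OF Gq_deriv[OF T(1) r2 T(2)]]) (auto intro!: derivative_eq_intros)
    have 2: "((\<lambda>r. r ^ 9) has_real_derivative 9 * r ^ 8) (at r)" by (auto intro!: derivative_eq_intros)
    have "((\<lambda>r. Gq c (r\<^sup>2) / r ^ 9) has_real_derivative
       ((((9 / 2 * Gq c (r\<^sup>2) + kint 2 (\<lambda>x. (rad c x - 3 / 2 * U x)\<^sup>2) c (r\<^sup>2)) / r\<^sup>2) * (2 * r)) * r ^ 9 - Gq c (r\<^sup>2) * (9 * r ^ 8)) / (r ^ 9 * r ^ 9)) (at r)"
      by (rule DERIV_divide[OF 1 2]) (use r in auto)
    moreover have "((((9 / 2 * g + k) / r\<^sup>2) * (2 * r)) * r ^ 9 - g * (9 * r ^ 8)) / (r ^ 9 * r ^ 9) = 2 * k / r ^ 10" for g k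
    proof -
      have e: "((((9 / 2 * g + k) / r\<^sup>2) * (2 * r)) * r ^ 9 - g * (9 * r ^ 8)) = 2 * k * r ^ 8"
        using r by (simp add: field_simps power2_eq_square eval_nat_numeral)
      have f: "r ^ 9 * r ^ 9 = r ^ 10 * r ^ 8" by (simp add: power_add[symmetric])
      show ?thesis unfolding e f using r by (metis mult_divide_mult_cancel_right power_not_zero less_irrefl)
    qed
    ultimately show ?thesis by simp
  qed
  have le: "Gq c (a\<^sup>2) / a ^ 9 \<le> Gq c (b\<^sup>2) / b ^ 9" if a: "0 < a" "a < b" for a
    using a by (intro nondecreasing_if_deriv_nonneg[OF _ d]) (auto intro!: divide_nonneg_nonneg mult_nonneg_nonneg kint_nonneg)
  have "0 \<le> Gq c (b\<^sup>2) / b ^ 9"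
  proof (rule tendsto_upperbound[OF lim])
    show "\<forall>\<^sub>F a in at_right 0. Gq c (a\<^sup>2) / a ^ 9 \<le> Gq c (b\<^sup>2) / b ^ 9"
      using le b unfolding eventually_at_right_field by blast
  qed simp
  then show ?thesis using b by (simp add: zero_le_divide_iff)
qed

text \<open>The part of membership in \<Sigma> that survives a limit of centers. An accumulation
  point of \<Sigma> is not known to belong to \<Sigma>, but it inherits these conditions by
  \<open>good_limit\<close>. The sign of \<open>Gq\<close> says that the frequency is at least
  3/2.\<close>

definition good :: "pt \<Rightarrow> real \<Rightarrow> bool" where
  "good c T \<longleftrightarrow> adm c T \<and> c $ 2 = 0 \<and> c \<in> closure P \<and> (\<forall>\<tau>. 0 < \<tau> \<longrightarrow> \<tau> < T \<longrightarrow> Gq c \<tau> \<ge> 0)"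

text \<open>If the mass vanished, then by continuity \<open>u\<close> would be zero on a whole ball
  about \<open>c\<close>, against \<open>c \<in> closure P\<close>.\<close>

lemma Iq_pos:
  assumes "adm c \<tau>" "c \<in> closure P" shows "Iq c \<tau> > 0"
proof (rule ccontr)
  assume "\<not> Iq c \<tau> > 0"
  then have 0: "Iq c \<tau> = 0" using quantities_nonneg(3)[of c \<tau>] by simp
  have i: "integrable lborel (\<lambda>x. (U x)\<^sup>2 * kern 2 c \<tau> x)" by (rule kern_integrable[OF loc_int_U2 assms(1)]) simp
  have "AE x in lborel. (U x)\<^sup>2 * kern 2 c \<tau> x = 0"
    using 0 unfolding Iq_def kint_def
    by (subst (asm) integral_nonneg_eq_0_iff_AE[OF i]) (auto simp: kern_nonneg)
  then have ae: "AE x in lborel. x \<in> \<Omega> \<longrightarrow> (U x)\<^sup>2 * kern 2 c \<tau> x = 0" by eventually_elim simp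
  have z: "(U x)\<^sup>2 * kern 2 c \<tau> x = 0" if "x \<in> \<Omega>" for x
    by (rule continuous_AE_zero[OF op _ ae that]) (intro continuous_intros U_cont kern_continuous)
  have t: "\<tau> > 0" using assms(1) by (simp add: adm_def)
  obtain x where x: "x \<in> P" "dist x c < sqrt \<tau>"
    using assms(2) t unfolding closure_approachable by (metis real_sqrt_gt_zero)
  have "(dist x c)\<^sup>2 < (sqrt \<tau>)\<^sup>2" using x(2) by (intro power_strict_mono) auto
  then have "kern 2 c \<tau> x > 0" using t by (simp add: kern_def pp_def dist_norm)
  moreover have "U x > 0" "x \<in> \<Omega>" using x(1) by (auto simp: P_def U_def)
  ultimately show False using z[of x] by simp
qed

text \<open>The frequency; \<open>dev\<close> below measures the distance to functions homogeneous of degree \<open>Sq / Iq\<close>.\<close>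

definition Hq where "Hq c \<tau> = (Sq c \<tau> - Yq c \<tau>) / Iq c \<tau>"

lemma good_adm: "good c T \<Longrightarrow> 0 < \<tau> \<Longrightarrow> \<tau> \<le> T \<Longrightarrow> adm c \<tau>"
  using adm_mono by (auto simp: good_def)

lemma good_Iq_pos: "good c T \<Longrightarrow> 0 < \<tau> \<Longrightarrow> \<tau> \<le> T \<Longrightarrow> Iq c \<tau> > 0"
  using Iq_pos good_adm by (auto simp: good_def)

lemma good_SIY: "good c T \<Longrightarrow> 0 < \<tau> \<Longrightarrow> \<tau> < T \<Longrightarrow> Sq c \<tau> \<ge> 3 / 2 * Iq c \<tau> + Yq c \<tau>"
  by (auto simp: good_def Gq_def algebra_simps)

lemma Hq_ge: assumes "good c T" "0 < \<tau>" "\<tau> < T" shows "Hq c \<tau> \<ge> 3 / 2"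
  using good_SIY[OF assms] good_Iq_pos[OF assms(1,2)] assms(3) by (simp add: Hq_def pos_le_divide_eq)

definition dev where "dev c \<tau> = kint 2 (\<lambda>x. (rad c x - Sq c \<tau> / Iq c \<tau> * U x)\<^sup>2) c \<tau>"

text \<open>For the minimising factor \<open>Sq / Iq\<close> the deviation is the deficit in the
  Cauchy-Schwarz inequality between \<open>rad\<close> and \<open>U\<close>.\<close>

lemma dev_eq:
  assumes "good c T" "0 < \<tau>" "\<tau> \<le> T"
  shows "dev c \<tau> * Iq c \<tau> = Rq c \<tau> * Iq c \<tau> - (Sq c \<tau>)\<^sup>2"
  unfolding dev_def quadratic_deviation[OF good_adm[OF assms]]
  using good_Iq_pos[OF assms] by (simp add: field_simps power2_eq_square)

text \<open>Quotient rule with the two differential equations. The first part is the Cauchy-Schwarz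
  deficit; the second is nonnegative because \<open>Sq - 3 / 2 * Iq\<close> is at least
  \<open>Yq\<close> at good points.\<close>

lemma Hq_deriv:
  assumes "good c T" "0 < \<tau>" "\<tau> < T"
  shows "(Hq c has_real_derivative
     (dev c \<tau> / Iq c \<tau> + Yq c \<tau> * (Sq c \<tau> - 3 / 2 * Iq c \<tau>) / (Iq c \<tau>)\<^sup>2) / \<tau>) (at \<tau>)"
proof -
  have adm: "adm c T" "c $ 2 = 0" using assms(1) by (auto simp: good_def)
  have I: "Iq c \<tau> > 0" using good_Iq_pos[OF assms(1,2)] assms(3) by simp
  have "(Hq c has_real_derivative
    ((3 * Sq c \<tau> - 9 / 2 * Yq c \<tau> + Rq c \<tau>) / \<tau> * Iq c \<tau> - (Sq c \<tau> - Yq c \<tau>) * ((3 * Iq c \<tau> + Sq c \<tau>) / \<tau>)) / (Iq c \<tau> * Iq c \<tau>)) (at \<tau>)"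
    unfolding Hq_def[abs_def]
    by (rule DERIV_divide[OF SY_deriv[OF adm(1) assms(2,3) adm(2)] Iq_deriv[OF adm(1) assms(2,3)]]) (use I in simp)
  moreover have "((3 * Sq c \<tau> - 9 / 2 * Yq c \<tau> + Rq c \<tau>) / \<tau> * Iq c \<tau> - (Sq c \<tau> - Yq c \<tau>) * ((3 * Iq c \<tau> + Sq c \<tau>) / \<tau>)) / (Iq c \<tau> * Iq c \<tau>)
     = (dev c \<tau> / Iq c \<tau> + Yq c \<tau> * (Sq c \<tau> - 3 / 2 * Iq c \<tau>) / (Iq c \<tau>)\<^sup>2) / \<tau>"
  proof -
    have "dev c \<tau> / Iq c \<tau> = (Rq c \<tau> * Iq c \<tau> - (Sq c \<tau>)\<^sup>2) / (Iq c \<tau>)\<^sup>2"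
      using dev_eq[OF assms(1,2)] assms(3) I by (simp add: field_simps power2_eq_square)
    then have r: "(dev c \<tau> / Iq c \<tau> + Yq c \<tau> * (Sq c \<tau> - 3 / 2 * Iq c \<tau>) / (Iq c \<tau>)\<^sup>2) / \<tau>
      = (Rq c \<tau> * Iq c \<tau> - (Sq c \<tau>)\<^sup>2 + Yq c \<tau> * (Sq c \<tau> - 3 / 2 * Iq c \<tau>)) / (Iq c \<tau>)\<^sup>2 / \<tau>"
      by (simp add: add_divide_distrib)
    have l: "(3 * Sq c \<tau> - 9 / 2 * Yq c \<tau> + Rq c \<tau>) / \<tau> * Iq c \<tau> - (Sq c \<tau> - Yq c \<tau>) * ((3 * Iq c \<tau> + Sq c \<tau>) / \<tau>)
      = (Rq c \<tau> * Iq c \<tau> - (Sq c \<tau>)\<^sup>2 + Yq c \<tau> * (Sq c \<tau> - 3 / 2 * Iq c \<tau>)) / \<tau>"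
      using assms(2) by (simp add: field_simps power2_eq_square)
    show ?thesis unfolding l r by (simp add: power2_eq_square)
  qed
  ultimately show ?thesis by simp
qed

lemma dev_nonneg: "dev c \<tau> \<ge> 0"
  unfolding dev_def by (intro kint_nonneg) simp

text \<open>Through this quadratic bound the volume of \<open>E\<close> becomes visible in the
  growth of the frequency: a nearly constant frequency forces \<open>Yq\<close> to be small against
  \<open>Iq\<close>.\<close>

lemma Hq_deriv_bound:
  assumes "good c T" "0 < \<tau>" "\<tau> < T"
  shows "(Yq c \<tau> / Iq c \<tau>)\<^sup>2 \<le> Yq c \<tau> * (Sq c \<tau> - 3 / 2 * Iq c \<tau>) / (Iq c \<tau>)\<^sup>2"
proof -
  have "Yq c \<tau> * Yq c \<tau> \<le> Yq c \<tau> * (Sq c \<tau> - 3 / 2 * Iq c \<tau>)"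
    using good_SIY[OF assms] quantities_nonneg(2)[of c \<tau>] by (intro mult_left_mono) auto
  then show ?thesis by (simp add: power_divide power2_eq_square divide_right_mono)
qed

lemma Hq_mono:
  assumes "good c T" "0 < a" "a \<le> b" "b < T" shows "Hq c a \<le> Hq c b"
proof (rule nondecreasing_if_deriv_nonneg[OF assms(3)])
  fix x assume "a \<le> x" "x \<le> b"
  then have x: "0 < x" "x < T" using assms by auto
  show "(Hq c has_real_derivative (dev c x / Iq c x + Yq c x * (Sq c x - 3 / 2 * Iq c x) / (Iq c x)\<^sup>2) / x) (at x)"
    by (rule Hq_deriv[OF assms(1) x])
  have "0 \<le> Yq c x * (Sq c x - 3 / 2 * Iq c x) / (Iq c x)\<^sup>2"
    using Hq_deriv_bound[OF assms(1) x] by (meson order_trans zero_le_power2)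
  moreover have "0 \<le> dev c x / Iq c x" by (intro divide_nonneg_nonneg dev_nonneg quantities_nonneg)
  ultimately show "0 \<le> (dev c x / Iq c x + Yq c x * (Sq c x - 3 / 2 * Iq c x) / (Iq c x)\<^sup>2) / x"
    using x by (intro divide_nonneg_nonneg[OF add_nonneg_nonneg]) auto
qed

text \<open>By the mean value theorem the increment of \<open>Hq\<close> is \<open>b - a\<close>
  times its derivative at one scale, and each of the two nonnegative parts is bounded by their sum.
  Deviation and \<open>Yq\<close> are thus controlled at the same \<tau>.\<close>

lemma pinching:
  assumes "good c T" "0 < a" "a < b" "b < T"
  obtains \<tau> where "a < \<tau>" "\<tau> < b" "dev c \<tau> \<le> b / (b - a) * (Hq c b - Hq c a) * Iq c \<tau>"
    "(Yq c \<tau>)\<^sup>2 \<le> b / (b - a) * (Hq c b - Hq c a) * (Iq c \<tau>)\<^sup>2"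
proof -
  have d: "\<And>x. a \<le> x \<Longrightarrow> x \<le> b \<Longrightarrow> (Hq c has_real_derivative
     (dev c x / Iq c x + Yq c x * (Sq c x - 3 / 2 * Iq c x) / (Iq c x)\<^sup>2) / x) (at x)"
    using assms by (intro Hq_deriv[OF assms(1)]) auto
  obtain \<tau> where t: "a < \<tau>" "\<tau> < b" and
    e: "Hq c b - Hq c a = (b - a) * ((dev c \<tau> / Iq c \<tau> + Yq c \<tau> * (Sq c \<tau> - 3 / 2 * Iq c \<tau>) / (Iq c \<tau>)\<^sup>2) / \<tau>)"
    using MVT2[OF assms(3) d] by blast
  have t': "0 < \<tau>" "\<tau> < T" using t assms by auto
  have I: "Iq c \<tau> > 0" using good_Iq_pos[OF assms(1), of \<tau>] t' by simp
  define Q where "Q = Yq c \<tau> * (Sq c \<tau> - 3 / 2 * Iq c \<tau>) / (Iq c \<tau>)\<^sup>2"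
  have Q: "(Yq c \<tau> / Iq c \<tau>)\<^sup>2 \<le> Q" unfolding Q_def by (rule Hq_deriv_bound[OF assms(1) t'])
  have dv: "0 \<le> dev c \<tau> / Iq c \<tau>" by (intro divide_nonneg_nonneg dev_nonneg quantities_nonneg)
  have "dev c \<tau> / Iq c \<tau> + Q = \<tau> / (b - a) * (Hq c b - Hq c a)"
    unfolding e Q_def using t' assms by simp
  also have "\<dots> \<le> b / (b - a) * (Hq c b - Hq c a)"
    using t assms Hq_mono[OF assms(1,2), of b] by (intro mult_right_mono divide_right_mono) auto
  finally have s: "dev c \<tau> / Iq c \<tau> + Q \<le> b / (b - a) * (Hq c b - Hq c a)" .
  show ?thesis
  proof (rule that[OF t])
    have "dev c \<tau> / Iq c \<tau> \<le> b / (b - a) * (Hq c b - Hq c a)"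
      using s Q zero_le_power2[of "Yq c \<tau> / Iq c \<tau>"] by linarith
    then show "dev c \<tau> \<le> b / (b - a) * (Hq c b - Hq c a) * Iq c \<tau>" using I by (simp add: pos_divide_le_eq)
    have "(Yq c \<tau> / Iq c \<tau>)\<^sup>2 \<le> b / (b - a) * (Hq c b - Hq c a)" using s Q dv by linarith
    then show "(Yq c \<tau>)\<^sup>2 \<le> b / (b - a) * (Hq c b - Hq c a) * (Iq c \<tau>)\<^sup>2"
      using I by (simp add: power_divide pos_divide_le_eq)
  qed
qed

text \<open>At good points \<tau> times the derivative of \<open>Iq\<close> is at least 9/2 times
  \<open>Iq\<close>. Squaring keeps the exponent an integer.\<close>

lemma Iq_growth:
  assumes "good c T" "0 < a" "a \<le> b" "b < T"
  shows "(Iq c a)\<^sup>2 * b ^ 9 \<le> (Iq c b)\<^sup>2 * a ^ 9"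
proof -
  have "(Iq c a)\<^sup>2 / a ^ 9 \<le> (Iq c b)\<^sup>2 / b ^ 9"
  proof (rule nondecreasing_if_deriv_nonneg[where f="\<lambda>x. (Iq c x)\<^sup>2 / x ^ 9", OF assms(3)])
    fix x assume "a \<le> x" "x \<le> b"
    then have x: "0 < x" "x < T" using assms by auto
    have adm: "adm c T" using assms(1) by (simp add: good_def)
    have 1: "((\<lambda>x. (Iq c x)\<^sup>2) has_real_derivative 2 * Iq c x * ((3 * Iq c x + Sq c x) / x)) (at x)"
      using Iq_deriv[OF adm x] by (auto intro!: derivative_eq_intros)
    have 2: "((\<lambda>r. r ^ 9) has_real_derivative 9 * x ^ 8) (at x)" by (auto intro!: derivative_eq_intros)
    show "((\<lambda>x. (Iq c x)\<^sup>2 / x ^ 9) has_real_derivative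
      (2 * Iq c x * ((3 * Iq c x + Sq c x) / x) * x ^ 9 - (Iq c x)\<^sup>2 * (9 * x ^ 8)) / (x ^ 9 * x ^ 9)) (at x)"
      by (rule DERIV_divide[OF 1 2]) (use x in simp)
    have "2 * Iq c x * ((3 * Iq c x + Sq c x) / x) * x ^ 9 - (Iq c x)\<^sup>2 * (9 * x ^ 8) = x ^ 8 * Iq c x * (2 * Sq c x - 3 * Iq c x)"
      using x by (simp add: field_simps power2_eq_square eval_nat_numeral)
    also have "\<dots> \<ge> 0"
      using x good_SIY[OF assms(1) x] quantities_nonneg[of c x] by (intro mult_nonneg_nonneg) auto
    finally show "0 \<le> (2 * Iq c x * ((3 * Iq c x + Sq c x) / x) * x ^ 9 - (Iq c x)\<^sup>2 * (9 * x ^ 8)) / (x ^ 9 * x ^ 9)"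
      using x by (intro divide_nonneg_nonneg) auto
  qed
  then show ?thesis using assms by (simp add: field_simps)
qed

lemma Sq_mono: "adm c T \<Longrightarrow> 0 < \<tau> \<Longrightarrow> \<tau> \<le> T \<Longrightarrow> Sq c \<tau> \<le> Sq c T"
  unfolding Sq_def by (intro divide_right_mono kint_mono loc_int_p2) auto

lemma Yq_mono: "adm c T \<Longrightarrow> 0 < \<tau> \<Longrightarrow> \<tau> \<le> T \<Longrightarrow> Yq c \<tau> \<le> Yq c T"
  unfolding Yq_def by (intro divide_right_mono kint_mono loc_int_fE fE_nonneg) auto

text \<open>A Caccioppoli inequality without a further cutoff: \<open>Sq\<close> is monotone and
  occurs in the derivative of \<open>Iq\<close>, so the increment of \<open>Iq\<close> over one
  doubling controls it.\<close>

lemma Sq_le_Iq: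
  assumes "good c T" "0 < \<tau>" "2 * \<tau> < T" shows "Sq c \<tau> \<le> 2 * Iq c (2 * \<tau>)"
proof -
  have adm: "adm c T" using assms(1) by (simp add: good_def)
  have d: "\<And>x. \<tau> \<le> x \<Longrightarrow> x \<le> 2 * \<tau> \<Longrightarrow> (Iq c has_real_derivative (3 * Iq c x + Sq c x) / x) (at x)"
    using assms by (intro Iq_deriv[OF adm]) auto
  have "\<tau> < 2 * \<tau>" using assms by simp
  then obtain \<xi> where x: "\<tau> < \<xi>" "\<xi> < 2 * \<tau>" and e: "Iq c (2 * \<tau>) - Iq c \<tau> = (2 * \<tau> - \<tau>) * ((3 * Iq c \<xi> + Sq c \<xi>) / \<xi>)"
    using MVT2[OF _ d] by blast
  have "Sq c \<tau> \<le> Sq c \<xi>" using x assms by (intro Sq_mono adm_mono[OF adm]) auto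
  also have "\<dots> \<le> 3 * Iq c \<xi> + Sq c \<xi>" using quantities_nonneg by simp
  finally have "\<tau> * (Sq c \<tau> / (2 * \<tau>)) \<le> \<tau> * ((3 * Iq c \<xi> + Sq c \<xi>) / \<xi>)"
    using x assms quantities_nonneg[of c \<tau>] by (intro mult_left_mono frac_le) auto
  then have "Sq c \<tau> / 2 \<le> Iq c (2 * \<tau>) - Iq c \<tau>" using e assms by simp
  then show ?thesis using quantities_nonneg[of c \<tau>] by simp
qed

text \<open>The counterpart of \<open>Iq_growth\<close>: an upper bound for the frequency limits the
  growth of \<open>Iq\<close>. The frequency bounds \<open>Sq - Yq\<close>, so \<open>Sq\<close>
  exceeds \<Lambda> times \<open>Iq\<close> by at most \<open>Yq\<close>, which is monotone and
  hence controlled at the top scale; this is the error term with \<delta>. A natural number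
  \<Lambda> keeps the exponent an integer.\<close>

lemma Iq_doubling:
  fixes \<Lambda> :: nat
  assumes "good c T" "0 < t" "t < s" "s < T" and H: "Hq c s \<le> \<Lambda>" and Y: "Yq c s \<le> \<delta> * Iq c s"
  shows "Iq c t \<ge> Iq c s * ((t / s) ^ (3 + \<Lambda>) - \<delta> * (s / t))"
proof -
  define m where "m = 3 + \<Lambda>"
  have adm: "adm c T" using assms(1) by (simp add: good_def)
  have Is: "Iq c s > 0" using good_Iq_pos[OF assms(1), of s] assms by simp
  have d: "((\<lambda>x. Iq c x / x ^ m) has_real_derivative (Sq c x - \<Lambda> * Iq c x) / x ^ (m + 1)) (at x)" if x: "t \<le> x" "x \<le> s" for x
  proof -
    have x': "0 < x" "x < T" using x assms by auto
    have 2: "((\<lambda>r. r ^ m) has_real_derivative m * x ^ (m - 1)) (at x)" by (auto intro!: derivative_eq_intros)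
    have "((\<lambda>x. Iq c x / x ^ m) has_real_derivative
       ((3 * Iq c x + Sq c x) / x * x ^ m - Iq c x * (m * x ^ (m - 1))) / (x ^ m * x ^ m)) (at x)"
      by (rule DERIV_divide[OF Iq_deriv[OF adm x'] 2]) (use x' in simp)
    moreover have "((3 * Iq c x + Sq c x) / x * x ^ m - Iq c x * (m * x ^ (m - 1))) / (x ^ m * x ^ m) = (Sq c x - \<Lambda> * Iq c x) / x ^ (m + 1)"
    proof -
      have xm: "x ^ m = x * x ^ (m - 1)" by (simp add: m_def power_eq_if)
      have "(3 * Iq c x + Sq c x) / x * x ^ m - Iq c x * (m * x ^ (m - 1)) = (Sq c x - \<Lambda> * Iq c x) * x ^ (m - 1)"
        unfolding xm using x' by (simp add: m_def field_simps)
      moreover have "x ^ m * x ^ m = x ^ (m + 1) * x ^ (m - 1)" unfolding power_add[symmetric] by (rule arg_cong[where f="\<lambda>k. x ^ k"]) (simp add: m_def)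
      ultimately show ?thesis using x' by simp
    qed
    ultimately show ?thesis by simp
  qed
  obtain \<xi> where x: "t < \<xi>" "\<xi> < s" and e: "Iq c s / s ^ m - Iq c t / t ^ m = (s - t) * ((Sq c \<xi> - \<Lambda> * Iq c \<xi>) / \<xi> ^ (m + 1))"
    using MVT2[OF assms(3) d] by blast
  have x': "0 < \<xi>" "\<xi> < T" using x assms by auto
  have "Hq c \<xi> \<le> \<Lambda>" using Hq_mono[OF assms(1) x'(1), of s] x assms H by linarith
  then have "Sq c \<xi> - Yq c \<xi> \<le> \<Lambda> * Iq c \<xi>"
    using good_Iq_pos[OF assms(1) x'(1)] x' by (simp add: Hq_def pos_divide_le_eq)
  moreover have "Yq c \<xi> \<le> Yq c s" using x x' assms by (intro Yq_mono adm_mono[OF adm]) auto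
  ultimately have SL: "Sq c \<xi> - \<Lambda> * Iq c \<xi> \<le> \<delta> * Iq c s" using Y by linarith
  have dI: "0 \<le> \<delta> * Iq c s" using Y quantities_nonneg(2)[of c s] by linarith
  have "(Sq c \<xi> - \<Lambda> * Iq c \<xi>) / \<xi> ^ (m + 1) \<le> (\<delta> * Iq c s) / t ^ (m + 1)"
  proof -
    note 1 = SL
    have "(Sq c \<xi> - \<Lambda> * Iq c \<xi>) / \<xi> ^ (m + 1) \<le> (\<delta> * Iq c s) / \<xi> ^ (m + 1)"
      using 1 x' by (intro divide_right_mono) auto
    also have "\<dots> \<le> (\<delta> * Iq c s) / t ^ (m + 1)"
      using x x' assms dI by (intro divide_left_mono power_mono mult_pos_pos) auto
    finally show ?thesis .
  qed
  then have "(s - t) * ((Sq c \<xi> - \<Lambda> * Iq c \<xi>) / \<xi> ^ (m + 1)) \<le> (s - t) * ((\<delta> * Iq c s) / t ^ (m + 1))"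
    using assms by (intro mult_left_mono) auto
  also have "\<dots> \<le> s * ((\<delta> * Iq c s) / t ^ (m + 1))"
    using assms dI by (intro mult_right_mono) auto
  finally have "Iq c s / s ^ m - s * ((\<delta> * Iq c s) / t ^ (m + 1)) \<le> Iq c t / t ^ m" using e by linarith
  then have "(Iq c s / s ^ m - s * ((\<delta> * Iq c s) / t ^ (m + 1))) * t ^ m \<le> Iq c t"
    using assms by (simp add: pos_le_divide_eq)
  moreover have "(Iq c s / s ^ m - s * ((\<delta> * Iq c s) / t ^ (m + 1))) * t ^ m = Iq c s * ((t / s) ^ m - \<delta> * (s / t))"
    using assms by (simp add: field_simps power_divide)
  ultimately show ?thesis by (simp add: m_def)
qed

end

subsection \<open>Comparison with the boundary-adjusted energy\<close>

lemma emeasure_annulus: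
  fixes c :: pt
  assumes "0 \<le> a" "a\<^sup>2 \<le> t"
  shows "emeasure lborel {x. a < norm (x - c) \<and> (norm (x - c))\<^sup>2 \<le> t} = ennreal (pi * (t - a\<^sup>2))"
proof -
  have t: "t \<ge> 0" using assms(2) zero_le_power2[of a] by linarith
  have eq: "{x. a < norm (x - c) \<and> (norm (x - c))\<^sup>2 \<le> t} = cball c (sqrt t) - cball c a"
  proof (rule set_eqI)
    fix x
    have "x \<in> cball c a \<longleftrightarrow> norm (x - c) \<le> a" by (simp add: dist_norm norm_minus_commute)
    then show "x \<in> {x. a < norm (x - c) \<and> (norm (x - c))\<^sup>2 \<le> t} \<longleftrightarrow> x \<in> cball c (sqrt t) - cball c a"
      unfolding Diff_iff in_cball_sqrt[OF t] mem_Collect_eq by linarith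
  qed
  have sub: "cball c a \<subseteq> cball c (sqrt t)"
    using assms by (intro subset_cball) (simp add: real_le_rsqrt)
  have em: "emeasure lborel (cball c r) = ennreal (pi * r\<^sup>2)" if "r \<ge> 0" for r
    using emeasure_cball[OF that, of c] unit_ball_vol_2 by simp
  have "emeasure lborel (cball c (sqrt t) - cball c a) = emeasure lborel (cball c (sqrt t)) - emeasure lborel (cball c a)"
    by (rule emeasure_Diff) (use em[of a] assms sub in auto)
  also have "\<dots> = ennreal (pi * t - pi * a\<^sup>2)"
    using em[of a] em[of "sqrt t"] assms t by (simp add: ennreal_minus)
  finally show ?thesis unfolding eq by (simp add: algebra_simps)
qed

text \<open>Layer-cake formula: \<open>kern 2\<close> is the integral of 2 (\<tau> - t) over the
  levels t between |x - c|^2 and \<tau>, which reduces the claim to areas of annuli.\<close>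

lemma kern_tail_integral:
  fixes c :: pt
  assumes a: "0 \<le> a"
  shows "(\<integral>x. indicator {x. a < norm (x - c)} x * kern 2 c \<tau> x \<partial>lborel) = pi / 3 * pp 3 (\<tau> - a\<^sup>2)"
proof -
  let ?A = "\<lambda>t. {x. a < norm (x - c) \<and> (norm (x - c))\<^sup>2 \<le> t}"
  have "(\<integral>\<^sup>+x. ennreal (indicator {x. a < norm (x - c)} x * kern 2 c \<tau> x) \<partial>lborel) = ennreal (pi / 3 * pp 3 (\<tau> - a\<^sup>2))"
  proof (cases "a\<^sup>2 \<le> \<tau>")
    case False
    have "indicator {x. a < norm (x - c)} x * kern 2 c \<tau> x = 0" for x
    proof (cases "a < norm (x - c)")
      case True
      then have "a\<^sup>2 \<le> (norm (x - c))\<^sup>2" using a by (intro power_mono) auto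
      then show ?thesis using False by (simp add: kern_def pp_zero)
    qed simp
    then have "(\<lambda>x. ennreal (indicator {x. a < norm (x - c)} x * kern 2 c \<tau> x)) = (\<lambda>x. 0)" by (simp only: ennreal_0)
    then show ?thesis using False by (simp add: pp_zero)
  next
    case True
    have 1: "ennreal (indicator {x. a < norm (x - c)} x * kern 2 c \<tau> x)
      = (\<integral>\<^sup>+t. ennreal (2 * (\<tau> - t)) * indicator {..\<tau>} t * indicator (?A t) x \<partial>lborel)" for x
    proof -
      let ?q = "(norm (x - c))\<^sup>2"
      consider "\<not> a < norm (x - c)" | "a < norm (x - c)" "?q > \<tau>" | "a < norm (x - c)" "?q \<le> \<tau>" by linarith
      then show ?thesis
      proof cases
        case 1 then show ?thesis by simp
      next
        case 2
        then have z: "ennreal (2 * (\<tau> - t)) * indicator {..\<tau>} t * indicator (?A t) x = 0" for t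
          by (auto simp: indicator_def)
        show ?thesis unfolding z using 2 by (simp add: kern_def pp_zero)
      next
        case 3
        have f: "(\<integral>\<^sup>+t. ennreal (2 * (\<tau> - t)) * indicator {?q..\<tau>} t \<partial>lborel) = ennreal (- (\<tau> - \<tau>)\<^sup>2 - - (\<tau> - ?q)\<^sup>2)"
          by (rule nn_integral_FTC_Icc) (use 3 in \<open>auto intro!: derivative_eq_intros\<close>)
        have z: "ennreal (2 * (\<tau> - t)) * indicator {..\<tau>} t * indicator (?A t) x = ennreal (2 * (\<tau> - t)) * indicator {?q..\<tau>} t" for t
          using 3 by (auto simp: indicator_def)
        show ?thesis unfolding z f using 3 by (simp add: kern_def pp_pos)
      qed
    qed
    have [measurable]: "(\<lambda>(t, x). ennreal (2 * (\<tau> - t)) * indicator {..\<tau>} t * indicator (?A t) (x::pt)) \<in> borel_measurable (lborel \<Otimes>\<^sub>M lborel)"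
      by measurable
    have "(\<integral>\<^sup>+x. ennreal (indicator {x. a < norm (x - c)} x * kern 2 c \<tau> x) \<partial>lborel)
      = (\<integral>\<^sup>+t. \<integral>\<^sup>+x. ennreal (2 * (\<tau> - t)) * indicator {..\<tau>} t * indicator (?A t) x \<partial>lborel \<partial>lborel)"
      unfolding 1 by (rule lborel_pair.Fubini') measurable
    also have "\<dots> = (\<integral>\<^sup>+t. ennreal (2 * pi * (\<tau> - t) * (t - a\<^sup>2)) * indicator {a\<^sup>2..\<tau>} t \<partial>lborel)"
    proof (rule nn_integral_cong)
      fix t :: real
      have "(\<integral>\<^sup>+x. ennreal (2 * (\<tau> - t)) * indicator {..\<tau>} t * indicator (?A t) x \<partial>lborel)
        = ennreal (2 * (\<tau> - t)) * indicator {..\<tau>} t * emeasure lborel (?A t)"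
        by (rule nn_integral_cmult_indicator) measurable
      also have "\<dots> = ennreal (2 * pi * (\<tau> - t) * (t - a\<^sup>2)) * indicator {a\<^sup>2..\<tau>} t"
      proof (cases "t \<in> {a\<^sup>2..\<tau>}")
        case True
        then show ?thesis using emeasure_annulus[OF a, of t c] by (simp add: ennreal_mult'[symmetric] mult_ac)
      next
        case False
        then consider "t > \<tau>" | "t < a\<^sup>2" by force
        then show ?thesis
        proof cases
          case 2
          have A0: "?A t = {}"
          proof safe
            fix x assume "a < norm (x - c)" "(norm (x - c))\<^sup>2 \<le> t"
            moreover from this have "a\<^sup>2 \<le> (norm (x - c))\<^sup>2" using a by (intro power_mono) auto
            ultimately show "x \<in> {}" using 2 by simp
          qed
          show ?thesis unfolding A0 using False by simp
        qed simp
      qed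
      finally show "(\<integral>\<^sup>+x. ennreal (2 * (\<tau> - t)) * indicator {..\<tau>} t * indicator (?A t) x \<partial>lborel)
        = ennreal (2 * pi * (\<tau> - t) * (t - a\<^sup>2)) * indicator {a\<^sup>2..\<tau>} t" .
    qed
    also have "\<dots> = ennreal ((pi * ((\<tau> - a\<^sup>2) * (\<tau> - a\<^sup>2)\<^sup>2 - 2 / 3 * (\<tau> - a\<^sup>2) ^ 3)) - (pi * ((\<tau> - a\<^sup>2) * (a\<^sup>2 - a\<^sup>2)\<^sup>2 - 2 / 3 * (a\<^sup>2 - a\<^sup>2) ^ 3)))"
    proof (rule nn_integral_FTC_Icc[where F="\<lambda>t. pi * ((\<tau> - a\<^sup>2) * (t - a\<^sup>2)\<^sup>2 - 2 / 3 * (t - a\<^sup>2) ^ 3)"])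
      show "((\<lambda>t. pi * ((\<tau> - a\<^sup>2) * (t - a\<^sup>2)\<^sup>2 - 2 / 3 * (t - a\<^sup>2) ^ 3)) has_real_derivative 2 * pi * (\<tau> - t) * (t - a\<^sup>2)) (at t)" for t
        by (auto intro!: derivative_eq_intros simp: power2_eq_square field_simps)
    qed (use True in \<open>auto intro!: mult_nonneg_nonneg\<close>)
    also have "\<dots> = ennreal (pi / 3 * pp 3 (\<tau> - a\<^sup>2))"
      using True by (simp add: pp_pos power2_eq_square power3_eq_cube)
    finally show ?thesis .
  qed
  moreover have "(\<integral>x. indicator {x. a < norm (x - c)} x * kern 2 c \<tau> x \<partial>lborel)
     = enn2real (\<integral>\<^sup>+x. ennreal (indicator {x. a < norm (x - c)} x * kern 2 c \<tau> x) \<partial>lborel)"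
    by (rule integral_eq_nn_integral) (auto simp: kern_nonneg)
  ultimately show ?thesis by (simp add: pp_nonneg)
qed

section \<open>Rotations and averages over circles\<close>

definition rot :: "real \<Rightarrow> pt \<Rightarrow> pt" where
  "rot t y = vector [cos t * y $ 1 - sin t * y $ 2, sin t * y $ 1 + cos t * y $ 2]"

lemma rot_nth [simp]: "rot t y $ 1 = cos t * y $ 1 - sin t * y $ 2" "rot t y $ 2 = sin t * y $ 1 + cos t * y $ 2"
  by (simp_all add: rot_def)

lemma pt_eqI: "x $ 1 = y $ 1 \<Longrightarrow> x $ 2 = y $ 2 \<Longrightarrow> x = (y::pt)"
  by (simp add: vec_eq_iff forall_2)

lemma norm_rot: "norm (rot t y) = norm y"
proof -
  have "(cos t)\<^sup>2 + (sin t)\<^sup>2 = 1" by simp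
  then have "(norm (rot t y))\<^sup>2 = (norm y)\<^sup>2" unfolding norm_sq_pt rot_nth by algebra
  then show ?thesis by simp
qed

lemma orthogonal_rot: "orthogonal_transformation (rot t)"
  unfolding orthogonal_transformation
proof
  show "linear (rot t)" by (rule linearI) (auto intro!: pt_eqI simp: algebra_simps)
qed (simp add: norm_rot)

lemma rot_rot_minus: "rot t (rot (- t) y) = y" "rot (- t) (rot t y) = y"
proof -
  have *: "(cos t)\<^sup>2 + (sin t)\<^sup>2 = 1" by simp
  show "rot t (rot (- t) y) = y" by (rule pt_eqI; simp; use * in algebra)
  show "rot (- t) (rot t y) = y" by (rule pt_eqI; simp; use * in algebra)
qed

lemma rot_measurable [measurable]: "rot t \<in> borel_measurable borel"
  using linear_continuous_on[OF linear_conv_bounded_linear[THEN iffD1, OF orthogonal_transformation_linear[OF orthogonal_rot]]]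
  by (rule borel_measurable_continuous_onI)

lemma distr_rot: "distr lborel borel (rot t) = lborel"
proof (rule lborel_eqI[symmetric])
  fix l u :: pt assume lu: "\<And>b. b \<in> Basis \<Longrightarrow> l \<bullet> b \<le> u \<bullet> b"
  have vi: "rot t -` box l u = rot (- t) ` box l u"
    by (auto simp: rot_rot_minus image_iff) (metis rot_rot_minus(2))
  have lm: "box l u \<in> lmeasurable" by simp
  have im: "rot (- t) ` box l u \<in> lmeasurable" by (rule measurable_orthogonal_image[OF orthogonal_rot lm])
  have bm: "rot t -` box l u \<in> sets borel" using measurable_sets[OF rot_measurable[of t], of "box l u"] by simp
  have "emeasure (distr lborel borel (rot t)) (box l u) = emeasure lborel (rot t -` box l u)"
    by (subst emeasure_distr) auto
  also have "\<dots> = emeasure lebesgue (rot t -` box l u)" using bm by simp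
  also have "\<dots> = ennreal (measure lebesgue (rot (- t) ` box l u))"
    unfolding vi using im by (simp add: emeasure_eq_measure2 fmeasurableD2)
  also have "\<dots> = ennreal (measure lebesgue (box l u))" by (simp add: measure_orthogonal_image[OF orthogonal_rot lm])
  also have "\<dots> = emeasure lebesgue (box l u)" by (simp add: emeasure_eq_measure2)
  also have "\<dots> = emeasure lborel (box l u)" by simp
  also have "\<dots> = ennreal (prod ((\<bullet>) (u - l)) Basis)" by (rule emeasure_lborel_box[OF lu])
  finally show "emeasure (distr lborel borel (rot t)) (box l u) = ennreal (prod ((\<bullet>) (u - l)) Basis)" .
qed simp

lemma integral_rot:
  fixes f :: "pt \<Rightarrow> real"
  assumes "f \<in> borel_measurable borel"
  shows "(\<integral>y. f (rot t y) \<partial>lborel) = (\<integral>y. f y \<partial>lborel)"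
proof -
  have "(\<integral>y. f y \<partial>distr lborel borel (rot t)) = (\<integral>y. f (rot t y) \<partial>lborel)"
    by (rule integral_distr) (use assms in auto)
  then show ?thesis unfolding distr_rot by simp
qed

lemma integral_periodic_shift:
  fixes F :: "real \<Rightarrow> real"
  assumes c: "continuous_on UNIV F" and per: "\<And>t. F (t + 2 * pi) = F t" and \<alpha>: "0 \<le> \<alpha>" "\<alpha> \<le> 2 * pi"
  shows "integral {0..2 * pi} (\<lambda>t. F (t + \<alpha>)) = integral {0..2 * pi} F"
proof -
  have ci: "F integrable_on {a..b}" for a b
    by (rule integrable_continuous_interval[OF continuous_on_subset[OF c]]) simp
  have sh: "integral {a..b} (\<lambda>t. F (t + d)) = integral {a + d..b + d} F" for a b d
    using integral_shift[of a d b F] continuous_on_subset[OF c] by (simp add: o_def)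
  have "integral {0..2 * pi} (\<lambda>t. F (t + \<alpha>)) = integral {\<alpha>..2 * pi + \<alpha>} F" using sh[of 0 "2 * pi" \<alpha>] by simp
  also have "\<dots> = integral {\<alpha>..2 * pi} F + integral {2 * pi..2 * pi + \<alpha>} F"
    by (rule Henstock_Kurzweil_Integration.integral_combine[symmetric]) (use \<alpha> ci in auto)
  also have "integral {2 * pi..2 * pi + \<alpha>} F = integral {0..\<alpha>} F"
    using sh[of 0 "2 * pi" \<alpha>] sh[of 0 \<alpha> "2 * pi"] by (simp add: per add.commute)
  also have "integral {\<alpha>..2 * pi} F + integral {0..\<alpha>} F = integral {0..2 * pi} F"
    using Henstock_Kurzweil_Integration.integral_combine[of 0 \<alpha> "2 * pi" F] \<alpha> ci by simp
  finally show ?thesis .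
qed

lemma integral_lborel_affine:
  fixes f :: "pt \<Rightarrow> real"
  assumes [measurable]: "f \<in> borel_measurable borel" and t: "t > 0"
  shows "(\<integral>x. f x \<partial>lborel) = t\<^sup>2 * (\<integral>x. f (c + t *\<^sub>R x) \<partial>lborel)"
proof -
  have "(lborel :: pt measure) = density (distr lborel borel (\<lambda>x. c + t *\<^sub>R x)) (\<lambda>_. ennreal (t\<^sup>2))"
    using lborel_affine[of t c] t by simp
  then have "(\<integral>x. f x \<partial>lborel) = (\<integral>x. f x \<partial>density (distr lborel borel (\<lambda>x. c + t *\<^sub>R x)) (\<lambda>_. ennreal (t\<^sup>2)))"
    by simp
  also have "\<dots> = (\<integral>x. t\<^sup>2 *\<^sub>R f x \<partial>distr lborel borel (\<lambda>x. c + t *\<^sub>R x))"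
    by (rule integral_density) auto
  also have "\<dots> = (\<integral>x. t\<^sup>2 *\<^sub>R f (c + t *\<^sub>R x) \<partial>lborel)"
    by (rule integral_distr) auto
  finally show ?thesis by simp
qed

lemma integrable_rot:
  fixes f :: "pt \<Rightarrow> real"
  assumes "integrable lborel f"
  shows "integrable lborel (\<lambda>y. f (rot t y))"
proof -
  have "integrable (distr lborel borel (rot t)) f" unfolding distr_rot by (rule assms)
  then show ?thesis by (subst (asm) integrable_distr_eq) (use assms in auto)
qed

lemma rot_alt: "rot t y = (cos t * y $ 1 - sin t * y $ 2) *\<^sub>R axis 1 1 + (sin t * y $ 1 + cos t * y $ 2) *\<^sub>R axis 2 1"
  by (rule pt_eqI) (simp_all add: axis_def)

lemma rot_pair_measurable [measurable]: "(\<lambda>z. rot (fst z) (snd z)) \<in> borel_measurable (borel \<Otimes>\<^sub>M borel)"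
  unfolding rot_alt by measurable

context varsol begin

text \<open>Interchange of integrations: the weight collected by a point \<open>y\<close> is the
  tail integral of \<open>kern 2\<close> beyond |y - c|, a multiple of \<open>kern 3\<close>. So an
  integral against \<open>kern 3\<close> is an average over radii of integrals over balls.\<close>

lemma radial_fubini:
  assumes f: "loc_int f" "f \<in> borel_measurable borel" and adm: "adm c \<tau>"
  defines "fB \<equiv> \<lambda>y. indicator (cball c (sqrt \<tau>)) y * f y"
  shows "has_bochner_integral lborel (\<lambda>x. (\<integral>y. indicator (ball c (norm (x - c))) y * fB y \<partial>lborel) * kern 2 c \<tau> x)
      (pi / 3 * kint 3 f c \<tau>)"
proof -
  note [measurable] = f(2)
  have [measurable]: "fB \<in> borel_measurable borel" unfolding fB_def
    by (intro borel_measurable_times borel_measurable_indicator f(2)) auto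
  have ifB: "integrable lborel fB"
    using f(1) adm unfolding loc_int_def adm_def set_integrable_def fB_def by simp
  let ?G = "\<lambda>x y. (if norm (y - c) < norm (x - c) then 1 else 0) * fB y * kern 2 c \<tau> x"
  have iK: "integrable lborel (\<lambda>x. 1 * kern 2 c \<tau> x)"
    by (rule kern_integrable[OF _ adm]) (auto intro: loc_int_continuous)
  have Gm [measurable]: "(\<lambda>(x, y). ?G x y) \<in> borel_measurable (lborel \<Otimes>\<^sub>M lborel)" by measurable
  have iG1: "integrable lborel (\<lambda>y. ?G x y)" for x
    by (rule Bochner_Integration.integrable_bound[OF integrable_mult_right[OF ifB, of "kern 2 c \<tau> x"]])
      (auto simp: abs_mult mult.commute)
  have iG: "integrable (lborel \<Otimes>\<^sub>M lborel) (\<lambda>(x, y). ?G x y)"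
  proof (rule lborel_pair.Fubini_integrable[OF Gm])
    show "integrable lborel (\<lambda>x. \<integral>y. norm (case (x, y) of (x, y) \<Rightarrow> ?G x y) \<partial>lborel)"
    proof (rule Bochner_Integration.integrable_bound[OF integrable_mult_right[OF iK, of "\<integral>y. \<bar>fB y\<bar> \<partial>lborel"]])
      show "(\<lambda>x. \<integral>y. norm (case (x, y) of (x, y) \<Rightarrow> ?G x y) \<partial>lborel) \<in> borel_measurable lborel" by measurable
      have "\<bar>\<integral>y. \<bar>?G x y\<bar> \<partial>lborel\<bar> \<le> \<bar>(\<integral>y. \<bar>fB y\<bar> \<partial>lborel) * (1 * kern 2 c \<tau> x)\<bar>" for x
      proof -
        have "(\<integral>y. \<bar>?G x y\<bar> \<partial>lborel) \<le> (\<integral>y. kern 2 c \<tau> x * \<bar>fB y\<bar> \<partial>lborel)"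
          by (rule integral_mono[OF integrable_abs[OF iG1] integrable_mult_right[OF integrable_abs[OF ifB]]])
            (auto simp: abs_mult kern_nonneg mult.commute)
        also have "\<dots> = (\<integral>y. \<bar>fB y\<bar> \<partial>lborel) * (1 * kern 2 c \<tau> x)" by simp
        finally have "(\<integral>y. \<bar>?G x y\<bar> \<partial>lborel) \<le> (\<integral>y. \<bar>fB y\<bar> \<partial>lborel) * (1 * kern 2 c \<tau> x)" .
        moreover have "0 \<le> (\<integral>y. \<bar>?G x y\<bar> \<partial>lborel)" by (intro integral_nonneg_AE) auto
        ultimately show ?thesis by linarith
      qed
      then show "AE x in lborel. norm (\<integral>y. norm (case (x, y) of (x, y) \<Rightarrow> ?G x y) \<partial>lborel)
          \<le> norm ((\<integral>y. \<bar>fB y\<bar> \<partial>lborel) * (1 * kern 2 c \<tau> x))" by simp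
    qed
  qed (use iG1 in auto)
  have inner: "(\<integral>y. ?G x y \<partial>lborel) = (\<integral>y. indicator (ball c (norm (x - c))) y * fB y \<partial>lborel) * kern 2 c \<tau> x" for x
  proof -
    have "(\<lambda>y. ?G x y) = (\<lambda>y. indicator (ball c (norm (x - c))) y * fB y * kern 2 c \<tau> x)"
      by (auto simp: fun_eq_iff indicator_def dist_norm norm_minus_commute)
    then show ?thesis by simp
  qed
  have outer: "(\<integral>x. ?G x y \<partial>lborel) = pi / 3 * (f y * kern 3 c \<tau> y)" for y
  proof -
    have "(\<lambda>x. ?G x y) = (\<lambda>x. fB y * (indicator {x. norm (y - c) < norm (x - c)} x * kern 2 c \<tau> x))"
      by (auto simp: fun_eq_iff indicator_def)
    then have "(\<integral>x. ?G x y \<partial>lborel) = fB y * (pi / 3 * pp 3 (\<tau> - (norm (y - c))\<^sup>2))"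
      using kern_tail_integral[of "norm (y - c)" c \<tau>] by simp
    also have "\<dots> = pi / 3 * (f y * kern 3 c \<tau> y)"
      using kern_zero[of 3 \<tau> \<tau> y c] adm by (cases "y \<in> cball c (sqrt \<tau>)") (auto simp: fB_def kern_def adm_def)
    finally show ?thesis .
  qed
  show ?thesis
    unfolding has_bochner_integral_iff inner[symmetric]
  proof
    show "integrable lborel (\<lambda>x. \<integral>y. ?G x y \<partial>lborel)" using lborel_pair.integrable_fst'[OF iG] by simp
    show "(\<integral>x. \<integral>y. ?G x y \<partial>lborel \<partial>lborel) = pi / 3 * kint 3 f c \<tau>"
      unfolding lborel_pair.Fubini_integral[OF iG, symmetric] outer by (simp add: kint_def)
  qed
qed

text \<open>The integral over the angle, without the arc-length factor \<open>t\<close>.\<close>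

definition Cq where "Cq c t = integral {0..2 * pi} (\<lambda>\<theta>. (U (c + t *\<^sub>R vector [cos \<theta>, sin \<theta>]))\<^sup>2)"

lemma norm_unit_circle: "norm (vector [cos \<theta>, sin \<theta>] :: pt) = 1"
proof -
  have "(norm (vector [cos \<theta>, sin \<theta>] :: pt))\<^sup>2 = 1" unfolding norm_sq_pt by simp
  then show ?thesis by (simp add: power2_eq_1_iff)
    (metis norm_ge_zero not_one_le_zero neg_0_le_iff_le)
qed

lemma circle_continuous:
  assumes "adm c \<tau>" "0 \<le> t" "t\<^sup>2 \<le> \<tau>"
  shows "continuous_on UNIV (\<lambda>\<theta>. (U (c + t *\<^sub>R vector [cos \<theta>, sin \<theta>]))\<^sup>2)"
proof -
  have 1: "continuous_on UNIV (\<lambda>\<theta>. c + t *\<^sub>R (vector [cos \<theta>, sin \<theta>] :: pt))"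
  proof -
    have "vector [cos \<theta>, sin \<theta>] = cos \<theta> *\<^sub>R axis 1 1 + sin \<theta> *\<^sub>R (axis 2 1 :: pt)" for \<theta>
      by (rule pt_eqI) (simp_all add: axis_def)
    then show ?thesis by (simp only:) (intro continuous_intros)
  qed
  have "c + t *\<^sub>R vector [cos \<theta>, sin \<theta>] \<in> \<Omega>" for \<theta>
  proof -
    have "c + t *\<^sub>R vector [cos \<theta>, sin \<theta>] \<in> cball c (sqrt \<tau>)"
      using assms(1) by (subst in_cball_sqrt) (use assms norm_unit_circle in \<open>auto simp: adm_def power_mult_distrib\<close>)
    then show ?thesis using assms(1) by (auto simp: adm_def)
  qed
  then show ?thesis
    by (intro continuous_intros continuous_on_compose2[OF U_cont 1]) auto
qed

lemma circle_shift:
  assumes "adm c \<tau>" "(norm y)\<^sup>2 \<le> \<tau>"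
  shows "has_bochner_integral lborel (\<lambda>\<theta>. indicator {0..2 * pi} \<theta> * (U (c + rot \<theta> y))\<^sup>2) (Cq c (norm y))"
proof -
  let ?F = "\<lambda>\<theta>. (U (c + norm y *\<^sub>R vector [cos \<theta>, sin \<theta>]))\<^sup>2"
  have c: "continuous_on UNIV ?F" by (rule circle_continuous[OF assms(1) _ assms(2)]) simp
  obtain \<alpha> where \<alpha>: "0 \<le> \<alpha>" "\<alpha> < 2 * pi" and y: "y $ 1 = norm y * cos \<alpha>" "y $ 2 = norm y * sin \<alpha>"
  proof (cases "y = 0")
    case True then show ?thesis using that[of 0] by simp
  next
    case False
    have "(y $ 1 / norm y)\<^sup>2 + (y $ 2 / norm y)\<^sup>2 = 1"
      unfolding power_divide add_divide_distrib[symmetric] norm_sq_pt[symmetric] using False by simp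
    then obtain t where "0 \<le> t" "t < 2 * pi" "y $ 1 / norm y = cos t" "y $ 2 / norm y = sin t"
      by (rule sincos_total_2pi)
    then show ?thesis using False by (intro that[of t]) (auto simp: field_simps)
  qed
  have r: "(U (c + rot \<theta> y))\<^sup>2 = ?F (\<theta> + \<alpha>)" for \<theta>
  proof -
    have "rot \<theta> y = norm y *\<^sub>R vector [cos (\<theta> + \<alpha>), sin (\<theta> + \<alpha>)]"
      by (rule pt_eqI) (simp_all add: y cos_add sin_add algebra_simps)
    then show ?thesis by simp
  qed
  have c': "continuous_on {0..2 * pi} (\<lambda>\<theta>. ?F (\<theta> + \<alpha>))"
    by (rule continuous_on_compose2[OF c, of _ "\<lambda>\<theta>. \<theta> + \<alpha>"]) (auto intro!: continuous_intros)
  have si: "set_integrable lborel {0..2 * pi} (\<lambda>\<theta>. ?F (\<theta> + \<alpha>))"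
    unfolding set_integrable_def by (rule borel_integrable_compact[OF compact_Icc c'])
  have "(\<integral>\<theta>. indicator {0..2 * pi} \<theta> * ?F (\<theta> + \<alpha>) \<partial>lborel) = integral {0..2 * pi} (\<lambda>\<theta>. ?F (\<theta> + \<alpha>))"
    using set_borel_integral_eq_integral(2)[OF si] by (simp add: set_lebesgue_integral_def)
  also have "\<dots> = Cq c (norm y)"
    unfolding Cq_def by (rule integral_periodic_shift[OF c]) (use \<alpha> in auto)
  finally show ?thesis unfolding r has_bochner_integral_iff
    using si by (simp add: set_integrable_def)
qed

text \<open>Averaging over all rotations about \<open>c\<close> replaces polar coordinates:
  rotations preserve the plane integral and the kernel, and following a point along its orbit yields
  the circle integral.\<close>

lemma circle_average:
  assumes adm: "adm c \<tau>"
  shows "has_bochner_integral lborel (\<lambda>x. Cq c (norm (x - c)) * kern 2 c \<tau> x) (2 * pi * Iq c \<tau>)"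
proof -
  let ?V = "\<lambda>y. (U (c + y))\<^sup>2 * kern 2 c \<tau> (c + y)"
  have ker: "kern 2 c \<tau> (c + y) = pp 2 (\<tau> - (norm y)\<^sup>2)" for y by (simp add: kern_def)
  have iV: "integrable lborel ?V" and V: "(\<integral>y. ?V y \<partial>lborel) = Iq c \<tau>"
    using integrable_lborel_translate[OF kern_integrable[OF loc_int_U2 adm, of 2], of c]
      integral_lborel_translate[of "\<lambda>x. (U x)\<^sup>2 * kern 2 c \<tau> x" c]
    by (auto simp: Iq_def kint_def)
  have [measurable]: "?V \<in> borel_measurable borel" by measurable
  let ?G = "\<lambda>\<theta> y. indicator {0..2 * pi} \<theta> * ?V (rot \<theta> y)"
  have Gm [measurable]: "(\<lambda>(\<theta>, y). ?G \<theta> y) \<in> borel_measurable (lborel \<Otimes>\<^sub>M lborel)"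
  proof -
    have "(\<lambda>z. indicator {0..2 * pi} (fst z) * ?V (rot (fst z) (snd z))) \<in> borel_measurable (borel \<Otimes>\<^sub>M borel)" by measurable
    then show ?thesis by (simp add: case_prod_beta')
  qed
  have iG1: "integrable lborel (\<lambda>y. ?G \<theta> y)" for \<theta>
    by (intro integrable_mult_right integrable_rot[OF iV])
  have iI: "integrable lborel (indicator {0..2 * pi} :: real \<Rightarrow> real)" by (simp add: integrable_real_indicator)
  have iG: "integrable (lborel \<Otimes>\<^sub>M lborel) (\<lambda>(\<theta>, y). ?G \<theta> y)"
  proof (rule lborel_pair.Fubini_integrable[OF Gm])
    have "(\<integral>y. norm (case (\<theta>, y) of (\<theta>, y) \<Rightarrow> ?G \<theta> y) \<partial>lborel) = indicator {0..2 * pi} \<theta> * (\<integral>y. \<bar>?V y\<bar> \<partial>lborel)" for \<theta>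
      using integral_rot[of "\<lambda>y. \<bar>?V y\<bar>" \<theta>] by (simp add: abs_mult)
    then show "integrable lborel (\<lambda>\<theta>. \<integral>y. norm (case (\<theta>, y) of (\<theta>, y) \<Rightarrow> ?G \<theta> y) \<partial>lborel)"
      using iI by (simp only: integrable_mult_left)
  qed (use iG1 in auto)
  have inner: "(\<integral>y. ?G \<theta> y \<partial>lborel) = indicator {0..2 * pi} \<theta> * Iq c \<tau>" for \<theta>
    using integral_rot[of ?V \<theta>] V by simp
  have outer: "(\<integral>\<theta>. ?G \<theta> y \<partial>lborel) = Cq c (norm y) * kern 2 c \<tau> (c + y)" for y
  proof (cases "(norm y)\<^sup>2 \<le> \<tau>")
    case True
    have "(\<lambda>\<theta>. ?G \<theta> y) = (\<lambda>\<theta>. (indicator {0..2 * pi} \<theta> * (U (c + rot \<theta> y))\<^sup>2) * kern 2 c \<tau> (c + y))"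
      by (simp add: ker norm_rot mult_ac)
    then show ?thesis using has_bochner_integral_integral_eq[OF circle_shift[OF adm True]] by simp
  next
    case False
    then have "kern 2 c \<tau> (c + y) = 0" "\<And>\<theta>. kern 2 c \<tau> (c + rot \<theta> y) = 0" by (simp_all add: ker norm_rot pp_zero)
    then show ?thesis by simp
  qed
  have "(\<integral>y. \<integral>\<theta>. ?G \<theta> y \<partial>lborel \<partial>lborel) = (\<integral>\<theta>. \<integral>y. ?G \<theta> y \<partial>lborel \<partial>lborel)"
    by (rule lborel_pair.Fubini_integral[OF iG])
  also have "\<dots> = 2 * pi * Iq c \<tau>" unfolding inner by simp
  finally have e: "(\<integral>y. Cq c (norm y) * kern 2 c \<tau> (c + y) \<partial>lborel) = 2 * pi * Iq c \<tau>" unfolding outer .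
  have i: "integrable lborel (\<lambda>y. Cq c (norm y) * kern 2 c \<tau> (c + y))"
    using lborel_pair.integrable_snd[OF iG] unfolding outer .
  let ?h = "\<lambda>y. Cq c (norm y) * kern 2 c \<tau> (c + y)"
  have "integrable lborel (\<lambda>x. ?h (- c + x))" by (rule integrable_lborel_translate[OF i])
  moreover have "(\<integral>x. ?h (- c + x) \<partial>lborel) = (\<integral>y. ?h y \<partial>lborel)"
    by (rule integral_lborel_translate) (use borel_measurable_integrable[OF i] in simp)
  ultimately show ?thesis using e by (simp add: has_bochner_integral_iff)
qed

lemma halfball_scaling:
  fixes c :: pt
  assumes t: "t > 0" and c: "c $ 2 = 0"
  shows "(\<integral>x. indicator (ball c t) x * max (x $ 2) 0 \<partial>lborel) = t ^ 3 * (LINT x:ball (0::pt) 1|lebesgue. max (x $ 2) 0)"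
proof -
  have "(\<integral>x. indicator (ball c t) x * max (x $ 2) 0 \<partial>lborel)
     = t\<^sup>2 * (\<integral>x. indicator (ball c t) (c + t *\<^sub>R x) * max ((c + t *\<^sub>R x) $ 2) 0 \<partial>lborel)"
    by (rule integral_lborel_affine[OF _ t])
      (intro borel_measurable_times borel_measurable_indicator borel_measurable_max borel_measurable_const borel_measurable_vec_nth, auto)
  also have "(\<lambda>x. indicator (ball c t) (c + t *\<^sub>R x) * max ((c + t *\<^sub>R x) $ 2) 0) = (\<lambda>x. t * (indicator (ball (0::pt) 1) x * max (x $ 2) (0::real)))"
    using t c by (auto simp: fun_eq_iff indicator_def dist_norm max_def zero_le_mult_iff mult_le_0_iff)
  also have "t\<^sup>2 * (\<integral>x. t * (indicator (ball (0::pt) 1) x * max (x $ 2) (0::real)) \<partial>lborel) = t ^ 3 * (\<integral>x. indicator (ball (0::pt) 1) x * max (x $ 2) 0 \<partial>lborel)"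
    by (simp add: power2_eq_square power3_eq_cube)
  also have "(\<integral>x. indicator (ball (0::pt) 1) x * max (x $ 2) 0 \<partial>lborel) = (LINT x:ball (0::pt) 1|lebesgue. max (x $ 2) 0)"
    by (rule lebesgue_to_lborel(1)[symmetric]) auto
  finally show ?thesis .
qed

definition f2 where "f2 x = (norm (p x))\<^sup>2 - fE x"

lemma loc_int_f2: "loc_int f2"
  using loc_int_p2 loc_int_fE unfolding loc_int_def f2_def[abs_def] by (auto intro: set_integral_diff)

lemma fE_measurable [measurable]: "fE \<in> borel_measurable borel"
  unfolding fE_def[abs_def] by measurable

lemma f2_measurable [measurable]: "f2 \<in> borel_measurable borel"
  unfolding f2_def[abs_def] by measurable

text \<open>On the ball, \<open>x $ 2\<close> restricted to \<open>{u > 0}\<close> is the positive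
  part of \<open>x $ 2\<close> minus \<open>fE\<close>. The integral of the positive part scales
  like t^3 and becomes the constant from the definition of \<Sigma>.\<close>

lemma Phi_bound_eq:
  assumes adm: "adm c \<tau>" "c $ 2 = 0" and t: "0 < t" "t\<^sup>2 \<le> \<tau>"
  shows "(\<integral>y. indicator (ball c t) y * f2 y \<partial>lborel) - 3 / 2 * Cq c t
     = t ^ 3 * (Phi_bound u g c t - (LINT x:ball (0::pt) 1|lebesgue. max (x $ 2) 0))"
proof -
  have sub: "cball c t \<subseteq> \<Omega>"
  proof -
    have "t \<le> sqrt \<tau>" using t by (simp add: real_le_rsqrt)
    then have "cball c t \<subseteq> cball c (sqrt \<tau>)" by (rule subset_cball)
    then show ?thesis using adm by (auto simp: adm_def)
  qed
  then have sub': "ball c t \<subseteq> \<Omega>" using ball_subset_cball by blast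
  let ?A = "LINT x:ball c t|lebesgue. (norm (g x))\<^sup>2 + x $ 2 * chi_pos u x"
  let ?f1 = "\<lambda>x. (norm (p x))\<^sup>2 + x $ 2 * indicator P x"
  have A: "?A = (\<integral>x. indicator (ball c t) x * ?f1 x \<partial>lborel)"
  proof (rule lebesgue_to_lborel(1))
    show "AE x in lborel. x \<in> ball c t \<longrightarrow> (norm (g x))\<^sup>2 + x $ 2 * chi_pos u x = ?f1 x"
      using g_eq_p by eventually_elim (use sub' in \<open>auto simp: chi_pos_def P_def indicator_def\<close>)
  qed auto
  have i1: "integrable lborel (\<lambda>x. indicator (ball c t) x * f2 x)"
  proof -
    have "set_integrable lborel (cball c t) f2" using loc_int_f2 sub by (simp add: loc_int_def)
    then have "set_integrable lborel (ball c t) f2" by (rule set_integrable_subset) auto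
    then show ?thesis by (simp add: set_integrable_def)
  qed
  have i2: "integrable lborel (\<lambda>x. indicator (ball c t) x * max (x $ 2) 0)"
  proof -
    have "set_integrable lborel (cball c t) (\<lambda>x. max (x $ 2) 0)"
      by (rule set_integrable_continuous) (auto intro!: continuous_intros)
    then have "set_integrable lborel (ball c t) (\<lambda>x. max (x $ 2) 0)" by (rule set_integrable_subset) auto
    then show ?thesis by (simp add: set_integrable_def)
  qed
  have eq: "indicator (ball c t) x * ?f1 x = indicator (ball c t) x * f2 x + indicator (ball c t) x * max (x $ 2) 0" for x
  proof (cases "x \<in> ball c t")
    case True
    then have x: "x \<in> \<Omega>" using sub' by auto
    consider "x \<in> P" "x \<notin> E" "x $ 2 > 0" | "x \<in> E" "x \<notin> P" "x $ 2 > 0" | "x \<notin> P" "x \<notin> E" "x $ 2 \<le> 0"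
      using P_pos[of x] x unfolding E_eq by force
    then show ?thesis by cases (use True in \<open>auto simp: f2_def fE_def\<close>)
  qed simp
  have A2: "?A = (\<integral>x. indicator (ball c t) x * f2 x \<partial>lborel) + t ^ 3 * (LINT x:ball (0::pt) 1|lebesgue. max (x $ 2) 0)"
    unfolding A eq halfball_scaling[OF t(1) adm(2), symmetric] by (rule Bochner_Integration.integral_add[OF i1 i2])
  have C: "(LBINT s=0..2 * pi. (u (c + t *\<^sub>R vector [cos s, sin s]))\<^sup>2 * t) = t * Cq c t"
  proof -
    have in\<Omega>: "c + t *\<^sub>R vector [cos s, sin s] \<in> \<Omega>" for s
    proof -
      have "dist c (c + t *\<^sub>R vector [cos s, sin s]) \<le> t" using t norm_unit_circle[of s] by (simp add: dist_norm)
      then show ?thesis using sub by auto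
    qed
    have cc: "continuous_on {0..2 * pi} (\<lambda>s. (U (c + t *\<^sub>R vector [cos s, sin s]))\<^sup>2)"
      by (rule continuous_on_subset[OF circle_continuous[OF adm(1) _ t(2)]]) (use t in auto)
    have "(LBINT s=ereal 0..ereal (2 * pi). (u (c + t *\<^sub>R vector [cos s, sin s]))\<^sup>2 * t)
      = (LBINT s:{0..2 * pi}. (u (c + t *\<^sub>R vector [cos s, sin s]))\<^sup>2 * t)"
      by (rule interval_integral_Icc) simp
    also have "\<dots> = (LBINT s:{0..2 * pi}. (U (c + t *\<^sub>R vector [cos s, sin s]))\<^sup>2) * t"
      unfolding set_lebesgue_integral_def U_eq[OF in\<Omega>] by (simp add: mult.assoc[symmetric])
    also have "(LBINT s:{0..2 * pi}. (U (c + t *\<^sub>R vector [cos s, sin s]))\<^sup>2) = Cq c t"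
      unfolding Cq_def
      by (rule set_borel_integral_eq_integral(2)) (unfold set_integrable_def, rule borel_integrable_compact[OF compact_Icc cc])
    finally show ?thesis by (simp add: zero_ereal_def mult.commute)
  qed
  have "t ^ 3 * Phi_bound u g c t = ?A - 3 / 2 * Cq c t"
    unfolding Phi_bound_def C using t by (simp add: field_simps eval_nat_numeral)
  then show ?thesis unfolding A2 by (simp add: algebra_simps)
qed

text \<open>By \<open>radial_fubini\<close> and \<open>circle_average\<close>,
  \<open>2 * pi * Gq\<close> is the integral against \<open>kern 2\<close> of t^3 times the
  difference of \<Phi> and the half-ball constant at the radius t = |x - c|. With r the square root
  of \<tau>, the bounds for t^3, the kernel and the area give r^3, r^4 and r^2.\<close>

lemma Gq_bound:
  assumes adm: "adm c \<tau>" "c $ 2 = 0" and e: "0 \<le> \<epsilon>"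
    and near: "\<And>t. 0 < t \<Longrightarrow> t\<^sup>2 \<le> \<tau> \<Longrightarrow> \<bar>Phi_bound u g c t - (LINT x:ball (0::pt) 1|lebesgue. max (x $ 2) 0)\<bar> \<le> \<epsilon>"
  shows "\<bar>Gq c \<tau>\<bar> \<le> \<epsilon> * (sqrt \<tau>) ^ 9"
proof -
  define M where "M = (LINT x:ball (0::pt) 1|lebesgue. max (x $ 2) 0)"
  let ?fB = "\<lambda>y. indicator (cball c (sqrt \<tau>)) y * f2 y"
  let ?h = "\<lambda>x. (\<integral>y. indicator (ball c (norm (x - c))) y * ?fB y \<partial>lborel) * kern 2 c \<tau> x - 3 / 2 * (Cq c (norm (x - c)) * kern 2 c \<tau> x)"
  have t0: "\<tau> > 0" using adm by (simp add: adm_def)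
  have e1: "kint 3 f2 c \<tau> = 6 * Sq c \<tau> - 6 * Yq c \<tau>"
  proof -
    have "has_bochner_integral lborel (\<lambda>x. (norm (p x))\<^sup>2 * kern 3 c \<tau> x - fE x * kern 3 c \<tau> x) (kint 3 (\<lambda>x. (norm (p x))\<^sup>2) c \<tau> - kint 3 fE c \<tau>)"
      by (intro has_bochner_integral_diff kint_hb loc_int_p2 loc_int_fE adm) auto
    from has_bochner_integral_integral_eq[OF this] show ?thesis
      by (simp add: kint_def f2_def left_diff_distrib Sq_def Yq_def)
  qed
  have v: "pi / 3 * kint 3 f2 c \<tau> - 3 / 2 * (2 * pi * Iq c \<tau>) = 2 * pi * Gq c \<tau>"
    unfolding e1 Gq_def by (simp add: field_simps)
  have "has_bochner_integral lborel ?h (pi / 3 * kint 3 f2 c \<tau> - 3 / 2 * (2 * pi * Iq c \<tau>))"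
    by (intro has_bochner_integral_diff has_bochner_integral_mult_right radial_fubini[OF loc_int_f2 f2_measurable adm(1)] circle_average[OF adm(1)])
  then have hb: "has_bochner_integral lborel ?h (2 * pi * Gq c \<tau>)" unfolding v .
  let ?b = "\<epsilon> * sqrt \<tau> ^ 3 * \<tau>\<^sup>2"
  have pw: "\<bar>?h x\<bar> \<le> ?b * indicator (cball c (sqrt \<tau>)) x" if "x \<noteq> c" for x
  proof (cases "x \<in> cball c (sqrt \<tau>)")
    case True
    then have n: "(norm (x - c))\<^sup>2 \<le> \<tau>" using t0 by (subst (asm) in_cball_sqrt) auto
    have s: "norm (x - c) \<le> sqrt \<tau>" using n by (simp add: real_le_rsqrt)
    have "(\<lambda>y. indicator (ball c (norm (x - c))) y * ?fB y) = (\<lambda>y. indicator (ball c (norm (x - c))) y * f2 y)"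
      using s by (auto simp: fun_eq_iff indicator_def)
    then have "(\<integral>y. indicator (ball c (norm (x - c))) y * ?fB y \<partial>lborel) - 3 / 2 * Cq c (norm (x - c))
        = (norm (x - c)) ^ 3 * (Phi_bound u g c (norm (x - c)) - M)"
      using Phi_bound_eq[OF adm _ n] that by (simp add: M_def)
    then have "?h x = (norm (x - c)) ^ 3 * (Phi_bound u g c (norm (x - c)) - M) * kern 2 c \<tau> x"
      by (metis (no_types, lifting) left_diff_distrib mult.assoc)
    also have "\<bar>\<dots>\<bar> = (norm (x - c)) ^ 3 * \<bar>Phi_bound u g c (norm (x - c)) - M\<bar> * kern 2 c \<tau> x"
      by (simp add: abs_mult kern_nonneg)
    also have "\<dots> \<le> sqrt \<tau> ^ 3 * \<epsilon> * \<tau>\<^sup>2"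
    proof (intro mult_mono)
      show "norm (x - c) ^ 3 \<le> sqrt \<tau> ^ 3" using s by (intro power_mono) auto
      show "\<bar>Phi_bound u g c (norm (x - c)) - M\<bar> \<le> \<epsilon>" unfolding M_def by (rule near) (use that n in auto)
      show "kern 2 c \<tau> x \<le> \<tau>\<^sup>2" using t0 unfolding kern_def pp_def by (intro power_mono) auto
    qed (use e t0 in \<open>auto simp: kern_nonneg\<close>)
    finally show ?thesis using True by (simp add: mult_ac)
  next
    case False
    then have "kern 2 c \<tau> x = 0" using t0 by (intro kern_zero[of 2 \<tau> \<tau>]) auto
    then show ?thesis using False by simp
  qed
  have em: "emeasure lborel (cball c (sqrt \<tau>)) = ennreal (pi * \<tau>)"
    using emeasure_cball[of "sqrt \<tau>" c] unit_ball_vol_2 t0 by simp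
  have "\<bar>2 * pi * Gq c \<tau>\<bar> \<le> (\<integral>x. ?b * indicator (cball c (sqrt \<tau>)) x \<partial>lborel)"
  proof -
    have "\<bar>2 * pi * Gq c \<tau>\<bar> = \<bar>\<integral>x. ?h x \<partial>lborel\<bar>" using has_bochner_integral_integral_eq[OF hb] by simp
    also have "\<dots> \<le> (\<integral>x. \<bar>?h x\<bar> \<partial>lborel)" by (rule integral_abs_bound)
    also have "\<dots> \<le> (\<integral>x. ?b * indicator (cball c (sqrt \<tau>)) x \<partial>lborel)"
    proof (rule integral_mono_AE)
      show "integrable lborel (\<lambda>x. \<bar>?h x\<bar>)" using hb by (intro integrable_abs) (simp add: has_bochner_integral_iff)
      show "integrable lborel (\<lambda>x. ?b * indicator (cball c (sqrt \<tau>)) x)"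
        using em by (intro integrable_mult_right integrable_real_indicator) auto
      \<comment> \<open>\<open>Phi_bound_eq\<close> is about positive radii, so the center, a null
        set, is left out.\<close>
      show "AE x in lborel. \<bar>?h x\<bar> \<le> ?b * indicator (cball c (sqrt \<tau>)) x"
        using AE_lborel_singleton[of c] by eventually_elim (rule pw)
    qed
    finally show ?thesis .
  qed
  also have "\<dots> = ?b * (pi * \<tau>)" using em t0 by (simp add: measure_def)
  also have "\<dots> = pi * (\<epsilon> * sqrt \<tau> ^ 9)"
  proof -
    have "sqrt \<tau> ^ 6 = (sqrt \<tau> ^ 2) ^ 3" by (simp only: power_mult[symmetric]) simp
    also have "\<dots> = \<tau> ^ 3" using t0 by simp
    finally have q: "\<tau>\<^sup>2 * \<tau> = sqrt \<tau> ^ 6" by (simp add: power2_eq_square power3_eq_cube)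
    have "?b * (pi * \<tau>) = pi * (\<epsilon> * (sqrt \<tau> ^ 3 * (\<tau>\<^sup>2 * \<tau>)))" by (simp only: mult_ac)
    then show ?thesis unfolding q by (simp only: power_add[symmetric]) simp
  qed
  finally have "2 * pi * \<bar>Gq c \<tau>\<bar> \<le> pi * (\<epsilon> * sqrt \<tau> ^ 9)" by (simp add: abs_mult)
  then have "pi * (2 * \<bar>Gq c \<tau>\<bar>) \<le> pi * (\<epsilon> * sqrt \<tau> ^ 9)" by (simp add: mult_ac)
  then have "2 * \<bar>Gq c \<tau>\<bar> \<le> \<epsilon> * sqrt \<tau> ^ 9" by (rule mult_left_le_imp_le) simp
  then show ?thesis by linarith
qed

text \<open>Convergence of \<Phi> makes \<open>Gq\<close> of smaller order than r^9 at 0, and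
  monotonicity turns this into a sign at all scales.\<close>

lemma Sigma_good:
  assumes c: "c \<in> Sigma_set \<Omega> u g" and adm: "adm c T"
  shows "good c T"
proof -
  let ?M = "LINT x:ball (0::pt) 1|lebesgue. max (x $ 2) 0"
  have c2: "c $ 2 = 0" and fr: "c \<in> frontier {y \<in> \<Omega>. u y > 0}"
    and lim: "((\<lambda>r. Phi_bound u g c r) \<longlongrightarrow> ?M) (at_right 0)"
    using c by (auto simp: Sigma_set_def S_set_def)
  have "c \<in> closure P" using fr by (simp add: frontier_def P_def)
  moreover have "Gq c \<tau> \<ge> 0" if t: "0 < \<tau>" "\<tau> < T" for \<tau>
  proof (rule Gq_nonneg_of_limit[OF adm c2 _ t])
    show "((\<lambda>r. Gq c (r\<^sup>2) / r ^ 9) \<longlongrightarrow> 0) (at_right 0)"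
    proof (rule tendstoI)
      fix e :: real assume e: "e > 0"
      then have "\<forall>\<^sub>F r in at_right 0. dist (Phi_bound u g c r) ?M < e / 2"
        using tendstoD[OF lim, of "e / 2"] by simp
      then obtain b where b: "b > 0" "\<And>r. 0 < r \<Longrightarrow> r < b \<Longrightarrow> dist (Phi_bound u g c r) ?M < e / 2"
        unfolding eventually_at_right_field by auto
      have T0: "T > 0" using adm by (simp add: adm_def)
      define d where "d = min b (sqrt T)"
      have d: "d > 0" using b T0 by (simp add: d_def)
      have "dist (Gq c (r\<^sup>2) / r ^ 9) 0 < e" if r: "0 < r" "r < d" for r
      proof -
        have "r\<^sup>2 < (sqrt T)\<^sup>2" using r by (intro power_strict_mono) (auto simp: d_def)
        then have "r\<^sup>2 \<le> T" using T0 by simp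
        then have ad: "adm c (r\<^sup>2)" using adm_mono[OF adm] r by simp
        have "\<bar>Gq c (r\<^sup>2)\<bar> \<le> e / 2 * (sqrt (r\<^sup>2)) ^ 9"
        proof (rule Gq_bound[OF ad c2])
          fix t assume t: "0 < t" "t\<^sup>2 \<le> r\<^sup>2"
          then have "t \<le> r" using r by (intro power2_le_imp_le[of t r]) auto
          then have "t < b" using r by (simp add: d_def)
          from b(2)[OF t(1) this] show "\<bar>Phi_bound u g c t - ?M\<bar> \<le> e / 2" by (simp add: dist_real_def)
        qed (use e in simp)
        then have "\<bar>Gq c (r\<^sup>2)\<bar> / r ^ 9 \<le> e / 2" using r by (simp add: pos_divide_le_eq)
        then have "\<bar>Gq c (r\<^sup>2)\<bar> / r ^ 9 < e" using e by linarith
        then show ?thesis using r by (simp add: dist_real_def)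
      qed
      then show "\<forall>\<^sub>F r in at_right 0. dist (Gq c (r\<^sup>2) / r ^ 9) 0 < e"
        unfolding eventually_at_right_field using d by blast
    qed
  qed
  ultimately show ?thesis using adm c2 by (simp add: good_def)
qed

subsection \<open>Limits of centers and decay at small scales\<close>

lemma kint_center_tendsto:
  assumes f: "loc_int f" and sub: "cball c (2 * \<rho>) \<subseteq> \<Omega>" and t: "0 < \<tau>" "sqrt \<tau> \<le> \<rho>" and n: "n > 0"
    and X: "X \<longlonglongrightarrow> c" "\<And>m. dist (X m) c \<le> \<rho>"
  shows "(\<lambda>m. kint n f (X m) \<tau>) \<longlonglongrightarrow> kint n f c \<tau>"
proof -
  have adm: "adm y \<tau>" if "dist y c \<le> \<rho>" for y
  proof -
    have "cball y (sqrt \<tau>) \<subseteq> cball c (2 * \<rho>)"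
    proof
      fix x assume "x \<in> cball y (sqrt \<tau>)"
      then show "x \<in> cball c (2 * \<rho>)" using that t dist_triangle[of c x y] by (simp add: dist_commute)
    qed
    then show ?thesis using sub t by (auto simp: adm_def)
  qed
  have r0: "0 \<le> \<rho>" using t by (meson order_trans real_sqrt_ge_zero less_imp_le)
  show ?thesis unfolding kint_def
  proof (rule integral_dominated_convergence[where w="\<lambda>x. \<tau> ^ n * \<bar>indicator (cball c (2 * \<rho>)) x *\<^sub>R f x\<bar>"])
    show "integrable lborel (\<lambda>x. \<tau> ^ n * \<bar>indicator (cball c (2 * \<rho>)) x *\<^sub>R f x\<bar>)"
      using f sub by (intro integrable_mult_right integrable_abs) (auto simp: loc_int_def set_integrable_def)
    show "(\<lambda>x. f x * kern n c \<tau> x) \<in> borel_measurable lborel"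
      by (rule borel_measurable_integrable[OF kern_integrable[OF f adm n]]) (use r0 in simp)
    show "(\<lambda>x. f x * kern n (X m) \<tau> x) \<in> borel_measurable lborel" for m
      by (rule borel_measurable_integrable[OF kern_integrable[OF f adm[OF X(2)] n]])
    show "AE x in lborel. (\<lambda>m. f x * kern n (X m) \<tau> x) \<longlonglongrightarrow> f x * kern n c \<tau> x"
    proof (intro AE_I2 tendsto_mult tendsto_const)
      fix x
      have "continuous_on UNIV (\<lambda>y. kern n y \<tau> x)" unfolding kern_def by (intro continuous_intros)
      then show "(\<lambda>m. kern n (X m) \<tau> x) \<longlonglongrightarrow> kern n c \<tau> x"
        by (rule continuous_on_tendsto_compose[OF _ X(1)]) auto
    qed
    show "AE x in lborel. norm (f x * kern n (X m) \<tau> x) \<le> \<tau> ^ n * \<bar>indicator (cball c (2 * \<rho>)) x *\<^sub>R f x\<bar>" for m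
    proof (intro AE_I2)
      fix x
      show "norm (f x * kern n (X m) \<tau> x) \<le> \<tau> ^ n * \<bar>indicator (cball c (2 * \<rho>)) x *\<^sub>R f x\<bar>"
      proof (cases "x \<in> cball c (2 * \<rho>)")
        case True
        have "kern n (X m) \<tau> x \<le> \<tau> ^ n" unfolding kern_def pp_def using t by (intro power_mono) auto
        then have "\<bar>f x\<bar> * kern n (X m) \<tau> x \<le> \<bar>f x\<bar> * \<tau> ^ n" by (intro mult_left_mono) auto
        then show ?thesis using True by (simp add: abs_mult kern_nonneg mult.commute)
      next
        case False
        have "x \<notin> cball (X m) (sqrt \<tau>)"
          using False X(2)[of m] t dist_triangle[of c x "X m"] by (auto simp: dist_commute)
        then have "kern n (X m) \<tau> x = 0" using kern_zero[OF n order_refl] t by simp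
        then show ?thesis using t by simp
      qed
    qed
  qed
qed

text \<open>For fixed \<tau> each weighted quantity depends continuously on its center, so every
  condition passes to the limit, and the limit of centers is never exchanged with a limit of
  scales.\<close>

lemma good_limit:
  assumes sub: "cball c (2 * \<rho>) \<subseteq> \<Omega>" and r: "\<rho> > 0"
    and X: "X \<longlonglongrightarrow> c" "\<And>m. dist (X m) c \<le> \<rho>" "\<And>m. good (X m) (\<rho>\<^sup>2)"
  shows "good c (\<rho>\<^sup>2)"
  unfolding good_def
proof (intro conjI allI impI)
  have "cball c \<rho> \<subseteq> cball c (2 * \<rho>)" using r by (intro subset_cball) simp
  then show "adm c (\<rho>\<^sup>2)" using r sub by (simp add: adm_def)
  have "(\<lambda>m. X m $ 2) \<longlonglongrightarrow> c $ 2" by (intro tendsto_intros X(1))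
  moreover have "X m $ 2 = 0" for m using X(3)[of m] by (simp add: good_def)
  ultimately show "c $ 2 = 0" by (simp add: LIMSEQ_const_iff)
  have "X m \<in> closure P" for m using X(3)[of m] by (simp add: good_def)
  then show "c \<in> closure P" using X(1) closed_sequentially[OF closed_closure] by blast
  fix \<tau> assume t: "0 < \<tau>" "\<tau> < \<rho>\<^sup>2"
  then have s: "sqrt \<tau> \<le> \<rho>" using r by (simp add: real_le_lsqrt)
  have "(\<lambda>m. Gq (X m) \<tau>) \<longlonglongrightarrow> Gq c \<tau>"
    unfolding Gq_def Sq_def Yq_def Iq_def
    by (intro tendsto_intros kint_center_tendsto[OF _ sub t(1) s _ X(1,2)] loc_int_p2 loc_int_fE loc_int_U2) auto
  moreover have "Gq (X m) \<tau> \<ge> 0" for m using X(3)[of m] t by (simp add: good_def)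
  ultimately show "0 \<le> Gq c \<tau>" by (intro LIMSEQ_le_const) auto
qed

section \<open>Integrals over balls and decay of the energy\<close>

definition bint :: "(pt \<Rightarrow> real) \<Rightarrow> pt \<Rightarrow> real \<Rightarrow> real" where
  "bint f c r = (\<integral>x. indicator (cball c r) x * f x \<partial>lborel)"

lemma bint_integrable: "loc_int f \<Longrightarrow> cball c r \<subseteq> \<Omega> \<Longrightarrow> integrable lborel (\<lambda>x. indicator (cball c r) x * f x)"
  by (simp add: loc_int_def set_integrable_def)

lemma bint_mono:
  assumes "loc_int f" "\<And>x. f x \<ge> 0" "cball c r \<subseteq> cball c' r'" "cball c' r' \<subseteq> \<Omega>"
  shows "bint f c r \<le> bint f c' r'"
  unfolding bint_def
  by (intro integral_mono bint_integrable assms(1)) (use assms in \<open>auto simp: indicator_def\<close>)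

lemma bint_nonneg: "(\<And>x. f x \<ge> 0) \<Longrightarrow> bint f c r \<ge> 0"
  unfolding bint_def by (intro integral_nonneg_AE) auto

lemma kint_lower:
  assumes f: "loc_int f" "\<And>x. f x \<ge> 0" and adm: "adm c \<tau>" and n: "n > 0" and m: "0 \<le> m" "r\<^sup>2 + m \<le> \<tau>"  "0 \<le> r"
  shows "m ^ n * bint f c r \<le> kint n f c \<tau>"
proof -
  have "r \<le> sqrt \<tau>" using m by (simp add: real_le_rsqrt)
  then have sub: "cball c r \<subseteq> \<Omega>" using adm subset_cball[of r "sqrt \<tau>" c] by (auto simp: adm_def)
  have "(\<integral>x. m ^ n * (indicator (cball c r) x * f x) \<partial>lborel) \<le> (\<integral>x. f x * kern n c \<tau> x \<partial>lborel)"
  proof (rule integral_mono)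
    show "integrable lborel (\<lambda>x. m ^ n * (indicator (cball c r) x * f x))"
      by (intro integrable_mult_right bint_integrable f sub)
    show "integrable lborel (\<lambda>x. f x * kern n c \<tau> x)" by (rule kern_integrable[OF f(1) adm n])
    show "m ^ n * (indicator (cball c r) x * f x) \<le> f x * kern n c \<tau> x" for x
    proof (cases "x \<in> cball c r")
      case True
      then have "norm (x - c) \<le> r" by (simp add: dist_norm norm_minus_commute)
      then have "(norm (x - c))\<^sup>2 \<le> r\<^sup>2" by (intro power_mono) auto
      then have "m \<le> max 0 (\<tau> - (norm (x - c))\<^sup>2)" using m by linarith
      then have "m ^ n \<le> kern n c \<tau> x" unfolding kern_def pp_def using m(1) by (intro power_mono) auto
      then have "f x * m ^ n \<le> f x * kern n c \<tau> x" using f by (intro mult_left_mono) auto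
      then show ?thesis using True by (simp add: mult.commute)
    qed (simp add: f kern_nonneg)
  qed
  then show ?thesis by (simp add: bint_def kint_def)
qed

lemma kint_upper:
  assumes f: "loc_int f" "\<And>x. f x \<ge> 0" and adm: "adm c \<tau>" and n: "n > 0"
  shows "kint n f c \<tau> \<le> \<tau> ^ n * bint f c (sqrt \<tau>)"
proof -
  have t: "\<tau> > 0" and sub: "cball c (sqrt \<tau>) \<subseteq> \<Omega>" using adm by (auto simp: adm_def)
  have "(\<integral>x. f x * kern n c \<tau> x \<partial>lborel) \<le> (\<integral>x. \<tau> ^ n * (indicator (cball c (sqrt \<tau>)) x * f x) \<partial>lborel)"
  proof (rule integral_mono)
    show "integrable lborel (\<lambda>x. \<tau> ^ n * (indicator (cball c (sqrt \<tau>)) x * f x))"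
      by (intro integrable_mult_right bint_integrable f sub)
    show "integrable lborel (\<lambda>x. f x * kern n c \<tau> x)" by (rule kern_integrable[OF f(1) adm n])
    show "f x * kern n c \<tau> x \<le> \<tau> ^ n * (indicator (cball c (sqrt \<tau>)) x * f x)" for x
    proof (cases "x \<in> cball c (sqrt \<tau>)")
      case True
      have "kern n c \<tau> x \<le> \<tau> ^ n" unfolding kern_def pp_def using t by (intro power_mono) auto
      then have "f x * kern n c \<tau> x \<le> f x * \<tau> ^ n" using f by (intro mult_left_mono) auto
      then show ?thesis using True by (simp add: mult.commute)
    next
      case False
      then show ?thesis using kern_zero[OF n order_refl _ False] t by simp
    qed
  qed
  then show ?thesis by (simp add: bint_def kint_def)
qed

text \<open>\<open>Sq_le_Iq\<close> bounds the energy near \<open>z\<close> by the mass on a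
  slightly larger ball, and \<open>Iq_growth\<close> compares this mass with the one at scale
  \<open>d\<close>. The cube of \<open>q / d\<close> reflects a frequency of at least 3/2.\<close>

lemma small_scale_energy:
  assumes z: "good z T" and q: "0 < q" "8 * q\<^sup>2 \<le> d\<^sup>2" and d: "0 < d" "d\<^sup>2 < T"
  shows "bint (\<lambda>x. (norm (p x))\<^sup>2) z q \<le> 12 * 3 ^ 9 * (q / d) ^ 3 / d\<^sup>2 * bint (\<lambda>x. (U x)\<^sup>2) z d"
proof -
  let ?E = "bint (\<lambda>x. (norm (p x))\<^sup>2) z q" and ?V = "bint (\<lambda>x. (U x)\<^sup>2) z d"
  have adm: "adm z t" if "0 < t" "t \<le> T" for t using good_adm[OF z that] .
  have q2: "0 < 4 * q\<^sup>2" "4 * q\<^sup>2 < T" "2 * (4 * q\<^sup>2) < T" "0 < 8 * q\<^sup>2"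
    using q(2) d(2) zero_less_power[OF q(1), of 2] by linarith+
  \<comment> \<open>On the ball of radius \<open>q\<close> the kernel at scale 4 q^2 is at least (3
    q^2)^3.\<close>
  have "(3 * q\<^sup>2) ^ 3 * ?E \<le> kint 3 (\<lambda>x. (norm (p x))\<^sup>2) z (4 * q\<^sup>2)"
    by (rule kint_lower[OF loc_int_p2 _ adm[OF q2(1) less_imp_le[OF q2(2)]]]) (use q in auto)
  also have "\<dots> = 6 * Sq z (4 * q\<^sup>2)" by (simp add: Sq_def)
  also have "\<dots> \<le> 6 * (2 * Iq z (2 * (4 * q\<^sup>2)))" by (intro mult_left_mono Sq_le_Iq[OF z q2(1) q2(3)]) auto
  finally have 1: "(3 * q\<^sup>2) ^ 3 * ?E \<le> 12 * Iq z (8 * q\<^sup>2)" by simp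
  have "q ^ 6 * ?E \<le> (3 * q\<^sup>2) ^ 3 * ?E"
    using bint_nonneg[of "\<lambda>x. (norm (p x))\<^sup>2" z q] q by (intro mult_right_mono) (auto simp: power_mult_distrib power_mult[symmetric])
  then have 1: "q ^ 6 * ?E \<le> 12 * Iq z (8 * q\<^sup>2)" using 1 by linarith
  have g: "(Iq z (8 * q\<^sup>2))\<^sup>2 * (d\<^sup>2) ^ 9 \<le> (Iq z (d\<^sup>2))\<^sup>2 * (8 * q\<^sup>2) ^ 9"
    by (rule Iq_growth[OF z q2(4) q(2) d(2)])
  have "(Iq z (8 * q\<^sup>2) * d ^ 9)\<^sup>2 = (Iq z (8 * q\<^sup>2))\<^sup>2 * (d\<^sup>2) ^ 9"
    by (simp add: power_mult_distrib power_mult[symmetric])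
  also have "\<dots> \<le> (Iq z (d\<^sup>2))\<^sup>2 * (8 * q\<^sup>2) ^ 9" by (rule g)
  \<comment> \<open>8 is rounded up to the square 9, so that a root of the squared inequality can be
    taken.\<close>
  also have "\<dots> \<le> (Iq z (d\<^sup>2))\<^sup>2 * ((3 * q)\<^sup>2) ^ 9"
    using q by (intro mult_left_mono power_mono) (auto simp: power_mult_distrib)
  also have "\<dots> = (Iq z (d\<^sup>2) * (3 * q) ^ 9)\<^sup>2" by (simp add: power_mult_distrib power_mult[symmetric])
  finally have "Iq z (8 * q\<^sup>2) * d ^ 9 \<le> Iq z (d\<^sup>2) * (3 * q) ^ 9"
    by (rule power2_le_imp_le) (use q quantities_nonneg(3)[of z "d\<^sup>2"] in simp)
  also have "\<dots> \<le> ((d\<^sup>2) ^ 2 * ?V) * (3 * q) ^ 9"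
  proof (intro mult_right_mono)
    have "Iq z (d\<^sup>2) \<le> (d\<^sup>2) ^ 2 * bint (\<lambda>x. (U x)\<^sup>2) z (sqrt (d\<^sup>2))"
      unfolding Iq_def by (rule kint_upper[OF loc_int_U2 _ adm]) (use d in auto)
    then show "Iq z (d\<^sup>2) \<le> (d\<^sup>2) ^ 2 * ?V" using d by simp
  qed (use q in simp)
  finally have 2: "Iq z (8 * q\<^sup>2) * d ^ 9 \<le> d ^ 4 * ?V * (3 * q) ^ 9" by simp
  have "(q ^ 6 * ?E) * d ^ 9 \<le> (12 * Iq z (8 * q\<^sup>2)) * d ^ 9" using 1 d by (intro mult_right_mono) auto
  also have "\<dots> = 12 * (Iq z (8 * q\<^sup>2) * d ^ 9)" by (simp only: mult_ac)
  also have "\<dots> \<le> 12 * (d ^ 4 * ?V * (3 * q) ^ 9)" using 2 by (intro mult_left_mono) auto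
  finally have "?E * (q ^ 6 * d ^ 9) \<le> (12 * 3 ^ 9 * (q / d) ^ 3 / d\<^sup>2 * ?V) * (q ^ 6 * d ^ 9)"
  proof -
    assume a: "(q ^ 6 * ?E) * d ^ 9 \<le> 12 * (d ^ 4 * ?V * (3 * q) ^ 9)"
    have "(12 * 3 ^ 9 * (q / d) ^ 3 / d\<^sup>2 * ?V) * (q ^ 6 * d ^ 9) = 12 * (((q / d) ^ 3 / d\<^sup>2 * d ^ 9) * ?V * (3 ^ 9 * q ^ 6))"
      by (simp only: mult_ac times_divide_eq_left times_divide_eq_right)
    also have "(q / d) ^ 3 / d\<^sup>2 * d ^ 9 = q ^ 3 * d ^ 4"
      using d by (simp add: power_divide eval_nat_numeral)
    also have "12 * (q ^ 3 * d ^ 4 * ?V * (3 ^ 9 * q ^ 6)) = 12 * (d ^ 4 * ?V * (3 ^ 9 * (q ^ 3 * q ^ 6)))"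
      by (simp only: mult_ac)
    also have "\<dots> = 12 * (d ^ 4 * ?V * (3 * q) ^ 9)" by (simp add: power_add[symmetric] power_mult_distrib)
    finally show ?thesis using a by (simp only: mult_ac)
  qed
  then show ?thesis by (rule mult_right_le_imp_le) (use q d in simp)
qed

end

subsection \<open>The rotation field\<close>

lemma Ck_const: "Ck_on k UNIV (\<lambda>x. c)"
proof (induction k arbitrary: c)
  case (Suc k)
  show ?case unfolding Ck_on.simps
  proof (intro exI[of _ "\<lambda>x. 0"] conjI ballI allI)
    show "((\<lambda>x. c) has_derivative (\<lambda>h. 0 \<bullet> h)) (at x)" for x :: pt by simp
    show "Ck_on k UNIV (\<lambda>x. 0 $ i)" for i :: 2 using Suc[of 0] by simp
  qed
qed simp

lemma Ck_coord: "Ck_on k UNIV (\<lambda>x. x $ i)"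
proof (cases k)
  case (Suc m)
  show ?thesis unfolding Suc Ck_on.simps
  proof (intro exI[of _ "\<lambda>x. axis i 1"] conjI ballI allI)
    show "((\<lambda>x. x $ i) has_derivative (\<lambda>h. axis i 1 \<bullet> h)) (at x)" for x :: pt
      by (auto simp: inner_axis' intro: bounded_linear_imp_has_derivative bounded_linear_vec_nth)
    show "Ck_on m UNIV (\<lambda>x. axis i 1 $ j)" for j by (rule Ck_const)
  qed
qed (auto intro!: continuous_intros)

lemma Ck_add: "Ck_on k UNIV f \<Longrightarrow> Ck_on k UNIV g \<Longrightarrow> Ck_on k UNIV (\<lambda>x. f x + g x)"
proof (induction k arbitrary: f g)
  case (Suc k)
  then obtain F G where *: "\<forall>x. (f has_derivative (\<lambda>h. F x \<bullet> h)) (at x)" "\<forall>i. Ck_on k UNIV (\<lambda>x. F x $ i)"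
    "\<forall>x. (g has_derivative (\<lambda>h. G x \<bullet> h)) (at x)" "\<forall>i. Ck_on k UNIV (\<lambda>x. G x $ i)" by auto
  show ?case unfolding Ck_on.simps
  proof (intro exI[of _ "\<lambda>x. F x + G x"] conjI ballI allI)
    show "((\<lambda>x. f x + g x) has_derivative (\<lambda>h. (F x + G x) \<bullet> h)) (at x)" for x
      unfolding inner_add_left using * by (intro has_derivative_add) auto
    show "Ck_on k UNIV (\<lambda>x. (F x + G x) $ i)" for i using * Suc.IH by simp
  qed
qed (auto intro: continuous_on_add)

lemma Ck_Suc_imp: "Ck_on (Suc k) UNIV f \<Longrightarrow> Ck_on k UNIV f"
proof (induction k arbitrary: f)
  case 0
  then obtain F where "\<forall>x. (f has_derivative (\<lambda>h. F x \<bullet> h)) (at x)" by auto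
  then show ?case using has_derivative_continuous_on[of UNIV f "\<lambda>x h. F x \<bullet> h"] by simp
next
  case (Suc k)
  then obtain F where *: "\<forall>x. (f has_derivative (\<lambda>h. F x \<bullet> h)) (at x)" "\<forall>i. Ck_on (Suc k) UNIV (\<lambda>x. F x $ i)"
    by (auto simp del: Ck_on.simps simp: Ck_on.simps(2)[of "Suc k"])
  show ?case unfolding Ck_on.simps(2)[of k] by (rule exI[of _ F]) (use * Suc.IH in auto)
qed

lemma Ck_mult: "Ck_on k UNIV f \<Longrightarrow> Ck_on k UNIV g \<Longrightarrow> Ck_on k UNIV (\<lambda>x. f x * g x)"
proof (induction k arbitrary: f g)
  case (Suc k)
  then obtain F G where *: "\<forall>x. (f has_derivative (\<lambda>h. F x \<bullet> h)) (at x)" "\<forall>i. Ck_on k UNIV (\<lambda>x. F x $ i)"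
    "\<forall>x. (g has_derivative (\<lambda>h. G x \<bullet> h)) (at x)" "\<forall>i. Ck_on k UNIV (\<lambda>x. G x $ i)" by auto
  have fg: "Ck_on k UNIV f" "Ck_on k UNIV g" using Suc.prems Ck_Suc_imp by blast+
  show ?case unfolding Ck_on.simps
  proof (intro exI[of _ "\<lambda>x. f x *\<^sub>R G x + g x *\<^sub>R F x"] conjI ballI allI)
    show "((\<lambda>x. f x * g x) has_derivative (\<lambda>h. (f x *\<^sub>R G x + g x *\<^sub>R F x) \<bullet> h)) (at x)" for x
      by (rule has_derivative_eq_rhs[OF has_derivative_mult]) (use * in \<open>auto simp: inner_add_left\<close>)
    show "Ck_on k UNIV (\<lambda>x. (f x *\<^sub>R G x + g x *\<^sub>R F x) $ i)" for i
      using * fg by (auto intro!: Ck_add Suc.IH)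
  qed
qed (auto intro: continuous_on_mult)

lemma Ck_pp: "Ck_on k UNIV f \<Longrightarrow> k < n \<Longrightarrow> Ck_on k UNIV (\<lambda>x. pp n (f x))"
proof (induction k arbitrary: n)
  case (Suc k)
  then obtain F where *: "\<forall>x. (f has_derivative (\<lambda>h. F x \<bullet> h)) (at x)" "\<forall>i. Ck_on k UNIV (\<lambda>x. F x $ i)" by auto
  have f: "Ck_on k UNIV f" using Suc.prems(1) by (rule Ck_Suc_imp)
  have n: "n \<ge> 2" using Suc.prems by simp
  show ?case unfolding Ck_on.simps
  proof (intro exI[of _ "\<lambda>x. (n * pp (n - 1) (f x)) *\<^sub>R F x"] conjI ballI allI)
    show "((\<lambda>x. pp n (f x)) has_derivative (\<lambda>h. ((n * pp (n - 1) (f x)) *\<^sub>R F x) \<bullet> h)) (at x)" for x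
      by (rule has_derivative_eq_rhs[OF has_derivative_compose[OF *(1)[rule_format] pp_deriv[OF n, unfolded has_field_derivative_def]]])
        simp
    have "Ck_on k UNIV (\<lambda>x. (real n * pp (n - 1) (f x)) * F x $ i)" for i
      using * f Suc.prems by (intro Ck_mult Ck_const Suc.IH) auto
    then show "Ck_on k UNIV (\<lambda>x. ((n * pp (n - 1) (f x)) *\<^sub>R F x) $ i)" for i by simp
  qed
qed (auto intro: pp_continuous)

lemma Ck_diff: "Ck_on k UNIV f \<Longrightarrow> Ck_on k UNIV g \<Longrightarrow> Ck_on k UNIV (\<lambda>x. f x - g x)"
  using Ck_add[of k f "\<lambda>x. -1 * g x"] Ck_mult[of k "\<lambda>x. -1" g] Ck_const[of k "-1"] by simp

text \<open>A step from 0 to 1 made of cubes of positive parts. It is C^2, as required of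
  \<open>Bf\<close>, whose gradient components become test functions themselves, and its derivative
  has the explicit bound 9.\<close>

definition stp :: "real \<Rightarrow> real" where "stp t = 1 - pp 3 (1 - pp 3 t)"

lemma pp3_le_one: "t \<le> 1 \<Longrightarrow> pp 3 t \<le> 1"
  unfolding pp_def by (intro power_le_one) auto

lemma stp_bounds: "0 \<le> stp t" "stp t \<le> 1"
  using pp3_le_one[of "1 - pp 3 t"] pp_nonneg[of 3 t] pp_nonneg[of 3 "1 - pp 3 t"] by (auto simp: stp_def)

lemma stp_zero: "t \<le> 0 \<Longrightarrow> stp t = 0" by (simp add: stp_def pp_def)

lemma stp_one: "t \<ge> 1 \<Longrightarrow> stp t = 1"
  by (simp add: stp_def pp_pos pp_zero one_le_power)

definition stp' :: "real \<Rightarrow> real" where "stp' t = 9 * pp 2 (1 - pp 3 t) * pp 2 t"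

lemma stp_deriv: "(stp has_real_derivative stp' t) (at t)"
proof -
  have 1: "((\<lambda>t. 1 - pp 3 t) has_real_derivative (- (3 * pp 2 t))) (at t)"
    using pp_deriv[of 3 t] by (auto intro!: derivative_eq_intros)
  have "((\<lambda>t. pp 3 (1 - pp 3 t)) has_real_derivative (3 * pp 2 (1 - pp 3 t)) * (- (3 * pp 2 t))) (at t)"
    by (rule DERIV_chain2[where f="pp 3" and g="\<lambda>t. 1 - pp 3 t", OF _ 1]) (use pp_deriv[of 3 "1 - pp 3 t"] in simp)
  then have "((\<lambda>t. 1 - pp 3 (1 - pp 3 t)) has_real_derivative 0 - (3 * pp 2 (1 - pp 3 t)) * (- (3 * pp 2 t))) (at t)"
    by (intro DERIV_diff DERIV_const)
  then show ?thesis by (simp add: stp_def[abs_def] stp'_def mult_ac)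
qed

lemma stp'_nonneg: "0 \<le> stp' t" by (simp add: stp'_def pp_nonneg)

lemma stp'_le: "stp' t \<le> 9"
proof (cases "t \<le> 1")
  case True
  have "pp 2 t \<le> 1" "pp 2 (1 - pp 3 t) \<le> 1"
    unfolding pp_def using True by (auto intro!: power_le_one)
  then have "pp 2 (1 - pp 3 t) * pp 2 t \<le> 1 * 1" by (intro mult_mono pp_nonneg) auto
  then show ?thesis by (simp add: stp'_def)
next
  case False
  then have "1 - pp 3 t \<le> 0" by (simp add: pp_pos one_le_power)
  then show ?thesis by (simp add: stp'_def pp_zero)
qed

lemma stp'_zero: "t \<le> 0 \<or> t \<ge> 1 \<Longrightarrow> stp' t = 0"
proof (elim disjE)
  assume "t \<ge> 1"
  then have "1 - pp 3 t \<le> 0" by (simp add: pp_pos one_le_power)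
  then show ?thesis by (simp add: stp'_def pp_zero)
qed (simp add: stp'_def pp_zero)

definition sqn :: "pt \<Rightarrow> real" where "sqn y = (y $ 1)\<^sup>2 + (y $ 2)\<^sup>2"

lemma sqn_norm: "sqn y = (norm y)\<^sup>2" by (simp add: sqn_def norm_sq_pt)

text \<open>After rescaling, \<open>c = 0\<close> and \<open>z = (i, 0)\<close> with \<open>i = \<plusminus>1\<close>. The factor \<open>etaf\<close> localises to the annulus,
  \<open>lamf\<close> removes a neighbourhood of \<open>z\<close>, and \<open>bf\<close> is chosen positive with angular derivative of a strict sign
  on the upper half-plane.\<close>

definition etaf :: "real \<Rightarrow> pt \<Rightarrow> real" where "etaf s y = pp 3 (1 - ((sqn y - 1) / s)\<^sup>2)"
definition bf :: "real \<Rightarrow> pt \<Rightarrow> real" where "bf i y = 2 + i * y $ 1 - i / 2 * (y $ 1 * y $ 2)"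
definition lamf :: "real \<Rightarrow> real \<Rightarrow> pt \<Rightarrow> real" where "lamf i s y = stp (((y $ 1 - i)\<^sup>2 + (y $ 2)\<^sup>2) / s\<^sup>2 - 9)"
definition Bf :: "real \<Rightarrow> real \<Rightarrow> pt \<Rightarrow> real" where "Bf i s y = etaf s y * bf i y * lamf i s y"

lemma etaf_support: "etaf s y \<noteq> 0 \<Longrightarrow> 0 < s \<Longrightarrow> \<bar>sqn y - 1\<bar> < s"
proof -
  assume "etaf s y \<noteq> 0" "0 < s"
  then have "((sqn y - 1) / s)\<^sup>2 < 1" unfolding etaf_def using pp_zero[of "1 - ((sqn y - 1) / s)\<^sup>2" 3] by fastforce
  then have "\<bar>(sqn y - 1) / s\<bar> < 1" by (simp add: abs_square_less_1)
  then show ?thesis using \<open>0 < s\<close> by (simp add: abs_divide)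
qed

lemma etaf_bounds: "0 \<le> etaf s y" "etaf s y \<le> 1"
  unfolding etaf_def by (auto simp: pp_nonneg intro!: pp3_le_one)

text \<open>The derivative along the rotation field about the origin of a function with gradient
  \<open>G\<close>.\<close>

definition dt :: "(pt \<Rightarrow> pt) \<Rightarrow> pt \<Rightarrow> real" where "dt G y = y $ 1 * G y $ 2 - y $ 2 * G y $ 1"

lemma etaf_support_geometry:
  fixes i s :: real and y :: pt
  assumes i: "i = 1 \<or> i = -1" and s: "0 < s" "s \<le> 1 / 8" and ne: "etaf s y \<noteq> 0"
  shows "sqn y < 1 + s" "sqn y > 1 - s" "\<bar>y $ 1\<bar> \<le> 9 / 8" "\<bar>y $ 2\<bar> \<le> 1 + s" "0 \<le> bf i y" "bf i y \<le> 4"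
proof -
  have a: "\<bar>sqn y - 1\<bar> < s" using etaf_support[OF ne s(1)] .
  then show 1: "sqn y < 1 + s" and 2: "sqn y > 1 - s" by auto
  have "(y $ 1)\<^sup>2 \<le> sqn y" "(y $ 2)\<^sup>2 \<le> sqn y" by (auto simp: sqn_def)
  \<comment> \<open>Avoids a root: the bound 1 + s for the squares is weakened to a square.\<close>
  moreover have "1 + s \<le> (1 + s)\<^sup>2" using s by (simp add: power2_eq_square algebra_simps)
  ultimately have y12: "(y $ 1)\<^sup>2 \<le> (1 + s)\<^sup>2" "(y $ 2)\<^sup>2 \<le> (1 + s)\<^sup>2" using 1 by auto
  then have y1: "\<bar>y $ 1\<bar> \<le> 1 + s" and y2: "\<bar>y $ 2\<bar> \<le> 1 + s"
    using s by (auto simp: abs_le_square_iff[symmetric])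
  then show "\<bar>y $ 1\<bar> \<le> 9 / 8" and "\<bar>y $ 2\<bar> \<le> 1 + s" using s by auto
  have "\<bar>y $ 1\<bar> \<le> 9 / 8" "\<bar>y $ 2\<bar> \<le> 9 / 8" using y1 y2 s by auto
  then have "\<bar>y $ 1 * y $ 2\<bar> \<le> 9 / 8 * (9 / 8)" unfolding abs_mult by (intro mult_mono) auto
  then have p: "\<bar>y $ 1 * y $ 2\<bar> \<le> 81 / 64" by simp
  show "0 \<le> bf i y" "bf i y \<le> 4"
    using i p \<open>\<bar>y $ 1\<bar> \<le> 9 / 8\<close> unfolding bf_def by (elim disjE; simp; linarith)+
qed

text \<open>Bounds the vertical component of the rotation field by the height. For
  \<open>i * y $ 1 \<le> 0\<close> the sign suffices. Otherwise a point of the annulus at height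
  below \<open>s\<close> would be within sqrt 5 times \<open>s\<close> of \<open>(i, 0)\<close>,
  inside the disc of radius \<open>3 * s\<close> where \<open>lamf\<close> vanishes. So the height
  is at least \<open>s\<close>, while the component is at most 9/8 * 4, which is below 5.\<close>

lemma Bf_vertical_bound:
  assumes i: "i = 1 \<or> i = -1" and s: "0 < s" "s \<le> 1 / 8" and y2: "y $ 2 > 0"
  shows "i * y $ 1 * Bf i s y \<le> (5 / s) * y $ 2"
proof (cases "Bf i s y = 0 \<or> i * y $ 1 \<le> 0")
  case True
  have "0 \<le> Bf i s y"
  proof (cases "etaf s y = 0")
    case False
    then show ?thesis using etaf_support_geometry(5)[OF i s False]
      unfolding Bf_def by (intro mult_nonneg_nonneg etaf_bounds) (auto simp: lamf_def stp_bounds)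
  qed (simp add: Bf_def)
  then have "i * y $ 1 * Bf i s y \<le> 0" using True by (auto intro: mult_nonpos_nonneg)
  also have "0 \<le> (5 / s) * y $ 2" using s y2 by simp
  finally show ?thesis .
next
  case False
  then have pos: "i * y $ 1 > 0" and e: "etaf s y \<noteq> 0" and l: "lamf i s y \<noteq> 0" by (auto simp: Bf_def)
  note g = etaf_support_geometry[OF i s e]
  have far: "((y $ 1 - i)\<^sup>2 + (y $ 2)\<^sup>2) / s\<^sup>2 - 9 > 0" 
    using l stp_zero[of "((y $ 1 - i)\<^sup>2 + (y $ 2)\<^sup>2) / s\<^sup>2 - 9"] unfolding lamf_def by linarith
  have ii: "i * i = 1" using i by auto
  have "y $ 2 \<ge> s"
  proof (rule ccontr)
    assume "\<not> y $ 2 \<ge> s"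
    then have "(y $ 2)\<^sup>2 \<le> s\<^sup>2" using y2 by (intro power_mono) auto
    moreover have ss: "s\<^sup>2 \<le> s" using s by (simp add: power2_eq_square mult_left_le_one_le)
    ultimately have b: "\<bar>(y $ 1)\<^sup>2 - 1\<bar> \<le> 2 * s" using g(1,2) zero_le_power2[of "y $ 2"] unfolding sqn_def by linarith
    define a where "a = i * y $ 1"
    have a2: "a\<^sup>2 = (y $ 1)\<^sup>2" unfolding a_def power_mult_distrib using i by auto
    have "\<bar>a - 1\<bar> * 1 \<le> \<bar>a - 1\<bar> * (a + 1)" using pos unfolding a_def by (intro mult_left_mono) auto
    also have "\<dots> = \<bar>a - 1\<bar> * \<bar>a + 1\<bar>" using pos unfolding a_def[symmetric] by simp
    also have "\<dots> = \<bar>a\<^sup>2 - 1\<bar>" unfolding abs_mult[symmetric] by (simp add: power2_eq_square algebra_simps)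
    finally have "\<bar>a - 1\<bar> \<le> 2 * s" using b a2 by simp
    then have "(a - 1)\<^sup>2 \<le> (2 * s)\<^sup>2" using s abs_le_square_iff[of "a - 1" "2 * s"] by simp
    moreover have "(a - 1)\<^sup>2 = (y $ 1 - i)\<^sup>2" unfolding a_def using i by (auto simp: power2_eq_square algebra_simps)
    ultimately have "(y $ 1 - i)\<^sup>2 + (y $ 2)\<^sup>2 \<le> 5 * s\<^sup>2" using \<open>(y $ 2)\<^sup>2 \<le> s\<^sup>2\<close> by (simp add: power_mult_distrib)
    then have "((y $ 1 - i)\<^sup>2 + (y $ 2)\<^sup>2) / s\<^sup>2 \<le> 5" using s by (simp add: pos_divide_le_eq)
    then show False using far by simp
  qed
  have "i * y $ 1 * Bf i s y \<le> 9 / 8 * 4"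
  proof (intro mult_mono)
    show "i * y $ 1 \<le> 9 / 8" using i g(3) by auto
    have "etaf s y * bf i y * lamf i s y \<le> 1 * 4 * 1"
      by (intro mult_mono etaf_bounds g mult_nonneg_nonneg) (auto simp: lamf_def stp_bounds)
    then show "Bf i s y \<le> 4" by (simp add: Bf_def)
    show "0 \<le> Bf i s y" unfolding Bf_def by (intro mult_nonneg_nonneg etaf_bounds g) (simp add: lamf_def stp_bounds)
  qed simp
  also have "\<dots> \<le> (5 / s) * s" using s by simp
  also have "\<dots> \<le> (5 / s) * y $ 2" using \<open>y $ 2 \<ge> s\<close> s by (intro mult_left_mono) auto
  finally show ?thesis .
qed

lemma dt_unique:
  assumes "(f has_derivative (\<lambda>h. G y \<bullet> h)) (at y)" "(f has_derivative D) (at y)"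
  shows "dt G y = D (vector [- y $ 2, y $ 1])"
proof -
  have "D = (\<lambda>h. G y \<bullet> h)" using has_derivative_unique[OF assms(2,1)] .
  then show ?thesis by (simp add: dt_def inner_vec_def sum_2)
qed

lemma coord_deriv: "((\<lambda>y::pt. y $ i) has_derivative (\<lambda>h. h $ i)) (at y)"
  by (intro bounded_linear_imp_has_derivative bounded_linear_vec_nth)

lemma etaf_rot_deriv: "\<exists>D. (etaf s has_derivative D) (at y) \<and> D (vector [- y $ 2, y $ 1]) = 0"
proof -
  have 1: "((\<lambda>y. 1 - ((sqn y - 1) / s)\<^sup>2) has_derivative
     (\<lambda>h. - (2 * ((sqn y - 1) / s) * ((2 * y $ 1 * h $ 1 + 2 * y $ 2 * h $ 2) / s)))) (at y)"
    unfolding sqn_def divide_inverse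
    by (auto intro!: derivative_eq_intros coord_deriv simp: fun_eq_iff algebra_simps power2_eq_square)
  have "(etaf s has_derivative (\<lambda>h. (3 * pp 2 (1 - ((sqn y - 1) / s)\<^sup>2)) * (- (2 * ((sqn y - 1) / s) * ((2 * y $ 1 * h $ 1 + 2 * y $ 2 * h $ 2) / s))))) (at y)"
    unfolding etaf_def[abs_def]
    using has_derivative_compose[OF 1 pp_deriv[of 3, unfolded has_field_derivative_def]] by simp
  moreover have "(\<lambda>h. (3 * pp 2 (1 - ((sqn y - 1) / s)\<^sup>2)) * (- (2 * ((sqn y - 1) / s) * ((2 * y $ 1 * h $ 1 + 2 * y $ 2 * h $ 2) / s)))) (vector [- y $ 2, y $ 1] :: pt) = 0"
    by simp
  ultimately show ?thesis by blast
qed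

lemma bf_deriv: "(bf i has_derivative (\<lambda>h. i * h $ 1 - i / 2 * (y $ 1 * h $ 2 + h $ 1 * y $ 2))) (at y)"
  unfolding bf_def[abs_def] by (rule derivative_eq_intros coord_deriv refl | simp)+

lemma lamf_deriv:
  "(lamf i s has_derivative (\<lambda>h. stp' (((y $ 1 - i)\<^sup>2 + (y $ 2)\<^sup>2) / s\<^sup>2 - 9) * ((2 * (y $ 1 - i) * h $ 1 + 2 * y $ 2 * h $ 2) / s\<^sup>2))) (at y)"
proof -
  have 1: "((\<lambda>y. ((y $ 1 - i)\<^sup>2 + (y $ 2)\<^sup>2) / s\<^sup>2 - 9) has_derivative (\<lambda>h. (2 * (y $ 1 - i) * h $ 1 + 2 * y $ 2 * h $ 2) / s\<^sup>2)) (at y)"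
    unfolding divide_inverse
    by (auto intro!: derivative_eq_intros coord_deriv simp: fun_eq_iff algebra_simps power2_eq_square)
  show ?thesis unfolding lamf_def[abs_def]
    by (rule has_derivative_compose[OF 1 stp_deriv[unfolded has_field_derivative_def]])
qed

text \<open>\<open>etaf\<close> is radial, so only \<open>bf\<close> and \<open>lamf\<close> are
  differentiated. Up to the factor -i, the term \<open>i * y $ 1\<close> of \<open>bf\<close>
  contributes y2, which degenerates on the axis; the term with \<open>y $ 1 * y $ 2\<close> adds
  (y1^2 - y2^2) / 2. The sum is |y|^2 / 2 + y2 - y2^2, at least 1/4 on the annulus above the axis.
  The derivative of \<open>lamf\<close> is confined to the ball of radius \<open>4 * s\<close> and
  is of order 1 / s.\<close>

lemma Bf_rot_deriv:
  assumes i: "i = 1 \<or> i = -1" and s: "0 < s" "s \<le> 1 / 8" and y2: "y $ 2 \<ge> 0"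
    and G: "(Bf i s has_derivative (\<lambda>h. G y \<bullet> h)) (at y)"
  shows "- i * dt G y \<ge> etaf s y / 4 - (400 / s) * indicator (cball (vector [i, 0]) (4 * s)) y"
proof -
  obtain De where De: "(etaf s has_derivative De) (at y)" "De (vector [- y $ 2, y $ 1]) = 0"
    using etaf_rot_deriv by blast
  let ?t = "((y $ 1 - i)\<^sup>2 + (y $ 2)\<^sup>2) / s\<^sup>2 - 9"
  let ?v = "vector [- y $ 2, y $ 1] :: pt"
  have d1: "((\<lambda>y. etaf s y * bf i y) has_derivative (\<lambda>h. etaf s y * (i * h $ 1 - i / 2 * (y $ 1 * h $ 2 + h $ 1 * y $ 2)) + De h * bf i y)) (at y)"
    by (rule has_derivative_mult[OF De(1) bf_deriv])
  have "(Bf i s has_derivative (\<lambda>h. etaf s y * bf i y * (stp' ?t * ((2 * (y $ 1 - i) * h $ 1 + 2 * y $ 2 * h $ 2) / s\<^sup>2))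
      + (etaf s y * (i * h $ 1 - i / 2 * (y $ 1 * h $ 2 + h $ 1 * y $ 2)) + De h * bf i y) * lamf i s y)) (at y)"
    unfolding Bf_def[abs_def] by (rule has_derivative_mult[OF d1 lamf_deriv])
  from dt_unique[where G=G and f="Bf i s" and y=y, OF G this] have dt: "dt G y = etaf s y * bf i y * (stp' ?t * ((2 * (y $ 1 - i) * (- y $ 2) + 2 * y $ 2 * y $ 1) / s\<^sup>2))
     + etaf s y * (i * (- y $ 2) - i / 2 * (y $ 1 * y $ 1 + - y $ 2 * y $ 2)) * lamf i s y"
    using De(2) by simp
  show ?thesis
  proof (cases "etaf s y = 0")
    case True
    have "0 \<le> (400 / s) * indicator (cball (vector [i, 0]) (4 * s)) y" using s by simp
    then show ?thesis using True unfolding dt by simp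
  next
    case False
    note g = etaf_support_geometry[OF i s False]
    have ii: "i * i = 1" "\<bar>i\<bar> = 1" using i by auto
    have main: "- i * (i * (- y $ 2) - i / 2 * (y $ 1 * y $ 1 + - y $ 2 * y $ 2)) \<ge> 1 / 4"
    proof -
      have "- i * (i * (- y $ 2) - i / 2 * (y $ 1 * y $ 1 + - y $ 2 * y $ 2)) = (i * i) * (sqn y / 2 + y $ 2 - (y $ 2)\<^sup>2)"
        unfolding sqn_def by (simp add: power2_eq_square algebra_simps)
      also have "\<dots> = sqn y / 2 - y $ 2 * (y $ 2 - 1)" unfolding ii by (simp add: power2_eq_square algebra_simps)
      also have "\<dots> \<ge> 1 / 4"
      proof -
        have "y $ 2 * (y $ 2 - 1) \<le> (1 + s) * s"
        proof (cases "y $ 2 \<le> 1")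
          case True
          then have "y $ 2 * (y $ 2 - 1) \<le> 0" using y2 by (intro mult_nonneg_nonpos) auto
          also have "0 \<le> (1 + s) * s" using s by simp
          finally show ?thesis .
        next
          case False
          then show ?thesis using g(4) by (intro mult_mono) auto
        qed
        also have "\<dots> \<le> (1 + 1 / 8) * (1 / 8)" using s by (intro mult_mono) auto
        finally show ?thesis using g(2) s by simp
      qed
      finally show ?thesis .
    qed
    define q where "q = - i * (i * (- y $ 2) - i / 2 * (y $ 1 * y $ 1 + - y $ 2 * y $ 2))"
    define w where "w = (2 * (y $ 1 - i) * (- y $ 2) + 2 * y $ 2 * y $ 1) / s\<^sup>2"
    have e: "- i * dt G y = etaf s y * lamf i s y * q - i * (etaf s y * bf i y * (stp' ?t * w))"
      unfolding dt q_def w_def by (simp add: algebra_simps)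
    have dist: "dist (vector [i, 0]) y \<le> 4 * s \<longleftrightarrow> (y $ 1 - i)\<^sup>2 + (y $ 2)\<^sup>2 \<le> 16 * s\<^sup>2"
    proof -
      have "(dist (vector [i, 0]) y)\<^sup>2 = (y $ 1 - i)\<^sup>2 + (y $ 2)\<^sup>2"
        unfolding dist_norm norm_sq_pt by (simp add: power2_commute)
      moreover have "dist (vector [i, 0]) y \<le> 4 * s \<longleftrightarrow> (dist (vector [i, 0]) y)\<^sup>2 \<le> (4 * s)\<^sup>2"
        using s abs_le_square_iff[of "dist (vector [i, 0]) y" "4 * s"] by simp
      ultimately show ?thesis by (simp add: power_mult_distrib)
    qed
    show ?thesis
    proof (cases "y \<in> cball (vector [i, 0]) (4 * s)")
      case True
      have "\<bar>y $ 2\<bar> \<le> 4 * s"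
      proof -
        have "(y $ 1 - i)\<^sup>2 + (y $ 2)\<^sup>2 \<le> 16 * s\<^sup>2" using True dist by simp
        moreover have "(4 * s)\<^sup>2 = 16 * s\<^sup>2" by (simp add: power_mult_distrib)
        ultimately have "(y $ 2)\<^sup>2 \<le> (4 * s)\<^sup>2" using zero_le_power2[of "y $ 1 - i"] by linarith
        then show ?thesis using s abs_le_square_iff[of "y $ 2" "4 * s"] by simp
      qed
      have "w = 2 * i * y $ 2 / s\<^sup>2" unfolding w_def by (simp add: algebra_simps)
      then have "\<bar>w\<bar> = 2 * \<bar>y $ 2\<bar> / s\<^sup>2" using ii by (simp add: abs_mult)
      also have "\<dots> \<le> 2 * (4 * s) / s\<^sup>2" using \<open>\<bar>y $ 2\<bar> \<le> 4 * s\<close> by (intro divide_right_mono) auto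
      also have "\<dots> = 8 / s" using s by (simp add: power2_eq_square)
      finally have w: "\<bar>w\<bar> \<le> 8 / s" .
      have "\<bar>i * (etaf s y * bf i y * (stp' ?t * w))\<bar> = etaf s y * bf i y * (stp' ?t * \<bar>w\<bar>)"
        using ii g(5) etaf_bounds(1)[of s y] stp'_nonneg[of ?t] by (simp add: abs_mult)
      \<comment> \<open>The bounds for \<open>etaf\<close>, \<open>bf\<close>, \<open>stp'\<close>
        and \<open>w\<close>. With a quarter of \<open>etaf\<close> added, the total stays below 400
        / s.\<close>
      also have "\<dots> \<le> 1 * 4 * (9 * (8 / s))"
        using w s by (intro mult_mono etaf_bounds g(6) stp'_le mult_nonneg_nonneg stp'_nonneg g(5)) auto
      finally have b: "\<bar>i * (etaf s y * bf i y * (stp' ?t * w))\<bar> \<le> 288 / s" by simp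
      have "0 \<le> etaf s y * lamf i s y * q"
        using main unfolding q_def[symmetric] by (intro mult_nonneg_nonneg etaf_bounds) (auto simp: lamf_def stp_bounds)
      moreover have "etaf s y / 4 \<le> 1 / s" 
      proof -
        have "etaf s y / 4 \<le> 1" using etaf_bounds(2)[of s y] by simp
        also have "1 \<le> 1 / s" using s by simp
        finally show ?thesis .
      qed
      moreover have "400 / s = 288 / s + 1 / s + 111 / s" by (simp add: add_divide_distrib[symmetric])
      moreover have "0 \<le> 111 / s" using s by simp
      ultimately show ?thesis using True b unfolding e by simp
    next
      case False
      then have "16 * s\<^sup>2 < (y $ 1 - i)\<^sup>2 + (y $ 2)\<^sup>2" using dist by auto
      then have "16 < ((y $ 1 - i)\<^sup>2 + (y $ 2)\<^sup>2) / s\<^sup>2" using s by (simp add: pos_less_divide_eq)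
      then have "?t > 1" by linarith
      then have "lamf i s y = 1" "stp' ?t = 0" unfolding lamf_def by (simp_all add: stp_one stp'_zero)
      then have "- i * dt G y = etaf s y * q" unfolding e by simp
      also have "\<dots> \<ge> etaf s y * (1 / 4)" using main unfolding q_def[symmetric] by (intro mult_left_mono etaf_bounds)
      finally show ?thesis using False by simp
    qed
  qed
qed

text \<open>Besides \<open>f\<close> the components of its gradient become test functions, with a
  symmetric Hessian, as \<open>curl_identity\<close> requires.\<close>

lemma Ck2_C1c_support:
  assumes "Ck_on 2 UNIV f" "\<And>x. x \<notin> K \<Longrightarrow> f x = 0" "compact K" "K \<subseteq> \<Omega>"
  obtains G H where "C1c \<Omega> f G" "\<And>j. C1c \<Omega> (\<lambda>x. G x $ j) (H j)" "\<And>x j k. H j x $ k = H k x $ j"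
proof -
  have "Ck_on (Suc 1) UNIV f" using assms(1) by (simp add: numeral_2_eq_2)
  then obtain G where G: "\<And>x. (f has_derivative (\<lambda>h. G x \<bullet> h)) (at x)" "\<And>j. Ck_on 1 UNIV (\<lambda>x. G x $ j)"
    unfolding Ck_on.simps(2) by blast
  have "continuous_on UNIV G"
    using G(2) Ck_Suc_imp[of 0] by (intro continuous_on_gradI) (auto simp del: Ck_on.simps(2) simp: One_nat_def)
  then have C: "C1c \<Omega> f G" using assms G by (intro C1cI[of K]) auto
  have z: "G x = 0" if "x \<notin> K" for x
    using has_derivative_inner_unique[OF G(1) has_derivative_zero_off_closed[OF compact_imp_closed[OF assms(3)] assms(2) that]] by blast
  have "\<exists>H. C1c \<Omega> (\<lambda>x. G x $ j) H" for j
  proof -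
    have "compact_supp_in \<Omega> (\<lambda>x. G x $ j)" by (rule compact_supp_inI[OF assms(3,4)]) (use z in auto)
    from Ck1_C1c[OF G(2) this] show ?thesis by blast
  qed
  then obtain H where H: "\<And>j. C1c \<Omega> (\<lambda>x. G x $ j) (H j)" by metis
  have "H j x $ k = H k x $ j" for x j k
    by (rule mixed_partials_symmetric[of UNIV f G H]) (use G(1) C1c_deriv[OF H] C1c_continuous_grad[OF H] in auto)
  then show ?thesis using that[OF C H] by blast
qed

lemma Bf_support:
  assumes "0 < s" "s \<le> 1 / 8" "y \<notin> cball 0 2" shows "Bf i s y = 0"
proof (rule ccontr)
  assume "Bf i s y \<noteq> 0"
  then have "etaf s y \<noteq> 0" by (auto simp: Bf_def)
  then have "sqn y < 1 + s" using etaf_support[OF _ assms(1)] by fastforce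
  then have "(norm y)\<^sup>2 \<le> 2\<^sup>2" using assms by (simp add: sqn_norm)
  then have "norm y \<le> 2" by (rule power2_le_imp_le) simp
  then show False using assms(3) by simp
qed

lemma Ck_Bf: "Ck_on 2 UNIV (Bf i s)"
proof -
  have "Ck_on 2 UNIV (\<lambda>y. Bf i s y)"
    unfolding Bf_def etaf_def bf_def lamf_def stp_def sqn_def power2_eq_square divide_inverse
    by (intro Ck_mult Ck_diff Ck_add Ck_const Ck_pp Ck_coord) auto
  then show ?thesis by simp
qed

lemma unit_field:
  assumes "0 < s" "s \<le> 1 / 8"
  obtains G H C where "C1c UNIV (Bf i s) G" "\<And>j. C1c UNIV (\<lambda>x. G x $ j) (H j)" "\<And>x j k. H j x $ k = H k x $ j"
    "C > 0" "\<And>y. norm (G y) \<le> C"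
proof -
  obtain G H where G: "C1c UNIV (Bf i s) G" "\<And>j. C1c UNIV (\<lambda>x. G x $ j) (H j)" "\<And>x j k. H j x $ k = H k x $ j"
    using Ck2_C1c_support[OF Ck_Bf Bf_support[OF assms] compact_cball subset_UNIV] by blast
  obtain L where L: "compact L" "L \<subseteq> UNIV" "\<And>x. x \<notin> L \<Longrightarrow> Bf i s x = 0" "\<And>x. x \<notin> L \<Longrightarrow> G x = 0"
    using C1c_support[OF G(1)] by blast
  obtain C where C: "C > 0" "\<And>x. x \<in> L \<Longrightarrow> norm (G x) \<le> C"
    using bounded_on_compact[OF L(1) continuous_on_subset[OF C1c_continuous_grad[OF G(1)] subset_UNIV]] by blast
  have "norm (G y) \<le> C" for y using C L(4)[of y] by (cases "y \<in> L") auto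
  then show ?thesis using that[OF G C(1)] by blast
qed

lemma C1c_rescale:
  assumes f: "C1c UNIV f F" "\<And>y. y \<notin> cball 0 2 \<Longrightarrow> f y = 0" and d: "d > 0" "cball c (2 * d) \<subseteq> \<Omega>"
  shows "C1c \<Omega> (\<lambda>x. f ((1 / d) *\<^sub>R (x - c))) (\<lambda>x. (1 / d) *\<^sub>R F ((1 / d) *\<^sub>R (x - c)))"
proof (rule C1cI[OF compact_cball d(2)])
  show "f ((1 / d) *\<^sub>R (x - c)) = 0" if "x \<notin> cball c (2 * d)" for x
  proof (rule f(2))
    have "norm (x - c) > 2 * d" using that by (simp add: dist_norm norm_minus_commute)
    then show "(1 / d) *\<^sub>R (x - c) \<notin> cball 0 2" using d by (simp add: pos_divide_le_eq)
  qed
  show "((\<lambda>x. f ((1 / d) *\<^sub>R (x - c))) has_derivative (\<lambda>h. ((1 / d) *\<^sub>R F ((1 / d) *\<^sub>R (x - c))) \<bullet> h)) (at x)" for x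
  proof -
    have 1: "((\<lambda>x. (1 / d) *\<^sub>R (x - c)) has_derivative (\<lambda>h. (1 / d) *\<^sub>R h)) (at x)"
      by (auto intro!: derivative_eq_intros)
    show ?thesis by (rule has_derivative_eq_rhs[OF has_derivative_compose[OF 1 C1c_deriv[OF f(1)]]]) simp
  qed
  show "continuous_on UNIV (\<lambda>x. (1 / d) *\<^sub>R F ((1 / d) *\<^sub>R (x - c)))"
    by (intro continuous_intros continuous_on_compose2[OF C1c_continuous_grad[OF f(1)]]) auto
qed

context varsol begin

text \<open>\<open>U * p\<close> is half the gradient of U^2. Integrating its cross product with the
  gradient \<open>G\<close> by parts, both terms give the same mixed second derivative and
  cancel.\<close>

lemma curl_identity:
  assumes B: "\<And>j. C1c \<Omega> (\<lambda>x. G x $ j) (H j)" "\<And>x j k. H j x $ k = H k x $ j"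
  shows "has_bochner_integral lborel (\<lambda>x. U x * (p x $ 1 * G x $ 2 - p x $ 2 * G x $ 1)) 0"
proof -
  have i: "has_bochner_integral lborel (\<lambda>x. U x * p x $ k * G x $ j) (\<integral>x. U x * p x $ k * G x $ j \<partial>lborel)" for j k
    by (rule has_bochner_integral_integrable[OF loc_int_mult_test(1)[OF loc_int_Up B(1)]])
  have "has_bochner_integral lborel (\<lambda>x. U x * p x $ 1 * G x $ 2 - U x * p x $ 2 * G x $ 1)
     ((\<integral>x. U x * p x $ 1 * G x $ 2 \<partial>lborel) - (\<integral>x. U x * p x $ 2 * G x $ 1 \<partial>lborel))"
    by (rule has_bochner_integral_diff[OF i i])
  moreover have "(\<integral>x. U x * p x $ 1 * G x $ 2 \<partial>lborel) = (\<integral>x. U x * p x $ 2 * G x $ 1 \<partial>lborel)"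
    using U_sq_by_parts[OF B(1)[of 2], of 1] U_sq_by_parts[OF B(1)[of 1], of 2] B(2)[of 2 _ 1] by simp
  ultimately show ?thesis by (simp add: algebra_simps)
qed

lemma loc_int_dev: "loc_int (\<lambda>x. (rad c x - N * U x)\<^sup>2)"
proof -
  have "loc_int (\<lambda>x. ((rad c x)\<^sup>2 + (U x * rad c x) * (- 2 * N)) + (U x)\<^sup>2 * N\<^sup>2)"
    by (intro loc_int_add loc_int_times_continuous loc_int_rad2 loc_int_Urad loc_int_U2 continuous_intros)
  then show ?thesis by (simp add: power2_eq_square algebra_simps)
qed

text \<open>The stress identity for \<open>i * B\<close> times the rotation about \<open>c\<close>.
  The part \<open>N * U\<close> of \<open>rad\<close> drops out by \<open>curl_identity\<close>, and
  Young's inequality bounds the part with the deviation. Its weight \<mu> stays free until the sizes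
  of deviation and energy are known.\<close>

lemma field_energy:
  fixes i N \<mu> :: real
  assumes C: "C1c \<Omega> B G" and B: "\<And>j. C1c \<Omega> (\<lambda>x. G x $ j) (H j)" "\<And>x j k. H j x $ k = H k x $ j"
    and i: "i = 1 \<or> i = -1"
    and sub: "cball c (2 * d) \<subseteq> \<Omega>" and d: "d > 0" and c2: "c $ 2 = 0"
    and Gb: "\<And>x. norm (G x) \<le> M / d" "\<And>x. x \<notin> cball c (2 * d) \<Longrightarrow> G x = 0 \<and> B x = 0" "M > 0"
    and Bb: "\<And>x. x $ 2 > 0 \<Longrightarrow> i * (x - c) $ 1 * B x \<le> k * x $ 2" "k \<ge> 0" and m: "\<mu> > 0"
  shows "- i * (\<integral>x. (norm (p x))\<^sup>2 * ((x - c) $ 1 * G x $ 2 - (x - c) $ 2 * G x $ 1) \<partial>lborel)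
     \<le> (2 * M + k) * bint fE c (2 * d)
       + (M / d) * (\<mu> * bint (\<lambda>x. (rad c x - N * U x)\<^sup>2) c (2 * d) + bint (\<lambda>x. (norm (p x))\<^sup>2) c (2 * d) / \<mu>)"
proof -
  let ?Bl = "cball c (2 * d)"
  let ?\<phi>1 = "\<lambda>x. (- i * (x - c) $ 2) * B x" and ?\<phi>2 = "\<lambda>x. (i * (x - c) $ 1) * B x"
  let ?F1 = "\<lambda>x. B x *\<^sub>R (- i) *\<^sub>R axis 2 1 + (- i * (x - c) $ 2) *\<^sub>R G x"
  let ?F2 = "\<lambda>x. B x *\<^sub>R i *\<^sub>R axis 1 1 + (i * (x - c) $ 1) *\<^sub>R G x"
  have lin: "((\<lambda>x. a * (x - c) $ j) has_derivative (\<lambda>h. (a *\<^sub>R axis j 1) \<bullet> h)) (at x)" for a :: real and j x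
    by (auto intro!: derivative_eq_intros coord_deriv simp: inner_axis' mult.commute)
  have 1: "C1c \<Omega> ?\<phi>1 ?F1" by (rule C1c_times[OF C lin]) simp
  have 2: "C1c \<Omega> ?\<phi>2 ?F2" by (rule C1c_times[OF C lin]) simp
  let ?t = "\<lambda>x. (x - c) $ 1 * G x $ 2 - (x - c) $ 2 * G x $ 1"
  let ?w = "\<lambda>x. p x $ 1 * G x $ 2 - p x $ 2 * G x $ 1"
  let ?e = "\<lambda>x. rad c x - N * U x"
  \<comment> \<open>The rotation generator is antisymmetric, so only the gradient of
    \<open>B\<close> enters the quadratic form. For planar vectors the tangential derivative of
    \<open>u\<close> is then exchanged for \<open>rad\<close>, which reverses the sign in front of
    |p|^2.\<close>
  have st: "stress ?F1 ?F2 x = - i * ((norm (p x))\<^sup>2 * ?t x) + (2 * i) * (?e x * ?w x) + (2 * i * N) * (U x * ?w x)" for x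
    unfolding stress_def norm_sq_pt rad_def inner_pt by (simp add: axis_def power2_eq_square algebra_simps)
  have it: "integrable lborel (\<lambda>x. (norm (p x))\<^sup>2 * ?t x)"
  proof -
    have "integrable lborel (\<lambda>x. ((norm (p x))\<^sup>2 * (x - c) $ 1) * G x $ 2 - ((norm (p x))\<^sup>2 * (x - c) $ 2) * G x $ 1)"
      by (intro Bochner_Integration.integrable_diff loc_int_mult_test(2)[OF _ C] loc_int_times_continuous loc_int_p2 continuous_intros)
    then show ?thesis by (simp add: algebra_simps)
  qed
  have ist: "integrable lborel (\<lambda>x. stress ?F1 ?F2 x)" using stress_integrable[OF 1 2] by simp
  have hc: "has_bochner_integral lborel (\<lambda>x. U x * ?w x) 0" by (rule curl_identity[OF B])
  have ie: "integrable lborel (\<lambda>x. ?e x * ?w x)"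
  proof -
    \<comment> \<open>\<open>st\<close> is solved for the product with the deviation, using
      \<open>i * i = 1\<close>.\<close>
    have "integrable lborel (\<lambda>x. (i / 2) * (stress ?F1 ?F2 x + i * ((norm (p x))\<^sup>2 * ?t x) - (2 * i * N) * (U x * ?w x)))"
      using hc by (intro integrable_mult_right Bochner_Integration.integrable_diff Bochner_Integration.integrable_add ist it) (auto simp: has_bochner_integral_iff)
    moreover have "(i / 2) * (stress ?F1 ?F2 x + i * ((norm (p x))\<^sup>2 * ?t x) - (2 * i * N) * (U x * ?w x)) = ?e x * ?w x" for x
      unfolding st using i by auto
    ultimately show ?thesis by (simp only:)
  qed
  have "has_bochner_integral lborel (\<lambda>x. - i * ((norm (p x))\<^sup>2 * ?t x) + (2 * i) * (?e x * ?w x) + (2 * i * N) * (U x * ?w x))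
     (- i * (\<integral>x. (norm (p x))\<^sup>2 * ?t x \<partial>lborel) + (2 * i) * (\<integral>x. ?e x * ?w x \<partial>lborel) + (2 * i * N) * 0)"
    by (intro has_bochner_integral_add has_bochner_integral_mult_right hc has_bochner_integral_integrable it ie)
  then have eq: "(\<integral>x. stress ?F1 ?F2 x \<partial>lborel) = - i * (\<integral>x. (norm (p x))\<^sup>2 * ?t x \<partial>lborel) + (2 * i) * (\<integral>x. ?e x * ?w x \<partial>lborel)"
    unfolding st by (simp add: has_bochner_integral_integral_eq)
  have tb: "\<bar>?t x\<bar> \<le> 2 * M * indicator ?Bl x" for x
  proof (cases "x \<in> ?Bl")
    case True
    have "(?t x)\<^sup>2 \<le> (norm (x - c))\<^sup>2 * (norm (G x))\<^sup>2"
    proof -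
      \<comment> \<open>Lagrange's identity: the cross product is at most the product of the
        norms.\<close>
      have "(norm (x - c))\<^sup>2 * (norm (G x))\<^sup>2 - (?t x)\<^sup>2 = ((x - c) $ 1 * G x $ 1 + (x - c) $ 2 * G x $ 2)\<^sup>2"
        unfolding norm_sq_pt by (simp add: power2_eq_square algebra_simps)
      then show ?thesis using zero_le_power2[of "(x - c) $ 1 * G x $ 1 + (x - c) $ 2 * G x $ 2"] by linarith
    qed
    then have "\<bar>?t x\<bar> \<le> norm (x - c) * norm (G x)"
      using abs_le_square_iff[of "?t x" "norm (x - c) * norm (G x)"] by (simp add: power_mult_distrib)
    also have "\<dots> \<le> (2 * d) * (M / d)"
      using True Gb(1)[of x] d by (intro mult_mono) (auto simp: dist_norm norm_minus_commute)
    finally show ?thesis using True d by simp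
  qed (use Gb(2) in simp)
  have s_le: "(\<integral>x. stress ?F1 ?F2 x \<partial>lborel) \<le> (2 * M + k) * bint fE c (2 * d)"
  proof -
    have iE: "integrable lborel (\<lambda>x. indicator E x * (x $ 2 * (?F1 x $ 1 + ?F2 x $ 2) + ?\<phi>2 x))"
    proof -
      have "integrable lborel (\<lambda>x. x $ 2 * ?F1 x $ 1 + x $ 2 * ?F2 x $ 2 + 1 * ?\<phi>2 x)"
        by (intro Bochner_Integration.integrable_add loc_int_mult_test[OF _ 1] loc_int_mult_test[OF _ 2] loc_int_continuous continuous_intros)
      from integrable_mult_indicator[OF _ this, of E] show ?thesis
        by (simp add: distrib_left)
    qed
    have "(\<integral>x. stress ?F1 ?F2 x \<partial>lborel) = (\<integral>x. indicator E x * (x $ 2 * (?F1 x $ 1 + ?F2 x $ 2) + ?\<phi>2 x) \<partial>lborel)"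
      by (rule stress_identity[OF 1 2])
    also have "\<dots> \<le> (\<integral>x. (2 * M + k) * (indicator ?Bl x * fE x) \<partial>lborel)"
    proof (rule integral_mono[OF iE])
      show "integrable lborel (\<lambda>x. (2 * M + k) * (indicator ?Bl x * fE x))"
        by (intro integrable_mult_right bint_integrable loc_int_fE sub)
      fix x
      show "indicator E x * (x $ 2 * (?F1 x $ 1 + ?F2 x $ 2) + ?\<phi>2 x) \<le> (2 * M + k) * (indicator ?Bl x * fE x)"
      proof (cases "x \<in> E \<and> x \<in> ?Bl")
        case True
        then have x2: "x $ 2 > 0" by (simp add: E_def)
        have "?F1 x $ 1 + ?F2 x $ 2 = i * ?t x" by (simp add: axis_def algebra_simps)
        also have "\<dots> \<le> 2 * M" using tb[of x] i True by (auto simp: abs_le_iff)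
        finally have "x $ 2 * (?F1 x $ 1 + ?F2 x $ 2) \<le> x $ 2 * (2 * M)" using x2 by (intro mult_left_mono) auto
        moreover have "?\<phi>2 x \<le> k * x $ 2" by (rule Bb(1)[OF x2])
        ultimately show ?thesis using True by (simp add: fE_def algebra_simps)
      next
        case False
        show ?thesis
        proof (cases "x \<in> ?Bl")
          case True then show ?thesis using False by (simp add: fE_def)
        next
          case out: False
          then show ?thesis using Gb(2)[OF out] by simp
        qed
      qed
    qed
    finally show ?thesis by (simp add: bint_def)
  qed
  have "\<bar>2 * i * (\<integral>x. ?e x * ?w x \<partial>lborel)\<bar> = 2 * \<bar>\<integral>x. ?e x * ?w x \<partial>lborel\<bar>" using i by (auto simp: abs_mult)
  also have "\<dots> \<le> 2 * (\<integral>x. \<bar>?e x * ?w x\<bar> \<partial>lborel)" by (intro mult_left_mono integral_abs_bound) simp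
  also have "\<dots> \<le> 2 * (\<integral>x. (M / d / 2) * (\<mu> * (indicator ?Bl x * (?e x)\<^sup>2) + (1 / \<mu>) * (indicator ?Bl x * (norm (p x))\<^sup>2)) \<partial>lborel)"
  proof (intro mult_left_mono integral_mono)
    show "integrable lborel (\<lambda>x. \<bar>?e x * ?w x\<bar>)" by (rule integrable_abs[OF ie])
    show "integrable lborel (\<lambda>x. (M / d / 2) * (\<mu> * (indicator ?Bl x * (?e x)\<^sup>2) + (1 / \<mu>) * (indicator ?Bl x * (norm (p x))\<^sup>2)))"
      by (intro integrable_mult_right Bochner_Integration.integrable_add bint_integrable loc_int_dev loc_int_p2 sub)
    fix x
    show "\<bar>?e x * ?w x\<bar> \<le> (M / d / 2) * (\<mu> * (indicator ?Bl x * (?e x)\<^sup>2) + (1 / \<mu>) * (indicator ?Bl x * (norm (p x))\<^sup>2))"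
    proof (cases "x \<in> ?Bl")
      case True
      have "(?w x)\<^sup>2 \<le> (norm (p x))\<^sup>2 * (norm (G x))\<^sup>2"
      proof -
        have "(norm (p x))\<^sup>2 * (norm (G x))\<^sup>2 - (?w x)\<^sup>2 = (p x $ 1 * G x $ 1 + p x $ 2 * G x $ 2)\<^sup>2"
          unfolding norm_sq_pt by (simp add: power2_eq_square algebra_simps)
        then show ?thesis using zero_le_power2[of "p x $ 1 * G x $ 1 + p x $ 2 * G x $ 2"] by linarith
      qed
      then have "\<bar>?w x\<bar> \<le> norm (p x) * norm (G x)"
        using abs_le_square_iff[of "?w x" "norm (p x) * norm (G x)"] by (simp add: power_mult_distrib)
      also have "\<dots> \<le> norm (p x) * (M / d)" using Gb(1)[of x] by (intro mult_left_mono) auto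
      finally have "\<bar>?e x * ?w x\<bar> \<le> \<bar>?e x\<bar> * (norm (p x) * (M / d))" unfolding abs_mult by (intro mult_left_mono) auto
      also have "\<dots> = (M / d / 2) * (2 * (\<bar>?e x\<bar> * norm (p x)))" by simp
      also have "\<dots> \<le> (M / d / 2) * (\<mu> * \<bar>?e x\<bar>\<^sup>2 + (1 / \<mu>) * (norm (p x))\<^sup>2)"
      proof (intro mult_left_mono)
        \<comment> \<open>Young's inequality, multiplied by \<mu>.\<close>
        have "0 \<le> (\<mu> * \<bar>?e x\<bar> - norm (p x))\<^sup>2" by simp
        then have "2 * (\<bar>?e x\<bar> * norm (p x)) * \<mu> \<le> (\<mu> * \<bar>?e x\<bar>\<^sup>2 + (1 / \<mu>) * (norm (p x))\<^sup>2) * \<mu>"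
          using m by (simp add: power2_eq_square algebra_simps)
        then show "2 * (\<bar>?e x\<bar> * norm (p x)) \<le> \<mu> * \<bar>?e x\<bar>\<^sup>2 + (1 / \<mu>) * (norm (p x))\<^sup>2"
          by (rule mult_right_le_imp_le[OF _ m])
      qed (use Gb(3) d in simp)
      finally show ?thesis using True by simp
    next
      case False
      then show ?thesis using Gb(2)[OF False] by simp
    qed
  qed simp
  also have "\<dots> = (M / d) * (\<mu> * bint (\<lambda>x. (?e x)\<^sup>2) c (2 * d) + bint (\<lambda>x. (norm (p x))\<^sup>2) c (2 * d) / \<mu>)"
  proof -
    have hb: "has_bochner_integral lborel (\<lambda>x. (M / d / 2) * (\<mu> * (indicator ?Bl x * (?e x)\<^sup>2) + (1 / \<mu>) * (indicator ?Bl x * (norm (p x))\<^sup>2)))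
       ((M / d / 2) * (\<mu> * bint (\<lambda>x. (?e x)\<^sup>2) c (2 * d) + (1 / \<mu>) * bint (\<lambda>x. (norm (p x))\<^sup>2) c (2 * d)))"
      unfolding bint_def
      by (intro has_bochner_integral_mult_right has_bochner_integral_add has_bochner_integral_integrable bint_integrable loc_int_dev loc_int_p2 sub)
    show ?thesis unfolding has_bochner_integral_integral_eq[OF hb] by simp
  qed
  finally show ?thesis using s_le eq by linarith
qed

end

section \<open>Localisation to the annulus and the radial cutoff\<close>

lemma etaf_continuous: "continuous_on S (\<lambda>x. etaf s ((1 / d) *\<^sub>R (x - c)))"
  unfolding etaf_def sqn_def divide_inverse by (intro pp_continuous continuous_intros)

lemma etaf_rescaled_zero:
  assumes "0 < s" "s \<le> 1 / 8" "d > 0" "x \<notin> cball c (2 * d)"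
  shows "etaf s ((1 / d) *\<^sub>R (x - c)) = 0"
proof (rule ccontr)
  assume "etaf s ((1 / d) *\<^sub>R (x - c)) \<noteq> 0"
  from etaf_support[OF this assms(1)] have "sqn ((1 / d) *\<^sub>R (x - c)) < 1 + s" by linarith
  then have "(norm (x - c) / d)\<^sup>2 \<le> 2\<^sup>2" using assms by (simp add: sqn_norm)
  then have "norm (x - c) / d \<le> 2" by (rule power2_le_imp_le) simp
  then show False using assms by (simp add: dist_norm norm_minus_commute pos_divide_le_eq)
qed

text \<open>The derivative of the step lives where |y|^2 differs from 1 by at most
  \<open>s / 2\<close>, and there \<open>etaf\<close> is at least (3/4)^3. The constant 48 fits
  these bounds exactly: 2 * 9 * 9/8 = 48 * 27/64.\<close>

lemma radial_cutoff_weight: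
  assumes "0 < s" "s \<le> 1 / 8"
  shows "2 * stp' ((sqn y - 1 + s / 2) / s) / s * sqn y \<le> (48 / s) * etaf s y"
proof (cases "stp' ((sqn y - 1 + s / 2) / s) = 0")
  case True
  then show ?thesis using assms etaf_bounds(1)[of s y] by simp
next
  case False
  then have "0 < (sqn y - 1 + s / 2) / s" "(sqn y - 1 + s / 2) / s < 1" 
    using stp'_zero[of "(sqn y - 1 + s / 2) / s"] by (meson not_le)+
  then have "0 < sqn y - 1 + s / 2" "sqn y - 1 + s / 2 < s" using assms by (auto simp: zero_less_divide_iff)
  then have l: "\<bar>sqn y - 1\<bar> \<le> s / 2" by linarith
  then have "\<bar>(sqn y - 1) / s\<bar> \<le> 1 / 2" using assms by (simp add: abs_divide pos_divide_le_eq)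
  then have "\<bar>(sqn y - 1) / s\<bar>\<^sup>2 \<le> (1 / 2)\<^sup>2" by (intro power_mono) auto
  then have "3 / 4 \<le> 1 - ((sqn y - 1) / s)\<^sup>2" unfolding power2_abs by (simp add: power2_eq_square)
  then have "(3 / 4) ^ 3 \<le> etaf s y" unfolding etaf_def pp_def by (intro power_mono) auto
  then have e: "27 / 64 \<le> etaf s y" by (simp add: eval_nat_numeral)
  have "stp' ((sqn y - 1 + s / 2) / s) * sqn y \<le> 9 * (9 / 8)"
  proof (intro mult_mono stp'_le)
    show "sqn y \<le> 9 / 8" using l assms by linarith
  qed (auto simp: sqn_def)
  then have "2 * (stp' ((sqn y - 1 + s / 2) / s) * sqn y) \<le> 48 * etaf s y" using e by linarith
  then have "2 * (stp' ((sqn y - 1 + s / 2) / s) * sqn y) / s \<le> 48 * etaf s y / s"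
    using assms by (intro divide_right_mono) auto
  then show ?thesis by simp
qed

lemma radial_cutoff_zero:
  assumes "0 < s" "s \<le> 1 / 8" "y \<notin> cball 0 2"
  shows "1 - stp ((sqn y - 1 + s / 2) / s) = 0"
proof -
  have "norm y > 2" using assms by simp
  then have "2\<^sup>2 \<le> (norm y)\<^sup>2" by (intro power_mono) auto
  then have "4 \<le> sqn y" by (simp add: sqn_norm)
  then have "(sqn y - 1 + s / 2) / s \<ge> 1" using assms by simp
  then show ?thesis by (simp add: stp_one)
qed

lemma radial_cutoff:
  assumes "0 < s" "s \<le> 1 / 8"
  shows "C1c UNIV (\<lambda>y. 1 - stp ((sqn y - 1 + s / 2) / s)) (\<lambda>y. - (2 * stp' ((sqn y - 1 + s / 2) / s) / s) *\<^sub>R y)"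
proof (rule C1cI[of "cball 0 2"])
  show "1 - stp ((sqn y - 1 + s / 2) / s) = 0" if "y \<notin> cball 0 2" for y
    by (rule radial_cutoff_zero[OF assms that])
  show "((\<lambda>y. 1 - stp ((sqn y - 1 + s / 2) / s)) has_derivative
      (\<lambda>h. (- (2 * stp' ((sqn y - 1 + s / 2) / s) / s) *\<^sub>R y) \<bullet> h)) (at y)" for y
  proof -
    have 1: "((\<lambda>y. (sqn y - 1 + s / 2) / s) has_derivative (\<lambda>h. (2 * y $ 1 * h $ 1 + 2 * y $ 2 * h $ 2) / s)) (at y)"
      unfolding sqn_def divide_inverse
      by (auto intro!: derivative_eq_intros coord_deriv simp: fun_eq_iff algebra_simps power2_eq_square)
    have 2: "((\<lambda>y. stp ((sqn y - 1 + s / 2) / s)) has_derivative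
       (\<lambda>h. stp' ((sqn y - 1 + s / 2) / s) * ((2 * y $ 1 * h $ 1 + 2 * y $ 2 * h $ 2) / s))) (at y)"
      by (rule has_derivative_eq_rhs[OF has_derivative_compose[OF 1 stp_deriv[unfolded has_field_derivative_def]]]) simp
    show ?thesis
      by (rule has_derivative_eq_rhs[OF has_derivative_diff[OF has_derivative_const 2]])
        (use assms in \<open>auto simp: fun_eq_iff inner_vec_def sum_2 field_simps\<close>)
  qed
  show "continuous_on UNIV (\<lambda>y. - (2 * stp' ((sqn y - 1 + s / 2) / s) / s) *\<^sub>R y)"
    unfolding stp'_def sqn_def divide_inverse by (intro continuous_intros pp_continuous)
qed auto

context varsol begin

subsection \<open>Energy in an annulus\<close>

text \<open>\<open>C\<close> bounds the gradient of \<open>Bf\<close> at unit scale, hence depends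
  on \<open>i\<close> and \<open>s\<close> alone; rescaling makes the estimate uniform in the
  center, the scale, \<open>N\<close> and \<mu>.\<close>

lemma annulus_energy_upper:
  assumes i: "i = 1 \<or> i = -1" and s: "0 < s" "s \<le> 1 / 12"
  shows "\<exists>C>0. \<forall>c d N \<mu>. cball c (2 * d) \<subseteq> \<Omega> \<longrightarrow> d > 0 \<longrightarrow> c $ 2 = 0 \<longrightarrow> \<mu> > 0 \<longrightarrow>
      bint (\<lambda>x. (norm (p x))\<^sup>2 * etaf s ((1 / d) *\<^sub>R (x - c))) c (2 * d) / 4
       \<le> (400 / s) * bint (\<lambda>x. (norm (p x))\<^sup>2) (c + d *\<^sub>R vector [i, 0]) (4 * s * d)
         + (2 * C + 5 / s) * bint fE c (2 * d)
         + (C / d) * (\<mu> * bint (\<lambda>x. (rad c x - N * U x)\<^sup>2) c (2 * d) + bint (\<lambda>x. (norm (p x))\<^sup>2) c (2 * d) / \<mu>)"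
proof -
  have s8: "s \<le> 1 / 8" using s by simp
  obtain G H C where G: "C1c UNIV (Bf i s) G" "\<And>j. C1c UNIV (\<lambda>x. G x $ j) (H j)" "\<And>x j k. H j x $ k = H k x $ j"
    and C: "C > 0" "\<And>y. norm (G y) \<le> C"
    using unit_field[OF s(1) s8] by metis
  have Gz: "G y = 0" if "y \<notin> cball 0 2" for y
    using has_derivative_inner_unique[OF C1c_deriv[OF G(1)] has_derivative_zero_off_closed[OF closed_cball Bf_support[OF s(1) s8] that]] by blast
  show ?thesis
  proof (intro exI[of _ C] conjI allI impI C(1))
    fix c d N \<mu>
    assume sub: "cball c (2 * d) \<subseteq> \<Omega>" and d: "d > 0" and c2: "c $ 2 = 0" and m: "(\<mu>::real) > 0"
    let ?y = "\<lambda>x. (1 / d) *\<^sub>R (x - c)"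
    let ?B = "\<lambda>x. Bf i s (?y x)" and ?G = "\<lambda>x. (1 / d) *\<^sub>R G (?y x)"
    let ?H = "\<lambda>j x. (1 / d) *\<^sub>R (1 / d) *\<^sub>R H j (?y x)"
    let ?z = "c + d *\<^sub>R vector [i, 0]"
    have CB: "C1c \<Omega> ?B ?G" by (rule C1c_rescale[OF G(1) Bf_support[OF s(1) s8] d sub])
    have CG: "C1c \<Omega> (\<lambda>x. ?G x $ j) (?H j)" for j
    proof -
      have "C1c \<Omega> (\<lambda>x. G (?y x) $ j) (\<lambda>x. (1 / d) *\<^sub>R H j (?y x))"
        by (rule C1c_rescale[OF G(2) _ d sub]) (simp add: Gz)
      from C1c_times[OF this, of "\<lambda>x. 1 / d" "\<lambda>x. 0"] show ?thesis by simp
    qed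
    have out: "?y x \<notin> cball 0 2" if "x \<notin> cball c (2 * d)" for x
      using that d by (simp add: dist_norm norm_minus_commute pos_divide_le_eq)
    have fe: "- i * (\<integral>x. (norm (p x))\<^sup>2 * ((x - c) $ 1 * ?G x $ 2 - (x - c) $ 2 * ?G x $ 1) \<partial>lborel)
     \<le> (2 * C + 5 / s) * bint fE c (2 * d)
       + (C / d) * (\<mu> * bint (\<lambda>x. (rad c x - N * U x)\<^sup>2) c (2 * d) + bint (\<lambda>x. (norm (p x))\<^sup>2) c (2 * d) / \<mu>)"
    proof (rule field_energy[OF CB CG _ i sub d c2 _ _ C(1) _ _ m])
      show "?H j x $ k = ?H k x $ j" for x j k using G(3) by simp
      show "norm (?G x) \<le> C / d" for x using C(2) d by (simp add: divide_right_mono)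
      show "?G x = 0 \<and> ?B x = 0" if "x \<notin> cball c (2 * d)" for x
        using Gz[OF out[OF that]] Bf_support[OF s(1) s8 out[OF that]] by simp
      show "0 \<le> 5 / s" using s by simp
      show "i * (x - c) $ 1 * ?B x \<le> 5 / s * x $ 2" if "x $ 2 > 0" for x
      proof -
        have "i * ?y x $ 1 * ?B x \<le> (5 / s) * ?y x $ 2"
          by (rule Bf_vertical_bound[OF i s(1) s8]) (use that c2 d in simp)
        then have "d * (i * ?y x $ 1 * ?B x) \<le> d * ((5 / s) * ?y x $ 2)" using d by (intro mult_left_mono) auto
        then show ?thesis using d c2 by simp
      qed
    qed
    have zsub: "cball ?z (4 * s * d) \<subseteq> cball c (2 * d)"
    proof
      fix x assume "x \<in> cball ?z (4 * s * d)"
      then have 1: "dist ?z x \<le> 4 * s * d" by simp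
      have "dist c ?z = d" using i d by (auto simp: dist_norm norm_eq_sqrt_inner inner_vec_def sum_2)
      moreover have "4 * s * d \<le> d" using s d by simp
      ultimately show "x \<in> cball c (2 * d)" using 1 dist_triangle[of c x ?z] by simp
    qed
    let ?t = "\<lambda>x. (x - c) $ 1 * ?G x $ 2 - (x - c) $ 2 * ?G x $ 1"
    have it: "integrable lborel (\<lambda>x. (norm (p x))\<^sup>2 * ?t x)"
    proof -
      have "integrable lborel (\<lambda>x. ((norm (p x))\<^sup>2 * (x - c) $ 1) * ?G x $ 2 - ((norm (p x))\<^sup>2 * (x - c) $ 2) * ?G x $ 1)"
        by (intro Bochner_Integration.integrable_diff loc_int_mult_test(2)[OF _ CB] loc_int_times_continuous loc_int_p2 continuous_intros)
      then show ?thesis by (simp only: right_diff_distrib mult.assoc)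
    qed
    have ie: "integrable lborel (\<lambda>x. indicator (cball c (2 * d)) x * ((norm (p x))\<^sup>2 * etaf s (?y x)))"
      by (intro bint_integrable sub loc_int_times_continuous loc_int_p2 etaf_continuous)
    have iz: "integrable lborel (\<lambda>x. indicator (cball ?z (4 * s * d)) x * (norm (p x))\<^sup>2)"
      using zsub sub by (intro bint_integrable loc_int_p2) auto
    have "(\<integral>x. (indicator (cball c (2 * d)) x * ((norm (p x))\<^sup>2 * etaf s (?y x))) / 4
        - (400 / s) * (indicator (cball ?z (4 * s * d)) x * (norm (p x))\<^sup>2) \<partial>lborel)
      \<le> (\<integral>x. (- i) * ((norm (p x))\<^sup>2 * ?t x) \<partial>lborel)"
    proof (rule integral_mono)
      show "integrable lborel (\<lambda>x. (indicator (cball c (2 * d)) x * ((norm (p x))\<^sup>2 * etaf s (?y x))) / 4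
        - (400 / s) * (indicator (cball ?z (4 * s * d)) x * (norm (p x))\<^sup>2))"
        by (intro Bochner_Integration.integrable_diff integrable_mult_right integrable_divide_zero ie iz)
      show "integrable lborel (\<lambda>x. (- i) * ((norm (p x))\<^sup>2 * ?t x))" by (intro integrable_mult_right it)
      fix x
      show "(indicator (cball c (2 * d)) x * ((norm (p x))\<^sup>2 * etaf s (?y x))) / 4
        - (400 / s) * (indicator (cball ?z (4 * s * d)) x * (norm (p x))\<^sup>2) \<le> (- i) * ((norm (p x))\<^sup>2 * ?t x)"
      proof (cases "x $ 2 > 0")
        case False
        \<comment> \<open>On and below the axis \<open>p\<close> vanishes, so the sign of the
          angular derivative matters only above it.\<close>
        then have "p x = 0" using P_pos[of x] by (cases "x \<in> P") (auto simp: p_def)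
        then show ?thesis by simp
      next
        case True
        have t: "?t x = dt G (?y x)" by (simp add: dt_def)
        have "- i * dt G (?y x) \<ge> etaf s (?y x) / 4 - (400 / s) * indicator (cball (vector [i, 0]) (4 * s)) (?y x)"
          by (rule Bf_rot_deriv[OF i s(1) s8 _ C1c_deriv[OF G(1)]]) (use True d c2 in simp)
        also have "indicator (cball (vector [i, 0]) (4 * s)) (?y x) = (indicator (cball ?z (4 * s * d)) x :: real)"
        proof -
          have "?z - x = d *\<^sub>R (vector [i, 0] - ?y x)" using d by (simp add: algebra_simps)
          then have "dist ?z x = d * dist (vector [i, 0]) (?y x)" using d by (simp add: dist_norm)
          then have "x \<in> cball ?z (4 * s * d) \<longleftrightarrow> ?y x \<in> cball (vector [i, 0]) (4 * s)"
            using d by (simp add: mult.commute[of _ d])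
          then show ?thesis by (simp add: indicator_def)
        qed
        finally have "(norm (p x))\<^sup>2 * (etaf s (?y x) / 4 - (400 / s) * indicator (cball ?z (4 * s * d)) x)
           \<le> (norm (p x))\<^sup>2 * (- i * ?t x)" unfolding t by (intro mult_left_mono) auto
        moreover have "indicator (cball c (2 * d)) x * ((norm (p x))\<^sup>2 * etaf s (?y x)) = (norm (p x))\<^sup>2 * etaf s (?y x)"
          using etaf_rescaled_zero[OF s(1) s8 d, of x c] by (cases "x \<in> cball c (2 * d)") auto
        moreover have "(norm (p x))\<^sup>2 * (etaf s (?y x) / 4 - (400 / s) * indicator (cball ?z (4 * s * d)) x)
          = (norm (p x))\<^sup>2 * etaf s (?y x) / 4 - (400 / s) * (indicator (cball ?z (4 * s * d)) x * (norm (p x))\<^sup>2)"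
          by (simp only: right_diff_distrib times_divide_eq_right mult_ac)
        moreover have "(norm (p x))\<^sup>2 * (- i * ?t x) = (- i) * ((norm (p x))\<^sup>2 * ?t x)" by (simp only: mult_ac)
        ultimately show ?thesis by (simp only:)
      qed
    qed
    also have "(\<integral>x. (indicator (cball c (2 * d)) x * ((norm (p x))\<^sup>2 * etaf s (?y x))) / 4
        - (400 / s) * (indicator (cball ?z (4 * s * d)) x * (norm (p x))\<^sup>2) \<partial>lborel)
      = bint (\<lambda>x. (norm (p x))\<^sup>2 * etaf s (?y x)) c (2 * d) / 4 - (400 / s) * bint (\<lambda>x. (norm (p x))\<^sup>2) ?z (4 * s * d)"
      unfolding bint_def
      by (rule has_bochner_integral_integral_eq)
        (intro has_bochner_integral_diff has_bochner_integral_mult_right has_bochner_integral_divide_zero has_bochner_integral_integrable ie iz)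
    also have "(\<integral>x. (- i) * ((norm (p x))\<^sup>2 * ?t x) \<partial>lborel) = - i * (\<integral>x. (norm (p x))\<^sup>2 * ?t x \<partial>lborel)" by simp
    finally show "bint (\<lambda>x. (norm (p x))\<^sup>2 * etaf s (?y x)) c (2 * d) / 4
       \<le> (400 / s) * bint (\<lambda>x. (norm (p x))\<^sup>2) ?z (4 * s * d)
         + (2 * C + 5 / s) * bint fE c (2 * d)
         + (C / d) * (\<mu> * bint (\<lambda>x. (rad c x - N * U x)\<^sup>2) c (2 * d) + bint (\<lambda>x. (norm (p x))\<^sup>2) c (2 * d) / \<mu>)"
      using fe by linarith
  qed
qed

text \<open>Flux through the annulus: integrate U^2 by parts against \<open>x - c\<close> times a
  cutoff falling from 1 to 0 across it. Up to the deviation the interior integrand is a positive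
  multiple of U^2, and the remaining term is the flux, at most of order 1 / s times the mass in the
  annulus.\<close>

lemma annulus_mass_lower:
  assumes s: "0 < s" "s \<le> 1 / 12" and sub: "cball c (2 * d) \<subseteq> \<Omega>" and d: "d > 0" and N: "N \<ge> 3 / 2"
  shows "bint (\<lambda>x. (U x)\<^sup>2) c (d / 2) \<le> bint (\<lambda>x. (rad c x - N * U x)\<^sup>2) c (2 * d)
     + (48 / s) * bint (\<lambda>x. (U x)\<^sup>2 * etaf s ((1 / d) *\<^sub>R (x - c))) c (2 * d)"
proof -
  have s8: "s \<le> 1 / 8" using s by simp
  let ?y = "\<lambda>x. (1 / d) *\<^sub>R (x - c)"
  let ?f = "\<lambda>y. 1 - stp ((sqn y - 1 + s / 2) / s)" and ?k = "\<lambda>y. 2 * stp' ((sqn y - 1 + s / 2) / s) / s"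
  let ?a = "\<lambda>x. ?f (?y x)" and ?A = "\<lambda>x. (1 / d) *\<^sub>R (- ?k (?y x) *\<^sub>R ?y x)"
  let ?e = "\<lambda>x. rad c x - N * U x"
  have fz: "?f y = 0" if "y \<notin> cball 0 2" for y by (rule radial_cutoff_zero[OF s(1) s8 that])
  have Ca: "C1c \<Omega> ?a ?A" by (rule C1c_rescale[OF radial_cutoff[OF s(1) s8] fz d sub])
  have az: "?a x = 0" if "x \<notin> cball c (2 * d)" for x
    by (rule fz) (use that d in \<open>simp add: dist_norm norm_minus_commute pos_divide_le_eq\<close>)
  let ?\<psi> = "\<lambda>j x. (x - c) $ j * ?a x" and ?F = "\<lambda>j x. ?a x *\<^sub>R axis j 1 + (x - c) $ j *\<^sub>R ?A x"
  have lin: "((\<lambda>x. (x - c) $ j) has_derivative (\<lambda>h. axis j 1 \<bullet> h)) (at x)" for j x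
    by (auto intro!: derivative_eq_intros coord_deriv simp: inner_axis')
  have C: "C1c \<Omega> (?\<psi> j) (?F j)" for j by (rule C1c_times[OF Ca lin]) simp
  have hL: "has_bochner_integral lborel (\<lambda>x. (U x)\<^sup>2 * ?F j x $ j) (- 2 * (\<integral>x. U x * p x $ j * ?\<psi> j x \<partial>lborel))" for j
    unfolding U_sq_by_parts[OF C, symmetric] by (rule has_bochner_integral_integrable[OF loc_int_mult_test(2)[OF loc_int_U2 C]])
  have hR: "has_bochner_integral lborel (\<lambda>x. U x * p x $ j * ?\<psi> j x) (\<integral>x. U x * p x $ j * ?\<psi> j x \<partial>lborel)" for j
    by (rule has_bochner_integral_integrable[OF loc_int_mult_test(1)[OF loc_int_Up C]])
  have "has_bochner_integral lborel (\<lambda>x. ((U x)\<^sup>2 * ?F 1 x $ 1 + (U x)\<^sup>2 * ?F 2 x $ 2)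
        + 2 * (U x * p x $ 1 * ?\<psi> 1 x + U x * p x $ 2 * ?\<psi> 2 x))
     ((- 2 * (\<integral>x. U x * p x $ 1 * ?\<psi> 1 x \<partial>lborel) + - 2 * (\<integral>x. U x * p x $ 2 * ?\<psi> 2 x \<partial>lborel))
        + 2 * ((\<integral>x. U x * p x $ 1 * ?\<psi> 1 x \<partial>lborel) + (\<integral>x. U x * p x $ 2 * ?\<psi> 2 x \<partial>lborel)))"
    by (intro has_bochner_integral_add has_bochner_integral_mult_right hL hR)
  \<comment> \<open>\<open>rad\<close> is split into the deviation and \<open>N * U\<close>; the
    left-hand side is the integrand whose integral vanishes.\<close>
  moreover have "((U x)\<^sup>2 * ?F 1 x $ 1 + (U x)\<^sup>2 * ?F 2 x $ 2)
        + 2 * (U x * p x $ 1 * ?\<psi> 1 x + U x * p x $ 2 * ?\<psi> 2 x)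
      = ((2 + 2 * N) * (U x)\<^sup>2 + 2 * U x * ?e x) * ?a x - (U x)\<^sup>2 * (?k (?y x) * sqn (?y x))" for x
  proof -
    have 1: "?F 1 x $ 1 + ?F 2 x $ 2 = 2 * ?a x - ?k (?y x) * sqn (?y x)"
      using d by (simp add: sqn_def axis_def power2_eq_square divide_simps) (simp add: algebra_simps)
    have 2: "p x $ 1 * ?\<psi> 1 x + p x $ 2 * ?\<psi> 2 x = rad c x * ?a x" by (simp add: rad_def inner_pt algebra_simps)
    have "((U x)\<^sup>2 * ?F 1 x $ 1 + (U x)\<^sup>2 * ?F 2 x $ 2) + 2 * (U x * p x $ 1 * ?\<psi> 1 x + U x * p x $ 2 * ?\<psi> 2 x)
      = (U x)\<^sup>2 * (?F 1 x $ 1 + ?F 2 x $ 2) + 2 * U x * (p x $ 1 * ?\<psi> 1 x + p x $ 2 * ?\<psi> 2 x)"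
      by (simp only: distrib_left distrib_right mult.assoc)
    also have "\<dots> = ((2 + 2 * N) * (U x)\<^sup>2 + 2 * U x * ?e x) * ?a x - (U x)\<^sup>2 * (?k (?y x) * sqn (?y x))"
      unfolding 1 2 by (simp only: power2_eq_square) algebra
    finally show ?thesis .
  qed
  ultimately have h0: "has_bochner_integral lborel
      (\<lambda>x. ((2 + 2 * N) * (U x)\<^sup>2 + 2 * U x * ?e x) * ?a x - (U x)\<^sup>2 * (?k (?y x) * sqn (?y x))) 0"
    by (simp only:) simp
  have sub2: "cball c (d / 2) \<subseteq> \<Omega>" using sub subset_cball[of "d / 2" "2 * d" c] d by auto
  have i1: "integrable lborel (\<lambda>x. indicator (cball c (d / 2)) x * (U x)\<^sup>2)" by (intro bint_integrable loc_int_U2 sub2)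
  have i2: "integrable lborel (\<lambda>x. indicator (cball c (2 * d)) x * (?e x)\<^sup>2)" by (intro bint_integrable loc_int_dev sub)
  have i3: "integrable lborel (\<lambda>x. indicator (cball c (2 * d)) x * ((U x)\<^sup>2 * etaf s (?y x)))"
    by (intro bint_integrable sub loc_int_times_continuous loc_int_U2 etaf_continuous)
  have hb: "has_bochner_integral lborel (\<lambda>x. indicator (cball c (d / 2)) x * (U x)\<^sup>2 - indicator (cball c (2 * d)) x * (?e x)\<^sup>2
        - (48 / s) * (indicator (cball c (2 * d)) x * ((U x)\<^sup>2 * etaf s (?y x))))
      (bint (\<lambda>x. (U x)\<^sup>2) c (d / 2) - bint (\<lambda>x. (?e x)\<^sup>2) c (2 * d) - (48 / s) * bint (\<lambda>x. (U x)\<^sup>2 * etaf s (?y x)) c (2 * d))"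
    unfolding bint_def by (intro has_bochner_integral_diff has_bochner_integral_mult_right has_bochner_integral_integrable i1 i2 i3)
  have "(\<integral>x. indicator (cball c (d / 2)) x * (U x)\<^sup>2 - indicator (cball c (2 * d)) x * (?e x)\<^sup>2
        - (48 / s) * (indicator (cball c (2 * d)) x * ((U x)\<^sup>2 * etaf s (?y x))) \<partial>lborel)
     \<le> (\<integral>x. ((2 + 2 * N) * (U x)\<^sup>2 + 2 * U x * ?e x) * ?a x - (U x)\<^sup>2 * (?k (?y x) * sqn (?y x)) \<partial>lborel)"
  proof (rule integral_mono)
    show "integrable lborel (\<lambda>x. indicator (cball c (d / 2)) x * (U x)\<^sup>2 - indicator (cball c (2 * d)) x * (?e x)\<^sup>2
        - (48 / s) * (indicator (cball c (2 * d)) x * ((U x)\<^sup>2 * etaf s (?y x))))"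
      using hb by (simp only: has_bochner_integral_iff)
    show "integrable lborel (\<lambda>x. ((2 + 2 * N) * (U x)\<^sup>2 + 2 * U x * ?e x) * ?a x - (U x)\<^sup>2 * (?k (?y x) * sqn (?y x)))"
      using h0 by (simp only: has_bochner_integral_iff)
    fix x
    have a01: "0 \<le> ?a x" "?a x \<le> 1" using stp_bounds by auto
    have 1: "(U x)\<^sup>2 * (?k (?y x) * sqn (?y x)) \<le> (48 / s) * (indicator (cball c (2 * d)) x * ((U x)\<^sup>2 * etaf s (?y x)))"
    proof -
      have "(U x)\<^sup>2 * (?k (?y x) * sqn (?y x)) \<le> (U x)\<^sup>2 * ((48 / s) * etaf s (?y x))"
        by (intro mult_left_mono radial_cutoff_weight[OF s(1) s8]) auto
      moreover have "indicator (cball c (2 * d)) x * ((U x)\<^sup>2 * etaf s (?y x)) = (U x)\<^sup>2 * etaf s (?y x)"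
        using etaf_rescaled_zero[OF s(1) s8 d, of x c] by (cases "x \<in> cball c (2 * d)") auto
      ultimately show ?thesis by (simp only: mult_ac)
    qed
    \<comment> \<open>One of the \<open>2 + 2 * N\<close> copies of U^2 absorbs the mixed term; the
      others leave the lower bound.\<close>
    have "0 \<le> (U x + ?e x)\<^sup>2" by simp
    then have "(U x)\<^sup>2 + 2 * U x * ?e x + (?e x)\<^sup>2 \<ge> 0" by (simp only: power2_sum add_ac mult_ac)
    moreover have "1 * (U x)\<^sup>2 \<le> (1 + 2 * N) * (U x)\<^sup>2" using N by (intro mult_right_mono) auto
    moreover have "(2 + 2 * N) * (U x)\<^sup>2 = (1 + 2 * N) * (U x)\<^sup>2 + (U x)\<^sup>2" by algebra
    ultimately have q: "(U x)\<^sup>2 - (?e x)\<^sup>2 \<le> (2 + 2 * N) * (U x)\<^sup>2 + 2 * U x * ?e x" by linarith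
    have 2: "indicator (cball c (d / 2)) x * (U x)\<^sup>2 - indicator (cball c (2 * d)) x * (?e x)\<^sup>2
       \<le> ((2 + 2 * N) * (U x)\<^sup>2 + 2 * U x * ?e x) * ?a x"
    proof (cases "x \<in> cball c (2 * d)")
      case False
      then have "x \<notin> cball c (d / 2)" using d by auto
      then show ?thesis using False az[OF False] by simp
    next
      case True
      have "indicator (cball c (d / 2)) x \<le> ?a x"
      proof (cases "x \<in> cball c (d / 2)")
        case True
        then have "norm (x - c) \<le> d / 2" by (simp add: dist_norm norm_minus_commute)
        then have "norm (?y x) \<le> 1 / 2" using d by (simp add: pos_divide_le_eq)
        then have "(norm (?y x))\<^sup>2 \<le> (1 / 2)\<^sup>2" by (intro power_mono) auto
        then have "sqn (?y x) \<le> 1 / 4" unfolding sqn_norm by (simp add: power_divide)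
        then have "(sqn (?y x) - 1 + s / 2) / s \<le> 0" using s by (simp add: divide_le_0_iff)
        then show ?thesis by (simp add: stp_zero)
      qed (use a01 in simp)
      then have "indicator (cball c (d / 2)) x * (U x)\<^sup>2 \<le> ?a x * (U x)\<^sup>2" by (intro mult_right_mono) auto
      moreover have "?a x * (?e x)\<^sup>2 \<le> 1 * (?e x)\<^sup>2" using a01 by (intro mult_right_mono) auto
      moreover have "?a x * ((U x)\<^sup>2 - (?e x)\<^sup>2) \<le> ?a x * ((2 + 2 * N) * (U x)\<^sup>2 + 2 * U x * ?e x)"
        using q a01 by (intro mult_left_mono) auto
      moreover have "?a x * ((U x)\<^sup>2 - (?e x)\<^sup>2) = ?a x * (U x)\<^sup>2 - ?a x * (?e x)\<^sup>2" by (rule right_diff_distrib)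
      ultimately have "indicator (cball c (d / 2)) x * (U x)\<^sup>2 - 1 * (?e x)\<^sup>2 \<le> ?a x * ((2 + 2 * N) * (U x)\<^sup>2 + 2 * U x * ?e x)" by linarith
      then show ?thesis using True by (simp add: mult.commute)
    qed
    show "indicator (cball c (d / 2)) x * (U x)\<^sup>2 - indicator (cball c (2 * d)) x * (?e x)\<^sup>2
        - (48 / s) * (indicator (cball c (2 * d)) x * ((U x)\<^sup>2 * etaf s (?y x)))
      \<le> ((2 + 2 * N) * (U x)\<^sup>2 + 2 * U x * ?e x) * ?a x - (U x)\<^sup>2 * (?k (?y x) * sqn (?y x))"
      using 1 2 by linarith
  qed
  then show ?thesis unfolding has_bochner_integral_integral_eq[OF hb] has_bochner_integral_integral_eq[OF h0] by simp
qed

text \<open>\<open>N * U\<close> is \<open>rad\<close> minus the deviation, and in the ball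
  \<open>rad\<close> is at most \<open>2 * d\<close> times the norm of \<open>p\<close>. N^2 \<ge>
  9/4 pays for the factor 2 from squaring the difference.\<close>

lemma annulus_mass_le_energy:
  assumes sub: "cball c (2 * d) \<subseteq> \<Omega>" and d: "d > 0" and N: "N \<ge> 3 / 2"
  shows "bint (\<lambda>x. (U x)\<^sup>2 * etaf s ((1 / d) *\<^sub>R (x - c))) c (2 * d)
    \<le> 4 * d\<^sup>2 * bint (\<lambda>x. (norm (p x))\<^sup>2 * etaf s ((1 / d) *\<^sub>R (x - c))) c (2 * d)
      + bint (\<lambda>x. (rad c x - N * U x)\<^sup>2) c (2 * d)"
proof -
  let ?y = "\<lambda>x. (1 / d) *\<^sub>R (x - c)"
  let ?e = "\<lambda>x. rad c x - N * U x"
  let ?I = "indicator (cball c (2 * d)) :: pt \<Rightarrow> real"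
  have i1: "integrable lborel (\<lambda>x. ?I x * ((U x)\<^sup>2 * etaf s (?y x)))"
    by (intro bint_integrable sub loc_int_times_continuous loc_int_U2 etaf_continuous)
  have i2: "integrable lborel (\<lambda>x. ?I x * (?e x)\<^sup>2)" by (intro bint_integrable loc_int_dev sub)
  have i3: "integrable lborel (\<lambda>x. ?I x * ((norm (p x))\<^sup>2 * etaf s (?y x)))"
    by (intro bint_integrable sub loc_int_times_continuous loc_int_p2 etaf_continuous)
  have hb: "has_bochner_integral lborel (\<lambda>x. 4 * d\<^sup>2 * (?I x * ((norm (p x))\<^sup>2 * etaf s (?y x))) + ?I x * (?e x)\<^sup>2)
     (4 * d\<^sup>2 * bint (\<lambda>x. (norm (p x))\<^sup>2 * etaf s (?y x)) c (2 * d) + bint (\<lambda>x. (?e x)\<^sup>2) c (2 * d))"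
    unfolding bint_def by (intro has_bochner_integral_add has_bochner_integral_mult_right has_bochner_integral_integrable i2 i3)
  have "(\<integral>x. ?I x * ((U x)\<^sup>2 * etaf s (?y x)) \<partial>lborel)
     \<le> (\<integral>x. 4 * d\<^sup>2 * (?I x * ((norm (p x))\<^sup>2 * etaf s (?y x))) + ?I x * (?e x)\<^sup>2 \<partial>lborel)"
  proof (rule integral_mono[OF i1])
    show "integrable lborel (\<lambda>x. 4 * d\<^sup>2 * (?I x * ((norm (p x))\<^sup>2 * etaf s (?y x))) + ?I x * (?e x)\<^sup>2)"
      using hb by (simp only: has_bochner_integral_iff)
    fix x
    show "?I x * ((U x)\<^sup>2 * etaf s (?y x)) \<le> 4 * d\<^sup>2 * (?I x * ((norm (p x))\<^sup>2 * etaf s (?y x))) + ?I x * (?e x)\<^sup>2"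
    proof (cases "x \<in> cball c (2 * d)")
      case True
      have r: "(rad c x)\<^sup>2 \<le> 4 * d\<^sup>2 * (norm (p x))\<^sup>2"
      proof -
        have "\<bar>rad c x\<bar> \<le> norm (x - c) * norm (p x)" unfolding rad_def by (rule Cauchy_Schwarz_ineq2)
        also have "\<dots> \<le> 2 * d * norm (p x)"
          using True by (intro mult_right_mono) (auto simp: dist_norm norm_minus_commute)
        finally have "\<bar>rad c x\<bar>\<^sup>2 \<le> (2 * d * norm (p x))\<^sup>2" by (intro power_mono) auto
        then show ?thesis by (simp add: power_mult_distrib)
      qed
      have "(3 / 2)\<^sup>2 \<le> N\<^sup>2" using N by (intro power_mono) auto
      then have "2 * (U x)\<^sup>2 \<le> N\<^sup>2 * (U x)\<^sup>2" by (intro mult_right_mono) (auto simp: power2_eq_square)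
      also have "\<dots> = (rad c x - ?e x)\<^sup>2" by (simp add: power_mult_distrib)
      also have "\<dots> \<le> 2 * (rad c x)\<^sup>2 + 2 * (?e x)\<^sup>2"
      proof -
        have "0 \<le> (rad c x + ?e x)\<^sup>2" by simp
        then show ?thesis using power2_sum[of "rad c x" "?e x"] power2_diff[of "rad c x" "?e x"] by linarith
      qed
      finally have u: "(U x)\<^sup>2 \<le> 4 * d\<^sup>2 * (norm (p x))\<^sup>2 + (?e x)\<^sup>2" using r by linarith
      have "(U x)\<^sup>2 * etaf s (?y x) \<le> (4 * d\<^sup>2 * (norm (p x))\<^sup>2 + (?e x)\<^sup>2) * etaf s (?y x)"
        using u etaf_bounds(1) by (intro mult_right_mono) auto
      also have "\<dots> = 4 * d\<^sup>2 * ((norm (p x))\<^sup>2 * etaf s (?y x)) + (?e x)\<^sup>2 * etaf s (?y x)"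
        by (simp only: distrib_right mult.assoc)
      also have "(?e x)\<^sup>2 * etaf s (?y x) \<le> (?e x)\<^sup>2 * 1" using etaf_bounds(2) by (intro mult_left_mono) auto
      finally show ?thesis using True by simp
    qed simp
  qed
  then show ?thesis unfolding has_bochner_integral_integral_eq[OF hb] by (simp only: bint_def)
qed

subsection \<open>The frequency gap and the conclusion\<close>

text \<open>All bounds are read off at the scale \<tau> supplied by \<open>pinching\<close>. It
  exceeds 16 d^2, so on the ball of radius \<open>2 * d\<close> the kernels are at least powers of
  d^2. \<open>J\<close> is the mass \<open>Iq\<close> divided by d^4, the common unit in which all
  quantities are measured.\<close>

lemma scale_estimates:
  fixes \<Lambda> :: nat
  assumes g: "good c T" and d: "d > 0" "64 * d\<^sup>2 < T" and H: "Hq c (64 * d\<^sup>2) \<le> \<Lambda>" and \<delta>: "0 < \<delta>" "\<delta> \<le> 1"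
    and gap: "4 / 3 * (Hq c (64 * d\<^sup>2) - Hq c (16 * d\<^sup>2)) \<le> \<delta>\<^sup>2"
  obtains N J :: real where "3 / 2 \<le> N" "J > 0" "bint (\<lambda>x. (rad c x - N * U x)\<^sup>2) c (2 * d) \<le> \<delta>\<^sup>2 * J"
    "bint (\<lambda>x. (U x)\<^sup>2) c (2 * d) \<le> J"
    "d\<^sup>2 * bint (\<lambda>x. (norm (p x))\<^sup>2) c (2 * d) \<le> 6 * (real \<Lambda> + 1) * J"
    "d\<^sup>2 * bint fE c (2 * d) \<le> 6 * \<delta> * J"
    "16 * ((1 / 256) ^ (3 + \<Lambda>) - 256 * \<delta>) * J \<le> bint (\<lambda>x. (U x)\<^sup>2) c (d / 2)"
proof -
  have d2: "d\<^sup>2 > 0" using d by simp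
  obtain \<tau> where t: "16 * d\<^sup>2 < \<tau>" "\<tau> < 64 * d\<^sup>2"
    and dv: "dev c \<tau> \<le> 64 * d\<^sup>2 / (64 * d\<^sup>2 - 16 * d\<^sup>2) * (Hq c (64 * d\<^sup>2) - Hq c (16 * d\<^sup>2)) * Iq c \<tau>"
    and Y2: "(Yq c \<tau>)\<^sup>2 \<le> 64 * d\<^sup>2 / (64 * d\<^sup>2 - 16 * d\<^sup>2) * (Hq c (64 * d\<^sup>2) - Hq c (16 * d\<^sup>2)) * (Iq c \<tau>)\<^sup>2"
    by (rule pinching[OF g, of "16 * d\<^sup>2" "64 * d\<^sup>2"]) (use d2 d in auto)
  have t0: "0 < \<tau>" "\<tau> < T" using t d2 d by auto
  have adm: "adm c \<tau>" using good_adm[OF g t0(1)] t0 by simp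
  have I: "Iq c \<tau> > 0" using good_Iq_pos[OF g t0(1)] t0 by simp
  \<comment> \<open>The factor from \<open>pinching\<close> for the interval from 16 d^2 to 64
    d^2.\<close>
  have fr: "64 * d\<^sup>2 / (64 * d\<^sup>2 - 16 * d\<^sup>2) = 4 / 3" using d2 by (simp add: field_simps)
  have dv': "dev c \<tau> \<le> \<delta>\<^sup>2 * Iq c \<tau>"
    using dv mult_right_mono[OF gap, of "Iq c \<tau>"] I unfolding fr by linarith
  have "(Yq c \<tau>)\<^sup>2 \<le> \<delta>\<^sup>2 * (Iq c \<tau>)\<^sup>2"
    using Y2 mult_right_mono[OF gap zero_le_power2[of "Iq c \<tau>"]] unfolding fr by linarith
  then have "(Yq c \<tau>)\<^sup>2 \<le> (\<delta> * Iq c \<tau>)\<^sup>2" by (simp add: power_mult_distrib)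
  then have Y: "Yq c \<tau> \<le> \<delta> * Iq c \<tau>" by (rule power2_le_imp_le) (use \<delta> I in simp)
  define N where "N = Sq c \<tau> / Iq c \<tau>"
  define J where "J = Iq c \<tau> / d ^ 4"
  have IJ: "Iq c \<tau> = d ^ 4 * J" using d by (simp add: J_def)
  have d4: "(d\<^sup>2) ^ 2 = d ^ 4" "(d\<^sup>2) ^ 3 = d ^ 4 * d\<^sup>2" by (simp_all add: eval_nat_numeral)
  have N: "3 / 2 \<le> N"
    using good_SIY[OF g t0] quantities_nonneg(2)[of c \<tau>] I by (simp add: N_def pos_le_divide_eq)
  have HL: "Hq c \<tau> \<le> \<Lambda>" using Hq_mono[OF g t0(1) less_imp_le[OF t(2)] d(2)] H by linarith
  have S: "Sq c \<tau> \<le> (real \<Lambda> + 1) * Iq c \<tau>"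
  proof -
    have "Sq c \<tau> - Yq c \<tau> \<le> \<Lambda> * Iq c \<tau>" using HL I by (simp add: Hq_def pos_divide_le_eq)
    moreover have "\<delta> * Iq c \<tau> \<le> 1 * Iq c \<tau>" using \<delta> I by (intro mult_right_mono) auto
    ultimately show ?thesis using Y by (simp add: algebra_simps)
  qed
  have low: "(d\<^sup>2) ^ n * bint f c (2 * d) \<le> kint n f c \<tau>" if "loc_int f" "\<And>x. f x \<ge> 0" "n > 0" for f n
    by (rule kint_lower[OF that(1,2) adm that(3)]) (use d t in \<open>auto simp: power_mult_distrib\<close>)
  have div: "a \<le> b" if "d ^ 4 * a \<le> d ^ 4 * b" for a b using that d by simp
  show ?thesis
  proof (rule that[of N J])
    show "3 / 2 \<le> N" by (rule N)
    show "J > 0" using I d by (simp add: J_def)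
    show "bint (\<lambda>x. (rad c x - N * U x)\<^sup>2) c (2 * d) \<le> \<delta>\<^sup>2 * J"
    proof (rule div)
      have "d ^ 4 * bint (\<lambda>x. (rad c x - N * U x)\<^sup>2) c (2 * d) \<le> dev c \<tau>"
        using low[OF loc_int_dev[of c N], of 2] by (simp add: d4 dev_def N_def)
      then show "d ^ 4 * bint (\<lambda>x. (rad c x - N * U x)\<^sup>2) c (2 * d) \<le> d ^ 4 * (\<delta>\<^sup>2 * J)"
        using dv' unfolding IJ by (simp only: mult_ac)
    qed
    show "bint (\<lambda>x. (U x)\<^sup>2) c (2 * d) \<le> J"
      by (rule div) (use low[OF loc_int_U2, of 2] in \<open>simp add: d4 Iq_def[symmetric] IJ\<close>)
    show "d\<^sup>2 * bint (\<lambda>x. (norm (p x))\<^sup>2) c (2 * d) \<le> 6 * (real \<Lambda> + 1) * J"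
    proof (rule div)
      have "(d\<^sup>2) ^ 3 * bint (\<lambda>x. (norm (p x))\<^sup>2) c (2 * d) \<le> 6 * Sq c \<tau>"
        using low[OF loc_int_p2, of 3] by (simp add: Sq_def)
      also have "\<dots> \<le> 6 * ((real \<Lambda> + 1) * Iq c \<tau>)" using S by (intro mult_left_mono) auto
      finally show "d ^ 4 * (d\<^sup>2 * bint (\<lambda>x. (norm (p x))\<^sup>2) c (2 * d)) \<le> d ^ 4 * (6 * (real \<Lambda> + 1) * J)"
        unfolding d4 IJ by (simp only: mult_ac)
    qed
    show "d\<^sup>2 * bint fE c (2 * d) \<le> 6 * \<delta> * J"
    proof (rule div)
      have "(d\<^sup>2) ^ 3 * bint fE c (2 * d) \<le> 6 * Yq c \<tau>"
        using low[OF loc_int_fE fE_nonneg, of 3] by (simp add: Yq_def)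
      also have "\<dots> \<le> 6 * (\<delta> * Iq c \<tau>)" using Y by (intro mult_left_mono) auto
      finally show "d ^ 4 * (d\<^sup>2 * bint fE c (2 * d)) \<le> d ^ 4 * (6 * \<delta> * J)"
        unfolding d4 IJ by (simp only: mult_ac)
    qed
    show "16 * ((1 / 256) ^ (3 + \<Lambda>) - 256 * \<delta>) * J \<le> bint (\<lambda>x. (U x)\<^sup>2) c (d / 2)"
    proof (rule div)
      \<comment> \<open>The scale of the ball of radius \<open>d / 2\<close>; \<tau> is less than
        256 times as large.\<close>
      let ?t = "d\<^sup>2 / 4"
      have tt: "0 < ?t" "?t < \<tau>" "?t \<le> T" using d2 t t0 by auto
      have "(1 / 256) ^ (3 + \<Lambda>) \<le> (?t / \<tau>) ^ (3 + \<Lambda>)"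
        using t t0 by (intro power_mono) (auto simp: field_simps)
      moreover have "\<delta> * (\<tau> / ?t) \<le> \<delta> * 256"
        using t d2 \<delta> by (intro mult_left_mono) (auto simp: field_simps)
      ultimately have "Iq c \<tau> * ((1 / 256) ^ (3 + \<Lambda>) - 256 * \<delta>) \<le> Iq c \<tau> * ((?t / \<tau>) ^ (3 + \<Lambda>) - \<delta> * (\<tau> / ?t))"
        using I by (intro mult_left_mono) auto
      also have "\<dots> \<le> Iq c ?t" by (rule Iq_doubling[OF g tt(1,2) t0(2) HL Y])
      also have "\<dots> \<le> ?t ^ 2 * bint (\<lambda>x. (U x)\<^sup>2) c (sqrt ?t)"
        unfolding Iq_def by (rule kint_upper[OF loc_int_U2 _ good_adm[OF g tt(1,3)]]) auto
      also have "sqrt ?t = d / 2" using d by (simp add: real_sqrt_divide)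
      also have "?t ^ 2 = d ^ 4 / 16" by (simp add: power_divide)
      finally have "16 * (Iq c \<tau> * ((1 / 256) ^ (3 + \<Lambda>) - 256 * \<delta>)) \<le> d ^ 4 * bint (\<lambda>x. (U x)\<^sup>2) c (d / 2)" by simp
      then show "d ^ 4 * (16 * ((1 / 256) ^ (3 + \<Lambda>) - 256 * \<delta>) * J) \<le> d ^ 4 * bint (\<lambda>x. (U x)\<^sup>2) c (d / 2)"
        unfolding IJ by (simp only: mult_ac)
    qed
  qed
qed

text \<open>The order of the choices matters. \<open>s\<close> depends on \<Lambda> alone and makes
  the contribution of the energy near \<open>z\<close> small. The constant \<open>C\<close> of the
  rotation field, over whose growth for small \<open>s\<close> there is no control, comes next.
  \<delta> is last and absorbs every term that carries \<open>C\<close> or 1 / s beside it.\<close>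

lemma frequency_gap_direction:
  fixes \<Lambda> :: nat
  assumes i: "i = 1 \<or> i = -1"
  obtains \<epsilon> where "\<epsilon> > 0"
    "\<And>c d T T'. good c T \<Longrightarrow> d > 0 \<Longrightarrow> 64 * d\<^sup>2 < T \<Longrightarrow> Hq c (64 * d\<^sup>2) \<le> \<Lambda> \<Longrightarrow>
       good (c + d *\<^sub>R vector [i, 0]) T' \<Longrightarrow> d\<^sup>2 < T' \<Longrightarrow> Hq c (64 * d\<^sup>2) - Hq c (16 * d\<^sup>2) \<ge> \<epsilon>"
proof -
  \<comment> \<open>The doubling factor of \<open>scale_estimates\<close>.\<close>
  define \<kappa> where "\<kappa> = (1 / 256 :: real) ^ (3 + \<Lambda>)"
  \<comment> \<open>4 from the quarter in \<open>annulus_energy_upper\<close>, 400 from the cutoff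
    near \<open>z\<close>, 12 * 3^9 from \<open>small_scale_energy\<close>, and 64 = 4^3 from the
    radius \<open>4 * s * d\<close>.\<close>
  define K where "K = (4 * 400 * 12 * 3 ^ 9 * 64 :: real)"
  define s where "s = min (1 / 12) (\<kappa> / (192 * K))"
  have k: "\<kappa> > 0" by (simp add: \<kappa>_def)
  have K: "K > 0" by (simp add: K_def)
  have s: "0 < s" "s \<le> 1 / 12" using k K by (auto simp: s_def)
  have sK: "192 * K * s \<le> \<kappa>"
  proof -
    have "s \<le> \<kappa> / (192 * K)" by (simp add: s_def)
    then show ?thesis using K by (simp add: pos_le_divide_eq mult_ac)
  qed
  obtain C where C: "C > 0" and up: "\<And>c d N \<mu>. cball c (2 * d) \<subseteq> \<Omega> \<Longrightarrow> d > 0 \<Longrightarrow> c $ 2 = 0 \<Longrightarrow> \<mu> > 0 \<Longrightarrow>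
      bint (\<lambda>x. (norm (p x))\<^sup>2 * etaf s ((1 / d) *\<^sub>R (x - c))) c (2 * d) / 4
       \<le> (400 / s) * bint (\<lambda>x. (norm (p x))\<^sup>2) (c + d *\<^sub>R vector [i, 0]) (4 * s * d)
         + (2 * C + 5 / s) * bint fE c (2 * d)
         + (C / d) * (\<mu> * bint (\<lambda>x. (rad c x - N * U x)\<^sup>2) c (2 * d) + bint (\<lambda>x. (norm (p x))\<^sup>2) c (2 * d) / \<mu>)"
    using annulus_energy_upper[OF i s] by blast
  define L where "L = 4 * ((2 * C + 5 / s) * 6 + C * (1 + 6 * (real \<Lambda> + 1)))"
  \<comment> \<open>4097 = 16 * 256 + 1: the loss in the doubling bound, and the bare \<delta>^2,
    which is at most \<delta>.\<close>
  define W where "W = 4097 + 192 / s * L + 48 / s"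
  have L: "L > 0" using C s by (simp add: L_def add_pos_pos)
  have W: "W > 0" using L s by (simp add: W_def add_pos_pos)
  define \<delta> where "\<delta> = min 1 (\<kappa> / W)"
  have \<delta>: "0 < \<delta>" "\<delta> \<le> 1" using k W by (auto simp: \<delta>_def)
  have dW: "W * \<delta> \<le> \<kappa>"
  proof -
    have "\<delta> \<le> \<kappa> / W" by (simp add: \<delta>_def)
    then show ?thesis using W by (simp add: pos_le_divide_eq mult_ac)
  qed
  show ?thesis
  proof (rule that[of "3 / 4 * \<delta>\<^sup>2"])
    show "3 / 4 * \<delta>\<^sup>2 > 0" using \<delta> by simp
    fix c d T T'
    assume g: "good c T" and d: "d > 0" "64 * d\<^sup>2 < T" and H: "Hq c (64 * d\<^sup>2) \<le> \<Lambda>"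
      and gz: "good (c + d *\<^sub>R vector [i, 0]) T'" "d\<^sup>2 < T'"
    let ?z = "c + d *\<^sub>R vector [i, 0]"
    have d2: "d\<^sup>2 > 0" using d by simp
    show "Hq c (64 * d\<^sup>2) - Hq c (16 * d\<^sup>2) \<ge> 3 / 4 * \<delta>\<^sup>2"
    proof (rule ccontr)
      assume "\<not> ?thesis"
      then have small_gap: "4 / 3 * (Hq c (64 * d\<^sup>2) - Hq c (16 * d\<^sup>2)) \<le> \<delta>\<^sup>2" by simp
      obtain N J :: real where N: "3 / 2 \<le> N" and J: "J > 0"
        and e: "bint (\<lambda>x. (rad c x - N * U x)\<^sup>2) c (2 * d) \<le> \<delta>\<^sup>2 * J"
        and U: "bint (\<lambda>x. (U x)\<^sup>2) c (2 * d) \<le> J"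
        and P: "d\<^sup>2 * bint (\<lambda>x. (norm (p x))\<^sup>2) c (2 * d) \<le> 6 * (real \<Lambda> + 1) * J"
        and F: "d\<^sup>2 * bint fE c (2 * d) \<le> 6 * \<delta> * J"
        and low: "16 * ((1 / 256) ^ (3 + \<Lambda>) - 256 * \<delta>) * J \<le> bint (\<lambda>x. (U x)\<^sup>2) c (d / 2)"
        by (rule scale_estimates[OF g d H \<delta> small_gap])
      have c2: "c $ 2 = 0" using g by (simp add: good_def)
      have sub: "cball c (2 * d) \<subseteq> \<Omega>"
      proof -
        have "adm c (64 * d\<^sup>2)" by (rule good_adm[OF g]) (use d d2 in auto)
        then have "cball c (8 * d) \<subseteq> \<Omega>" using d by (simp add: adm_def real_sqrt_mult)
        then show ?thesis using subset_cball[of "2 * d" "8 * d" c] d by auto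
      qed
      let ?X = "bint (\<lambda>x. (norm (p x))\<^sup>2 * etaf s ((1 / d) *\<^sub>R (x - c))) c (2 * d)"
      let ?V = "bint (\<lambda>x. (U x)\<^sup>2 * etaf s ((1 / d) *\<^sub>R (x - c))) c (2 * d)"
      let ?E = "bint (\<lambda>x. (rad c x - N * U x)\<^sup>2) c (2 * d)"
      let ?Pz = "bint (\<lambda>x. (norm (p x))\<^sup>2) ?z (4 * s * d)" and ?Pc = "bint (\<lambda>x. (norm (p x))\<^sup>2) c (2 * d)"
      have small: "d\<^sup>2 * ?Pz \<le> 12 * 3 ^ 9 * 64 * s ^ 3 * J"
      proof -
        have "8 * (4 * s * d)\<^sup>2 = (128 * s\<^sup>2) * d\<^sup>2" by (simp add: power_mult_distrib)
        also have "\<dots> \<le> 1 * d\<^sup>2"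
        proof (intro mult_right_mono)
          \<comment> \<open>The bound 1/12 on \<open>s\<close> ensures that the small ball meets the
            hypothesis of \<open>small_scale_energy\<close>: 128 / 144 < 1.\<close>
          have "s\<^sup>2 \<le> (1 / 12)\<^sup>2" using s by (intro power_mono) auto
          then show "128 * s\<^sup>2 \<le> 1" by (simp add: power2_eq_square)
        qed simp
        finally have "8 * (4 * s * d)\<^sup>2 \<le> d\<^sup>2" by simp
        from small_scale_energy[OF gz(1) _ this d(1) gz(2)] s d
        have "?Pz \<le> 12 * 3 ^ 9 * (4 * s * d / d) ^ 3 / d\<^sup>2 * bint (\<lambda>x. (U x)\<^sup>2) ?z d" by simp
        then have "d\<^sup>2 * ?Pz \<le> d\<^sup>2 * (12 * 3 ^ 9 * (4 * s * d / d) ^ 3 / d\<^sup>2 * bint (\<lambda>x. (U x)\<^sup>2) ?z d)"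
          by (intro mult_left_mono) auto
        also have "\<dots> = 12 * 3 ^ 9 * 64 * s ^ 3 * bint (\<lambda>x. (U x)\<^sup>2) ?z d"
          using d by (simp add: power_mult_distrib)
        also have "\<dots> \<le> 12 * 3 ^ 9 * 64 * s ^ 3 * J"
        proof (intro mult_left_mono)
          have "cball ?z d \<subseteq> cball c (2 * d)"
          proof
            fix x assume "x \<in> cball ?z d"
            moreover have "dist c ?z = d" using i d by (auto simp: dist_norm norm_eq_sqrt_inner inner_vec_def sum_2)
            ultimately show "x \<in> cball c (2 * d)" using dist_triangle[of c x ?z] by simp
          qed
          then have "bint (\<lambda>x. (U x)\<^sup>2) ?z d \<le> bint (\<lambda>x. (U x)\<^sup>2) c (2 * d)"
            by (intro bint_mono loc_int_U2 sub) auto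
          then show "bint (\<lambda>x. (U x)\<^sup>2) ?z d \<le> J" using U by linarith
        qed (use s in simp)
        finally show ?thesis .
      qed
      \<comment> \<open>Balances Young's inequality: the deviation, of order \<delta>^2, is divided
        by \<delta> and the energy multiplied by \<delta>, so both terms are of order \<delta>; the
        factor \<open>d\<close> adjusts the scale.\<close>
      define \<mu> where "\<mu> = 1 / (\<delta> * d)"
      have m: "\<mu> > 0" using \<delta> d by (simp add: \<mu>_def)
      have X: "d\<^sup>2 * ?X \<le> (K * s\<^sup>2 + L * \<delta>) * J"
      proof -
        have 1: "(400 / s) * (d\<^sup>2 * ?Pz) \<le> (400 / s) * (12 * 3 ^ 9 * 64 * s ^ 3 * J)"
          using small s by (intro mult_left_mono) auto
        have 2: "(2 * C + 5 / s) * (d\<^sup>2 * bint fE c (2 * d)) \<le> (2 * C + 5 / s) * (6 * \<delta> * J)"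
          using F s C by (intro mult_left_mono) auto
        have 3: "C * (?E / \<delta> + \<delta> * (d\<^sup>2 * ?Pc)) \<le> C * (\<delta>\<^sup>2 * J / \<delta> + \<delta> * (6 * (real \<Lambda> + 1) * J))"
          using e P C \<delta> by (intro mult_left_mono add_mono divide_right_mono) auto
        have "d\<^sup>2 * (?X / 4) \<le> d\<^sup>2 * ((400 / s) * ?Pz + (2 * C + 5 / s) * bint fE c (2 * d)
           + (C / d) * (\<mu> * ?E + ?Pc / \<mu>))"
          by (intro mult_left_mono up[OF sub d(1) c2 m]) auto
        also have "\<dots> = (400 / s) * (d\<^sup>2 * ?Pz) + (2 * C + 5 / s) * (d\<^sup>2 * bint fE c (2 * d)) + C * (?E / \<delta> + \<delta> * (d\<^sup>2 * ?Pc))"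
        proof -
          have "d\<^sup>2 * ((C / d) * (\<mu> * ?E + ?Pc / \<mu>)) = C * (?E / \<delta> + \<delta> * (d\<^sup>2 * ?Pc))"
            unfolding \<mu>_def using d \<delta> by (simp add: field_simps power2_eq_square)
          then show ?thesis unfolding distrib_left[of "d\<^sup>2"] by (simp only: mult_ac)
        qed
        also have "\<dots> \<le> (400 / s) * (12 * 3 ^ 9 * 64 * s ^ 3 * J) + (2 * C + 5 / s) * (6 * \<delta> * J)
            + C * (\<delta>\<^sup>2 * J / \<delta> + \<delta> * (6 * (real \<Lambda> + 1) * J))" using 1 2 3 by linarith
        also have "\<dots> = (K * s\<^sup>2 + L * \<delta>) * J / 4"
        proof -
          have 1: "(400 / s) * (12 * 3 ^ 9 * 64 * s ^ 3 * J) = K * s\<^sup>2 * J / 4"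
            using s by (simp add: K_def power3_eq_cube power2_eq_square)
          have 2: "\<delta>\<^sup>2 * J / \<delta> = \<delta> * J" using \<delta> by (simp add: power2_eq_square)
          show ?thesis unfolding 1 2 by (simp add: L_def algebra_simps)
        qed
        finally show ?thesis by simp
      qed
      have V: "?V \<le> 4 * ((K * s\<^sup>2 + L * \<delta>) * J) + \<delta>\<^sup>2 * J"
      proof -
        have "?V \<le> 4 * d\<^sup>2 * ?X + ?E" by (rule annulus_mass_le_energy[OF sub d(1) N])
        then show ?thesis using X e by linarith
      qed
      have "16 * (\<kappa> - 256 * \<delta>) * J \<le> ?E + (48 / s) * ?V"
        using low annulus_mass_lower[OF s sub d(1) N] by (simp add: \<kappa>_def)
      also have "\<dots> \<le> \<delta>\<^sup>2 * J + (48 / s) * (4 * ((K * s\<^sup>2 + L * \<delta>) * J) + \<delta>\<^sup>2 * J)"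
        using e V s by (intro add_mono mult_left_mono) auto
      also have "\<dots> = (\<delta>\<^sup>2 + 192 * K * s + 192 / s * L * \<delta> + 48 / s * \<delta>\<^sup>2) * J"
        using s by (simp add: field_simps power2_eq_square)
      finally have 1: "16 * (\<kappa> - 256 * \<delta>) \<le> \<delta>\<^sup>2 + 192 * K * s + 192 / s * L * \<delta> + 48 / s * \<delta>\<^sup>2"
        by (rule mult_right_le_imp_le[OF _ J])
      have 2: "\<delta>\<^sup>2 \<le> \<delta>" using \<delta> by (simp add: power2_eq_square mult_left_le)
      have 3: "48 / s * \<delta>\<^sup>2 \<le> 48 / s * \<delta>" using 2 s by (intro mult_left_mono) auto
      have 4: "W * \<delta> = 4097 * \<delta> + 192 / s * L * \<delta> + 48 / s * \<delta>" by (simp add: W_def algebra_simps)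
      \<comment> \<open>The terms with \<delta> add up to at most W \<delta> \<le> \<kappa> and the
        term with \<open>s\<close> to at most \<kappa>, which gives 16 \<kappa> \<le> 2
        \<kappa>.\<close>
      have contra: False if "16 * (k - 256 * x) \<le> y + m + n + q" "y \<le> x" "q \<le> r" "w = 4097 * x + n + r" "w \<le> k" "m \<le> k" "0 < k"
        for k x y m n q r w :: real using that by (simp add: algebra_simps)
      show False by (rule contra[OF 1 2 3 4 dW sK k])
    qed
  qed
qed

text \<open>Good centers lie on the axis, so \<open>z\<close> is either to the right or to the left
  of \<open>c\<close>, and the smaller of two constants serves both.\<close>

lemma frequency_gap:
  fixes \<Lambda> :: nat
  obtains \<epsilon> where "\<epsilon> > 0"
    "\<And>c z T T'. good c T \<Longrightarrow> good z T' \<Longrightarrow> z \<noteq> c \<Longrightarrow> 64 * (dist z c)\<^sup>2 < T \<Longrightarrow> (dist z c)\<^sup>2 < T' \<Longrightarrow>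
       Hq c (64 * (dist z c)\<^sup>2) \<le> \<Lambda> \<Longrightarrow> Hq c (64 * (dist z c)\<^sup>2) - Hq c (16 * (dist z c)\<^sup>2) \<ge> \<epsilon>"
proof -
  obtain e1 where e1: "e1 > 0" and a1: "\<And>c d T T'. good c T \<Longrightarrow> d > 0 \<Longrightarrow> 64 * d\<^sup>2 < T \<Longrightarrow> Hq c (64 * d\<^sup>2) \<le> \<Lambda> \<Longrightarrow>
       good (c + d *\<^sub>R vector [1, 0]) T' \<Longrightarrow> d\<^sup>2 < T' \<Longrightarrow> Hq c (64 * d\<^sup>2) - Hq c (16 * d\<^sup>2) \<ge> e1"
    using frequency_gap_direction[of 1 \<Lambda>] by (metis)
  obtain e2 where e2: "e2 > 0" and a2: "\<And>c d T T'. good c T \<Longrightarrow> d > 0 \<Longrightarrow> 64 * d\<^sup>2 < T \<Longrightarrow> Hq c (64 * d\<^sup>2) \<le> \<Lambda> \<Longrightarrow>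
       good (c + d *\<^sub>R vector [-1, 0]) T' \<Longrightarrow> d\<^sup>2 < T' \<Longrightarrow> Hq c (64 * d\<^sup>2) - Hq c (16 * d\<^sup>2) \<ge> e2"
    using frequency_gap_direction[of "-1" \<Lambda>] by (metis)
  show ?thesis
  proof (rule that[of "min e1 e2"])
    show "min e1 e2 > 0" using e1 e2 by simp
    fix c z T T'
    assume g: "good c T" "good z T'" and ne: "z \<noteq> c" and d: "64 * (dist z c)\<^sup>2 < T" "(dist z c)\<^sup>2 < T'"
      and H: "Hq c (64 * (dist z c)\<^sup>2) \<le> \<Lambda>"
    have z2: "z $ 2 = 0" "c $ 2 = 0" using g by (auto simp: good_def)
    have dd: "dist z c = \<bar>z $ 1 - c $ 1\<bar>" using z2 by (simp add: dist_norm norm_eq_sqrt_inner inner_vec_def sum_2)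
    have d0: "dist z c > 0" using ne by simp
    consider "z = c + dist z c *\<^sub>R vector [1, 0]" | "z = c + dist z c *\<^sub>R vector [-1, 0]"
    proof (cases "z $ 1 \<ge> c $ 1")
      case True
      then have "z = c + dist z c *\<^sub>R vector [1, 0]" using z2 by (simp add: dd vec_eq_iff forall_2)
      then show ?thesis using that by blast
    next
      case False
      then have "z = c + dist z c *\<^sub>R vector [-1, 0]" using z2 by (simp add: dd vec_eq_iff forall_2)
      then show ?thesis using that by blast
    qed
    then show "Hq c (64 * (dist z c)\<^sup>2) - Hq c (16 * (dist z c)\<^sup>2) \<ge> min e1 e2"
    proof cases
      case 1
      then show ?thesis using a1[OF g(1) d0 d(1) H _ d(2)] g(2) by simp
    next
      case 2
      then show ?thesis using a2[OF g(1) d0 d(1) H _ d(2)] g(2) by simp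
    qed
  qed
qed

text \<open>\<open>Hq\<close> is monotone and bounded below by 3/2, so at small scales it is close
  to its infimum, which stands in for the limit at 0.\<close>

lemma Hq_gap_small:
  assumes g: "good c T" and e: "\<epsilon> > 0"
  obtains t where "0 < t" "\<And>a b. 0 < a \<Longrightarrow> a \<le> b \<Longrightarrow> b \<le> t \<Longrightarrow> Hq c b - Hq c a < \<epsilon>" "t < T"
proof -
  have T: "0 < T" using g by (simp add: good_def adm_def)
  let ?A = "Hq c ` {0<..<T}"
  have bb: "bdd_below ?A" using Hq_ge[OF g] by (intro bdd_belowI[of _ "3 / 2"]) auto
  have "?A \<noteq> {}" using T by simp
  then have "\<exists>x\<in>?A. x < Inf ?A + \<epsilon>" using e by (intro cInf_lessD) auto
  then obtain t where t: "0 < t" "t < T" "Hq c t < Inf ?A + \<epsilon>" by auto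
  show ?thesis
  proof (rule that[OF t(1) _ t(2)])
    fix a b assume ab: "0 < a" "a \<le> b" "b \<le> t"
    have "Hq c b \<le> Hq c t" using ab t by (intro Hq_mono[OF g]) auto
    moreover have "Inf ?A \<le> Hq c a" using ab t by (intro cInf_lower[OF _ bb]) auto
    ultimately show "Hq c b - Hq c a < \<epsilon>" using t(3) by linarith
  qed
qed

theorem Sigma_locally_finite:
  assumes K: "compact K" "K \<subseteq> \<Omega>"
  shows "finite (K \<inter> Sigma_set \<Omega> u g)"
proof (rule ccontr)
  assume "infinite (K \<inter> Sigma_set \<Omega> u g)"
  then obtain c where c: "c \<in> K" "c islimpt (K \<inter> Sigma_set \<Omega> u g)"
    using Heine_Borel_imp_Bolzano_Weierstrass[OF K(1)] by blast
  then have lim: "c islimpt Sigma_set \<Omega> u g" using islimpt_subset by blast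
  have "c \<in> \<Omega>" using c K by blast
  then obtain R where R: "R > 0" "cball c R \<subseteq> \<Omega>" using op open_contains_cball by blast
  \<comment> \<open>Half of \<open>R\<close>, so that balls of radius \<rho> about points within
    \<rho> of \<open>c\<close> stay in \<open>\<Omega>\<close>.\<close>
  define \<rho> where "\<rho> = R / 2"
  have r: "\<rho> > 0" "cball c (2 * \<rho>) \<subseteq> \<Omega>" using R by (auto simp: \<rho>_def)
  have near: "good x (\<rho>\<^sup>2)" if "x \<in> Sigma_set \<Omega> u g" "dist x c \<le> \<rho>" for x
  proof (rule Sigma_good[OF that(1)])
    have "cball x \<rho> \<subseteq> cball c (2 * \<rho>)"
    proof
      fix y assume "y \<in> cball x \<rho>"
      then show "y \<in> cball c (2 * \<rho>)" using that(2) dist_triangle[of c y x] by (simp add: dist_commute)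
    qed
    then show "adm x (\<rho>\<^sup>2)" using r by (auto simp: adm_def)
  qed
  have ap: "\<exists>x\<in>Sigma_set \<Omega> u g. x \<noteq> c \<and> dist x c < e" if "e > 0" for e
    using lim that by (auto simp: islimpt_approachable)
  have "\<exists>x. x \<in> Sigma_set \<Omega> u g \<and> dist x c < min \<rho> (1 / real (Suc m))" for m
    using ap[of "min \<rho> (1 / real (Suc m))"] r by auto
  then obtain X where X: "\<And>m. X m \<in> Sigma_set \<Omega> u g" "\<And>m. dist (X m) c < min \<rho> (1 / real (Suc m))" by metis
  have "(\<lambda>m. dist (X m) c) \<longlonglongrightarrow> 0"
  proof (rule tendsto_sandwich[OF _ _ tendsto_const LIMSEQ_inverse_real_of_nat])
    show "\<forall>\<^sub>F m in sequentially. dist (X m) c \<le> inverse (real (Suc m))"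
      using X(2) by (intro always_eventually allI) (simp add: inverse_eq_divide less_imp_le)
  qed simp
  then have Xl: "X \<longlonglongrightarrow> c" by (rule iffD2[OF tendsto_dist_iff])
  have Xr: "dist (X m) c \<le> \<rho>" for m using X(2)[of m] by simp
  have g: "good c (\<rho>\<^sup>2)" by (rule good_limit[OF r(2,1) Xl Xr near[OF X(1) Xr]])
  \<comment> \<open>Read off at half of \<rho>^2, since \<open>Hq_mono\<close> applies strictly
    below \<rho>^2; rounded up because \<Lambda> occurs as an exponent.\<close>
  define \<Lambda> where "\<Lambda> = nat \<lceil>Hq c (\<rho>\<^sup>2 / 2)\<rceil>"
  have \<Lambda>: "Hq c (\<rho>\<^sup>2 / 2) \<le> \<Lambda>" unfolding \<Lambda>_def by linarith
  obtain \<epsilon> where e: "\<epsilon> > 0" and gap: "\<And>c z T T'. good c T \<Longrightarrow> good z T' \<Longrightarrow> z \<noteq> c \<Longrightarrow> 64 * (dist z c)\<^sup>2 < T \<Longrightarrow> (dist z c)\<^sup>2 < T' \<Longrightarrow>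
       Hq c (64 * (dist z c)\<^sup>2) \<le> \<Lambda> \<Longrightarrow> Hq c (64 * (dist z c)\<^sup>2) - Hq c (16 * (dist z c)\<^sup>2) \<ge> \<epsilon>"
    using frequency_gap[of \<Lambda>] by metis
  obtain t where t: "0 < t" "\<And>a b. 0 < a \<Longrightarrow> a \<le> b \<Longrightarrow> b \<le> t \<Longrightarrow> Hq c b - Hq c a < \<epsilon>" "t < \<rho>\<^sup>2"
    using Hq_gap_small[OF g e] by metis
  \<comment> \<open>The first bound gives 64 d^2 \<le> t, where \<open>Hq\<close> varies by less
    than \<epsilon>; the second keeps 64 d^2 below half of \<rho>^2, where the frequency is at most
    \<Lambda>.\<close>
  define h where "h = min (sqrt t / 8) (\<rho> / 16)"
  have h: "h > 0" using t r by (simp add: h_def)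
  obtain z where z: "z \<in> Sigma_set \<Omega> u g" "z \<noteq> c" "dist z c < h" using ap[OF h] by blast
  define d where "d = dist z c"
  have d: "0 < d" "d \<le> sqrt t / 8" "d \<le> \<rho> / 16" using z by (auto simp: d_def h_def)
  have d2: "d\<^sup>2 > 0" using d by simp
  have "d\<^sup>2 \<le> (sqrt t / 8)\<^sup>2" using d by (intro power_mono) auto
  then have dt: "64 * d\<^sup>2 \<le> t" using t by (simp add: power_divide)
  have "d\<^sup>2 \<le> (\<rho> / 16)\<^sup>2" using d by (intro power_mono) auto
  then have dr: "64 * d\<^sup>2 \<le> \<rho>\<^sup>2 / 4" by (simp add: power_divide)
  have r2: "\<rho>\<^sup>2 > 0" using r by simp
  have "Hq c (64 * d\<^sup>2) \<le> Hq c (\<rho>\<^sup>2 / 2)"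
    by (rule Hq_mono[OF g]) (use d2 dr r2 in linarith)+
  then have "Hq c (64 * d\<^sup>2) \<le> \<Lambda>" using \<Lambda> by linarith
  moreover have "good z (\<rho>\<^sup>2)" using near[OF z(1)] d r by (simp add: d_def)
  moreover have "64 * d\<^sup>2 < \<rho>\<^sup>2" "d\<^sup>2 < \<rho>\<^sup>2" using dr d2 r2 by linarith+
  ultimately have "Hq c (64 * d\<^sup>2) - Hq c (16 * d\<^sup>2) \<ge> \<epsilon>" using gap[OF g _ z(2)] by (simp add: d_def)
  moreover have "Hq c (64 * d\<^sup>2) - Hq c (16 * d\<^sup>2) < \<epsilon>" using d2 dt by (intro t(2)) auto
  ultimately show False by linarith
qed

end

theorem mainTheorem19:
  fixes \<Omega> :: "(real ^ 2) set" and u :: "real ^ 2 \<Rightarrow> real" and g :: "real ^ 2 \<Rightarrow> real ^ 2"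
  assumes "open \<Omega>" and "connected \<Omega>" and "bounded \<Omega>"
    and "\<exists>x\<in>\<Omega>. x $ 2 = 0"
    and "variational_solution \<Omega> u g"
  shows "\<forall>K. compact K \<and> K \<subseteq> \<Omega> \<longrightarrow> finite (K \<inter> Sigma_set \<Omega> u g)"
  using varsol.Sigma_locally_finite[OF varsol.intro[OF assms(1,5)]] by blast

end
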